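(* Let $d\ge2$ and let $E\subset\mathbb R^d$ be compact with $\dim_{\mathcal H}(E)>(2d+1)/3$. Then $$\operatorname{int}\left(\left\{\frac{|x-z|}{|x-y|} : x,y,z\in E,\ x\ne y\right\}\right)\ne\emptyset .$$
   Context: $\dim_{\mathcal H}$ denotes Hausdorff dimension, $|\cdot|$ the Euclidean norm, and $\operatorname{int}$ the interior in $\mathbb R$. *)

theory Defs
  imports "HOL-Analysis.Analysis"
begin

definition hausdorff_content :: "real \<Rightarrow> real \<Rightarrow> 'a::metric_space set \<Rightarrow> ennreal" where
  "hausdorff_content s \<delta> E =
     (INF U \<in> {U :: nat \<Rightarrow> 'a set. E \<subseteq> (\<Union>i. U i) \<and>
                 (\<forall>i. bounded (U i) \<and> diameter (U i) \<le> \<delta>)}.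
        (\<Sum>i. ennreal (diameter (U i) powr s)))"

definition hausdorff_measure :: "real \<Rightarrow> 'a::metric_space set \<Rightarrow> ennreal" where
  "hausdorff_measure s E = (SUP \<delta> \<in> {0<..}. hausdorff_content s \<delta> E)"

definition hausdorff_dim :: "'a::metric_space set \<Rightarrow> real" where
  "hausdorff_dim E = Inf {s. 0 \<le> s \<and> hausdorff_measure s E = 0}"

end

theory Submission
  imports Defs "HOL-Probability.Probability"
begin

text \<open>
  Fix an exponent \<open>\<alpha>\<close> with \<open>(2 d + 1) / 3 < \<alpha> < dim E\<close> and put Frostman weights of exponent \<open>\<alpha>\<close> on finite subsets of
  \<open>E\<close>, at ever finer resolution. The density of the squared ratios at \<open>T\<close> is the limit as \<open>\<epsilon>\<close> tends to 0 of the
  trilinear form with kernel \<open>\<theta>\<^sub>\<epsilon>(|x - z|\<^sup>2 - T |x - y|\<^sup>2)\<close>, where \<open>\<theta>\<^sub>\<epsilon>\<close> is a Gaussian approximate identity.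
  Averaging \<open>h\<close> over the thickened spheres around \<open>x\<close> is a smoothing operator: the square integral of the average over
  all centres and radii is a superposition of Gaussian energies of \<open>h\<close>, comparable to the energy with kernel \<open>1 / |z|\<close>.
  Pairing with the other two functions by Cauchy-Schwarz, the difference of the form between the mollification scales
  \<open>\<tau>\<close> and \<open>2 \<tau>\<close> is at most a constant times \<open>\<tau>\<close> to the power \<open>(3 \<alpha> - 2 d - 1) / 4\<close>, up to an arbitrarily small
  loss, uniformly in \<open>\<epsilon>\<close> and \<open>T\<close>; any of the three variables can carry the difference. The exponent is positive, so the
  density is uniformly close to the mollified density, which is equicontinuous in \<open>T\<close>. If the ratio set had empty
  interior, the density would be small on a dense set of \<open>T\<close>, hence everywhere, contradicting its positive integral.
\<close>

section \<open>Gaussian integrals\<close>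

text \<open>The threshold is a balance of powers of \<tau>, a squared length. Two of the three
  functions enter through their square norm: a weight of exponent \<alpha> mollified at scale \<tau>
  has square integral about \<tau> to the power (\<alpha> - d) / 2. The third enters through its
  shell energy, whose Fourier weight is |xi| to the power 1 - d; a difference of consecutive
  mollifications lives at |xi|^2 near 1 / \<tau>, where this energy is about \<tau> to the power
  (\<alpha> - 1) / 2. The product is a positive power of \<tau> exactly when 3 \<alpha> > 2 d + 1.
  Squared distances, together with Gaussians for shells, mollifiers and cut-offs, give every
  correlation in closed form. Weights on finite sets, with constants independent of the resolution,
  replace a Frostman measure and weak limits. \<open>T\<close> stays in an interval [T1, 1/2] with
  T1 > 0, because the Apollonius sphere degenerates to a hyperplane at T = 1 and to a point at T =
  0. Uniformity in \<epsilon> matters because \<epsilon> is fixed only after a finite net of missed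
  values of \<open>T\<close>.\<close>

definition heat :: "real \<Rightarrow> 'a::euclidean_space \<Rightarrow> real" where
  "heat s w = (4 * pi * s) powr (- (real DIM('a) / 2)) * exp (- (norm w)\<^sup>2 / (4 * s))"

text \<open>This is the characteristic function of the standard normal law, rescaled by
  \<open>sqrt (2 * s)\<close>.\<close>

lemma gaussian_fourier_real:
  fixes t s :: real
  assumes "s > 0"
  shows "integrable lborel (\<lambda>x. iexp (t * x) * complex_of_real (exp (- s * x\<^sup>2)))"
    and "(\<integral>x. iexp (t * x) * complex_of_real (exp (- s * x\<^sup>2)) \<partial>lborel)
           = complex_of_real (sqrt (pi / s) * exp (- t\<^sup>2 / (4 * s)))"
proof -
  define c where "c = sqrt (2 * s)"
  have c: "c > 0" "c\<^sup>2 = 2 * s" using assms by (auto simp: c_def)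
  let ?g = "\<lambda>x. std_normal_density x *\<^sub>R iexp ((t / c) * x)"
  have int: "integrable lborel ?g"
    by (rule Bochner_Integration.integrable_bound[OF integrable_normal_density[of 1 0]]) auto
  have val: "(\<integral>x. ?g x \<partial>lborel) = complex_of_real (exp (- ((t / c)\<^sup>2) / 2))"
    using fun_cong[OF char_std_normal_distribution, of "t / c"] unfolding char_def
    by (subst (asm) integral_density) (auto simp: normal_density_nonneg)
  have eq: "iexp (t * x) * complex_of_real (exp (- s * x\<^sup>2)) = complex_of_real (sqrt (2 * pi)) * ?g (0 + c * x)" for x
    using c by (simp add: std_normal_density_def power_mult_distrib scaleR_conv_of_real field_simps flip: of_real_mult)
  have int': "integrable lborel (\<lambda>x. ?g (0 + c * x))"
    using int c by (intro lborel_integrable_real_affine) auto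
  show "integrable lborel (\<lambda>x. iexp (t * x) * complex_of_real (exp (- s * x\<^sup>2)))"
    unfolding eq using integrable_mult_right[OF int', of "complex_of_real (sqrt (2 * pi))"] by (simp only:)
  have "(\<integral>x. ?g x \<partial>lborel) = c *\<^sub>R (\<integral>x. ?g (0 + c * x) \<partial>lborel)"
    using c lborel_integral_real_affine[of c ?g 0] by simp
  then have val': "(\<integral>x. ?g (0 + c * x) \<partial>lborel) = complex_of_real (exp (- ((t / c)\<^sup>2) / 2) / c)"
    using val c by (simp add: scaleR_conv_of_real field_simps)
  have "sqrt (2 * pi) / c = sqrt (pi / s)"
    unfolding c_def by (simp add: real_sqrt_mult real_sqrt_divide)
  moreover have "- ((t / c)\<^sup>2) / 2 = - t\<^sup>2 / (4 * s)"
    using c by (simp add: power_divide)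
  ultimately have "sqrt (2 * pi) * (exp (- ((t / c)\<^sup>2) / 2) / c) = sqrt (pi / s) * exp (- t\<^sup>2 / (4 * s))"
    by (metis mult.commute times_divide_eq_left)
  then show "(\<integral>x. iexp (t * x) * complex_of_real (exp (- s * x\<^sup>2)) \<partial>lborel)
           = complex_of_real (sqrt (pi / s) * exp (- t\<^sup>2 / (4 * s)))"
    unfolding eq integral_mult_right_zero val' of_real_mult[symmetric] by (simp only:)
qed

text \<open>The integrand factors over the coordinates and \<open>lborel\<close> is the image of a
  product measure, so the one-dimensional formula is multiplied over \<open>Basis\<close>.\<close>

lemma
  fixes w :: "'a::euclidean_space"
  assumes "s > 0"
  shows integrable_gaussian_iexp: "integrable lborel (\<lambda>x. iexp (w \<bullet> x) * complex_of_real (exp (- s * (norm x)\<^sup>2)))"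
    and gaussian_fourier_iexp: "(\<integral>x. iexp (w \<bullet> x) * complex_of_real (exp (- s * (norm x)\<^sup>2)) \<partial>lborel)
           = complex_of_real ((pi / s) powr (real DIM('a) / 2) * exp (- (norm w)\<^sup>2 / (4 * s)))"
proof -
  define f where "f b x = iexp ((w \<bullet> b) * x) * complex_of_real (exp (- s * x\<^sup>2))" for b :: 'a and x :: real
  interpret product_sigma_finite "\<lambda>_::'a. lborel :: real measure" ..
  let ?P = "\<Pi>\<^sub>M b\<in>(Basis::'a set). (lborel::real measure)"
  let ?S = "\<lambda>h. (\<Sum>b\<in>Basis. h b *\<^sub>R b) :: 'a"
  have [measurable]: "?S \<in> borel_measurable ?P" by measurable
  have prod: "iexp (w \<bullet> ?S h) * complex_of_real (exp (- s * (norm (?S h))\<^sup>2)) = (\<Prod>b\<in>Basis. f b (h b))" for h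
  proof -
    have 1: "w \<bullet> ?S h = (\<Sum>b\<in>Basis. (w \<bullet> b) * h b)"
      by (simp add: inner_sum_right mult.commute)
    have 2: "(norm (?S h))\<^sup>2 = (\<Sum>b\<in>Basis. (h b)\<^sup>2)"
      by (subst norm_eq_sqrt_inner)
        (simp add: euclidean_inner[of "?S h" "?S h"] power2_eq_square sum_nonneg)
    show ?thesis
      unfolding 1 2 f_def
      by (simp add: prod.distrib sum_distrib_left exp_sum flip: of_real_prod)
  qed
  have fint: "integrable lborel (f b)" for b
    unfolding f_def using gaussian_fourier_real(1)[OF assms] by simp
  have "integrable ?P (\<lambda>h. \<Prod>b\<in>Basis. f b (h b))"
    by (intro product_integrable_prod fint) auto
  then show "integrable lborel (\<lambda>x. iexp (w \<bullet> x) * complex_of_real (exp (- s * (norm x)\<^sup>2)))"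
    by (subst lborel_eq, subst integrable_distr_eq) (simp_all only: prod, measurable)
  have "(\<integral>x. iexp (w \<bullet> x) * complex_of_real (exp (- s * (norm x)\<^sup>2)) \<partial>lborel) = (\<integral>h. (\<Prod>b\<in>Basis. f b (h b)) \<partial>?P)"
    by (subst lborel_eq, subst integral_distr) (simp_all only: prod, measurable)
  also have "\<dots> = (\<Prod>b\<in>Basis. integral\<^sup>L lborel (f b))"
    by (intro product_integral_prod fint) auto
  also have "\<dots> = (\<Prod>b\<in>(Basis::'a set). complex_of_real (sqrt (pi / s) * exp (- (w \<bullet> b)\<^sup>2 / (4 * s))))"
    unfolding f_def by (intro prod.cong refl gaussian_fourier_real(2) assms)
  also have "\<dots> = complex_of_real ((\<Prod>b\<in>(Basis::'a set). sqrt (pi / s)) * exp (\<Sum>b\<in>Basis. - (w \<bullet> b)\<^sup>2 / (4 * s)))"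
    by (simp add: prod.distrib exp_sum)
  also have "(\<Sum>b\<in>Basis. - (w \<bullet> b)\<^sup>2 / (4 * s)) = - (norm w)\<^sup>2 / (4 * s)"
    by (simp add: norm_eq_sqrt_inner euclidean_inner[of w w] sum_nonneg power2_eq_square
        sum_divide_distrib sum_negf)
  also have "(\<Prod>b\<in>(Basis::'a set). sqrt (pi / s)) = (pi / s) powr (real DIM('a) / 2)"
    using assms by (simp add: powr_half_sqrt[symmetric] powr_powr flip: powr_realpow)
  finally show "(\<integral>x. iexp (w \<bullet> x) * complex_of_real (exp (- s * (norm x)\<^sup>2)) \<partial>lborel)
           = complex_of_real ((pi / s) powr (real DIM('a) / 2) * exp (- (norm w)\<^sup>2 / (4 * s)))" .
qed

lemma
  fixes w :: "'a::euclidean_space"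
  assumes "s > 0"
  shows integrable_gaussian_cos: "integrable lborel (\<lambda>x. cos (w \<bullet> x) * exp (- s * (norm x)\<^sup>2))"
    and gaussian_fourier_cos: "(\<integral>x. cos (w \<bullet> x) * exp (- s * (norm x)\<^sup>2) \<partial>lborel)
           = (pi / s) powr (real DIM('a) / 2) * exp (- (norm w)\<^sup>2 / (4 * s))"
proof -
  have eq: "cos (w \<bullet> x) * exp (- s * (norm x)\<^sup>2) = Re (iexp (w \<bullet> x) * complex_of_real (exp (- s * (norm x)\<^sup>2)))" for x
    by (simp add: Re_exp)
  show "integrable lborel (\<lambda>x. cos (w \<bullet> x) * exp (- s * (norm x)\<^sup>2))"
    unfolding eq by (intro integrable_Re integrable_gaussian_iexp assms)
  show "(\<integral>x. cos (w \<bullet> x) * exp (- s * (norm x)\<^sup>2) \<partial>lborel)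
           = (pi / s) powr (real DIM('a) / 2) * exp (- (norm w)\<^sup>2 / (4 * s))"
    unfolding eq
    by (subst integral_Re[OF integrable_gaussian_iexp[OF assms]]) (simp only: gaussian_fourier_iexp[OF assms] Re_complex_of_real)
qed

lemma
  assumes "s > 0"
  shows integrable_gaussian: "integrable lborel (\<lambda>x::'a::euclidean_space. exp (- s * (norm x)\<^sup>2))"
    and integral_gaussian: "(\<integral>x. exp (- s * (norm (x::'a))\<^sup>2) \<partial>lborel) = (pi / s) powr (real DIM('a) / 2)"
  using integrable_gaussian_cos[OF assms, of 0] gaussian_fourier_cos[OF assms, of 0] by simp_all

lemma integral_lborel_translate:
  fixes f :: "'a::euclidean_space \<Rightarrow> 'b::{banach,second_countable_topology}"
  shows "(\<integral>x. f (c + x) \<partial>lborel) = (\<integral>x. f x \<partial>lborel)"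
    "integrable lborel (\<lambda>x. f (c + x)) \<longleftrightarrow> integrable lborel f"
proof -
  have *: "(\<lambda>x. c + x) ` UNIV = UNIV" by auto
  have 1: "integral\<^sup>L (distr lborel lborel ((+) c)) f = (\<integral>x. f (c + x) \<partial>lborel)" 
    if "f \<in> borel_measurable borel" for f :: "'a \<Rightarrow> 'b" and c
    using that by (subst integral_distr) auto
  have 2: "integrable (distr lborel lborel ((+) c)) f = integrable lborel (\<lambda>x. f (c + x))" 
    if "f \<in> borel_measurable borel" for f :: "'a \<Rightarrow> 'b" and c
    using that by (subst integrable_distr_eq) auto
  have 3: "distr lborel lborel ((+) c) = lborel" for c :: 'a
    using lborel_distr_plus[of c] by (metis distr_cong sets_lborel)
  have i: "integrable lborel (\<lambda>x. f (c + x)) \<longleftrightarrow> integrable lborel f"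
  proof
    assume a: "integrable lborel f"
    then have "f \<in> borel_measurable borel" by (auto dest: borel_measurable_integrable)
    from 2[OF this, of c] 3 a show "integrable lborel (\<lambda>x. f (c + x))" by simp
  next
    assume a: "integrable lborel (\<lambda>x. f (c + x))"
    then have "(\<lambda>x. f (c + x)) \<in> borel_measurable borel" by (auto dest: borel_measurable_integrable)
    from 2[OF this, of "-c"] 3 a show "integrable lborel f" by simp
  qed
  then show "integrable lborel (\<lambda>x. f (c + x)) \<longleftrightarrow> integrable lborel f" .
  show "(\<integral>x. f (c + x) \<partial>lborel) = (\<integral>x. f x \<partial>lborel)"
  proof (cases "integrable lborel f")
    case True
    then have "f \<in> borel_measurable borel" by (auto dest: borel_measurable_integrable)
    from 1[OF this, of c] 3 show ?thesis by simp
  qed (use i in \<open>simp add: not_integrable_integral_eq\<close>)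
qed

lemma nn_integral_lborel_translate:
  fixes f :: "'a::euclidean_space \<Rightarrow> ennreal"
  assumes [measurable]: "f \<in> borel_measurable borel"
  shows "(\<integral>\<^sup>+x. f (c + x) \<partial>lborel) = (\<integral>\<^sup>+x. f x \<partial>lborel)"
  by (subst (2) lborel_distr_plus[of c, symmetric], subst nn_integral_distr) auto

text \<open>Completing the square around the weighted mean of \<open>a\<close> and
  \<open>b\<close>.\<close>

lemma two_gaussians:
  fixes x a b :: "'a::euclidean_space"
  assumes "\<beta> + \<gamma> > 0"
  shows "\<beta> * (norm (x - a))\<^sup>2 + \<gamma> * (norm (x - b))\<^sup>2
    = (\<beta> + \<gamma>) * (norm (x - ((\<beta> / (\<beta> + \<gamma>)) *\<^sub>R a + (\<gamma> / (\<beta> + \<gamma>)) *\<^sub>R b)))\<^sup>2 + \<beta> * \<gamma> / (\<beta> + \<gamma>) * (norm (a - b))\<^sup>2"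
proof -
  define s p where "s = \<beta> + \<gamma>" and "p = \<beta> / s"
  have s: "s \<noteq> 0" "\<beta> = s * p" "\<gamma> = s * (1 - p)" using assms by (auto simp: s_def p_def field_simps)
  have e: "\<beta> + \<gamma> = s" "\<beta> / s = p" "\<gamma> / s = 1 - p" "\<beta> * \<gamma> / s = s * (p * (1 - p))"
    using s(1) unfolding s(2,3) by (simp_all add: field_simps)
  have "p * (norm (x - a))\<^sup>2 + (1 - p) * (norm (x - b))\<^sup>2
      = (norm (x - (p *\<^sub>R a + (1 - p) *\<^sub>R b)))\<^sup>2 + p * (1 - p) * (norm (a - b))\<^sup>2"
    unfolding power2_norm_eq_inner by (simp add: inner_simps inner_commute algebra_simps)
  from arg_cong[OF this, of "\<lambda>r. s * r"] show ?thesis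
    using e unfolding e unfolding s(2,3) by (simp only: algebra_simps)
qed

lemma
  fixes a b :: "'a::euclidean_space"
  assumes "\<beta> > 0" "\<gamma> > 0"
  shows integrable_two_gaussians: "integrable lborel (\<lambda>x. exp (- \<beta> * (norm (x - a))\<^sup>2) * exp (- \<gamma> * (norm (x - b))\<^sup>2))"
    and integral_two_gaussians: "(\<integral>x. exp (- \<beta> * (norm (x - a))\<^sup>2) * exp (- \<gamma> * (norm (x - b))\<^sup>2) \<partial>lborel)
      = (pi / (\<beta> + \<gamma>)) powr (real DIM('a) / 2) * exp (- (\<beta> * \<gamma> / (\<beta> + \<gamma>)) * (norm (a - b))\<^sup>2)"
proof -
  define c where "c = (\<beta> / (\<beta> + \<gamma>)) *\<^sub>R a + (\<gamma> / (\<beta> + \<gamma>)) *\<^sub>R b"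
  have pos: "\<beta> + \<gamma> > 0" using assms by simp
  have eq: "exp (- \<beta> * (norm (x - a))\<^sup>2) * exp (- \<gamma> * (norm (x - b))\<^sup>2)
     = exp (- (\<beta> * \<gamma> / (\<beta> + \<gamma>)) * (norm (a - b))\<^sup>2) * exp (- (\<beta> + \<gamma>) * (norm (- c + x))\<^sup>2)" for x
    using two_gaussians[OF pos, of x a b] unfolding c_def[symmetric]
    by (simp add: algebra_simps flip: exp_add)
  have i: "integrable lborel (\<lambda>x. exp (- (\<beta> + \<gamma>) * (norm (- c + x))\<^sup>2))"
    using integral_lborel_translate(2)[of "\<lambda>x. exp (- (\<beta> + \<gamma>) * (norm (x))\<^sup>2)" "-c"] integrable_gaussian[OF pos] by simp
  have v: "(\<integral>x. exp (- (\<beta> + \<gamma>) * (norm (- c + x))\<^sup>2) \<partial>lborel) = (pi / (\<beta> + \<gamma>)) powr (real DIM('a) / 2)"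
    using integral_lborel_translate(1)[of "\<lambda>x. exp (- (\<beta> + \<gamma>) * (norm (x))\<^sup>2)" "-c"] integral_gaussian[OF pos, where 'a='a] by simp
  show "integrable lborel (\<lambda>x. exp (- \<beta> * (norm (x - a))\<^sup>2) * exp (- \<gamma> * (norm (x - b))\<^sup>2))"
    unfolding eq using i by simp
  show "(\<integral>x. exp (- \<beta> * (norm (x - a))\<^sup>2) * exp (- \<gamma> * (norm (x - b))\<^sup>2) \<partial>lborel)
      = (pi / (\<beta> + \<gamma>)) powr (real DIM('a) / 2) * exp (- (\<beta> * \<gamma> / (\<beta> + \<gamma>)) * (norm (a - b))\<^sup>2)"
    unfolding eq using v by simp
qed

section \<open>The heat kernel\<close>

lemma heat_nonneg [simp]: "heat s w \<ge> 0"
  by (simp add: heat_def)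

lemma continuous_on_heat [continuous_intros]:
  fixes f :: "'b::topological_space \<Rightarrow> 'a::euclidean_space"
  assumes "continuous_on S f"
  shows "continuous_on S (\<lambda>x. heat s (f x))"
  unfolding heat_def divide_inverse by (intro continuous_intros assms)

lemma borel_measurable_heat [measurable]: "heat s \<in> borel_measurable borel"
  by (intro borel_measurable_continuous_onI continuous_intros)

lemma exp_eq_heat:
  fixes w :: "'a::euclidean_space"
  assumes "V > 0"
  shows "exp (- V * (norm w)\<^sup>2) = (pi / V) powr (real DIM('a) / 2) * heat (1 / (4 * V)) w"
proof -
  have "(4 * pi * (1 / (4 * V))) = pi / V" by simp
  moreover have "(pi / V) powr (real DIM('a) / 2) * (pi / V) powr - (real DIM('a) / 2) = 1"
    using assms by (simp flip: powr_add)
  ultimately show ?thesis unfolding heat_def using assms by (simp add: field_simps)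
qed

text \<open>Fourier inversion with the positive symbol exp (- s |x|^2). It turns quadratic forms in
  heat kernels into integrals of squares, and it makes times add under convolution.\<close>

lemma heat_fourier:
  fixes w :: "'a::euclidean_space"
  assumes "s > 0"
  shows "heat s w = (2 * pi) powr - real DIM('a) * (\<integral>x. cos (w \<bullet> x) * exp (- s * (norm x)\<^sup>2) \<partial>lborel)"
proof -
  have "(2 * pi) powr - real DIM('a) = ((2 * pi) powr 2) powr (- (real DIM('a) / 2))"
    unfolding powr_powr by simp
  also have "(2 * pi) powr 2 = 4 * pi\<^sup>2" by (simp add: powr_numeral power_mult_distrib)
  finally have "(2 * pi) powr - real DIM('a) * (pi / s) powr (real DIM('a) / 2)
      = (4 * pi\<^sup>2) powr (- (real DIM('a) / 2)) * (s / pi) powr (- (real DIM('a) / 2))"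
    using assms by (simp add: powr_minus powr_divide field_simps)
  also have "\<dots> = (4 * pi * s) powr (- (real DIM('a) / 2))"
    using assms by (simp add: powr_mult[symmetric] power2_eq_square mult.assoc)
  finally have e: "(4 * pi * s) powr (- (real DIM('a) / 2)) = (2 * pi) powr - real DIM('a) * (pi / s) powr (real DIM('a) / 2)" ..
  show ?thesis unfolding gaussian_fourier_cos[OF assms] heat_def e by simp
qed

lemma
  fixes a b :: "'a::euclidean_space"
  assumes "s > 0" "t > 0"
  shows integrable_heat_mult: "integrable lborel (\<lambda>x. heat s (x - a) * heat t (x - b))"
    and heat_semigroup: "(\<integral>x. heat s (x - a) * heat t (x - b) \<partial>lborel) = heat (s + t) (a - b)"
proof -
  define d where "d = real DIM('a) / 2"
  have eq: "heat s (x - a) * heat t (x - b) = (4 * pi * s) powr - d * (4 * pi * t) powr - d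
     * (exp (- (1 / (4 * s)) * (norm (x - a))\<^sup>2) * exp (- (1 / (4 * t)) * (norm (x - b))\<^sup>2))" for x
    unfolding heat_def d_def by simp
  have p: "1 / (4 * s) > 0" "1 / (4 * t) > 0" using assms by auto
  show "integrable lborel (\<lambda>x. heat s (x - a) * heat t (x - b))"
    unfolding eq using integrable_two_gaussians[OF p] by (rule integrable_mult_right)
  have 1: "1 / (4 * s) + 1 / (4 * t) = (s + t) / (4 * s * t)" using assms by (simp add: field_simps)
  have 2: "1 / (4 * s) * (1 / (4 * t)) / (1 / (4 * s) + 1 / (4 * t)) = 1 / (4 * (s + t))"
    unfolding 1 using assms by (simp add: field_simps)
  have "(4 * pi * s) powr - d * (4 * pi * t) powr - d * (pi / ((s + t) / (4 * s * t))) powr d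
     = (4 * pi * s) powr - d * (4 * pi * t) powr - d * (((4 * pi * s) * (4 * pi * t)) / (4 * pi * (s + t))) powr d"
  proof -
    have "pi / ((s + t) / (4 * s * t)) = ((4 * pi * s) * (4 * pi * t)) / (4 * pi * (s + t))"
      using assms by (simp add: divide_simps)
    then show ?thesis by (simp only:)
  qed
  also have "\<dots> = (4 * pi * (s + t)) powr - d"
  proof -
    define P Q S where "P = 4 * pi * s" and "Q = 4 * pi * t" and "S = 4 * pi * (s + t)"
    have "P > 0" "Q > 0" "S > 0" using assms by (auto simp: P_def Q_def S_def)
    then show ?thesis unfolding P_def[symmetric] Q_def[symmetric] S_def[symmetric]
      by (simp add: powr_divide powr_mult powr_minus divide_simps)
  qed
  finally have 3: "(4 * pi * s) powr - d * (4 * pi * t) powr - d * (pi / ((s + t) / (4 * s * t))) powr d = (4 * pi * (s + t)) powr - d" .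
  show "(\<integral>x. heat s (x - a) * heat t (x - b) \<partial>lborel) = heat (s + t) (a - b)"
  proof -
    have "(\<integral>x. heat s (x - a) * heat t (x - b) \<partial>lborel)
      = (4 * pi * s) powr - d * (4 * pi * t) powr - d * ((pi / ((s + t) / (4 * s * t))) powr d * exp (- (1 / (4 * (s + t))) * (norm (a - b))\<^sup>2))"
      unfolding eq integral_mult_right_zero integral_two_gaussians[OF p] 1 2[unfolded 1] d_def[symmetric] ..
    also have "\<dots> = (4 * pi * (s + t)) powr - d * exp (- (1 / (4 * (s + t))) * (norm (a - b))\<^sup>2)"
      unfolding 3[symmetric] by (simp only: mult.assoc)
    finally show ?thesis unfolding heat_def d_def by simp
  qed
qed

lemma
  fixes a :: "'a::euclidean_space"
  assumes "s > 0"
  shows integrable_heat: "integrable lborel (\<lambda>x. heat s (x - a))"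
    and integral_heat: "(\<integral>x. heat s (x - a) \<partial>lborel) = 1"
proof -
  have p: "1 / (4 * s) > 0" using assms by auto
  have eq: "heat s x = (4 * pi * s) powr (- (real DIM('a) / 2)) * exp (- (1 / (4 * s)) * (norm x)\<^sup>2)" for x :: 'a
    unfolding heat_def by simp
  have "integrable lborel (heat s :: 'a \<Rightarrow> real)"
    unfolding eq[abs_def] by (intro integrable_mult_right integrable_gaussian p)
  then show "integrable lborel (\<lambda>x. heat s (x - a))"
    using integral_lborel_translate(2)[of "heat s" "-a"] by simp
  have "(\<integral>x. heat s (x::'a) \<partial>lborel) = 1"
    unfolding eq integral_mult_right_zero integral_gaussian[OF p]
    using assms by (simp add: powr_minus mult.commute mult.left_commute)
  then show "(\<integral>x. heat s (x - a) \<partial>lborel) = 1"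
    using integral_lborel_translate(1)[of "heat s" "-a"] by simp
qed

text \<open>Plancherel: \<open>E x\<close> is the squared modulus of the Fourier transform of the
  sum of the \<open>q i * heat (s i)\<close> centred at \<open>p i\<close>, and the addition formula
  for the cosine turns the double sum into the two squares. The case \<open>s i = 0\<close> of point
  masses is included; convergence then rests on \<sigma> > 0.\<close>

lemma heat_energy:
  fixes p :: "'i \<Rightarrow> 'a::euclidean_space" and q s :: "'i \<Rightarrow> real"
  assumes "finite I" "\<sigma> > 0" "\<And>i. i \<in> I \<Longrightarrow> s i \<ge> 0"
  defines "E \<equiv> \<lambda>x::'a. (\<Sum>i\<in>I. q i * exp (- s i * (norm x)\<^sup>2) * cos (p i \<bullet> x))\<^sup>2 + (\<Sum>i\<in>I. q i * exp (- s i * (norm x)\<^sup>2) * sin (p i \<bullet> x))\<^sup>2"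
  shows "integrable lborel (\<lambda>x. E x * exp (- \<sigma> * (norm x)\<^sup>2))"
    and "(\<Sum>i\<in>I. \<Sum>j\<in>I. q i * q j * heat (s i + s j + \<sigma>) (p i - p j))
      = (2 * pi) powr - real DIM('a) * (\<integral>x. E x * exp (- \<sigma> * (norm x)\<^sup>2) \<partial>lborel)"
proof -
  have pos: "s i + s j + \<sigma> > 0" if "i \<in> I" "j \<in> I" for i j
    using assms(2) assms(3)[OF that(1)] assms(3)[OF that(2)] by linarith
  have eq: "E x * exp (- \<sigma> * (norm x)\<^sup>2) =
     (\<Sum>i\<in>I. \<Sum>j\<in>I. q i * q j * (cos ((p i - p j) \<bullet> x) * exp (- (s i + s j + \<sigma>) * (norm x)\<^sup>2)))" for x
  proof -
    have "q i * q j * (cos ((p i - p j) \<bullet> x) * exp (- (s i + s j + \<sigma>) * (norm x)\<^sup>2))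
      = ((q i * exp (- s i * (norm x)\<^sup>2) * cos (p i \<bullet> x)) * (q j * exp (- s j * (norm x)\<^sup>2) * cos (p j \<bullet> x))
        + (q i * exp (- s i * (norm x)\<^sup>2) * sin (p i \<bullet> x)) * (q j * exp (- s j * (norm x)\<^sup>2) * sin (p j \<bullet> x)))
        * exp (- \<sigma> * (norm x)\<^sup>2)" for i j
      by (simp add: inner_diff_left cos_diff distrib_left distrib_right mult_ac
          minus_add_distrib[symmetric] flip: exp_add) (simp add: exp_add exp_diff exp_minus field_simps)
    then show ?thesis
      unfolding E_def by (simp only: power2_eq_square[of "sum _ _"] sum_product sum.distrib sum_distrib_right[symmetric])
  qed
  show "integrable lborel (\<lambda>x. E x * exp (- \<sigma> * (norm x)\<^sup>2))"
    unfolding eq by (intro Bochner_Integration.integrable_sum integrable_mult_right integrable_gaussian_cos pos)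
  have "(\<integral>x. E x * exp (- \<sigma> * (norm x)\<^sup>2) \<partial>lborel)
    = (\<Sum>i\<in>I. \<Sum>j\<in>I. q i * q j * (\<integral>x. cos ((p i - p j) \<bullet> x) * exp (- (s i + s j + \<sigma>) * (norm x)\<^sup>2) \<partial>lborel))"
    unfolding eq
    by (subst Bochner_Integration.integral_sum, intro Bochner_Integration.integrable_sum integrable_mult_right integrable_gaussian_cos pos, assumption, assumption,
        intro sum.cong refl, subst Bochner_Integration.integral_sum, intro integrable_mult_right integrable_gaussian_cos pos) simp_all
  then show "(\<Sum>i\<in>I. \<Sum>j\<in>I. q i * q j * heat (s i + s j + \<sigma>) (p i - p j))
      = (2 * pi) powr - real DIM('a) * (\<integral>x. E x * exp (- \<sigma> * (norm x)\<^sup>2) \<partial>lborel)"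
    by (simp add: sum_distrib_left heat_fourier pos mult.assoc mult.left_commute cong: sum.cong)
qed

text \<open>The approximate identity of the shells, without the factor 1 / sqrt pi: its mass is sqrt
  pi for every \<epsilon>.\<close>

definition thick :: "real \<Rightarrow> real \<Rightarrow> real" where
  "thick \<epsilon> v = exp (- (v / \<epsilon>)\<^sup>2) / \<epsilon>"

lemma thick_bounds: "\<epsilon> > 0 \<Longrightarrow> thick \<epsilon> v \<ge> 0" "\<epsilon> > 0 \<Longrightarrow> thick \<epsilon> v \<le> 1 / \<epsilon>"
  by (auto simp: thick_def divide_simps)

lemma thick_minus [simp]: "thick \<epsilon> (- v) = thick \<epsilon> v"
  by (simp add: thick_def)

lemma borel_measurable_thick [measurable]: "thick \<epsilon> \<in> borel_measurable borel"
  unfolding thick_def[abs_def] by measurable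

text \<open>The integral over \<open>r\<close> is Gaussian and leaves a Gaussian in
  \<open>a - b\<close>. That Gaussian is written back as a cosine integral over \<open>y\<close>, so
  that \<open>a - b\<close> occurs only in a phase; in the application \<open>a - b\<close> is
  linear in the centre of the shell, and the integral over centres becomes a Fourier
  transform.\<close>

lemma thick_correlation:
  fixes a b B \<epsilon> :: real
  assumes "B > 0" "\<epsilon> > 0"
  shows "integrable lborel (\<lambda>r. exp (- r) * thick \<epsilon> (a - B * r) * thick \<epsilon> (b - B * r))"
    and "(\<integral>r. exp (- r) * thick \<epsilon> (a - B * r) * thick \<epsilon> (b - B * r) \<partial>lborel)
      = exp (\<epsilon>\<^sup>2 / (8 * B\<^sup>2)) / (2 * B) * exp (- (a + b) / (2 * B)) * (\<integral>y. cos ((a - b) * y) * exp (- (\<epsilon>\<^sup>2 / 2) * y\<^sup>2) \<partial>lborel)"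
proof -
  \<comment> \<open>Completing the square in \<open>r\<close>: \<open>c\<close> is the quadratic
    coefficient, \<open>- m\<close> the vertex, and \<open>K\<close> the factor that
    remains.\<close>
  define c where "c = 2 * B\<^sup>2 / \<epsilon>\<^sup>2"
  define m where "m = \<epsilon>\<^sup>2 / (4 * B\<^sup>2) - (a + b) / (2 * B)"
  define K where "K = exp (\<epsilon>\<^sup>2 / (8 * B\<^sup>2)) * exp (- (a + b) / (2 * B)) * exp (- (a - b)\<^sup>2 / (2 * \<epsilon>\<^sup>2)) / \<epsilon>\<^sup>2"
  have c: "c > 0" using assms by (simp add: c_def)
  have "- r + - ((a - B * r) / \<epsilon>)\<^sup>2 + - ((b - B * r) / \<epsilon>)\<^sup>2
     = \<epsilon>\<^sup>2 / (8 * B\<^sup>2) + - (a + b) / (2 * B) + - (a - b)\<^sup>2 / (2 * \<epsilon>\<^sup>2) + (- c * (m + r)\<^sup>2)" for r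
    unfolding c_def m_def using assms by (simp add: field_simps power2_eq_square) 
  then have eq: "exp (- r) * thick \<epsilon> (a - B * r) * thick \<epsilon> (b - B * r) = K * exp (- c * (norm (m + r))\<^sup>2)" for r
    unfolding thick_def K_def by (simp add: power2_eq_square[of \<epsilon>] flip: exp_add)
  have i: "integrable lborel (\<lambda>r. exp (- c * (norm (m + r))\<^sup>2))"
    using integral_lborel_translate(2)[of "\<lambda>x. exp (- c * (norm x)\<^sup>2)" m] integrable_gaussian[OF c, where 'a=real] by simp
  have v: "(\<integral>r. exp (- c * (norm (m + r))\<^sup>2) \<partial>lborel) = sqrt (pi / c)"
    using integral_lborel_translate(1)[of "\<lambda>x. exp (- c * (norm x)\<^sup>2)" m] integral_gaussian[OF c, where 'a=real] c
    by (simp add: powr_half_sqrt)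
  show "integrable lborel (\<lambda>r. exp (- r) * thick \<epsilon> (a - B * r) * thick \<epsilon> (b - B * r))"
    unfolding eq using i by simp
  have e2: "\<epsilon>\<^sup>2 / 2 > 0" using assms by simp
  have sq1: "sqrt (pi / c) = \<epsilon> / B * sqrt (pi / 2)"
    unfolding c_def using assms by (simp add: real_sqrt_mult real_sqrt_divide mult_ac)
  have sq2: "sqrt (pi / (\<epsilon>\<^sup>2 / 2)) = 2 / \<epsilon> * sqrt (pi / 2)"
    using assms by (simp add: real_sqrt_mult real_sqrt_divide field_simps)
  have "(\<integral>y. cos ((a - b) * y) * exp (- (\<epsilon>\<^sup>2 / 2) * y\<^sup>2) \<partial>lborel) = sqrt (pi / (\<epsilon>\<^sup>2 / 2)) * exp (- (a - b)\<^sup>2 / (2 * \<epsilon>\<^sup>2))"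
    using gaussian_fourier_cos[OF e2, of "a - b"] e2 by (simp add: powr_half_sqrt)
  then show "(\<integral>r. exp (- r) * thick \<epsilon> (a - B * r) * thick \<epsilon> (b - B * r) \<partial>lborel)
      = exp (\<epsilon>\<^sup>2 / (8 * B\<^sup>2)) / (2 * B) * exp (- (a + b) / (2 * B)) * (\<integral>y. cos ((a - b) * y) * exp (- (\<epsilon>\<^sup>2 / 2) * y\<^sup>2) \<partial>lborel)"
    unfolding eq integral_mult_right_zero v sq1 sq2 K_def using assms
    by (simp add: field_simps power2_eq_square[of \<epsilon>])
qed

section \<open>Averages over thickened shells\<close>

text \<open>With the origin at the midpoint of \<open>z\<close> and \<open>w\<close>, the two
  squared distances to \<open>x\<close> have a radial sum and a difference linear in
  \<open>x\<close>. The phase from \<open>thick_correlation\<close> then makes the integral over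
  \<open>x\<close> a Gaussian Fourier transform at a frequency proportional to
  \<open>y * (z - w)\<close>. Without the cut-off in \<epsilon>, the integral over \<open>y\<close>
  of the resulting Gaussians would be of size 1 / |z - w| at small distances.\<close>

lemma thick_correlation_nn:
  fixes z w :: "'a::euclidean_space" and A B \<epsilon> :: real
  assumes "A > 0" "B > 0" "\<epsilon> > 0"
  shows "(\<integral>\<^sup>+x. \<integral>\<^sup>+r. ennreal (exp (- r) * thick \<epsilon> (A * (norm (z - x))\<^sup>2 - B * r) * thick \<epsilon> (A * (norm (w - x))\<^sup>2 - B * r)) \<partial>lborel \<partial>lborel)
    = ennreal (exp (\<epsilon>\<^sup>2 / (8 * B\<^sup>2)) / (2 * B) * (pi * B / A) powr (real DIM('a) / 2)) *
       (\<integral>\<^sup>+y. ennreal (exp (- (\<epsilon>\<^sup>2 / 2) * y\<^sup>2) * exp (- (A / (4 * B) + A * B * y\<^sup>2) * (norm (z - w))\<^sup>2)) \<partial>lborel)"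
proof -
  define u where "u = (1 / 2) *\<^sub>R (z - w)"
  define m where "m = (1 / 2) *\<^sub>R (z + w)"
  define K where "K = exp (\<epsilon>\<^sup>2 / (8 * B\<^sup>2)) / (2 * B)"
  define e where "e = \<epsilon>\<^sup>2 / 2"
  define F where "F x = (\<integral>r. exp (- r) * thick \<epsilon> (A * (norm (u - x))\<^sup>2 - B * r) * thick \<epsilon> (A * (norm (- u - x))\<^sup>2 - B * r) \<partial>lborel)" for x
  have K: "K > 0" and e: "e > 0" using assms by (auto simp: K_def e_def)
  have zm: "z - (m + x) = u - x" "w - (m + x) = - u - x" for x
    unfolding u_def m_def by (simp_all add: algebra_simps flip: scaleR_add_left)
  have F_nonneg: "F x \<ge> 0" for x
    unfolding F_def using assms by (intro Bochner_Integration.integral_nonneg) (auto simp: thick_bounds)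
  have "(\<integral>\<^sup>+x. \<integral>\<^sup>+r. ennreal (exp (- r) * thick \<epsilon> (A * (norm (z - x))\<^sup>2 - B * r) * thick \<epsilon> (A * (norm (w - x))\<^sup>2 - B * r)) \<partial>lborel \<partial>lborel)
    = (\<integral>\<^sup>+x. \<integral>\<^sup>+r. ennreal (exp (- r) * thick \<epsilon> (A * (norm (u - x))\<^sup>2 - B * r) * thick \<epsilon> (A * (norm (- u - x))\<^sup>2 - B * r)) \<partial>lborel \<partial>lborel)"
    by (subst nn_integral_lborel_translate[of _ m, symmetric]) (measurable, simp only: zm)
  also have "\<dots> = (\<integral>\<^sup>+x. ennreal (F x) \<partial>lborel)"
    unfolding F_def using assms
    by (intro nn_integral_cong nn_integral_eq_integral thick_correlation AE_I2) (auto simp: thick_bounds)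
  finally have 1: "(\<integral>\<^sup>+x. \<integral>\<^sup>+r. ennreal (exp (- r) * thick \<epsilon> (A * (norm (z - x))\<^sup>2 - B * r) * thick \<epsilon> (A * (norm (w - x))\<^sup>2 - B * r)) \<partial>lborel \<partial>lborel) = (\<integral>\<^sup>+x. ennreal (F x) \<partial>lborel)" .
  \<comment> \<open>The integrand in both variables once the correlation is an oscillatory integral.
    It changes sign, so exchanging the integrals needs the dominating product of Gaussians in
    \<open>Gb\<close>.\<close>
  define G where "G x y = K * exp (- (A / B) * (norm u)\<^sup>2) * (exp (- (A / B) * (norm x)\<^sup>2) * cos (((4 * A * y) *\<^sub>R u) \<bullet> x) * exp (- e * y\<^sup>2))" for x y
  have F_eq: "F x = (\<integral>y. G x y \<partial>lborel)" for x
  proof -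
    have sum: "A * (norm (u - x))\<^sup>2 + A * (norm (- u - x))\<^sup>2 = 2 * A * (norm u)\<^sup>2 + 2 * A * (norm x)\<^sup>2"
      by (simp add: power2_norm_eq_inner inner_simps inner_commute algebra_simps)
    have diff: "A * (norm (u - x))\<^sup>2 - A * (norm (- u - x))\<^sup>2 = - (4 * A * (u \<bullet> x))"
      by (simp add: power2_norm_eq_inner inner_simps inner_commute algebra_simps)
    have "exp (- (2 * A * (norm u)\<^sup>2 + 2 * A * (norm x)\<^sup>2) / (2 * B)) = exp (- (A / B) * (norm u)\<^sup>2) * exp (- (A / B) * (norm x)\<^sup>2)"
      using assms by (simp add: field_simps flip: exp_add)
    then show ?thesis
      unfolding F_def thick_correlation(2)[OF assms(2,3)] sum diff G_def K_def[symmetric] e_def[symmetric]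
      by (simp add: mult_ac flip: integral_mult_right_zero)
  qed
  have AB: "A / B > 0" using assms by simp
  have i0: "integrable lborel (\<lambda>y::real. exp (- e * y\<^sup>2))"
    using integrable_gaussian[OF e, where 'a=real] by simp
  have Gb: "\<bar>G x y\<bar> \<le> K * (exp (- (A / B) * (norm x)\<^sup>2) * exp (- e * y\<^sup>2))" for x y
  proof -
    have "exp (- (A / B) * (norm u)\<^sup>2) \<le> 1" using assms by simp
    moreover have "\<bar>cos (((4 * A * y) *\<^sub>R u) \<bullet> x)\<bar> \<le> 1" by simp
    ultimately have "exp (- (A / B) * (norm u)\<^sup>2) * \<bar>cos (((4 * A * y) *\<^sub>R u) \<bullet> x)\<bar> \<le> 1"
      by (intro mult_le_one) auto
    then have "K * (exp (- (A / B) * (norm x)\<^sup>2) * exp (- e * y\<^sup>2)) * (exp (- (A / B) * (norm u)\<^sup>2) * \<bar>cos (((4 * A * y) *\<^sub>R u) \<bullet> x)\<bar>)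
      \<le> K * (exp (- (A / B) * (norm x)\<^sup>2) * exp (- e * y\<^sup>2)) * 1"
      using K by (intro mult_left_mono) auto
    then show ?thesis unfolding G_def using K by (simp add: abs_mult mult_ac)
  qed
  have Gm [measurable]: "case_prod G \<in> borel_measurable (lborel \<Otimes>\<^sub>M lborel)"
    unfolding G_def by measurable
  have ib: "integrable (lborel \<Otimes>\<^sub>M lborel) (\<lambda>(x::'a, y::real). K * (exp (- (A / B) * (norm x)\<^sup>2) * exp (- e * y\<^sup>2)))"
    by (rule lborel_pair.Fubini_integrable)
      (use K integrable_gaussian[OF AB, where 'a='a] i0 in \<open>auto intro!: integrable_mult_right integrable_mult_left simp: abs_mult simp del: mult_minus_left\<close>)
  have iG: "integrable (lborel \<Otimes>\<^sub>M lborel) (case_prod G)"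
    by (rule Bochner_Integration.integrable_bound[OF ib Gm]) (use K Gb in \<open>auto simp: abs_mult\<close>)
  have Gx: "(\<integral>x. G x y \<partial>lborel) = K * (pi * B / A) powr (real DIM('a) / 2) *
      (exp (- e * y\<^sup>2) * exp (- (A / (4 * B) + A * B * y\<^sup>2) * (norm (z - w))\<^sup>2))" for y
  proof -
    have "(\<integral>x. G x y \<partial>lborel) = K * exp (- (A / B) * (norm u)\<^sup>2) * exp (- e * y\<^sup>2) * (\<integral>x. cos (((4 * A * y) *\<^sub>R u) \<bullet> x) * exp (- (A / B) * (norm x)\<^sup>2) \<partial>lborel)"
      unfolding G_def by (simp add: mult_ac flip: integral_mult_right_zero)
    also have "\<dots> = K * exp (- (A / B) * (norm u)\<^sup>2) * exp (- e * y\<^sup>2) * ((pi / (A / B)) powr (real DIM('a) / 2) * exp (- (norm ((4 * A * y) *\<^sub>R u))\<^sup>2 / (4 * (A / B))))"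
      unfolding gaussian_fourier_cos[OF AB] ..
    also have "- (norm ((4 * A * y) *\<^sub>R u))\<^sup>2 / (4 * (A / B)) = - (4 * A * B * y\<^sup>2) * (norm u)\<^sup>2"
      using assms by (simp add: power_mult_distrib field_simps power2_eq_square)
    also have "K * exp (- (A / B) * (norm u)\<^sup>2) * exp (- e * y\<^sup>2) * ((pi / (A / B)) powr (real DIM('a) / 2) * exp (- (4 * A * B * y\<^sup>2) * (norm u)\<^sup>2))
      = K * (pi * B / A) powr (real DIM('a) / 2) * (exp (- e * y\<^sup>2) * (exp (- (A / B) * (norm u)\<^sup>2) * exp (- (4 * A * B * y\<^sup>2) * (norm u)\<^sup>2)))"
      by simp
    also have "(norm u)\<^sup>2 = (norm (z - w))\<^sup>2 / 4"
      unfolding u_def by (simp add: power_mult_distrib power_divide)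
    also have "exp (- (A / B) * ((norm (z - w))\<^sup>2 / 4)) * exp (- (4 * A * B * y\<^sup>2) * ((norm (z - w))\<^sup>2 / 4))
       = exp (- (A / (4 * B) + A * B * y\<^sup>2) * (norm (z - w))\<^sup>2)"
      by (simp add: algebra_simps flip: exp_add)
    finally show ?thesis .
  qed
  have "integrable lborel F" unfolding F_eq[abs_def]
    using lborel_pair.integrable_fst[OF iG] by simp
  then have "(\<integral>\<^sup>+x. ennreal (F x) \<partial>lborel) = ennreal (\<integral>x. F x \<partial>lborel)"
    by (intro nn_integral_eq_integral) (auto simp: F_nonneg)
  also have "(\<integral>x. F x \<partial>lborel) = (\<integral>y. \<integral>x. G x y \<partial>lborel \<partial>lborel)"
    unfolding F_eq by (rule lborel_pair.Fubini_integral[OF iG, symmetric])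
  also have "ennreal \<dots> = (\<integral>\<^sup>+y. ennreal (\<integral>x. G x y \<partial>lborel) \<partial>lborel)"
    by (rule nn_integral_eq_integral[symmetric])
      (use lborel_pair.integrable_snd[OF iG] K in \<open>auto simp: Gx\<close>)
  also have "\<dots> = ennreal (K * (pi * B / A) powr (real DIM('a) / 2)) *
     (\<integral>\<^sup>+y. ennreal (exp (- e * y\<^sup>2) * exp (- (A / (4 * B) + A * B * y\<^sup>2) * (norm (z - w))\<^sup>2)) \<partial>lborel)"
    unfolding Gx using K by (subst nn_integral_cmult[symmetric]) (auto simp: ennreal_mult[symmetric])
  finally show ?thesis unfolding 1 K_def e_def .
qed

text \<open>The parameter \<open>r\<close> is the squared radius. It is also allowed to be negative, which only enlarges the energies
  below and makes all the integrals over \<open>r\<close> Gaussian.\<close>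

definition shell_avg :: "real \<Rightarrow> real \<Rightarrow> real \<Rightarrow> ('a::euclidean_space \<Rightarrow> real) \<Rightarrow> 'a \<Rightarrow> real \<Rightarrow> real" where
  "shell_avg A B \<epsilon> h x r = (\<integral>z. h z * thick \<epsilon> (A * (norm (z - x))\<^sup>2 - B * r) \<partial>lborel)"

lemma integrable_mult_thick:
  assumes "integrable M h" "\<epsilon> > 0" and [measurable]: "g \<in> borel_measurable M"
  shows "integrable M (\<lambda>z. h z * thick \<epsilon> (g z))"
proof (rule Bochner_Integration.integrable_bound[of _ "\<lambda>z. (1 / \<epsilon>) * h z"])
  have [measurable]: "h \<in> borel_measurable M" using assms(1) by auto
  show "(\<lambda>z. h z * thick \<epsilon> (g z)) \<in> borel_measurable M" by measurable
  show "AE x in M. norm (h x * thick \<epsilon> (g x)) \<le> norm ((1 / \<epsilon>) * h x)"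
    using assms(2) thick_bounds[OF assms(2)]
    by (intro AE_I2) (auto simp: abs_mult intro!: mult_right_mono simp: mult.commute[of "\<bar>h _\<bar>"] simp del: times_divide_eq_left)
qed (use assms in auto)

lemma borel_measurable_shell_avg [measurable]:
  assumes [measurable]: "h \<in> borel_measurable borel"
  shows "(\<lambda>(x, r). shell_avg A B \<epsilon> h x r) \<in> borel_measurable (borel \<Otimes>\<^sub>M borel)"
  unfolding shell_avg_def[abs_def] by measurable

lemma shell_avg_nonneg:
  assumes "\<epsilon> > 0" "\<And>z. h z \<ge> 0"
  shows "shell_avg A B \<epsilon> h x r \<ge> 0"
  unfolding shell_avg_def by (intro Bochner_Integration.integral_nonneg) (auto simp: assms thick_bounds)

lemma shell_avg_sum:
  assumes "\<epsilon> > 0" "\<And>i. i \<in> I \<Longrightarrow> integrable lborel (h i)"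
  shows "shell_avg A B \<epsilon> (\<lambda>z. \<Sum>i\<in>I. q i * h i z) x r = (\<Sum>i\<in>I. q i * shell_avg A B \<epsilon> (h i) x r)"
  unfolding shell_avg_def sum_distrib_right mult.assoc using assms
  by (subst Bochner_Integration.integral_sum) (auto intro!: integrable_mult_right integrable_mult_thick)

text \<open>Both averages are expanded and, by Tonelli, the integrals over centre and radius are
  moved inside, where \<open>thick_correlation_nn\<close> evaluates them. Signed combinations are
  treated later by bilinearity.\<close>

lemma shell_avg_correlation:
  fixes g h :: "'a::euclidean_space \<Rightarrow> real"
  assumes "A > 0" "B > 0" "\<epsilon> > 0" "integrable lborel g" "integrable lborel h" "\<And>z. g z \<ge> 0" "\<And>z. h z \<ge> 0"
  shows "(\<integral>\<^sup>+x. \<integral>\<^sup>+r. ennreal (exp (- r) * shell_avg A B \<epsilon> g x r * shell_avg A B \<epsilon> h x r) \<partial>lborel \<partial>lborel)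
    = ennreal (exp (\<epsilon>\<^sup>2 / (8 * B\<^sup>2)) / (2 * B) * (pi * B / A) powr (real DIM('a) / 2)) *
       (\<integral>\<^sup>+y. ennreal (exp (- (\<epsilon>\<^sup>2 / 2) * y\<^sup>2)) * (\<integral>\<^sup>+z. \<integral>\<^sup>+w. ennreal (g z * h w * exp (- (A / (4 * B) + A * B * y\<^sup>2) * (norm (z - w))\<^sup>2)) \<partial>lborel \<partial>lborel) \<partial>lborel)"
proof -
  have [measurable]: "g \<in> borel_measurable borel" "h \<in> borel_measurable borel" using assms(4,5) by auto
  define T where "T x r z = thick \<epsilon> (A * (norm (z - x))\<^sup>2 - B * r)" for x z :: 'a and r
  have [measurable (raw)]: "(\<lambda>p. T (f1 p) (f2 p) (f3 p)) \<in> borel_measurable M"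
    if [measurable]: "f1 \<in> M \<rightarrow>\<^sub>M borel" "f2 \<in> M \<rightarrow>\<^sub>M borel" "f3 \<in> M \<rightarrow>\<^sub>M borel" for M :: "'z measure" and f1 f2 f3
    unfolding T_def by measurable
  have T0: "T x r z \<ge> 0" for x r z unfolding T_def using assms by (simp add: thick_bounds)
  define K where "K = ennreal (exp (\<epsilon>\<^sup>2 / (8 * B\<^sup>2)) / (2 * B) * (pi * B / A) powr (real DIM('a) / 2))"
  have sh: "ennreal (shell_avg A B \<epsilon> f x r) = (\<integral>\<^sup>+z. ennreal (f z * T x r z) \<partial>lborel)"
    if "integrable lborel f" "\<And>z. f z \<ge> 0" for f x r
    unfolding shell_avg_def T_def using that assms(3)
    by (intro nn_integral_eq_integral[symmetric] integrable_mult_thick) (auto simp: thick_bounds)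
  have "(\<integral>\<^sup>+x. \<integral>\<^sup>+r. ennreal (exp (- r) * shell_avg A B \<epsilon> g x r * shell_avg A B \<epsilon> h x r) \<partial>lborel \<partial>lborel)
    = (\<integral>\<^sup>+x. \<integral>\<^sup>+r. ennreal (exp (- r)) * ((\<integral>\<^sup>+z. ennreal (g z * T x r z) \<partial>lborel) * (\<integral>\<^sup>+z. ennreal (h z * T x r z) \<partial>lborel)) \<partial>lborel \<partial>lborel)"
    using assms by (simp add: ennreal_mult shell_avg_nonneg sh mult.assoc)
  also have "\<dots> = (\<integral>\<^sup>+x. \<integral>\<^sup>+r. \<integral>\<^sup>+z. \<integral>\<^sup>+w. ennreal (exp (- r) * T x r z * T x r w) * ennreal (g z * h w) \<partial>lborel \<partial>lborel \<partial>lborel \<partial>lborel)"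
  proof (intro nn_integral_cong)
    fix x :: 'a and r :: real
    have "(\<integral>\<^sup>+z. \<integral>\<^sup>+w. ennreal (exp (- r) * T x r z * T x r w) * ennreal (g z * h w) \<partial>lborel \<partial>lborel)
      = (\<integral>\<^sup>+z. \<integral>\<^sup>+w. ennreal (exp (- r)) * (ennreal (g z * T x r z) * ennreal (h w * T x r w)) \<partial>lborel \<partial>lborel)"
      using assms(6,7) T0 by (intro nn_integral_cong) (simp add: ennreal_mult[symmetric] mult_ac)
    then show "ennreal (exp (- r)) * ((\<integral>\<^sup>+z. ennreal (g z * T x r z) \<partial>lborel) * (\<integral>\<^sup>+z. ennreal (h z * T x r z) \<partial>lborel))
      = (\<integral>\<^sup>+z. \<integral>\<^sup>+w. ennreal (exp (- r) * T x r z * T x r w) * ennreal (g z * h w) \<partial>lborel \<partial>lborel)"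
      by (simp add: nn_integral_cmult nn_integral_multc)
  qed
  also have "\<dots> = (\<integral>\<^sup>+x. \<integral>\<^sup>+z. \<integral>\<^sup>+r. \<integral>\<^sup>+w. ennreal (exp (- r) * T x r z * T x r w) * ennreal (g z * h w) \<partial>lborel \<partial>lborel \<partial>lborel \<partial>lborel)"
    by (intro nn_integral_cong lborel_pair.Fubini') measurable
  also have "\<dots> = (\<integral>\<^sup>+x. \<integral>\<^sup>+z. \<integral>\<^sup>+w. \<integral>\<^sup>+r. ennreal (exp (- r) * T x r z * T x r w) * ennreal (g z * h w) \<partial>lborel \<partial>lborel \<partial>lborel \<partial>lborel)"
    by (intro nn_integral_cong lborel_pair.Fubini') measurable
  also have "\<dots> = (\<integral>\<^sup>+z. \<integral>\<^sup>+x. \<integral>\<^sup>+w. \<integral>\<^sup>+r. ennreal (exp (- r) * T x r z * T x r w) * ennreal (g z * h w) \<partial>lborel \<partial>lborel \<partial>lborel \<partial>lborel)"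
    by (intro lborel_pair.Fubini') measurable
  also have "\<dots> = (\<integral>\<^sup>+z. \<integral>\<^sup>+w. \<integral>\<^sup>+x. \<integral>\<^sup>+r. ennreal (exp (- r) * T x r z * T x r w) * ennreal (g z * h w) \<partial>lborel \<partial>lborel \<partial>lborel \<partial>lborel)"
    by (intro nn_integral_cong lborel_pair.Fubini') measurable
  also have "\<dots> = (\<integral>\<^sup>+z. \<integral>\<^sup>+w. (\<integral>\<^sup>+x. \<integral>\<^sup>+r. ennreal (exp (- r) * T x r z * T x r w) \<partial>lborel \<partial>lborel) * ennreal (g z * h w) \<partial>lborel \<partial>lborel)"
    by (intro nn_integral_cong) (simp add: nn_integral_multc)
  also have "\<dots> = (\<integral>\<^sup>+z. \<integral>\<^sup>+w. K * (\<integral>\<^sup>+y. ennreal (exp (- (\<epsilon>\<^sup>2 / 2) * y\<^sup>2) * exp (- (A / (4 * B) + A * B * y\<^sup>2) * (norm (z - w))\<^sup>2)) \<partial>lborel) * ennreal (g z * h w) \<partial>lborel \<partial>lborel)"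
    unfolding T_def K_def using assms(1-3) by (subst thick_correlation_nn) auto
  also have "\<dots> = (\<integral>\<^sup>+z. \<integral>\<^sup>+w. \<integral>\<^sup>+y. K * (ennreal (exp (- (\<epsilon>\<^sup>2 / 2) * y\<^sup>2)) * ennreal (g z * h w * exp (- (A / (4 * B) + A * B * y\<^sup>2) * (norm (z - w))\<^sup>2))) \<partial>lborel \<partial>lborel \<partial>lborel)"
    using assms(6,7)
    by (intro nn_integral_cong)
      (simp add: nn_integral_cmult[symmetric] nn_integral_multc[symmetric] ennreal_mult mult_ac)
  also have "\<dots> = (\<integral>\<^sup>+z. \<integral>\<^sup>+y. \<integral>\<^sup>+w. K * (ennreal (exp (- (\<epsilon>\<^sup>2 / 2) * y\<^sup>2)) * ennreal (g z * h w * exp (- (A / (4 * B) + A * B * y\<^sup>2) * (norm (z - w))\<^sup>2))) \<partial>lborel \<partial>lborel \<partial>lborel)"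
    by (intro nn_integral_cong lborel_pair.Fubini') measurable
  also have "\<dots> = (\<integral>\<^sup>+y. \<integral>\<^sup>+z. \<integral>\<^sup>+w. K * (ennreal (exp (- (\<epsilon>\<^sup>2 / 2) * y\<^sup>2)) * ennreal (g z * h w * exp (- (A / (4 * B) + A * B * y\<^sup>2) * (norm (z - w))\<^sup>2))) \<partial>lborel \<partial>lborel \<partial>lborel)"
    by (intro lborel_pair.Fubini') measurable
  also have "\<dots> = K * (\<integral>\<^sup>+y. ennreal (exp (- (\<epsilon>\<^sup>2 / 2) * y\<^sup>2)) * (\<integral>\<^sup>+z. \<integral>\<^sup>+w. ennreal (g z * h w * exp (- (A / (4 * B) + A * B * y\<^sup>2) * (norm (z - w))\<^sup>2)) \<partial>lborel \<partial>lborel) \<partial>lborel)"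
    by (simp add: nn_integral_cmult)
  finally show ?thesis unfolding K_def .
qed

section \<open>Shell energies of combinations of heat kernels\<close>

lemma heat_minus_commute: "heat s (x - y) = heat s (y - x)"
  by (simp add: heat_def norm_minus_commute)

lemma heat_le:
  fixes w :: "'a::euclidean_space"
  assumes "t > 0" "t \<le> s"
  shows "heat s w \<le> (4 * pi * t) powr (- (real DIM('a) / 2))"
proof -
  have "heat s w \<le> (4 * pi * s) powr (- (real DIM('a) / 2)) * 1"
    unfolding heat_def using assms by (intro mult_left_mono) auto
  also have "\<dots> \<le> (4 * pi * t) powr (- (real DIM('a) / 2))"
    using assms by (simp add: powr_mono2')
  finally show ?thesis .
qed

text \<open>Up to normalisation the Gaussian in \<open>z - w\<close> is itself a heat kernel, of
  time \<open>1 / (4 * V)\<close>; two applications of the semigroup law add up the three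
  times.\<close>

lemma heat_pair_exp:
  fixes p q :: "'a::euclidean_space"
  assumes "s > 0" "t > 0" "V > 0"
  shows "(\<integral>\<^sup>+z. \<integral>\<^sup>+w. ennreal (heat s (z - p) * heat t (w - q) * exp (- V * (norm (z - w))\<^sup>2)) \<partial>lborel \<partial>lborel)
    = ennreal ((pi / V) powr (real DIM('a) / 2) * heat (s + t + 1 / (4 * V)) (p - q))"
proof -
  define \<kappa> where "\<kappa> = (pi / V) powr (real DIM('a) / 2)"
  have \<kappa>: "\<kappa> \<ge> 0" by (simp add: \<kappa>_def)
  define v where "v = 1 / (4 * V)"
  have v: "v > 0" using assms by (simp add: v_def)
  have "(\<integral>\<^sup>+w. ennreal (heat s (z - p) * heat t (w - q) * exp (- V * (norm (z - w))\<^sup>2)) \<partial>lborel)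
     = ennreal (\<kappa> * (heat s (z - p) * heat (t + v) (z - q)))" for z
  proof -
    have "heat s (z - p) * heat t (w - q) * exp (- V * (norm (z - w))\<^sup>2) = \<kappa> * heat s (z - p) * (heat t (w - q) * heat v (w - z))" for w
      unfolding exp_eq_heat[OF assms(3)] \<kappa>_def v_def by (simp add: heat_minus_commute[of _ z w])
    then have "(\<integral>\<^sup>+w. ennreal (heat s (z - p) * heat t (w - q) * exp (- V * (norm (z - w))\<^sup>2)) \<partial>lborel)
      = ennreal (\<integral>w. \<kappa> * heat s (z - p) * (heat t (w - q) * heat v (w - z)) \<partial>lborel)"
      using \<kappa> by (simp only:) (intro nn_integral_eq_integral integrable_mult_right integrable_heat_mult assms v, auto)
    also have "\<dots> = ennreal (\<kappa> * heat s (z - p) * heat (t + v) (q - z))"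
      using heat_semigroup[OF assms(2) v, of q z] by simp
    finally show ?thesis by (simp add: heat_minus_commute[of _ q z] mult.assoc)
  qed
  then have "(\<integral>\<^sup>+z. \<integral>\<^sup>+w. ennreal (heat s (z - p) * heat t (w - q) * exp (- V * (norm (z - w))\<^sup>2)) \<partial>lborel \<partial>lborel)
    = (\<integral>\<^sup>+z. ennreal (\<kappa> * (heat s (z - p) * heat (t + v) (z - q))) \<partial>lborel)" by simp
  also have "\<dots> = ennreal (\<integral>z. \<kappa> * (heat s (z - p) * heat (t + v) (z - q)) \<partial>lborel)"
    using assms v \<kappa> by (intro nn_integral_eq_integral integrable_mult_right integrable_heat_mult) auto
  also have "\<dots> = ennreal (\<kappa> * heat (s + (t + v)) (p - q))"
    using assms v by (simp add: heat_semigroup)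
  finally show ?thesis by (simp add: \<kappa>_def v_def add.assoc)
qed

text \<open>The coefficient of |z - w|^2 in the Gaussian energies. The corresponding heat time
  \<open>1 / (4 * freq A B y)\<close> is at most \<open>B / A\<close> and decays like the inverse
  square of \<open>y\<close>.\<close>

definition freq :: "real \<Rightarrow> real \<Rightarrow> real \<Rightarrow> real" where
  "freq A B y = A / (4 * B) + A * B * y\<^sup>2"

lemma freq_pos: "A > 0 \<Longrightarrow> B > 0 \<Longrightarrow> freq A B y > 0"
  unfolding freq_def by (simp add: add_pos_nonneg)

lemma borel_measurable_freq [measurable]: "freq A B \<in> borel_measurable borel"
  unfolding freq_def[abs_def] by measurable

lemma
  fixes p q :: "'a::euclidean_space"
  assumes "s > 0" "t > 0" "A > 0" "B > 0" "\<epsilon> > 0"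
  defines "J \<equiv> \<lambda>y. exp (- (\<epsilon>\<^sup>2 / 2) * y\<^sup>2) * ((pi / freq A B y) powr (real DIM('a) / 2) * heat (s + t + 1 / (4 * freq A B y)) (p - q))"
  shows integrable_heat_correlation: "integrable lborel J"
    and shell_avg_heat_correlation: "(\<integral>\<^sup>+x. \<integral>\<^sup>+r. ennreal (exp (- r) * shell_avg A B \<epsilon> (\<lambda>z. heat s (z - p)) x r * shell_avg A B \<epsilon> (\<lambda>z. heat t (z - q)) x r) \<partial>lborel \<partial>lborel)
     = ennreal (exp (\<epsilon>\<^sup>2 / (8 * B\<^sup>2)) / (2 * B) * (pi * B / A) powr (real DIM('a) / 2) * (\<integral>y. J y \<partial>lborel))"
proof -
  have e: "\<epsilon>\<^sup>2 / 2 > 0" using assms by simp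
  have V: "freq A B y > 0" for y using assms by (intro freq_pos)
  have J0: "J y \<ge> 0" for y unfolding J_def by simp
  \<comment> \<open>The factor \<open>(pi / freq A B y) powr (real DIM('a) / 2)\<close> is the
    inverse of the peak of the heat kernel of time \<open>1 / (4 * freq A B y)\<close>, and a longer
    time only lowers the peak. Hence the Gaussian cut-off in \<open>y\<close> alone dominates
    \<open>J\<close>.\<close>
  have J1: "J y \<le> exp (- (\<epsilon>\<^sup>2 / 2) * y\<^sup>2)" for y
  proof -
    have "heat (s + t + 1 / (4 * freq A B y)) (p - q) \<le> (4 * pi * (1 / (4 * freq A B y))) powr (- (real DIM('a) / 2))"
      using assms V[of y] by (intro heat_le) auto
    then have "(pi / freq A B y) powr (real DIM('a) / 2) * heat (s + t + 1 / (4 * freq A B y)) (p - q)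
      \<le> (pi / freq A B y) powr (real DIM('a) / 2) * (pi / freq A B y) powr (- (real DIM('a) / 2))"
      by (intro mult_left_mono) auto
    also have "\<dots> = 1" using V[of y] by (simp flip: powr_add)
    finally show ?thesis unfolding J_def by (intro mult_left_le) auto
  qed
  have [measurable]: "J \<in> borel_measurable borel"
    unfolding J_def heat_def by measurable
  show iJ: "integrable lborel J"
    by (rule Bochner_Integration.integrable_bound[OF integrable_gaussian[OF e, where 'a=real]])
      (use J0 J1 in \<open>auto simp: abs_of_nonneg\<close>)
  show "(\<integral>\<^sup>+x. \<integral>\<^sup>+r. ennreal (exp (- r) * shell_avg A B \<epsilon> (\<lambda>z. heat s (z - p)) x r * shell_avg A B \<epsilon> (\<lambda>z. heat t (z - q)) x r) \<partial>lborel \<partial>lborel)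
     = ennreal (exp (\<epsilon>\<^sup>2 / (8 * B\<^sup>2)) / (2 * B) * (pi * B / A) powr (real DIM('a) / 2) * (\<integral>y. J y \<partial>lborel))"
    unfolding shell_avg_correlation[OF assms(3-5) integrable_heat[OF assms(1)] integrable_heat[OF assms(2)] heat_nonneg heat_nonneg]
      freq_def[symmetric] heat_pair_exp[OF assms(1,2) V]
  proof -
    have "(\<integral>\<^sup>+y. ennreal (exp (- (\<epsilon>\<^sup>2 / 2) * y\<^sup>2)) * ennreal ((pi / freq A B y) powr (real DIM('a) / 2) * heat (s + t + 1 / (4 * freq A B y)) (p - q)) \<partial>lborel)
      = (\<integral>\<^sup>+y. ennreal (J y) \<partial>lborel)"
      unfolding J_def by (intro nn_integral_cong ennreal_mult[symmetric]) auto
    also have "\<dots> = ennreal (\<integral>y. J y \<partial>lborel)"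
      using iJ J0 by (intro nn_integral_eq_integral) auto
    finally show "ennreal (exp (\<epsilon>\<^sup>2 / (8 * B\<^sup>2)) / (2 * B) * (pi * B / A) powr (real DIM('a) / 2)) *
       (\<integral>\<^sup>+y. ennreal (exp (- (\<epsilon>\<^sup>2 / 2) * y\<^sup>2)) * ennreal ((pi / freq A B y) powr (real DIM('a) / 2) * heat (s + t + 1 / (4 * freq A B y)) (p - q)) \<partial>lborel)
      = ennreal (exp (\<epsilon>\<^sup>2 / (8 * B\<^sup>2)) / (2 * B) * (pi * B / A) powr (real DIM('a) / 2) * (\<integral>y. J y \<partial>lborel))"
      using assms(4) by (simp only:) (intro ennreal_mult[symmetric] Bochner_Integration.integral_nonneg J0, simp)
  qed
qed

text \<open>Bilinear expansion of the square. The coefficients may have any sign, so each pair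
  correlation is first shown to be Bochner integrable from its nonnegative integral, and only then
  are the finite sums formed.\<close>

lemma shell_avg_energy:
  fixes p :: "'i \<Rightarrow> 'a::euclidean_space" and q s :: "'i \<Rightarrow> real"
  assumes "finite I" "\<And>i. i \<in> I \<Longrightarrow> s i > 0" "A > 0" "B > 0" "\<epsilon> > 0"
  shows "(\<integral>\<^sup>+x. \<integral>\<^sup>+r. ennreal (exp (- r) * (shell_avg A B \<epsilon> (\<lambda>z. \<Sum>i\<in>I. q i * heat (s i) (z - p i)) x r)\<^sup>2) \<partial>lborel \<partial>lborel)
    = ennreal (exp (\<epsilon>\<^sup>2 / (8 * B\<^sup>2)) / (2 * B) * (pi * B / A) powr (real DIM('a) / 2) *
       (\<integral>y. exp (- (\<epsilon>\<^sup>2 / 2) * y\<^sup>2) * ((pi / freq A B y) powr (real DIM('a) / 2) *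
          (\<Sum>i\<in>I. \<Sum>j\<in>I. q i * q j * heat (s i + s j + 1 / (4 * freq A B y)) (p i - p j))) \<partial>lborel))"
proof -
  define K where "K = exp (\<epsilon>\<^sup>2 / (8 * B\<^sup>2)) / (2 * B) * (pi * B / A) powr (real DIM('a) / 2)"
  have K: "K \<ge> 0" using assms by (simp add: K_def)
  define J where "J i j y = exp (- (\<epsilon>\<^sup>2 / 2) * y\<^sup>2) * ((pi / freq A B y) powr (real DIM('a) / 2) * heat (s i + s j + 1 / (4 * freq A B y)) (p i - p j))" for i j y
  define S where "S i x r = shell_avg A B \<epsilon> (\<lambda>z. heat (s i) (z - p i)) x r" for i x r
  define f where "f i j = (\<lambda>(x, r). exp (- r) * S i x r * S j x r)" for i j
  have [measurable (raw)]: "(\<lambda>u. S i (f1 u) (f2 u)) \<in> borel_measurable M"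
    if [measurable]: "f1 \<in> M \<rightarrow>\<^sub>M borel" "f2 \<in> M \<rightarrow>\<^sub>M borel" for i and M :: "'z measure" and f1 f2
    unfolding S_def shell_avg_def by measurable
  have iJ: "integrable lborel (J i j)" if "i \<in> I" "j \<in> I" for i j
    unfolding J_def using integrable_heat_correlation assms that by blast
  have bf: "has_bochner_integral (lborel \<Otimes>\<^sub>M lborel) (f i j) (K * (\<integral>y. J i j y \<partial>lborel))" if "i \<in> I" "j \<in> I" for i j
  proof (rule has_bochner_integral_nn_integral)
    show "f i j \<in> borel_measurable (lborel \<Otimes>\<^sub>M lborel)"
      unfolding f_def by measurable
    then have "(\<integral>\<^sup>+u. ennreal (f i j u) \<partial>(lborel \<Otimes>\<^sub>M lborel)) = (\<integral>\<^sup>+x. \<integral>\<^sup>+r. ennreal (f i j (x, r)) \<partial>lborel \<partial>lborel)"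
      by (subst lborel.nn_integral_fst[symmetric]) auto
    also have "\<dots> = ennreal (K * (\<integral>y. J i j y \<partial>lborel))"
      unfolding f_def S_def J_def K_def prod.case using shell_avg_heat_correlation assms that by blast
    finally show "(\<integral>\<^sup>+u. ennreal (f i j u) \<partial>(lborel \<Otimes>\<^sub>M lborel)) = ennreal (K * (\<integral>y. J i j y \<partial>lborel))" .
  qed (use K assms in \<open>auto simp: f_def S_def J_def shell_avg_nonneg intro!: mult_nonneg_nonneg Bochner_Integration.integral_nonneg\<close>)
  define F where "F = (\<lambda>(x, r). exp (- r) * (shell_avg A B \<epsilon> (\<lambda>z. \<Sum>i\<in>I. q i * heat (s i) (z - p i)) x r)\<^sup>2)"
  have F_eq: "F u = (\<Sum>i\<in>I. \<Sum>j\<in>I. q i * q j * f i j u)" for u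
  proof (cases u)
    case (Pair x r)
    have "shell_avg A B \<epsilon> (\<lambda>z. \<Sum>i\<in>I. q i * heat (s i) (z - p i)) x r = (\<Sum>i\<in>I. q i * S i x r)"
      unfolding S_def using assms by (intro shell_avg_sum integrable_heat) auto
    then show ?thesis
      unfolding Pair F_def f_def prod.case
      by (simp only: power2_eq_square sum_product) (simp only: sum_distrib_left mult_ac)
  qed
  have "has_bochner_integral (lborel \<Otimes>\<^sub>M lborel) F (\<Sum>i\<in>I. \<Sum>j\<in>I. q i * q j * (K * (\<integral>y. J i j y \<partial>lborel)))"
    unfolding F_eq[abs_def]
    by (rule has_bochner_integral_sum, rule has_bochner_integral_sum, rule has_bochner_integral_mult_right, rule bf)
  moreover have [measurable]: "F \<in> borel_measurable (lborel \<Otimes>\<^sub>M lborel)"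
    unfolding F_eq[abs_def] f_def by measurable
  moreover have "F u \<ge> 0" for u by (simp add: F_def split_beta)
  ultimately have "(\<integral>\<^sup>+x. \<integral>\<^sup>+r. ennreal (F (x, r)) \<partial>lborel \<partial>lborel) = ennreal (\<Sum>i\<in>I. \<Sum>j\<in>I. q i * q j * (K * (\<integral>y. J i j y \<partial>lborel)))"
    by (subst lborel.nn_integral_fst) (auto simp: has_bochner_integral_iff nn_integral_eq_integral)
  also have "(\<Sum>i\<in>I. \<Sum>j\<in>I. q i * q j * (K * (\<integral>y. J i j y \<partial>lborel))) = K * (\<integral>y. (\<Sum>i\<in>I. \<Sum>j\<in>I. q i * q j * J i j y) \<partial>lborel)"
    using iJ by (simp add: Bochner_Integration.integral_sum sum_distrib_left mult_ac)
  also have "(\<lambda>y. \<Sum>i\<in>I. \<Sum>j\<in>I. q i * q j * J i j y) = (\<lambda>y. exp (- (\<epsilon>\<^sup>2 / 2) * y\<^sup>2) * ((pi / freq A B y) powr (real DIM('a) / 2) *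
          (\<Sum>i\<in>I. \<Sum>j\<in>I. q i * q j * heat (s i + s j + 1 / (4 * freq A B y)) (p i - p j))))"
    unfolding J_def sum_distrib_left by (intro ext sum.cong refl) (simp only: mult_ac)
  finally show ?thesis unfolding F_def K_def prod.case .
qed

section \<open>Passing from vectors to squared radii\<close>

lemma powr_le_exp:
  fixes m :: real
  assumes "m \<ge> 0"
  obtains C where "C > 0" "\<And>r. r \<ge> 0 \<Longrightarrow> r powr m \<le> C * exp r"
proof
  \<comment> \<open>For an integer \<open>n\<close> above \<open>m\<close>, the inequality r / n <=
    exp (r / n) raised to the power \<open>n\<close> gives the constant
    \<open>n ^ n\<close>.\<close>
  define n where "n = nat \<lceil>m\<rceil> + 1"
  have n: "n \<ge> 1" "m \<le> real n" unfolding n_def by linarith+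
  show "real n ^ n > 0" using n by simp
  fix r :: real assume r: "r \<ge> 0"
  show "r powr m \<le> real n ^ n * exp r"
  proof (cases "r \<le> 1")
    case True
    then have "r powr m \<le> 1" using r assms by (simp add: powr_le1)
    also have "\<dots> \<le> real n ^ n * exp r"
      using n r by (intro mult_ge1_I) auto
    finally show ?thesis .
  next
    case False
    then have "r powr m \<le> r powr real n" using n by (intro powr_mono) auto
    also have "\<dots> = r ^ n" using False by (simp add: powr_realpow)
    also have "r \<le> real n * exp (r / real n)"
    proof -
      have "r / real n \<le> exp (r / real n)" using exp_ge_add_one_self[of "r / real n"] by linarith
      then show ?thesis using n by (simp add: field_simps)
    qed
    then have "r ^ n \<le> (real n * exp (r / real n)) ^ n" using r by (intro power_mono) auto
    also have "\<dots> = real n ^ n * exp r"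
      using n by (simp add: power_mult_distrib flip: exp_of_nat_mult)
    finally show ?thesis .
  qed
qed

text \<open>Half-lines pull back to balls, so both measures are compared on half-lines through the
  volume of balls as a function of the squared radius.\<close>

lemma distr_norm_square:
  defines "k \<equiv> unit_ball_vol (real DIM('a::euclidean_space)) * (real DIM('a) / 2)"
  shows "distr (lborel :: 'a measure) borel (\<lambda>u. (norm u)\<^sup>2)
    = density lborel (\<lambda>r. ennreal (indicator {0..} r * (k * r powr (real DIM('a) / 2 - 1))))" (is "?D = ?E")
proof (rule measure_eqI_generator_eq[where E="range (\<lambda>a::real. {..a})" and \<Omega>=UNIV and A="\<lambda>i::nat. {..real i}"])
  define d where "d = real DIM('a) / 2"
  have d: "d > 0" by (simp add: d_def)
  have k: "k \<ge> 0" "k / d = unit_ball_vol (real DIM('a))" by (auto simp: k_def d_def)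
  have D: "emeasure ?D {..a} = (if a \<ge> 0 then ennreal (unit_ball_vol (real DIM('a)) * a powr d) else 0)" for a
  proof -
    have "emeasure ?D {..a} = emeasure lborel {u::'a. (norm u)\<^sup>2 \<le> a}"
      by (subst emeasure_distr) (auto simp: vimage_def)
    also have "\<dots> = (if a \<ge> 0 then ennreal (unit_ball_vol (real DIM('a)) * a powr d) else 0)"
    proof (cases "a \<ge> 0")
      case True
      then have "{u::'a. (norm u)\<^sup>2 \<le> a} = cball 0 (sqrt a)"
        by (auto simp: real_le_rsqrt) (metis norm_ge_zero power_mono real_sqrt_pow2)
      moreover have "sqrt a ^ DIM('a) = a powr d"
        using True unfolding d_def by (cases "a = 0") (auto simp: powr_half_sqrt[symmetric] powr_powr simp flip: powr_realpow)
      ultimately show ?thesis using True by (simp add: emeasure_cball)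
    next
      case False
      then have "{u::'a. (norm u)\<^sup>2 \<le> a} = {}"
        by (auto simp: not_le intro: less_le_trans[of _ 0])
      then show ?thesis using False by simp
    qed
    finally show ?thesis .
  qed
  have E: "emeasure ?E {..a} = (if a \<ge> 0 then ennreal (unit_ball_vol (real DIM('a)) * a powr d) else 0)" for a
  proof -
    have "emeasure ?E {..a} = (\<integral>\<^sup>+r. ennreal (indicator {0..a} r * (k * r powr (d - 1))) \<partial>lborel)"
      by (subst emeasure_density) (auto intro!: nn_integral_cong simp: d_def split: split_indicator)
    also have "\<dots> = (if a \<ge> 0 then ennreal (unit_ball_vol (real DIM('a)) * a powr d) else 0)"
    proof (cases "a \<ge> 0")
      case True
      have "((\<lambda>r. k * r powr (d - 1)) has_integral (k * (a powr (d - 1 + 1) / (d - 1 + 1)))) {0..a}"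
        using d True by (intro has_integral_mult_right has_integral_powr_from_0) auto
      then have "(\<integral>\<^sup>+r. ennreal (indicator {0..a} r * (k * r powr (d - 1))) \<partial>lborel) = ennreal (k / d * a powr d)"
        using k(1) nn_integral_has_integral_lebesgue[of "{0..a}" "\<lambda>r. k * r powr (d - 1)" "k / d * a powr d"] by simp
      then show ?thesis using True k by simp
    qed simp
    finally show ?thesis .
  qed
  show "emeasure ?D X = emeasure ?E X" if "X \<in> range atMost" for X
    using that D E by auto
  show "emeasure ?D {..real i} \<noteq> \<infinity>" for i by (simp add: D)
  show "Int_stable (range (\<lambda>a::real. {..a}))" by (auto simp: Int_stable_def)
  have "(borel :: real measure) = sigma UNIV (range atMost)" by (rule borel_eq_atMost)
  then have "sets (borel :: real measure) = sigma_sets UNIV (range atMost)" by (metis Pow_UNIV sets_measure_of subset_UNIV)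
  then show "sets ?D = sigma_sets UNIV (range atMost)" "sets ?E = sigma_sets UNIV (range atMost)" by auto
  show "(\<Union>i. {..real i}) = UNIV" by (auto intro: real_arch_simple)
qed auto

text \<open>In dimension at least 2 the density \<open>r powr (real DIM('a) / 2 - 1)\<close> of the
  squared radius is bounded near 0, and half of the decay \<open>exp (- 2 * r)\<close> pays for its
  growth. Afterwards \<open>r\<close> runs over the whole line.\<close>

lemma nn_integral_radial_le:
  assumes "DIM('a::euclidean_space) \<ge> 2"
  obtains C :: real where "C > 0" "\<And>F. F \<in> borel_measurable borel \<Longrightarrow>
    (\<integral>\<^sup>+u. ennreal (exp (- 2 * (norm (u::'a))\<^sup>2)) * F ((norm u)\<^sup>2) \<partial>lborel) \<le> ennreal C * (\<integral>\<^sup>+r. ennreal (exp (- r)) * F r \<partial>lborel)"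
proof -
  define k where "k = unit_ball_vol (real DIM('a)) * (real DIM('a) / 2)"
  have k: "k > 0" by (simp add: k_def)
  have "real DIM('a) / 2 - 1 \<ge> 0" using assms by simp
  then obtain C where C: "C > 0" "\<And>r. r \<ge> 0 \<Longrightarrow> r powr (real DIM('a) / 2 - 1) \<le> C * exp r"
    using powr_le_exp by blast
  show thesis
  proof
    show "k * C > 0" using k C by simp
    fix F :: "real \<Rightarrow> ennreal" assume [measurable]: "F \<in> borel_measurable borel"
    have "(\<integral>\<^sup>+u. ennreal (exp (- 2 * (norm (u::'a))\<^sup>2)) * F ((norm u)\<^sup>2) \<partial>lborel)
      = (\<integral>\<^sup>+r. ennreal (exp (- 2 * r)) * F r \<partial>distr (lborel :: 'a measure) borel (\<lambda>u. (norm u)\<^sup>2))"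
      by (subst nn_integral_distr) auto
    also have "\<dots> = (\<integral>\<^sup>+r. ennreal (indicator {0..} r * (k * r powr (real DIM('a) / 2 - 1))) * (ennreal (exp (- 2 * r)) * F r) \<partial>lborel)"
      unfolding distr_norm_square k_def[symmetric] by (subst nn_integral_density) auto
    also have "\<dots> \<le> (\<integral>\<^sup>+r. ennreal (k * C) * (ennreal (exp (- r)) * F r) \<partial>lborel)"
    proof (intro nn_integral_mono)
      fix r :: real
      have "indicator {0..} r * (k * r powr (real DIM('a) / 2 - 1)) * exp (- 2 * r) \<le> k * C * exp (- r)"
      proof (cases "r \<ge> 0")
        case True
        have "exp r * exp (- 2 * r) = exp (- r)" by (simp flip: exp_add)
        moreover have "k * r powr (real DIM('a) / 2 - 1) * exp (- 2 * r) \<le> k * (C * exp r) * exp (- 2 * r)"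
          using C(2)[OF True] k by (intro mult_right_mono mult_left_mono) auto
        ultimately show ?thesis using True by (simp add: mult.assoc)
      qed (use k C in simp)
      then have "ennreal (indicator {0..} r * (k * r powr (real DIM('a) / 2 - 1))) * ennreal (exp (- 2 * r)) \<le> ennreal (k * C) * ennreal (exp (- r))"
        using k C by (subst (1 2) ennreal_mult[symmetric]) (auto intro!: ennreal_leI)
      then show "ennreal (indicator {0..} r * (k * r powr (real DIM('a) / 2 - 1))) * (ennreal (exp (- 2 * r)) * F r) \<le> ennreal (k * C) * (ennreal (exp (- r)) * F r)"
        unfolding mult.assoc[symmetric] by (rule mult_right_mono) simp
    qed
    also have "\<dots> = ennreal (k * C) * (\<integral>\<^sup>+r. ennreal (exp (- r)) * F r \<partial>lborel)"
      by (rule nn_integral_cmult) simp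
    finally show "(\<integral>\<^sup>+u. ennreal (exp (- 2 * (norm (u::'a))\<^sup>2)) * F ((norm u)\<^sup>2) \<partial>lborel) \<le> ennreal (k * C) * (\<integral>\<^sup>+r. ennreal (exp (- r)) * F r \<partial>lborel)" .
  qed
qed

section \<open>The trilinear form\<close>

text \<open>The growing weight pays for the Gaussian decay in |y - z| given to the shell average.
  The constant 4 comes from squaring exp (|y - z|^2) and from |y - z|^2 <= 2 |y|^2 + 2
  |z|^2.\<close>

definition wnorm :: "('a::euclidean_space \<Rightarrow> real) \<Rightarrow> ennreal" where
  "wnorm f = (\<integral>\<^sup>+x. ennreal ((f x)\<^sup>2 * exp (4 * (norm x)\<^sup>2)) \<partial>lborel)"

definition shell_energy :: "real \<Rightarrow> real \<Rightarrow> real \<Rightarrow> ('a::euclidean_space \<Rightarrow> real) \<Rightarrow> ennreal" where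
  "shell_energy A B \<epsilon> h = (\<integral>\<^sup>+x. \<integral>\<^sup>+r. ennreal (exp (- r) * (shell_avg A B \<epsilon> h x r)\<^sup>2) \<partial>lborel \<partial>lborel)"

text \<open>The passage from (z, y) to the centre \<open>z - \<kappa> *\<^sub>R (y - z)\<close> and
  the displacement \<open>y - z\<close> is a composition of two shears, hence preserves volume. The
  parameter \<kappa> lets one statement serve shells centred at a given point and Apollonius spheres
  alike.\<close>

lemma nn_integral_shear:
  fixes \<Psi> :: "'a::euclidean_space \<Rightarrow> 'a \<Rightarrow> ennreal"
  assumes [measurable]: "case_prod \<Psi> \<in> borel_measurable (borel \<Otimes>\<^sub>M borel)"
  shows "(\<integral>\<^sup>+z. \<integral>\<^sup>+y. \<Psi> (z - \<kappa> *\<^sub>R (y - z)) (y - z) \<partial>lborel \<partial>lborel) = (\<integral>\<^sup>+c. \<integral>\<^sup>+u. \<Psi> c u \<partial>lborel \<partial>lborel)"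
proof -
  have [measurable (raw)]: "(\<lambda>p. \<Psi> (f1 p) (f2 p)) \<in> borel_measurable M"
    if "f1 \<in> M \<rightarrow>\<^sub>M borel" "f2 \<in> M \<rightarrow>\<^sub>M borel" for M :: "'z measure" and f1 f2
    using measurable_compose[OF measurable_Pair[OF that] assms] by simp
  have "(\<integral>\<^sup>+z. \<integral>\<^sup>+y. \<Psi> (z - \<kappa> *\<^sub>R (y - z)) (y - z) \<partial>lborel \<partial>lborel) = (\<integral>\<^sup>+z. \<integral>\<^sup>+u. \<Psi> (z - \<kappa> *\<^sub>R u) u \<partial>lborel \<partial>lborel)"
  proof (rule nn_integral_cong)
    fix z :: 'a
    show "(\<integral>\<^sup>+y. \<Psi> (z - \<kappa> *\<^sub>R (y - z)) (y - z) \<partial>lborel) = (\<integral>\<^sup>+u. \<Psi> (z - \<kappa> *\<^sub>R u) u \<partial>lborel)"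
      by (subst nn_integral_lborel_translate[of _ z, symmetric]) auto
  qed
  also have "\<dots> = (\<integral>\<^sup>+u. \<integral>\<^sup>+z. \<Psi> (z - \<kappa> *\<^sub>R u) u \<partial>lborel \<partial>lborel)"
    by (rule lborel_pair.Fubini') measurable
  also have "\<dots> = (\<integral>\<^sup>+u. \<integral>\<^sup>+c. \<Psi> c u \<partial>lborel \<partial>lborel)"
  proof (rule nn_integral_cong)
    fix u :: 'a
    show "(\<integral>\<^sup>+z. \<Psi> (z - \<kappa> *\<^sub>R u) u \<partial>lborel) = (\<integral>\<^sup>+c. \<Psi> c u \<partial>lborel)"
      by (subst (2) nn_integral_lborel_translate[of _ "- (\<kappa> *\<^sub>R u)", symmetric]) auto
  qed
  also have "\<dots> = (\<integral>\<^sup>+c. \<integral>\<^sup>+u. \<Psi> c u \<partial>lborel \<partial>lborel)"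
    by (rule lborel_pair.Fubini') measurable
  finally show ?thesis .
qed

lemma radial_energy_le:
  assumes "DIM('a::euclidean_space) \<ge> 2"
  obtains C :: real where "C > 0" "\<And>S :: 'a \<Rightarrow> real \<Rightarrow> real. case_prod S \<in> borel_measurable (borel \<Otimes>\<^sub>M borel) \<Longrightarrow>
    (\<integral>\<^sup>+c. \<integral>\<^sup>+u. ennreal (exp (- 2 * (norm u)\<^sup>2) * (S c ((norm u)\<^sup>2))\<^sup>2) \<partial>(lborel :: 'a measure) \<partial>lborel)
      \<le> ennreal C * (\<integral>\<^sup>+c. \<integral>\<^sup>+r. ennreal (exp (- r) * (S c r)\<^sup>2) \<partial>lborel \<partial>lborel)"
proof -
  obtain C where C: "C > 0" "\<And>F. F \<in> borel_measurable borel \<Longrightarrow>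
    (\<integral>\<^sup>+u. ennreal (exp (- 2 * (norm (u::'a))\<^sup>2)) * F ((norm u)\<^sup>2) \<partial>lborel) \<le> ennreal C * (\<integral>\<^sup>+r. ennreal (exp (- r)) * F r \<partial>lborel)"
    using nn_integral_radial_le[OF assms] by blast
  show thesis
  proof
    fix S :: "'a \<Rightarrow> real \<Rightarrow> real" assume S: "case_prod S \<in> borel_measurable (borel \<Otimes>\<^sub>M borel)"
    have [measurable (raw)]: "(\<lambda>p. S (f1 p) (f2 p)) \<in> borel_measurable M"
      if "f1 \<in> M \<rightarrow>\<^sub>M borel" "f2 \<in> M \<rightarrow>\<^sub>M borel" for M :: "'z measure" and f1 f2
      using measurable_compose[OF measurable_Pair[OF that] S] by simp
    have "(\<integral>\<^sup>+c. \<integral>\<^sup>+u. ennreal (exp (- 2 * (norm u)\<^sup>2) * (S c ((norm u)\<^sup>2))\<^sup>2) \<partial>(lborel :: 'a measure) \<partial>lborel)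
      \<le> (\<integral>\<^sup>+c. ennreal C * (\<integral>\<^sup>+r. ennreal (exp (- r) * (S c r)\<^sup>2) \<partial>lborel) \<partial>lborel)"
      using C(2)[of "\<lambda>r. ennreal ((S c r)\<^sup>2)" for c] by (intro nn_integral_mono) (simp add: ennreal_mult)
    also have "\<dots> = ennreal C * (\<integral>\<^sup>+c. \<integral>\<^sup>+r. ennreal (exp (- r) * (S c r)\<^sup>2) \<partial>lborel \<partial>lborel)"
      by (rule nn_integral_cmult) measurable
    finally show "(\<integral>\<^sup>+c. \<integral>\<^sup>+u. ennreal (exp (- 2 * (norm u)\<^sup>2) * (S c ((norm u)\<^sup>2))\<^sup>2) \<partial>(lborel :: 'a measure) \<partial>lborel)
      \<le> ennreal C * (\<integral>\<^sup>+c. \<integral>\<^sup>+r. ennreal (exp (- r) * (S c r)\<^sup>2) \<partial>lborel \<partial>lborel)" .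
  qed (rule C(1))
qed

lemma nn_integral_Cauchy_Schwarz_iterated:
  fixes F W :: "'a::euclidean_space \<Rightarrow> 'b::euclidean_space \<Rightarrow> real"
  assumes F: "case_prod F \<in> borel_measurable (borel \<Otimes>\<^sub>M borel)" and W: "case_prod W \<in> borel_measurable (borel \<Otimes>\<^sub>M borel)"
  shows "(\<integral>\<^sup>+x. \<integral>\<^sup>+y. ennreal \<bar>F x y * W x y\<bar> \<partial>lborel \<partial>lborel)\<^sup>2
    \<le> (\<integral>\<^sup>+x. \<integral>\<^sup>+y. ennreal ((F x y)\<^sup>2) \<partial>lborel \<partial>lborel) * (\<integral>\<^sup>+x. \<integral>\<^sup>+y. ennreal ((W x y)\<^sup>2) \<partial>lborel \<partial>lborel)"
proof -
  let ?f = "\<lambda>u. ennreal \<bar>case_prod F u\<bar>" and ?w = "\<lambda>u. ennreal \<bar>case_prod W u\<bar>"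
  have m [measurable]: "case_prod F \<in> borel_measurable (lborel \<Otimes>\<^sub>M lborel)" "case_prod W \<in> borel_measurable (lborel \<Otimes>\<^sub>M lborel)"
    using F W by (simp_all cong: measurable_cong_sets add: sets_pair_measure_cong[OF sets_lborel sets_lborel])
  have "(\<integral>\<^sup>+u. ?f u * ?w u \<partial>(lborel \<Otimes>\<^sub>M lborel))\<^sup>2 \<le> (\<integral>\<^sup>+u. ?f u ^ 2 \<partial>(lborel \<Otimes>\<^sub>M lborel)) * (\<integral>\<^sup>+u. ?w u ^ 2 \<partial>(lborel \<Otimes>\<^sub>M lborel))"
    by (rule Cauchy_Schwarz_nn_integral) measurable
  then show ?thesis
    by (simp add: lborel.nn_integral_fst[symmetric] ennreal_power abs_mult ennreal_mult)
qed

text \<open>Cauchy-Schwarz in the pair of variables that are not averaged. After the shear the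
  centre and the displacement are independent, so the second factor is the full energy of
  \<open>S\<close> over centres and squared radii.\<close>

lemma weighted_pairing_le:
  assumes "DIM('a::euclidean_space) \<ge> 2"
  obtains C :: real where "C > 0" "\<And>(S :: 'a \<Rightarrow> real \<Rightarrow> real) g h \<kappa>. case_prod S \<in> borel_measurable (borel \<Otimes>\<^sub>M borel) \<Longrightarrow>
    g \<in> borel_measurable borel \<Longrightarrow> h \<in> borel_measurable borel \<Longrightarrow>
    (\<integral>\<^sup>+z. \<integral>\<^sup>+y. ennreal \<bar>h z * g y * S (z - \<kappa> *\<^sub>R (y - z)) ((norm (y - z))\<^sup>2)\<bar> \<partial>lborel \<partial>lborel)\<^sup>2
      \<le> ennreal C * wnorm h * wnorm g * (\<integral>\<^sup>+c. \<integral>\<^sup>+r. ennreal (exp (- r) * (S c r)\<^sup>2) \<partial>lborel \<partial>lborel)"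
proof -
  obtain C where C: "C > 0" "\<And>S :: 'a \<Rightarrow> real \<Rightarrow> real. case_prod S \<in> borel_measurable (borel \<Otimes>\<^sub>M borel) \<Longrightarrow>
    (\<integral>\<^sup>+c. \<integral>\<^sup>+u. ennreal (exp (- 2 * (norm u)\<^sup>2) * (S c ((norm u)\<^sup>2))\<^sup>2) \<partial>(lborel :: 'a measure) \<partial>lborel)
      \<le> ennreal C * (\<integral>\<^sup>+c. \<integral>\<^sup>+r. ennreal (exp (- r) * (S c r)\<^sup>2) \<partial>lborel \<partial>lborel)"
    using radial_energy_le[OF assms] by blast
  show thesis
  proof
    fix S :: "'a \<Rightarrow> real \<Rightarrow> real" and g h :: "'a \<Rightarrow> real" and \<kappa> :: real
    assume S: "case_prod S \<in> borel_measurable (borel \<Otimes>\<^sub>M borel)" and [measurable]: "g \<in> borel_measurable borel" "h \<in> borel_measurable borel"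
    have [measurable (raw)]: "(\<lambda>p. S (f1 p) (f2 p)) \<in> borel_measurable M"
      if "f1 \<in> M \<rightarrow>\<^sub>M borel" "f2 \<in> M \<rightarrow>\<^sub>M borel" for M :: "'z measure" and f1 f2
      using measurable_compose[OF measurable_Pair[OF that] S] by simp
    \<comment> \<open>The factor exp (|y - z|^2) and its inverse are inserted: the growing one is
      absorbed by \<open>wnorm\<close>, the decaying one makes the energy of \<open>S\<close>
      finite.\<close>
    define F where "F z y = h z * g y * exp ((norm (y - z))\<^sup>2)" for z y
    define W where "W z y = exp (- (norm (y - z))\<^sup>2) * S (z - \<kappa> *\<^sub>R (y - z)) ((norm (y - z))\<^sup>2)" for z y
    have "h z * g y * S (z - \<kappa> *\<^sub>R (y - z)) ((norm (y - z))\<^sup>2) = F z y * W z y" for z y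
      unfolding F_def W_def by (simp add: exp_minus)
    then have "(\<integral>\<^sup>+z. \<integral>\<^sup>+y. ennreal \<bar>h z * g y * S (z - \<kappa> *\<^sub>R (y - z)) ((norm (y - z))\<^sup>2)\<bar> \<partial>lborel \<partial>lborel)\<^sup>2
       = (\<integral>\<^sup>+z. \<integral>\<^sup>+y. ennreal \<bar>F z y * W z y\<bar> \<partial>lborel \<partial>lborel)\<^sup>2" by simp
    also have "\<dots> \<le> (\<integral>\<^sup>+x. \<integral>\<^sup>+y. ennreal ((F x y)\<^sup>2) \<partial>lborel \<partial>lborel) * (\<integral>\<^sup>+x. \<integral>\<^sup>+y. ennreal ((W x y)\<^sup>2) \<partial>lborel \<partial>lborel)"
      by (rule nn_integral_Cauchy_Schwarz_iterated) (auto simp: F_def W_def)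
    also have "\<dots> \<le> (wnorm h * wnorm g) * (ennreal C * (\<integral>\<^sup>+c. \<integral>\<^sup>+r. ennreal (exp (- r) * (S c r)\<^sup>2) \<partial>lborel \<partial>lborel))"
    proof (rule mult_mono)
      have "(F x y)\<^sup>2 \<le> ((h x)\<^sup>2 * exp (4 * (norm x)\<^sup>2)) * ((g y)\<^sup>2 * exp (4 * (norm y)\<^sup>2))" for x y
      proof -
        have "(norm (y - x))\<^sup>2 \<le> 2 * (norm x)\<^sup>2 + 2 * (norm y)\<^sup>2"
        proof -
          have "(norm (y - x))\<^sup>2 + (norm (y + x))\<^sup>2 = 2 * (norm x)\<^sup>2 + 2 * (norm y)\<^sup>2"
            by (simp add: power2_norm_eq_inner inner_simps inner_commute)
          then show ?thesis by (smt (verit) zero_le_power2)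
        qed
        then have "exp (2 * (norm (y - x))\<^sup>2) \<le> exp (4 * (norm x)\<^sup>2) * exp (4 * (norm y)\<^sup>2)"
          by (simp flip: exp_add)
        then have "((h x)\<^sup>2 * (g y)\<^sup>2) * exp (2 * (norm (y - x))\<^sup>2) \<le> ((h x)\<^sup>2 * (g y)\<^sup>2) * (exp (4 * (norm x)\<^sup>2) * exp (4 * (norm y)\<^sup>2))"
          by (intro mult_left_mono) auto
        then show ?thesis by (simp add: F_def power_mult_distrib exp_double mult_ac)
      qed
      then have "(\<integral>\<^sup>+x. \<integral>\<^sup>+y. ennreal ((F x y)\<^sup>2) \<partial>lborel \<partial>lborel)
         \<le> (\<integral>\<^sup>+x. \<integral>\<^sup>+y. ennreal ((h x)\<^sup>2 * exp (4 * (norm x)\<^sup>2)) * ennreal ((g y)\<^sup>2 * exp (4 * (norm y)\<^sup>2)) \<partial>lborel \<partial>lborel)"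
        by (intro nn_integral_mono) (simp add: ennreal_mult[symmetric] ennreal_leI)
      also have "\<dots> = wnorm h * wnorm g"
        unfolding wnorm_def by (simp add: nn_integral_cmult nn_integral_multc)
      finally show "(\<integral>\<^sup>+x. \<integral>\<^sup>+y. ennreal ((F x y)\<^sup>2) \<partial>lborel \<partial>lborel) \<le> wnorm h * wnorm g" .
      have "(\<integral>\<^sup>+x. \<integral>\<^sup>+y. ennreal ((W x y)\<^sup>2) \<partial>lborel \<partial>lborel) =
        (\<integral>\<^sup>+z. \<integral>\<^sup>+y. (\<lambda>c u. ennreal (exp (- 2 * (norm u)\<^sup>2) * (S c ((norm u)\<^sup>2))\<^sup>2)) (z - \<kappa> *\<^sub>R (y - z)) (y - z) \<partial>lborel \<partial>lborel)"
        by (simp add: W_def power_mult_distrib exp_double[symmetric])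
      also have "\<dots> = (\<integral>\<^sup>+c. \<integral>\<^sup>+(u::'a). ennreal (exp (- 2 * (norm u)\<^sup>2) * (S c ((norm u)\<^sup>2))\<^sup>2) \<partial>lborel \<partial>lborel)"
      proof -
        have "case_prod (\<lambda>c (u::'a). ennreal (exp (- 2 * (norm u)\<^sup>2) * (S c ((norm u)\<^sup>2))\<^sup>2)) \<in> borel_measurable (borel \<Otimes>\<^sub>M borel)"
          by measurable
        from nn_integral_shear[OF this, of \<kappa>] show ?thesis by simp
      qed
      also have "\<dots> \<le> ennreal C * (\<integral>\<^sup>+c. \<integral>\<^sup>+r. ennreal (exp (- r) * (S c r)\<^sup>2) \<partial>lborel \<partial>lborel)"
        by (rule C(2)[OF S])
      finally show "(\<integral>\<^sup>+x. \<integral>\<^sup>+y. ennreal ((W x y)\<^sup>2) \<partial>lborel \<partial>lborel) \<le> \<dots>" .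
    qed auto
    finally show "(\<integral>\<^sup>+z. \<integral>\<^sup>+y. ennreal \<bar>h z * g y * S (z - \<kappa> *\<^sub>R (y - z)) ((norm (y - z))\<^sup>2)\<bar> \<partial>lborel \<partial>lborel)\<^sup>2
      \<le> ennreal C * wnorm h * wnorm g * (\<integral>\<^sup>+c. \<integral>\<^sup>+r. ennreal (exp (- r) * (S c r)\<^sup>2) \<partial>lborel \<partial>lborel)"
      by (simp add: mult_ac)
  qed (rule C(1))
qed

definition tri_form :: "real \<Rightarrow> real \<Rightarrow> ('a::euclidean_space \<Rightarrow> real) \<Rightarrow> ('a \<Rightarrow> real) \<Rightarrow> ('a \<Rightarrow> real) \<Rightarrow> real" where
  "tri_form \<epsilon> T f g h = (\<integral>(x, y, z). f x * g y * h z * thick \<epsilon> ((norm (x - z))\<^sup>2 - T * (norm (x - y))\<^sup>2) \<partial>(lborel \<Otimes>\<^sub>M (lborel \<Otimes>\<^sub>M lborel)))"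

lemma integrable_lborel_pair_mult:
  fixes f :: "'a::euclidean_space \<Rightarrow> real" and g :: "'b::euclidean_space \<Rightarrow> real"
  assumes "integrable lborel f" "integrable lborel g"
  shows "integrable (lborel \<Otimes>\<^sub>M lborel) (\<lambda>(x, y). f x * g y)"
proof -
  have [measurable]: "f \<in> borel_measurable borel" "g \<in> borel_measurable borel" using assms by auto
  show ?thesis
    by (rule lborel_pair.Fubini_integrable) (use assms in \<open>auto simp: abs_mult\<close>)
qed

lemma integrable_tri:
  fixes f g h :: "'a::euclidean_space \<Rightarrow> real"
  assumes "integrable lborel f" "integrable lborel g" "integrable lborel h" "\<epsilon> > 0"
  shows "integrable (lborel \<Otimes>\<^sub>M (lborel \<Otimes>\<^sub>M lborel)) (\<lambda>(x, y, z). f x * g y * h z * thick \<epsilon> ((norm (x - z))\<^sup>2 - T * (norm (x - y))\<^sup>2))"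
proof -
  have [measurable]: "f \<in> borel_measurable borel" "g \<in> borel_measurable borel" "h \<in> borel_measurable borel" using assms by auto
  have "integrable lborel (\<lambda>u. case u of (y, z) \<Rightarrow> g y * h z)"
    using integrable_lborel_pair_mult[OF assms(2,3)] by (simp add: lborel_prod)
  from integrable_lborel_pair_mult[OF assms(1) this]
  have "integrable (lborel \<Otimes>\<^sub>M (lborel \<Otimes>\<^sub>M lborel)) (\<lambda>(x, y, z). f x * g y * h z)"
    by (simp add: lborel_prod case_prod_unfold mult.assoc)
  from integrable_mult_thick[OF this assms(4), of "\<lambda>(x, y, z). (norm (x - z))\<^sup>2 - T * (norm (x - y))\<^sup>2"]
  show ?thesis by (simp add: case_prod_unfold)
qed

lemma tri_diff1:
  assumes "integrable lborel f" "integrable lborel f'" "integrable lborel g" "integrable lborel h" "\<epsilon> > 0"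
  shows "tri_form \<epsilon> T (\<lambda>x. f x - f' x) g h = tri_form \<epsilon> T f g h - tri_form \<epsilon> T f' g h"
  unfolding tri_form_def using integrable_tri[OF assms(1,3,4,5), of T] integrable_tri[OF assms(2,3,4,5), of T]
  by (subst Bochner_Integration.integral_diff[symmetric]) (auto simp: case_prod_unfold algebra_simps)

lemma tri_diff2:
  assumes "integrable lborel f" "integrable lborel g" "integrable lborel g'" "integrable lborel h" "\<epsilon> > 0"
  shows "tri_form \<epsilon> T f (\<lambda>x. g x - g' x) h = tri_form \<epsilon> T f g h - tri_form \<epsilon> T f g' h"
  unfolding tri_form_def using integrable_tri[OF assms(1,2,4,5), of T] integrable_tri[OF assms(1,3,4,5), of T]
  by (subst Bochner_Integration.integral_diff[symmetric]) (auto simp: case_prod_unfold algebra_simps)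

lemma tri_diff3:
  assumes "integrable lborel f" "integrable lborel g" "integrable lborel h" "integrable lborel h'" "\<epsilon> > 0"
  shows "tri_form \<epsilon> T f g (\<lambda>x. h x - h' x) = tri_form \<epsilon> T f g h - tri_form \<epsilon> T f g h'"
  unfolding tri_form_def using integrable_tri[OF assms(1,2,3,5), of T] integrable_tri[OF assms(1,2,4,5), of T]
  by (subst Bochner_Integration.integral_diff[symmetric]) (auto simp: case_prod_unfold algebra_simps)

text \<open>In each order of integration the innermost variable is the one that will be averaged
  over shells.\<close>

lemma
  fixes f g h :: "'a::euclidean_space \<Rightarrow> real"
  assumes "integrable lborel f" "integrable lborel g" "integrable lborel h" "\<epsilon> > 0"
  shows tri_xyz: "tri_form \<epsilon> T f g h = (\<integral>x. \<integral>y. \<integral>z. f x * g y * h z * thick \<epsilon> ((norm (x - z))\<^sup>2 - T * (norm (x - y))\<^sup>2) \<partial>lborel \<partial>lborel \<partial>lborel)"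
    and tri_xzy: "tri_form \<epsilon> T f g h = (\<integral>x. \<integral>z. \<integral>y. f x * g y * h z * thick \<epsilon> ((norm (x - z))\<^sup>2 - T * (norm (x - y))\<^sup>2) \<partial>lborel \<partial>lborel \<partial>lborel)"
    and tri_zyx: "tri_form \<epsilon> T f g h = (\<integral>z. \<integral>y. \<integral>x. f x * g y * h z * thick \<epsilon> ((norm (x - z))\<^sup>2 - T * (norm (x - y))\<^sup>2) \<partial>lborel \<partial>lborel \<partial>lborel)"
proof -
  have [measurable]: "f \<in> borel_measurable borel" "g \<in> borel_measurable borel" "h \<in> borel_measurable borel" using assms by auto
  let ?\<psi> = "\<lambda>x y z. f x * g y * h z * thick \<epsilon> ((norm (x - z))\<^sup>2 - T * (norm (x - y))\<^sup>2)"
  have iyz: "integrable (lborel \<Otimes>\<^sub>M lborel) (\<lambda>(y, z). ?\<psi> x y z)" for x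
    using integrable_mult_right[OF integrable_mult_thick[OF integrable_lborel_pair_mult[OF assms(2,3)] assms(4), of "\<lambda>(y, z). (norm (x - z))\<^sup>2 - T * (norm (x - y))\<^sup>2"], of "f x"]
    by (simp add: case_prod_unfold mult.assoc)
  have ixy: "integrable (lborel \<Otimes>\<^sub>M lborel) (\<lambda>(x, y). ?\<psi> x y z)" for z
    using integrable_mult_right[OF integrable_mult_thick[OF integrable_lborel_pair_mult[OF assms(1,2)] assms(4), of "\<lambda>(x, y). (norm (x - z))\<^sup>2 - T * (norm (x - y))\<^sup>2"], of "h z"]
    by (simp add: case_prod_unfold mult_ac)
  have i3: "integrable (lborel \<Otimes>\<^sub>M lborel) (\<lambda>(x, u). ?\<psi> x (fst u) (snd u))"
    using integrable_tri[OF assms, of T] by (simp add: lborel_prod case_prod_unfold)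
  have "tri_form \<epsilon> T f g h = (\<integral>x. \<integral>u. ?\<psi> x (fst u) (snd u) \<partial>lborel \<partial>lborel)"
    unfolding tri_form_def using lborel_pair.integral_fst[OF i3] by (simp add: lborel_prod case_prod_unfold)
  also have "\<dots> = (\<integral>x. \<integral>y. \<integral>z. ?\<psi> x y z \<partial>lborel \<partial>lborel \<partial>lborel)"
    using lborel_pair.integral_fst[OF iyz] by (simp add: lborel_prod case_prod_unfold)
  finally show 1: "tri_form \<epsilon> T f g h = (\<integral>x. \<integral>y. \<integral>z. ?\<psi> x y z \<partial>lborel \<partial>lborel \<partial>lborel)" .
  also have "\<dots> = (\<integral>x. \<integral>z. \<integral>y. ?\<psi> x y z \<partial>lborel \<partial>lborel \<partial>lborel)"
    using lborel_pair.Fubini_integral[OF iyz] by simp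
  finally show 2: "tri_form \<epsilon> T f g h = (\<integral>x. \<integral>z. \<integral>y. ?\<psi> x y z \<partial>lborel \<partial>lborel \<partial>lborel)" .
  define G where "G = (\<integral>y. \<bar>g y\<bar> \<partial>lborel)"
  \<comment> \<open>The last order exchanges \<open>x\<close> and \<open>z\<close> outside an inner
    integral over \<open>y\<close>, so integrability in (x, z) is needed after that integration; the
    peak 1 / \<epsilon> of the kernel and the mass of \<open>g\<close> give the dominating
    function.\<close>
  have ixz: "integrable (lborel \<Otimes>\<^sub>M lborel) (\<lambda>(x, z). \<integral>y. ?\<psi> x y z \<partial>lborel)"
  proof (rule Bochner_Integration.integrable_bound)
    show "integrable (lborel \<Otimes>\<^sub>M lborel) (\<lambda>(x, z). (G / \<epsilon>) * (f x * h z))"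
      using integrable_mult_right[OF integrable_lborel_pair_mult[OF assms(1,3)], of "G / \<epsilon>"] by (simp add: case_prod_unfold)
    show "(\<lambda>(x, z). \<integral>y. ?\<psi> x y z \<partial>lborel) \<in> borel_measurable (lborel \<Otimes>\<^sub>M lborel)" by measurable
    show "AE u in lborel \<Otimes>\<^sub>M lborel. norm (case u of (x, z) \<Rightarrow> \<integral>y. ?\<psi> x y z \<partial>lborel) \<le> norm (case u of (x, z) \<Rightarrow> (G / \<epsilon>) * (f x * h z))"
    proof (intro AE_I2, clarify)
      fix x z
      have "norm (\<integral>y. ?\<psi> x y z \<partial>lborel) \<le> (\<integral>y. norm (?\<psi> x y z) \<partial>lborel)" by (rule integral_norm_bound)
      also have "\<dots> \<le> (\<integral>y. \<bar>f x * h z\<bar> / \<epsilon> * \<bar>g y\<bar> \<partial>lborel)"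
      proof (rule integral_mono)
        have "integrable lborel (\<lambda>y. (f x * h z) * (g y * thick \<epsilon> ((norm (x - z))\<^sup>2 - T * (norm (x - y))\<^sup>2)))"
          by (intro integrable_mult_right integrable_mult_thick assms) measurable
        then show "integrable lborel (\<lambda>y. norm (?\<psi> x y z))"
          by (intro integrable_norm) (simp add: mult_ac)
        show "integrable lborel (\<lambda>y. \<bar>f x * h z\<bar> / \<epsilon> * \<bar>g y\<bar>)" using assms by auto
        fix y
        have "\<bar>f x * h z\<bar> * \<bar>g y\<bar> * thick \<epsilon> ((norm (x - z))\<^sup>2 - T * (norm (x - y))\<^sup>2) \<le> \<bar>f x * h z\<bar> * \<bar>g y\<bar> * (1 / \<epsilon>)"
          using assms by (intro mult_left_mono thick_bounds) auto
        then show "norm (?\<psi> x y z) \<le> \<bar>f x * h z\<bar> / \<epsilon> * \<bar>g y\<bar>"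
          using assms by (simp add: abs_mult thick_bounds mult_ac)
      qed
      also have "\<dots> = norm ((G / \<epsilon>) * (f x * h z))"
        using assms by (simp add: G_def abs_mult Bochner_Integration.integral_nonneg mult_ac)
      finally show "norm (\<integral>y. ?\<psi> x y z \<partial>lborel) \<le> norm ((G / \<epsilon>) * (f x * h z))" .
    qed
  qed
  have "(\<integral>x. \<integral>z. \<integral>y. ?\<psi> x y z \<partial>lborel \<partial>lborel \<partial>lborel) = (\<integral>z. \<integral>x. \<integral>y. ?\<psi> x y z \<partial>lborel \<partial>lborel \<partial>lborel)"
    using lborel_pair.Fubini_integral[OF ixz] by simp
  also have "\<dots> = (\<integral>z. \<integral>y. \<integral>x. ?\<psi> x y z \<partial>lborel \<partial>lborel \<partial>lborel)"
    using lborel_pair.Fubini_integral[OF ixy] by simp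
  finally show "tri_form \<epsilon> T f g h = (\<integral>z. \<integral>y. \<integral>x. ?\<psi> x y z \<partial>lborel \<partial>lborel \<partial>lborel)"
    using 2 by simp
qed

lemma abs_iterated_integral_le:
  fixes \<phi> :: "'a::euclidean_space \<Rightarrow> 'b::euclidean_space \<Rightarrow> real"
  shows "ennreal \<bar>\<integral>x. \<integral>y. \<phi> x y \<partial>lborel \<partial>lborel\<bar> \<le> (\<integral>\<^sup>+x. \<integral>\<^sup>+y. ennreal \<bar>\<phi> x y\<bar> \<partial>lborel \<partial>lborel)"
proof -
  have *: "ennreal \<bar>\<integral>x. f x \<partial>lborel\<bar> \<le> (\<integral>\<^sup>+x. ennreal \<bar>f x\<bar> \<partial>lborel)" for f :: "'c::euclidean_space \<Rightarrow> real"
    using integral_norm_bound_ennreal[of lborel f] by (cases "integrable lborel f") (auto simp: not_integrable_integral_eq)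
  show ?thesis
    by (rule order_trans[OF *]) (intro nn_integral_mono *)
qed

text \<open>In each arrangement one function is averaged over spherical shells and paired with the other two.
  When the averaged variable is the pin \<open>x\<close>, the locus \<open>|x - z|\<^sup>2 = T |x - y|\<^sup>2\<close> is an Apollonius sphere.\<close>

lemma apollonius:
  fixes x y z :: "'a::real_inner"
  assumes "T < 1"
  shows "(norm (x - z))\<^sup>2 - T * (norm (x - y))\<^sup>2
    = (1 - T) * (norm (x - (z - (T / (1 - T)) *\<^sub>R (y - z))))\<^sup>2 - T / (1 - T) * (norm (y - z))\<^sup>2"
proof -
  define k where "k = T / (1 - T)"
  have k: "(1 - T) * k = T" "k * (1 - T) = T" using assms by (auto simp: k_def)
  then have k2: "(1 - T) * (k * k) = T * k" by (simp flip: mult.assoc)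
  define u v where "u = x - z" and "v = y - z"
  have xy: "x - y = u - v" "x - (z - k *\<^sub>R v) = u + k *\<^sub>R v" by (auto simp: u_def v_def)
  have Tk: "T + T * k = k" using k by (simp add: algebra_simps)
  have "(1 - T) * (norm (u + k *\<^sub>R v))\<^sup>2 = (1 - T) * (u \<bullet> u) + 2 * ((1 - T) * k) * (u \<bullet> v) + ((1 - T) * (k * k)) * (v \<bullet> v)"
    by (simp add: power2_norm_eq_inner inner_simps inner_commute algebra_simps)
  also have "\<dots> = (1 - T) * (u \<bullet> u) + 2 * T * (u \<bullet> v) + T * k * (v \<bullet> v)"
    unfolding k k2 ..
  finally have N: "(1 - T) * (norm (u + k *\<^sub>R v))\<^sup>2 = (1 - T) * (u \<bullet> u) + 2 * T * (u \<bullet> v) + T * k * (v \<bullet> v)" .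
  have "(norm u)\<^sup>2 - T * (norm (u - v))\<^sup>2 = (1 - T) * (u \<bullet> u) + 2 * T * (u \<bullet> v) - T * (v \<bullet> v)"
    by (simp add: power2_norm_eq_inner inner_simps inner_commute algebra_simps)
  with N have "(1 - T) * (norm (u + k *\<^sub>R v))\<^sup>2 - (T + T * k) * (norm v)\<^sup>2 = (norm u)\<^sup>2 - T * (norm (u - v))\<^sup>2"
    by (simp add: power2_norm_eq_inner[of v] distrib_right)
  then show ?thesis unfolding Tk unfolding k_def[symmetric] v_def[symmetric] u_def[symmetric] xy by simp
qed

text \<open>For \<open>h\<close> the shells around \<open>x\<close> have squared radius
  \<open>T\<close> |x - y|^2. For \<open>g\<close> the sign of the argument is flipped, which the
  even kernel permits, and |x - z|^2 is the radius parameter. For \<open>f\<close> the centre lies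
  on the line through \<open>y\<close> and \<open>z\<close>, so \<kappa> = T / (1 - T).\<close>

lemma tri_bounds:
  assumes "DIM('a::euclidean_space) \<ge> 2"
  obtains C :: real where "C > 0" "\<And>(f :: 'a \<Rightarrow> real) g h \<epsilon> T.
      integrable lborel f \<Longrightarrow> integrable lborel g \<Longrightarrow> integrable lborel h \<Longrightarrow> 0 < \<epsilon> \<Longrightarrow> 0 < T \<Longrightarrow> T < 1 \<Longrightarrow>
      (ennreal \<bar>tri_form \<epsilon> T f g h\<bar>)\<^sup>2 \<le> ennreal C * wnorm f * wnorm g * shell_energy 1 T \<epsilon> h \<and>
      (ennreal \<bar>tri_form \<epsilon> T f g h\<bar>)\<^sup>2 \<le> ennreal C * wnorm f * wnorm h * shell_energy T 1 \<epsilon> g \<and>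
      (ennreal \<bar>tri_form \<epsilon> T f g h\<bar>)\<^sup>2 \<le> ennreal C * wnorm h * wnorm g * shell_energy (1 - T) (T / (1 - T)) \<epsilon> f"
proof -
  obtain C where C: "C > 0" "\<And>(S :: 'a \<Rightarrow> real \<Rightarrow> real) g h \<kappa>. case_prod S \<in> borel_measurable (borel \<Otimes>\<^sub>M borel) \<Longrightarrow>
    g \<in> borel_measurable borel \<Longrightarrow> h \<in> borel_measurable borel \<Longrightarrow>
    (\<integral>\<^sup>+z. \<integral>\<^sup>+y. ennreal \<bar>h z * g y * S (z - \<kappa> *\<^sub>R (y - z)) ((norm (y - z))\<^sup>2)\<bar> \<partial>lborel \<partial>lborel)\<^sup>2
      \<le> ennreal C * wnorm h * wnorm g * (\<integral>\<^sup>+c. \<integral>\<^sup>+r. ennreal (exp (- r) * (S c r)\<^sup>2) \<partial>lborel \<partial>lborel)"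
    using weighted_pairing_le[OF assms] by blast
  have key: "(ennreal \<bar>I\<bar>)\<^sup>2 \<le> ennreal C * wnorm h * wnorm g * shell_energy A B \<epsilon> f"
    if "integrable lborel f" "integrable lborel g" "integrable lborel h"
      "I = (\<integral>z. \<integral>y. h z * g y * shell_avg A B \<epsilon> f (z - \<kappa> *\<^sub>R (y - z)) ((norm (y - z))\<^sup>2) \<partial>lborel \<partial>lborel)"
    for f g h :: "'a \<Rightarrow> real" and A B \<epsilon> \<kappa> I
  proof -
    have "(ennreal \<bar>I\<bar>)\<^sup>2 \<le> (\<integral>\<^sup>+z. \<integral>\<^sup>+y. ennreal \<bar>h z * g y * shell_avg A B \<epsilon> f (z - \<kappa> *\<^sub>R (y - z)) ((norm (y - z))\<^sup>2)\<bar> \<partial>lborel \<partial>lborel)\<^sup>2"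
      unfolding that(4) by (intro power_mono abs_iterated_integral_le) auto
    also have "\<dots> \<le> ennreal C * wnorm h * wnorm g * shell_energy A B \<epsilon> f"
      unfolding shell_energy_def using that(1-3) by (intro C(2) borel_measurable_shell_avg) auto
    finally show ?thesis .
  qed
  show thesis
  proof (rule that[OF C(1)], intro conjI)
    fix f g h :: "'a \<Rightarrow> real" and \<epsilon> T :: real
    assume fgh: "integrable lborel f" "integrable lborel g" "integrable lborel h" and \<epsilon>: "0 < \<epsilon>" and T: "0 < T" "T < 1"
    show "(ennreal \<bar>tri_form \<epsilon> T f g h\<bar>)\<^sup>2 \<le> ennreal C * wnorm f * wnorm g * shell_energy 1 T \<epsilon> h"
      by (rule key[where \<kappa>=0, OF fgh(3,2,1)], subst tri_xyz[OF fgh \<epsilon>])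
        (simp add: shell_avg_def norm_minus_commute mult.assoc)
    have "thick \<epsilon> (T * (norm (y - x))\<^sup>2 - 1 * (norm (z - x))\<^sup>2) = thick \<epsilon> ((norm (x - z))\<^sup>2 - T * (norm (x - y))\<^sup>2)" for x y z :: 'a
      using thick_minus[of \<epsilon> "T * (norm (y - x))\<^sup>2 - 1 * (norm (z - x))\<^sup>2"] by (simp add: norm_minus_commute)
    then show "(ennreal \<bar>tri_form \<epsilon> T f g h\<bar>)\<^sup>2 \<le> ennreal C * wnorm f * wnorm h * shell_energy T 1 \<epsilon> g"
      by (intro key[where \<kappa>=0, OF fgh(2,3,1)], subst tri_xzy[OF fgh \<epsilon>])
        (simp add: shell_avg_def mult_ac flip: integral_mult_right_zero)
    show "(ennreal \<bar>tri_form \<epsilon> T f g h\<bar>)\<^sup>2 \<le> ennreal C * wnorm h * wnorm g * shell_energy (1 - T) (T / (1 - T)) \<epsilon> f"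
      by (rule key[where \<kappa>="T / (1 - T)", OF fgh(1,2,3)], subst tri_zyx[OF fgh \<epsilon>])
        (simp add: shell_avg_def apollonius[OF T(2)] mult_ac flip: integral_mult_right_zero)
  qed
qed

section \<open>Energies of mollified Frostman weights\<close>

text \<open>This is where the small loss arises: at \<omega> = 0 the integrand decays only like 1 /
  |y| and the integral diverges logarithmically.\<close>

lemma integrable_inverse_power:
  fixes \<omega> :: real
  assumes "\<omega> > 0"
  shows "integrable lborel (\<lambda>y::real. (1 + y\<^sup>2) powr (- (1 / 2 + \<omega>)))"
proof -
  let ?f = "\<lambda>y::real. (1 + y\<^sup>2) powr (- (1 / 2 + \<omega>))"
  let ?g = "\<lambda>y::real. indicator {1..} y * y powr (- 1 - 2 * \<omega>)"
  have "((\<lambda>y. y powr (- 1 - 2 * \<omega>)) has_integral (- (1 powr (- 1 - 2 * \<omega> + 1)) / (- 1 - 2 * \<omega> + 1))) {1..}"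
    using assms by (intro has_integral_powr_to_inf) auto
  from nn_integral_has_integral_lebesgue[OF _ this]
  have "(\<integral>\<^sup>+y. ennreal (?g y) \<partial>lborel) < \<infinity>" by simp
  then have ig: "integrable lborel ?g"
    by (intro integrableI_nonneg) auto
  then have ig': "integrable lborel (\<lambda>y. ?g (0 + (-1) * y))"
    by (intro lborel_integrable_real_affine) auto
  have i1: "integrable lborel (\<lambda>y::real. indicator {-1..1} y :: real)"
    by (intro integrable_real_indicator) auto
  have b: "?f y \<le> indicator {-1..1} y + ?g y + ?g (0 + (-1) * y)" for y
  proof -
    have *: "?f y \<le> z powr (- 1 - 2 * \<omega>)" if "z \<ge> 1" "z\<^sup>2 = y\<^sup>2" for z
    proof -
      have "?f y \<le> (z\<^sup>2) powr (- (1 / 2 + \<omega>))"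
        using that assms by (intro powr_mono2') auto
      also have "z\<^sup>2 = z powr 2" using that by (simp add: powr_numeral)
      also have "(z powr 2) powr (- (1 / 2 + \<omega>)) = z powr (- 1 - 2 * \<omega>)"
        unfolding powr_powr by (intro arg_cong[of _ _ "\<lambda>t. z powr t"]) (simp add: algebra_simps)
      finally show ?thesis .
    qed
    have "?f y \<le> 1 powr (- (1 / 2 + \<omega>))" using assms by (intro powr_mono2') auto
    then have "?f y \<le> 1" by simp
    then show ?thesis
      using *[of y] *[of "- y"] by (cases "y \<ge> 1"; cases "y \<le> -1") (auto split: split_indicator simp: add_increasing add_increasing2)
  qed
  show ?thesis
    by (rule Bochner_Integration.integrable_bound[OF Bochner_Integration.integrable_add[OF Bochner_Integration.integrable_add[OF i1 ig] ig']])
      (use b in \<open>auto simp: abs_of_nonneg\<close>)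
qed

text \<open>The Frostman condition is required only at scales \<open>r \<ge> \<delta>\<close>, as the weights live on finite sets.\<close>

definition frostman :: "real \<Rightarrow> real \<Rightarrow> real \<Rightarrow> 'a::euclidean_space set \<Rightarrow> ('a \<Rightarrow> real) \<Rightarrow> bool" where
  "frostman K \<alpha> \<delta> A m \<longleftrightarrow> finite A \<and> (\<forall>a\<in>A. m a \<ge> 0) \<and> sum m A \<le> K \<and>
     (\<forall>x r. r \<ge> \<delta> \<longrightarrow> sum m (A \<inter> cball x r) \<le> K * r powr \<alpha>)"

lemma summable_powr_gauss:
  fixes \<alpha> :: real
  assumes "\<alpha> \<ge> 0"
  shows "summable (\<lambda>k::nat. (real k + 1) powr \<alpha> * exp (- (real k)\<^sup>2 / 4))"
proof -
  obtain C where C: "C > 0" "\<And>r. r \<ge> 0 \<Longrightarrow> r powr \<alpha> \<le> C * exp r"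
    using powr_le_exp[OF assms] by blast
  show ?thesis
  proof (rule summable_comparison_test')
    show "summable (\<lambda>k::nat. C * exp 5 * (exp (- 1)) ^ k)"
      by (intro summable_mult summable_geometric) simp
    fix k :: nat
    have "0 \<le> (real k / 2 - 2)\<^sup>2" by simp
    then have "- (real k)\<^sup>2 / 4 \<le> 4 - 2 * real k" by (simp add: power2_eq_square field_simps)
    then have "exp (- (real k)\<^sup>2 / 4) \<le> exp (4 - 2 * real k)" by simp
    then have "(real k + 1) powr \<alpha> * exp (- (real k)\<^sup>2 / 4) \<le> (C * exp (real k + 1)) * exp (4 - 2 * real k)"
      using C by (intro mult_mono) auto
    also have "\<dots> = C * exp 5 * (exp (- 1)) ^ k"
      by (simp flip: exp_add exp_of_nat_mult)
    finally show "norm ((real k + 1) powr \<alpha> * exp (- (real k)\<^sup>2 / 4)) \<le> C * exp 5 * (exp (- 1)) ^ k"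
      by simp
  qed
qed

text \<open>Splitting into annuli of width \<open>sqrt \<sigma>\<close> around \<open>x\<close>: the
  one with index \<open>j\<close> lies in a ball of radius \<open>(j + 1) * sqrt \<sigma>\<close>,
  which is at least \<delta>, so the Frostman bound applies, and the Gaussian factor makes the sum
  over \<open>j\<close> converge.\<close>

lemma frostman_potential:
  assumes "\<alpha> \<ge> 0"
  obtains C1 :: real where "C1 > 0" "\<And>K \<delta> A m \<sigma> (x :: 'a::euclidean_space). frostman K \<alpha> \<delta> A m \<Longrightarrow> \<delta> > 0 \<Longrightarrow> \<sigma> \<ge> \<delta>\<^sup>2 \<Longrightarrow>
     (\<Sum>a\<in>A. m a * heat \<sigma> (x - a)) \<le> C1 * K * \<sigma> powr ((\<alpha> - real DIM('a)) / 2)"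
proof -
  define u where "u k = (real k + 1) powr \<alpha> * exp (- (real k)\<^sup>2 / 4)" for k :: nat
  have su: "summable u" unfolding u_def using summable_powr_gauss[OF assms] .
  have u0: "u k > 0" for k by (simp add: u_def)
  define S where "S = suminf u"
  have S: "S > 0" unfolding S_def using su u0 by (simp add: suminf_pos)
  define C1 where "C1 = (4 * pi) powr (- (real DIM('a) / 2)) * S"
  show thesis
  proof
    show "C1 > 0" using S by (simp add: C1_def)
    fix K \<delta> and A :: "'a set" and m \<sigma> and x :: 'a
    assume F: "frostman K \<alpha> \<delta> A m" and \<delta>: "\<delta> > 0" and \<sigma>: "\<sigma> \<ge> \<delta>\<^sup>2"
    have A: "finite A" and m0: "\<And>a. a \<in> A \<Longrightarrow> m a \<ge> 0" and K: "sum m A \<le> K"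
      and FB: "\<And>x r. r \<ge> \<delta> \<Longrightarrow> sum m (A \<inter> cball x r) \<le> K * r powr \<alpha>"
      using F by (auto simp: frostman_def)
    have K0: "K \<ge> 0" using K m0 sum_nonneg[of A m] by force
    have sp: "\<sigma> > 0" using \<delta> \<sigma> by (smt (verit) zero_less_power)
    have sq: "sqrt \<sigma> \<ge> \<delta>" "sqrt \<sigma> > 0" using \<delta> \<sigma> sp by (auto intro: real_le_rsqrt)
    define k where "k a = nat \<lfloor>norm (x - a) / sqrt \<sigma>\<rfloor>" for a
    have k1: "real (k a) \<le> norm (x - a) / sqrt \<sigma>" "norm (x - a) / sqrt \<sigma> \<le> real (k a) + 1" for a
      unfolding k_def using sq by (auto simp: real_of_int_floor_add_one_ge)
    have "(\<Sum>a\<in>A. m a * exp (- (norm (x - a))\<^sup>2 / (4 * \<sigma>))) \<le> (\<Sum>a\<in>A. m a * exp (- (real (k a))\<^sup>2 / 4))"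
    proof (intro sum_mono mult_left_mono m0)
      fix a
      have "(real (k a))\<^sup>2 \<le> (norm (x - a) / sqrt \<sigma>)\<^sup>2" using k1 by (intro power_mono) auto
      also have "\<dots> = (norm (x - a))\<^sup>2 / \<sigma>" using sp by (simp add: power_divide)
      finally show "exp (- (norm (x - a))\<^sup>2 / (4 * \<sigma>)) \<le> exp (- (real (k a))\<^sup>2 / 4)" by simp
    qed
    also have "\<dots> = (\<Sum>j\<in>k ` A. \<Sum>a | a \<in> A \<and> k a = j. m a * exp (- (real (k a))\<^sup>2 / 4))"
      by (rule sum.image_gen[OF A])
    also have "\<dots> \<le> (\<Sum>j\<in>k ` A. K * (sqrt \<sigma>) powr \<alpha> * u j)"
    proof (intro sum_mono)
      fix j
      have "(\<Sum>a | a \<in> A \<and> k a = j. m a * exp (- (real (k a))\<^sup>2 / 4)) = (\<Sum>a | a \<in> A \<and> k a = j. m a) * exp (- (real j)\<^sup>2 / 4)"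
        by (simp add: sum_distrib_right)
      also have "(\<Sum>a | a \<in> A \<and> k a = j. m a) \<le> sum m (A \<inter> cball x ((real j + 1) * sqrt \<sigma>))"
        using k1(2) sq A m0 by (intro sum_mono2) (auto simp: dist_norm field_simps)
      also have "\<dots> \<le> K * ((real j + 1) * sqrt \<sigma>) powr \<alpha>"
        using sq mult_mono[of 1 "real j + 1" \<delta> "sqrt \<sigma>"] \<delta> by (intro FB) auto
      also have "\<dots> = K * (sqrt \<sigma>) powr \<alpha> * (real j + 1) powr \<alpha>"
        using sq by (simp add: powr_mult)
      finally show "(\<Sum>a | a \<in> A \<and> k a = j. m a * exp (- (real (k a))\<^sup>2 / 4)) \<le> K * (sqrt \<sigma>) powr \<alpha> * u j"
        unfolding u_def by (simp add: mult.assoc)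
    qed
    also have "\<dots> = K * (sqrt \<sigma>) powr \<alpha> * (\<Sum>j\<in>k ` A. u j)" by (simp add: sum_distrib_left)
    also have "\<dots> \<le> K * (sqrt \<sigma>) powr \<alpha> * S"
      unfolding S_def using A u0 K0 by (intro mult_left_mono sum_le_suminf su) (auto simp: less_imp_le)
    finally have *: "(\<Sum>a\<in>A. m a * exp (- (norm (x - a))\<^sup>2 / (4 * \<sigma>))) \<le> K * (sqrt \<sigma>) powr \<alpha> * S" .
    have "(\<Sum>a\<in>A. m a * heat \<sigma> (x - a)) = (4 * pi * \<sigma>) powr (- (real DIM('a) / 2)) * (\<Sum>a\<in>A. m a * exp (- (norm (x - a))\<^sup>2 / (4 * \<sigma>)))"
      unfolding heat_def sum_distrib_left by (intro sum.cong) auto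
    also have "\<dots> \<le> (4 * pi * \<sigma>) powr (- (real DIM('a) / 2)) * (K * (sqrt \<sigma>) powr \<alpha> * S)"
      by (intro mult_left_mono *) auto
    also have "\<dots> = C1 * K * (\<sigma> powr (- (real DIM('a) / 2)) * \<sigma> powr (\<alpha> / 2))"
      unfolding C1_def using sp by (simp add: powr_mult powr_half_sqrt[symmetric] powr_powr)
    also have "\<sigma> powr (- (real DIM('a) / 2)) * \<sigma> powr (\<alpha> / 2) = \<sigma> powr ((\<alpha> - real DIM('a)) / 2)"
      by (simp add: diff_divide_distrib flip: powr_add)
    finally show "(\<Sum>a\<in>A. m a * heat \<sigma> (x - a)) \<le> C1 * K * \<sigma> powr ((\<alpha> - real DIM('a)) / 2)" .
  qed
qed

text \<open>The potential bound is integrated once more against the weights. Since \<alpha> is at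
  most the dimension, the exponent is nonpositive and the bound at the smaller time \<tau>
  dominates.\<close>

lemma frostman_heat_energy:
  assumes "0 \<le> \<alpha>" "\<alpha> \<le> real DIM('a::euclidean_space)"
  obtains C1 :: real where "C1 > 0" "\<And>K \<delta> (A :: 'a set) m \<sigma> \<tau>. frostman K \<alpha> \<delta> A m \<Longrightarrow> \<delta> > 0 \<Longrightarrow> \<tau> \<ge> \<delta>\<^sup>2 \<Longrightarrow> \<sigma> \<ge> \<tau> \<Longrightarrow>
     (\<Sum>a\<in>A. \<Sum>b\<in>A. m a * m b * heat \<sigma> (a - b)) \<le> C1 * K\<^sup>2 * \<tau> powr ((\<alpha> - real DIM('a)) / 2)"
proof -
  obtain C1 where C1: "C1 > 0" "\<And>K \<delta> A m \<sigma> (x :: 'a::euclidean_space). frostman K \<alpha> \<delta> A m \<Longrightarrow> \<delta> > 0 \<Longrightarrow> \<sigma> \<ge> \<delta>\<^sup>2 \<Longrightarrow>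
     (\<Sum>a\<in>A. m a * heat \<sigma> (x - a)) \<le> C1 * K * \<sigma> powr ((\<alpha> - real DIM('a)) / 2)"
    using frostman_potential[OF assms(1)] by blast
  show thesis
  proof (rule that[OF C1(1)])
    fix K \<delta> and A :: "'a set" and m \<sigma> \<tau>
    assume F: "frostman K \<alpha> \<delta> A m" and \<delta>: "\<delta> > 0" and \<tau>: "\<tau> \<ge> \<delta>\<^sup>2" and \<sigma>: "\<sigma> \<ge> \<tau>"
    have A: "finite A" and m0: "\<And>a. a \<in> A \<Longrightarrow> m a \<ge> 0" and K: "sum m A \<le> K"
      using F by (auto simp: frostman_def)
    have K0: "K \<ge> 0" using K m0 sum_nonneg[of A m] by force
    have tp: "\<tau> > 0" using \<delta> \<tau> by (smt (verit) zero_less_power)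
    have "(\<Sum>a\<in>A. \<Sum>b\<in>A. m a * m b * heat \<sigma> (a - b)) = (\<Sum>a\<in>A. m a * (\<Sum>b\<in>A. m b * heat \<sigma> (a - b)))"
      by (simp add: sum_distrib_left mult.assoc)
    also have "\<dots> \<le> (\<Sum>a\<in>A. m a * (C1 * K * \<tau> powr ((\<alpha> - real DIM('a)) / 2)))"
    proof (intro sum_mono mult_left_mono m0)
      fix a
      have "(\<Sum>b\<in>A. m b * heat \<sigma> (a - b)) \<le> C1 * K * \<sigma> powr ((\<alpha> - real DIM('a)) / 2)"
        using \<tau> \<sigma> by (intro C1(2)[OF F \<delta>]) auto
      also have "\<dots> \<le> C1 * K * \<tau> powr ((\<alpha> - real DIM('a)) / 2)"
        using tp \<sigma> assms C1 K0 by (intro mult_left_mono powr_mono2') auto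
      finally show "(\<Sum>b\<in>A. m b * heat \<sigma> (a - b)) \<le> C1 * K * \<tau> powr ((\<alpha> - real DIM('a)) / 2)" .
    qed
    also have "\<dots> = sum m A * (C1 * K * \<tau> powr ((\<alpha> - real DIM('a)) / 2))"
      by (simp add: sum_distrib_right)
    also have "\<dots> \<le> K * (C1 * K * \<tau> powr ((\<alpha> - real DIM('a)) / 2))"
      using K K0 C1 by (intro mult_right_mono) auto
    finally show "(\<Sum>a\<in>A. \<Sum>b\<in>A. m a * m b * heat \<sigma> (a - b)) \<le> C1 * K\<^sup>2 * \<tau> powr ((\<alpha> - real DIM('a)) / 2)"
      by (simp add: power2_eq_square mult_ac)
  qed
qed

text \<open>The convolution of the atomic measure with a combination of heat kernels of times
  \<tau>, 2 \<tau>, ..., N \<tau>. On the Fourier side it multiplies by the polynomial with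
  coefficients \<open>c\<close> in X = exp (- \<tau> |xi|^2).\<close>

definition moll :: "nat \<Rightarrow> (nat \<Rightarrow> real) \<Rightarrow> real \<Rightarrow> 'a::euclidean_space set \<Rightarrow> ('a \<Rightarrow> real) \<Rightarrow> 'a \<Rightarrow> real" where
  "moll N c \<tau> A m x = (\<Sum>i\<in>A \<times> {1..N}. (m (fst i) * c (snd i)) * heat (\<tau> * real (snd i)) (x - fst i))"

lemma integrable_moll:
  assumes "\<tau> > 0"
  shows "integrable lborel (moll N c \<tau> A m)"
  unfolding moll_def[abs_def] using assms
  by (intro Bochner_Integration.integrable_sum integrable_mult_right integrable_heat) auto

text \<open>Doubling the time frees half of the Gaussian exponent, |v|^2 / (8 s), and this is at
  least 4 |v|^2 exactly when s <= 1/32.\<close>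

lemma heat_times_gauss_le:
  fixes v :: "'a::euclidean_space"
  assumes "s > 0" "s \<le> 1 / 32"
  shows "heat s v * exp (4 * (norm v)\<^sup>2) \<le> 2 powr (real DIM('a) / 2) * heat (2 * s) v"
proof -
  have "4 * s \<le> 1 / 8" using assms by simp
  then have "4 * (norm v)\<^sup>2 \<le> (norm v)\<^sup>2 / (8 * s)"
    using assms mult_right_mono[of "4 * s" "1/8" "(norm v)\<^sup>2"] by (simp add: field_simps)
  then have "- (norm v)\<^sup>2 / (4 * s) + 4 * (norm v)\<^sup>2 \<le> - (norm v)\<^sup>2 / (4 * (2 * s))"
    using assms by (simp add: field_simps)
  then have e: "exp (- (norm v)\<^sup>2 / (4 * s)) * exp (4 * (norm v)\<^sup>2) \<le> exp (- (norm v)\<^sup>2 / (4 * (2 * s)))"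
    by (simp flip: exp_add)
  have p: "(4 * pi * s) powr (- (real DIM('a) / 2)) = 2 powr (real DIM('a) / 2) * (4 * pi * (2 * s)) powr (- (real DIM('a) / 2))"
  proof -
    have "4 * pi * (2 * s) = 2 * (4 * pi * s)" by simp
    then have "(4 * pi * (2 * s)) powr (- (real DIM('a) / 2)) = 2 powr (- (real DIM('a) / 2)) * (4 * pi * s) powr (- (real DIM('a) / 2))"
      using assms by (simp only: powr_mult)
    then show ?thesis by (simp add: powr_minus)
  qed
  show ?thesis
    unfolding heat_def p using mult_left_mono[OF e, of "2 powr (real DIM('a) / 2) * (4 * pi * (2 * s)) powr (- (real DIM('a) / 2))"]
    by (simp add: mult.assoc)
qed

text \<open>As the atoms lie in a fixed ball, the weight at \<open>x\<close> is moved to x - a at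
  the cost of a constant and absorbed by doubling the heat times. The remaining square integral is,
  by the semigroup law, a sum of heat energies of the weights at times above \<tau>.\<close>

lemma wnorm_moll_le:
  assumes "0 \<le> \<alpha>" "\<alpha> \<le> real DIM('a::euclidean_space)"
  obtains C :: real where "C > 0" "\<And>\<delta> (A :: 'a set) m \<tau>. frostman K \<alpha> \<delta> A m \<Longrightarrow> A \<subseteq> cball 0 R \<Longrightarrow> \<delta> > 0 \<Longrightarrow> \<tau> \<ge> \<delta>\<^sup>2 \<Longrightarrow> \<tau> * real N \<le> 1 / 32 \<Longrightarrow>
     wnorm (moll N c \<tau> A m) \<le> ennreal (C * \<tau> powr ((\<alpha> - real DIM('a)) / 2))"
proof -
  obtain C1 where C1: "C1 > 0" "\<And>K \<delta> (A :: 'a set) m \<sigma> \<tau>. frostman K \<alpha> \<delta> A m \<Longrightarrow> \<delta> > 0 \<Longrightarrow> \<tau> \<ge> \<delta>\<^sup>2 \<Longrightarrow> \<sigma> \<ge> \<tau> \<Longrightarrow>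
     (\<Sum>a\<in>A. \<Sum>b\<in>A. m a * m b * heat \<sigma> (a - b)) \<le> C1 * K\<^sup>2 * \<tau> powr ((\<alpha> - real DIM('a)) / 2)"
    using frostman_heat_energy[OF assms] by blast
  define B where "B = exp (4 * R\<^sup>2) * 2 powr (real DIM('a) / 2)"
  have B: "B > 0" by (simp add: B_def)
  define Sc where "Sc = (\<Sum>l\<in>{1..N}. \<bar>c l\<bar>)"
  have Sc: "Sc \<ge> 0" by (simp add: Sc_def sum_nonneg)
  define C where "C = B\<^sup>2 * (Sc\<^sup>2 * (C1 * K\<^sup>2)) + 1"
  show thesis
  proof
    show "C > 0" using C1 Sc by (simp add: C_def add_nonneg_pos)
    fix \<delta> and A :: "'a set" and m \<tau>
    assume F: "frostman K \<alpha> \<delta> A m" and AR: "A \<subseteq> cball 0 R" and \<delta>: "\<delta> > 0" and \<tau>: "\<tau> \<ge> \<delta>\<^sup>2" and \<tau>N: "\<tau> * real N \<le> 1 / 32"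
    have A: "finite A" and m0: "\<And>a. a \<in> A \<Longrightarrow> m a \<ge> 0"
      using F by (auto simp: frostman_def)
    have tp: "\<tau> > 0" using \<delta> \<tau> by (smt (verit) zero_less_power)
    define I where "I = A \<times> {1..N}"
    define q where "q i = m (fst i) * \<bar>c (snd i)\<bar>" for i :: "'a \<times> nat"
    have q0: "q i \<ge> 0" if "i \<in> I" for i using that m0 by (auto simp: q_def I_def)
    define g where "g x = (\<Sum>i\<in>I. q i * heat (2 * (\<tau> * real (snd i))) (x - fst i))" for x
    have g0: "g x \<ge> 0" for x unfolding g_def by (intro sum_nonneg mult_nonneg_nonneg q0) auto
    have bound: "\<bar>moll N c \<tau> A m x\<bar> * exp (2 * (norm x)\<^sup>2) \<le> B * g x" for x
    proof -
      have "\<bar>moll N c \<tau> A m x\<bar> * exp (2 * (norm x)\<^sup>2) \<le> (\<Sum>i\<in>I. q i * heat (\<tau> * real (snd i)) (x - fst i)) * exp (2 * (norm x)\<^sup>2)"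
        unfolding moll_def I_def[symmetric]
        by (intro mult_right_mono order_trans[OF sum_abs] sum_mono) (auto simp: q_def abs_mult m0 I_def)
      also have "\<dots> = (\<Sum>i\<in>I. q i * (heat (\<tau> * real (snd i)) (x - fst i) * exp (2 * (norm x)\<^sup>2)))"
        by (simp add: sum_distrib_right mult.assoc)
      also have "\<dots> \<le> (\<Sum>i\<in>I. q i * (B * heat (2 * (\<tau> * real (snd i))) (x - fst i)))"
      proof (intro sum_mono mult_left_mono q0)
        fix i assume i: "i \<in> I"
        define a where "a = fst i"
        have s: "\<tau> * real (snd i) > 0" "\<tau> * real (snd i) \<le> 1 / 32"
          using i tp order_trans[OF mult_left_mono[of "real (snd i)" "real N" \<tau>] \<tau>N] by (auto simp: I_def)
        have aR: "(norm a)\<^sup>2 \<le> R\<^sup>2" using i AR by (intro power_mono) (auto simp: I_def a_def)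
        have "(norm x)\<^sup>2 \<le> 2 * (norm a)\<^sup>2 + 2 * (norm (x - a))\<^sup>2"
        proof -
          have "(norm (a + (x - a)))\<^sup>2 + (norm (a - (x - a)))\<^sup>2 = 2 * (norm a)\<^sup>2 + 2 * (norm (x - a))\<^sup>2"
            by (simp add: power2_norm_eq_inner inner_simps inner_commute)
          then show ?thesis by (simp del: diff_diff_eq2) (smt (verit) zero_le_power2)
        qed
        then have "exp (2 * (norm x)\<^sup>2) \<le> exp (4 * R\<^sup>2) * exp (4 * (norm (x - a))\<^sup>2)"
          using aR by (simp flip: exp_add)
        then have "heat (\<tau> * real (snd i)) (x - a) * exp (2 * (norm x)\<^sup>2) \<le> heat (\<tau> * real (snd i)) (x - a) * (exp (4 * R\<^sup>2) * exp (4 * (norm (x - a))\<^sup>2))"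
          by (intro mult_left_mono) auto
        also have "\<dots> = exp (4 * R\<^sup>2) * (heat (\<tau> * real (snd i)) (x - a) * exp (4 * (norm (x - a))\<^sup>2))" by simp
        also have "\<dots> \<le> exp (4 * R\<^sup>2) * (2 powr (real DIM('a) / 2) * heat (2 * (\<tau> * real (snd i))) (x - a))"
          by (intro mult_left_mono heat_times_gauss_le s) auto
        finally show "heat (\<tau> * real (snd i)) (x - fst i) * exp (2 * (norm x)\<^sup>2) \<le> B * heat (2 * (\<tau> * real (snd i))) (x - fst i)"
          by (simp add: B_def a_def mult.assoc)
      qed
      also have "\<dots> = B * g x" by (simp add: g_def sum_distrib_left mult_ac)
      finally show ?thesis .
    qed
    have gsq: "(g x)\<^sup>2 = (\<Sum>i\<in>I. \<Sum>j\<in>I. q i * q j * (heat (2 * (\<tau> * real (snd i))) (x - fst i) * heat (2 * (\<tau> * real (snd j))) (x - fst j)))" for x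
      unfolding g_def by (simp only: power2_eq_square sum_product) (simp only: mult_ac)
    have si: "2 * (\<tau> * real (snd i)) > 0" if "i \<in> I" for i using that tp by (auto simp: I_def)
    have ig: "integrable lborel (\<lambda>x. (g x)\<^sup>2)"
      unfolding gsq by (intro Bochner_Integration.integrable_sum integrable_mult_right integrable_heat_mult si)
    have "(\<integral>x. (g x)\<^sup>2 \<partial>lborel) = (\<Sum>i\<in>I. \<Sum>j\<in>I. q i * q j * heat (2 * (\<tau> * real (snd i)) + 2 * (\<tau> * real (snd j))) (fst i - fst j))"
      unfolding gsq using si
      by (simp add: Bochner_Integration.integral_sum integrable_heat_mult heat_semigroup)
    also have "\<dots> = (\<Sum>l\<in>{1..N}. \<Sum>k\<in>{1..N}. \<bar>c l\<bar> * \<bar>c k\<bar> * (\<Sum>a\<in>A. \<Sum>b\<in>A. m a * m b * heat (2 * (\<tau> * real l) + 2 * (\<tau> * real k)) (a - b)))"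
    proof -
      have "(\<Sum>i\<in>I. \<Sum>j\<in>I. q i * q j * heat (2 * (\<tau> * real (snd i)) + 2 * (\<tau> * real (snd j))) (fst i - fst j))
        = (\<Sum>a\<in>A. \<Sum>l\<in>{1..N}. \<Sum>b\<in>A. \<Sum>k\<in>{1..N}. \<bar>c l\<bar> * \<bar>c k\<bar> * (m a * m b * heat (2 * (\<tau> * real l) + 2 * (\<tau> * real k)) (a - b)))"
        unfolding I_def q_def sum.cartesian_product' by (simp add: mult_ac)
      also have "\<dots> = (\<Sum>l\<in>{1..N}. \<Sum>a\<in>A. \<Sum>k\<in>{1..N}. \<Sum>b\<in>A. \<bar>c l\<bar> * \<bar>c k\<bar> * (m a * m b * heat (2 * (\<tau> * real l) + 2 * (\<tau> * real k)) (a - b)))"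
        by (subst sum.swap) (intro sum.cong refl sum.swap)
      also have "\<dots> = (\<Sum>l\<in>{1..N}. \<Sum>k\<in>{1..N}. \<Sum>a\<in>A. \<Sum>b\<in>A. \<bar>c l\<bar> * \<bar>c k\<bar> * (m a * m b * heat (2 * (\<tau> * real l) + 2 * (\<tau> * real k)) (a - b)))"
        by (intro sum.cong refl sum.swap)
      finally show ?thesis by (simp add: sum_distrib_left)
    qed
    also have "\<dots> \<le> (\<Sum>l\<in>{1..N}. \<Sum>k\<in>{1..N}. \<bar>c l\<bar> * \<bar>c k\<bar> * (C1 * K\<^sup>2 * \<tau> powr ((\<alpha> - real DIM('a)) / 2)))"
    proof (intro sum_mono mult_left_mono C1(2)[OF F \<delta> \<tau>])
      fix l k assume "l \<in> {1..N}" "k \<in> {1..N}"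
      then have "\<tau> * 1 \<le> \<tau> * (2 * real l + 2 * real k)" using tp by (intro mult_left_mono) auto
      then show "\<tau> \<le> 2 * (\<tau> * real l) + 2 * (\<tau> * real k)" by (simp add: algebra_simps)
    qed auto
    also have "\<dots> = Sc\<^sup>2 * (C1 * K\<^sup>2) * \<tau> powr ((\<alpha> - real DIM('a)) / 2)"
      unfolding Sc_def by (simp only: power2_eq_square[of "sum _ _"] sum_product) (simp only: sum_distrib_right mult.assoc)
    finally have gi: "(\<integral>x. (g x)\<^sup>2 \<partial>lborel) \<le> Sc\<^sup>2 * (C1 * K\<^sup>2) * \<tau> powr ((\<alpha> - real DIM('a)) / 2)" .
    have "wnorm (moll N c \<tau> A m) \<le> (\<integral>\<^sup>+x. ennreal (B\<^sup>2 * (g x)\<^sup>2) \<partial>lborel)"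
      unfolding wnorm_def
    proof (intro nn_integral_mono ennreal_leI)
      fix x
      have "(\<bar>moll N c \<tau> A m x\<bar> * exp (2 * (norm x)\<^sup>2))\<^sup>2 \<le> (B * g x)\<^sup>2"
        by (intro power_mono bound) auto
      then show "(moll N c \<tau> A m x)\<^sup>2 * exp (4 * (norm x)\<^sup>2) \<le> B\<^sup>2 * (g x)\<^sup>2"
        by (simp add: power_mult_distrib flip: exp_double)
    qed
    also have "\<dots> = ennreal (B\<^sup>2 * (\<integral>x. (g x)\<^sup>2 \<partial>lborel))"
      using ig by (subst nn_integral_eq_integral) auto
    also have "\<dots> \<le> ennreal (C * \<tau> powr ((\<alpha> - real DIM('a)) / 2))"
    proof (intro ennreal_leI)
      have "B\<^sup>2 * (\<integral>x. (g x)\<^sup>2 \<partial>lborel) \<le> B\<^sup>2 * (Sc\<^sup>2 * (C1 * K\<^sup>2) * \<tau> powr ((\<alpha> - real DIM('a)) / 2))"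
        by (intro mult_left_mono gi) auto
      also have "\<dots> \<le> C * \<tau> powr ((\<alpha> - real DIM('a)) / 2)"
        unfolding C_def by (simp add: distrib_right mult.assoc)
      finally show "B\<^sup>2 * (\<integral>x. (g x)\<^sup>2 \<partial>lborel) \<le> C * \<tau> powr ((\<alpha> - real DIM('a)) / 2)" .
    qed
    finally show "wnorm (moll N c \<tau> A m) \<le> ennreal (C * \<tau> powr ((\<alpha> - real DIM('a)) / 2))" .
  qed
qed

text \<open>The superposition over \<open>y\<close> is bounded frequency by frequency. With heat
  time \<sigma> of order at most 1 / (1 + y^2), the required power 1/2 + \<omega> of \<sigma> is
  what makes the integral over \<open>y\<close> converge. The bounds \<kappa> on the shell
  parameters keep all constants uniform in \<open>T\<close>, and \<epsilon> enters only through
  factors bounded for \<epsilon> \<le> 1.\<close>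

lemma shell_energy_le:
  assumes "0 < \<kappa>" "\<kappa> \<le> 1" "\<omega> > 0"
  obtains C :: real where "C > 0" "\<And>(I :: 'i set) q s (p :: 'i \<Rightarrow> 'a::euclidean_space) A B \<epsilon> D.
     finite I \<Longrightarrow> (\<And>i. i \<in> I \<Longrightarrow> s i > 0) \<Longrightarrow> \<kappa> \<le> A \<Longrightarrow> A \<le> 1 \<Longrightarrow> \<kappa> \<le> B \<Longrightarrow> B \<le> 1 \<Longrightarrow> 0 < \<epsilon> \<Longrightarrow> \<epsilon> \<le> 1 \<Longrightarrow> D \<ge> 0 \<Longrightarrow>
     (\<And>\<sigma>. 0 < \<sigma> \<Longrightarrow> \<sigma> \<le> 1 / \<kappa>\<^sup>2 \<Longrightarrow> (4 * pi * \<sigma>) powr (real DIM('a) / 2) * (\<Sum>i\<in>I. \<Sum>j\<in>I. q i * q j * heat (s i + s j + \<sigma>) (p i - p j)) \<le> D * \<sigma> powr (1 / 2 + \<omega>)) \<Longrightarrow>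
     shell_energy A B \<epsilon> (\<lambda>z. \<Sum>i\<in>I. q i * heat (s i) (z - p i)) \<le> ennreal (C * D)"
proof -
  define K1 where "K1 = exp (1 / (8 * \<kappa>\<^sup>2)) / (2 * \<kappa>) * (pi / \<kappa>) powr (real DIM('a) / 2)"
  define Y where "Y = (\<integral>(y::real). (1 + y\<^sup>2) powr (- (1 / 2 + \<omega>)) \<partial>lborel)"
  define k where "k = (\<kappa>\<^sup>2) powr (- (1 / 2 + \<omega>))"
  have iY: "integrable lborel (\<lambda>y::real. (1 + y\<^sup>2) powr (- (1 / 2 + \<omega>)))" by (rule integrable_inverse_power[OF assms(3)])
  have Y: "Y \<ge> 0" unfolding Y_def by (intro Bochner_Integration.integral_nonneg) auto
  have K1: "K1 > 0" using assms by (simp add: K1_def)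
  have k: "k > 0" using assms by (simp add: k_def)
  show thesis
  proof
    show "K1 * (k * Y) + 1 > 0" using K1 k Y by (simp add: add_nonneg_pos)
    fix I :: "'i set" and q s and p :: "'i \<Rightarrow> 'a" and A B \<epsilon> D :: real
    assume I: "finite I" "\<And>i. i \<in> I \<Longrightarrow> s i > 0" and AB: "\<kappa> \<le> A" "A \<le> 1" "\<kappa> \<le> B" "B \<le> 1" and \<epsilon>: "0 < \<epsilon>" "\<epsilon> \<le> 1" and D: "D \<ge> 0"
      and hyp: "\<And>\<sigma>. 0 < \<sigma> \<Longrightarrow> \<sigma> \<le> 1 / \<kappa>\<^sup>2 \<Longrightarrow> (4 * pi * \<sigma>) powr (real DIM('a) / 2) * (\<Sum>i\<in>I. \<Sum>j\<in>I. q i * q j * heat (s i + s j + \<sigma>) (p i - p j)) \<le> D * \<sigma> powr (1 / 2 + \<omega>)"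
    have AB0: "A > 0" "B > 0" using AB assms by auto
    define J where "J y = exp (- (\<epsilon>\<^sup>2 / 2) * y\<^sup>2) * ((pi / freq A B y) powr (real DIM('a) / 2) *
          (\<Sum>i\<in>I. \<Sum>j\<in>I. q i * q j * heat (s i + s j + 1 / (4 * freq A B y)) (p i - p j)))" for y
    define K2 where "K2 = exp (\<epsilon>\<^sup>2 / (8 * B\<^sup>2)) / (2 * B) * (pi * B / A) powr (real DIM('a) / 2)"
    have K2: "0 \<le> K2" "K2 \<le> K1"
    proof -
      show "0 \<le> K2" using AB0 by (simp add: K2_def)
      have "\<epsilon>\<^sup>2 / (8 * B\<^sup>2) \<le> 1\<^sup>2 / (8 * \<kappa>\<^sup>2)"
        using AB AB0 \<epsilon> assms by (intro frac_le mult_left_mono power_mono) auto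
      then have 1: "exp (\<epsilon>\<^sup>2 / (8 * B\<^sup>2)) / (2 * B) \<le> exp (1 / (8 * \<kappa>\<^sup>2)) / (2 * \<kappa>)"
        using AB AB0 assms by (intro frac_le) auto
      have "pi * B / A \<le> pi * 1 / \<kappa>"
        using AB AB0 assms by (intro frac_le mult_left_mono) auto
      then have 2: "(pi * B / A) powr (real DIM('a) / 2) \<le> (pi / \<kappa>) powr (real DIM('a) / 2)"
        using AB0 by (intro powr_mono2) auto
      show "K2 \<le> K1" unfolding K1_def K2_def using 1 2 AB0 assms by (intro mult_mono) auto
    qed
    have J: "J y \<le> D * k * (1 + y\<^sup>2) powr (- (1 / 2 + \<omega>))" for y
    proof -
      define \<sigma> where "\<sigma> = 1 / (4 * freq A B y)"
      have f: "freq A B y > 0" using AB0 by (rule freq_pos)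
      \<comment> \<open>Both coefficients of
        \<open>4 * freq A B y = A / B + 4 * A * B * y\<^sup>2\<close> are at least
        \<open>\<kappa>\<^sup>2\<close>.\<close>
      have "\<kappa>\<^sup>2 * (1 + y\<^sup>2) \<le> 4 * freq A B y"
      proof -
        have "\<kappa>\<^sup>2 \<le> A / B"
        proof -
          have "\<kappa>\<^sup>2 * B \<le> \<kappa> * 1" unfolding power2_eq_square mult.assoc
            using AB AB0 assms by (intro mult_left_mono mult_le_one) auto
          then show ?thesis using AB AB0 by (simp add: field_simps)
        qed
        moreover have "\<kappa>\<^sup>2 * y\<^sup>2 \<le> 4 * (A * B * y\<^sup>2)"
        proof -
          have "\<kappa> * \<kappa> \<le> A * B" using AB assms by (intro mult_mono) auto
          then have "\<kappa>\<^sup>2 * y\<^sup>2 \<le> A * B * y\<^sup>2" unfolding power2_eq_square[of \<kappa>] by (intro mult_right_mono) auto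
          moreover have "0 \<le> A * B * y\<^sup>2" using AB0 by simp
          ultimately show ?thesis by linarith
        qed
        ultimately show ?thesis unfolding freq_def by (simp add: algebra_simps)
      qed
      moreover have "\<kappa>\<^sup>2 * (1 + y\<^sup>2) > 0" using assms by (simp add: add_pos_nonneg)
      ultimately have \<sigma>1: "\<sigma> \<le> 1 / (\<kappa>\<^sup>2 * (1 + y\<^sup>2))"
        unfolding \<sigma>_def by (intro divide_left_mono) auto
      moreover have "1 / (\<kappa>\<^sup>2 * (1 + y\<^sup>2)) \<le> 1 / \<kappa>\<^sup>2"
        using assms by (intro divide_left_mono) (auto simp: add_pos_nonneg)
      ultimately have \<sigma>2: "\<sigma> \<le> 1 / \<kappa>\<^sup>2" by linarith
      have \<sigma>0: "\<sigma> > 0" using f by (simp add: \<sigma>_def)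
      have pf: "pi / freq A B y = 4 * pi * \<sigma>" by (simp add: \<sigma>_def)
      have "J y \<le> exp (- (\<epsilon>\<^sup>2 / 2) * y\<^sup>2) * (D * \<sigma> powr (1 / 2 + \<omega>))"
        unfolding J_def pf unfolding \<sigma>_def[symmetric] by (intro mult_left_mono hyp \<sigma>0 \<sigma>2) auto
      also have "\<dots> \<le> 1 * (D * \<sigma> powr (1 / 2 + \<omega>))"
        using D by (intro mult_right_mono) auto
      also have "\<sigma> powr (1 / 2 + \<omega>) \<le> (1 / (\<kappa>\<^sup>2 * (1 + y\<^sup>2))) powr (1 / 2 + \<omega>)"
        using \<sigma>0 \<sigma>1 assms by (intro powr_mono2) auto
      also have "\<dots> = k * (1 + y\<^sup>2) powr (- (1 / 2 + \<omega>))"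
      proof -
        have "(1 / (\<kappa>\<^sup>2 * (1 + y\<^sup>2))) powr (1 / 2 + \<omega>) = (\<kappa>\<^sup>2 * (1 + y\<^sup>2)) powr (- (1 / 2 + \<omega>))"
          unfolding powr_minus_divide by (subst powr_divide) (auto simp: add_nonneg_nonneg)
        then show ?thesis unfolding k_def by (simp only: powr_mult)
      qed
      finally show ?thesis using D by (simp add: mult_left_mono mult.assoc)
    qed
    have "(\<integral>y. J y \<partial>lborel) \<le> (\<integral>y. D * k * (1 + y\<^sup>2) powr (- (1 / 2 + \<omega>)) \<partial>lborel)"
      using iY J D k by (intro integral_mono') auto
    also have "\<dots> = D * k * Y" by (simp add: Y_def)
    finally have JY: "(\<integral>y. J y \<partial>lborel) \<le> D * k * Y" .
    have "shell_energy A B \<epsilon> (\<lambda>z. \<Sum>i\<in>I. q i * heat (s i) (z - p i)) = ennreal (K2 * (\<integral>y. J y \<partial>lborel))"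
      unfolding shell_energy_def K2_def J_def by (rule shell_avg_energy[OF I AB0 \<epsilon>(1)])
    also have "\<dots> \<le> ennreal ((K1 * (k * Y) + 1) * D)"
    proof (intro ennreal_leI)
      have "K2 * (\<integral>y. J y \<partial>lborel) \<le> K2 * (D * k * Y)" by (intro mult_left_mono JY K2)
      also have "\<dots> \<le> K1 * (D * k * Y)" using K2 D k Y by (intro mult_right_mono) auto
      also have "\<dots> \<le> (K1 * (k * Y) + 1) * D" using D by (simp add: algebra_simps)
      finally show "K2 * (\<integral>y. J y \<partial>lborel) \<le> (K1 * (k * Y) + 1) * D" .
    qed
    finally show "shell_energy A B \<epsilon> (\<lambda>z. \<Sum>i\<in>I. q i * heat (s i) (z - p i)) \<le> ennreal ((K1 * (k * Y) + 1) * D)" .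
  qed
qed

text \<open>On the Fourier side both quadratic forms integrate the same nonnegative function, the
  squared modulus of the transform of the weights, against radial multipliers. A pointwise
  comparison of the multipliers in u = |xi|^2 therefore suffices.\<close>

lemma moll_energy_le:
  fixes A :: "'a::euclidean_space set"
  assumes "finite A" "\<tau> > 0" "\<sigma> > 0" "\<theta> > 0"
    and le: "\<And>u. u \<ge> 0 \<Longrightarrow> (\<Sum>l\<in>{1..N}. c l * exp (- \<tau> * u) ^ l)\<^sup>2 * exp (- \<sigma> * u) \<le> D * exp (- \<theta> * u)"
  shows "(\<Sum>i\<in>A \<times> {1..N}. \<Sum>j\<in>A \<times> {1..N}. (m (fst i) * c (snd i)) * (m (fst j) * c (snd j)) * heat (\<tau> * real (snd i) + \<tau> * real (snd j) + \<sigma>) (fst i - fst j))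
    \<le> D * (\<Sum>a\<in>A. \<Sum>b\<in>A. m a * m b * heat \<theta> (a - b))"
proof -
  define P where "P x = (\<Sum>l\<in>{1..N}. c l * exp (- \<tau> * (norm x)\<^sup>2) ^ l)" for x :: 'a
  define \<mu> where "\<mu> x = (\<Sum>a\<in>A. m a * cos (a \<bullet> x))\<^sup>2 + (\<Sum>a\<in>A. m a * sin (a \<bullet> x))\<^sup>2" for x :: 'a
  let ?I = "A \<times> {1..N}"
  \<comment> \<open>The transform of the mollified weights is the symbol \<open>P\<close> times the
    transform of the atoms, separately for the cosine and the sine part.\<close>
  have fac: "(\<Sum>i\<in>?I. (m (fst i) * c (snd i)) * exp (- (\<tau> * real (snd i)) * (norm x)\<^sup>2) * t (fst i)) = P x * (\<Sum>a\<in>A. m a * t a)" for t x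
  proof -
    have "exp (- (\<tau> * real l) * (norm x)\<^sup>2) = exp (- \<tau> * (norm x)\<^sup>2) ^ l" for l
      by (simp add: mult_ac flip: exp_of_nat_mult)
    then show ?thesis
      unfolding P_def sum_product sum.cartesian_product' by (subst sum.swap) (simp add: mult_ac)
  qed
  note facs = fac[where t="\<lambda>a. cos (a \<bullet> x)" and x=x for x] fac[where t="\<lambda>a. sin (a \<bullet> x)" and x=x for x]
  have h1: "(\<Sum>i\<in>?I. \<Sum>j\<in>?I. (m (fst i) * c (snd i)) * (m (fst j) * c (snd j)) * heat (\<tau> * real (snd i) + \<tau> * real (snd j) + \<sigma>) (fst i - fst j))
     = (2 * pi) powr - real DIM('a) * (\<integral>x. (P x)\<^sup>2 * \<mu> x * exp (- \<sigma> * (norm x)\<^sup>2) \<partial>lborel)"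
    using heat_energy(2)[of ?I \<sigma> "\<lambda>i. \<tau> * real (snd i)" "\<lambda>i. m (fst i) * c (snd i)" fst, unfolded facs] assms
    by (simp add: \<mu>_def power_mult_distrib distrib_left)
  have i2: "integrable lborel (\<lambda>x. \<mu> x * exp (- \<theta> * (norm x)\<^sup>2))"
    using heat_energy(1)[of A \<theta> "\<lambda>_. 0" m "\<lambda>a. a"] assms by (simp add: \<mu>_def)
  have h2: "(\<Sum>a\<in>A. \<Sum>b\<in>A. m a * m b * heat \<theta> (a - b)) = (2 * pi) powr - real DIM('a) * (\<integral>x. \<mu> x * exp (- \<theta> * (norm x)\<^sup>2) \<partial>lborel)"
    using heat_energy(2)[of A \<theta> "\<lambda>_. 0" m "\<lambda>a. a"] assms by (simp add: \<mu>_def)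
  have D: "D \<ge> 0" using le[of 0] by (simp add: order_trans[OF zero_le_power2])
  have \<mu>0: "\<mu> x \<ge> 0" for x by (simp add: \<mu>_def)
  have "(\<integral>x. (P x)\<^sup>2 * \<mu> x * exp (- \<sigma> * (norm x)\<^sup>2) \<partial>lborel) \<le> (\<integral>x. D * (\<mu> x * exp (- \<theta> * (norm x)\<^sup>2)) \<partial>lborel)"
  proof (rule integral_mono')
    show "integrable lborel (\<lambda>x. D * (\<mu> x * exp (- \<theta> * (norm x)\<^sup>2)))" using i2 by simp
    show "(P x)\<^sup>2 * \<mu> x * exp (- \<sigma> * (norm x)\<^sup>2) \<le> D * (\<mu> x * exp (- \<theta> * (norm x)\<^sup>2))" for x
      using mult_right_mono[OF le[of "(norm x)\<^sup>2"] \<mu>0[of x]] by (simp add: P_def mult_ac)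
    show "0 \<le> D * (\<mu> x * exp (- \<theta> * (norm x)\<^sup>2))" for x using D \<mu>0 by simp
  qed
  then show ?thesis unfolding h1 h2
    by (subst mult.left_commute) (intro mult_left_mono, simp_all)
qed

text \<open>With these coefficients \<open>1 - (\<Sum>l. moll_coeff M l * X ^ l) = (1 - X) ^ M\<close>, so the mollifier has many vanishing
  moments; a plain Gaussian would lose the low frequencies when \<open>d\<close> is large. The coefficients \<open>moll_coeff_double\<close>
  encode the same mollifier at scale \<open>2 \<tau>\<close> with respect to the scale \<open>\<tau>\<close>.\<close>

definition moll_coeff :: "nat \<Rightarrow> nat \<Rightarrow> real" where
  "moll_coeff M l = (- 1) ^ (l + 1) * real (M choose l)"

definition moll_coeff_double :: "nat \<Rightarrow> nat \<Rightarrow> real" where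
  "moll_coeff_double M l = (if even l then moll_coeff M (l div 2) else 0)"

text \<open>The binomial theorem with the term of index 0 split off. The range runs to
  \<open>2 * M\<close>, where the binomial coefficients vanish beyond \<open>M\<close>, so that it
  agrees with the range needed for \<open>moll_coeff_double\<close>.\<close>

lemma sum_moll_coeff: "(\<Sum>l\<in>{1..2 * M}. moll_coeff M l * X ^ l) = 1 - (1 - X) ^ M"
proof -
  have "(1 - X) ^ M = (\<Sum>l\<le>M. real (M choose l) * (- X) ^ l)"
    using binomial_ring[of "- X" 1 M] by simp
  also have "\<dots> = (\<Sum>l\<le>2 * M. real (M choose l) * (- X) ^ l)"
    by (intro sum.mono_neutral_left) (auto simp: not_le binomial_eq_0)
  also have "{..2 * M} = insert 0 {1..2 * M}" by auto
  also have "(\<Sum>l\<in>insert 0 {1..2 * M}. real (M choose l) * (- X) ^ l) = 1 + (\<Sum>l\<in>{1..2 * M}. real (M choose l) * (- X) ^ l)"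
    by (subst sum.insert) auto
  also have "(\<Sum>l\<in>{1..2 * M}. real (M choose l) * (- X) ^ l) = - (\<Sum>l\<in>{1..2 * M}. moll_coeff M l * X ^ l)"
    unfolding moll_coeff_def sum_negf[symmetric] by (intro sum.cong refl) (simp add: power_minus[of X] mult_ac)
  finally show ?thesis by simp
qed

lemma sum_moll_coeff_double:
  fixes h :: "nat \<Rightarrow> real"
  shows "(\<Sum>l\<in>{1..2 * M}. moll_coeff_double M l * h l) = (\<Sum>l\<in>{1..2 * M}. moll_coeff M l * h (2 * l))"
proof -
  have "(\<Sum>l\<in>{1..2 * M}. moll_coeff_double M l * h l) = (\<Sum>l\<in>(\<lambda>k. 2 * k) ` {1..M}. moll_coeff_double M l * h l)"
    by (intro sum.mono_neutral_right) (auto simp: moll_coeff_double_def elim!: evenE)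
  also have "\<dots> = (\<Sum>l\<in>{1..M}. moll_coeff M l * h (2 * l))"
    by (subst sum.reindex) (auto simp: inj_on_def moll_coeff_double_def)
  also have "\<dots> = (\<Sum>l\<in>{1..2 * M}. moll_coeff M l * h (2 * l))"
    by (intro sum.mono_neutral_left) (auto simp: moll_coeff_def binomial_eq_0)
  finally show ?thesis .
qed

lemma moll_coeff_double_eq: "moll (2 * M) (moll_coeff_double M) \<tau> A m = moll (2 * M) (moll_coeff M) (2 * \<tau>) A m"
proof
  fix x
  have "moll (2 * M) (moll_coeff_double M) \<tau> A m x = (\<Sum>a\<in>A. \<Sum>l\<in>{1..2 * M}. moll_coeff_double M l * (m a * heat (\<tau> * real l) (x - a)))"
    unfolding moll_def sum.cartesian_product' by (simp add: mult_ac)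
  also have "\<dots> = (\<Sum>a\<in>A. \<Sum>l\<in>{1..2 * M}. moll_coeff M l * (m a * heat (\<tau> * real (2 * l)) (x - a)))"
    unfolding sum_moll_coeff_double ..
  also have "\<dots> = moll (2 * M) (moll_coeff M) (2 * \<tau>) A m x"
    unfolding moll_def sum.cartesian_product' by (simp add: mult_ac)
  finally show "moll (2 * M) (moll_coeff_double M) \<tau> A m x = moll (2 * M) (moll_coeff M) (2 * \<tau>) A m x" .
qed

lemma moll_diff: "moll N (\<lambda>l. c l - c' l) \<tau> A m x = moll N c \<tau> A m x - moll N c' \<tau> A m x"
  unfolding moll_def by (simp add: algebra_simps sum_subtractf)

text \<open>The difference of the symbols is (1 - X^2)^M - (1 - X)^M = (1 - X)^M ((1 + X)^M - 1).
  The first factor vanishes to order M at frequency 0, where X = 1; the second is at most a multiple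
  of X and so decays at high frequency.\<close>

lemma mollifier_symbol_le:
  fixes X :: real
  assumes "0 \<le> X" "X \<le> 1"
  shows "\<bar>\<Sum>l\<in>{1..2 * M}. (moll_coeff M l - moll_coeff_double M l) * X ^ l\<bar> \<le> 2 ^ M * X * (1 - X) ^ M"
proof -
  have "(\<Sum>l\<in>{1..2 * M}. moll_coeff_double M l * X ^ l) = (\<Sum>l\<in>{1..2 * M}. moll_coeff M l * (X\<^sup>2) ^ l)"
    by (subst sum_moll_coeff_double) (simp add: power_mult)
  then have "(\<Sum>l\<in>{1..2 * M}. (moll_coeff M l - moll_coeff_double M l) * X ^ l) = (1 - X\<^sup>2) ^ M - (1 - X) ^ M"
    unfolding left_diff_distrib sum_subtractf by (simp only: sum_moll_coeff)
  also have "\<dots> = (1 - X) ^ M * ((1 + X) ^ M - 1)"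
  proof -
    have "1 - X\<^sup>2 = (1 - X) * (1 + X)" by (simp add: power2_eq_square algebra_simps)
    then show ?thesis unfolding power_mult_distrib[symmetric] by (simp add: right_diff_distrib flip: power_mult_distrib)
  qed
  finally have eq: "(\<Sum>l\<in>{1..2 * M}. (moll_coeff M l - moll_coeff_double M l) * X ^ l) = (1 - X) ^ M * ((1 + X) ^ M - 1)" .
  have up: "(1 + X) ^ M - 1 \<le> (2 ^ M - 1) * X"
  proof (induction M)
    case (Suc M)
    have "(1 + X) ^ Suc M - 1 = (1 + X) * ((1 + X) ^ M - 1) + X" by (simp add: algebra_simps)
    also have "\<dots> \<le> 2 * ((2 ^ M - 1) * X) + X"
      using assms Suc one_le_power[of "1 + X" M] by (intro add_right_mono mult_mono) auto
    also have "\<dots> = (2 ^ Suc M - 1) * X" by (simp add: algebra_simps)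
    finally show ?case .
  qed simp
  also have "\<dots> \<le> 2 ^ M * X" using assms by (simp add: algebra_simps)
  finally have "(1 + X) ^ M - 1 \<le> 2 ^ M * X" .
  moreover have "(1 + X) ^ M - 1 \<ge> 0" using assms one_le_power[of "1 + X" M] by simp
  moreover have "(1 - X) ^ M \<ge> 0" using assms by simp
  ultimately have "\<bar>(1 - X) ^ M * ((1 + X) ^ M - 1)\<bar> \<le> (1 - X) ^ M * (2 ^ M * X)"
    by (subst abs_of_nonneg) (auto intro: mult_left_mono)
  then show ?thesis unfolding eq by (simp add: mult_ac)
qed

text \<open>The symbol of the difference is concentrated where |xi|^2 is about 1 / \<tau>. Heat
  times \<sigma> much longer than \<tau> see only low frequencies, where the vanishing moments give
  a high power of \<tau> / \<sigma>; the power in excess of what \<open>shell_energy_le\<close> asks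
  for is given away.\<close>

lemma shell_energy_difference:
  fixes \<kappa> \<omega> \<alpha> K :: real
  assumes "0 < \<kappa>" "\<kappa> \<le> 1" "\<omega> > 0" "\<omega> \<le> (real DIM('a) - 1) / 2" "0 \<le> \<alpha>" "\<alpha> \<le> real DIM('a::euclidean_space)"
  defines "M \<equiv> DIM('a)"
  obtains C :: real where "C > 0" "\<And>\<delta> (A :: 'a set) m \<tau> Aa Bb \<epsilon>. frostman K \<alpha> \<delta> A m \<Longrightarrow> \<delta> > 0 \<Longrightarrow> \<tau> \<ge> \<delta>\<^sup>2 \<Longrightarrow>
     \<kappa> \<le> Aa \<Longrightarrow> Aa \<le> 1 \<Longrightarrow> \<kappa> \<le> Bb \<Longrightarrow> Bb \<le> 1 \<Longrightarrow> 0 < \<epsilon> \<Longrightarrow> \<epsilon> \<le> 1 \<Longrightarrow>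
     shell_energy Aa Bb \<epsilon> (moll (2 * M) (\<lambda>l. moll_coeff M l - moll_coeff_double M l) \<tau> A m) \<le> ennreal (C * \<tau> powr ((\<alpha> - 1) / 2 - \<omega>))"
proof -
  define d where "d = real DIM('a)"
  have M: "M \<ge> 1" "real M = d" unfolding M_def d_def by (auto simp: Suc_leI)
  obtain C where C: "C > 0" "\<And>(I :: ('a \<times> nat) set) q s (p :: 'a \<times> nat \<Rightarrow> 'a::euclidean_space) A B \<epsilon> D.
     finite I \<Longrightarrow> (\<And>i. i \<in> I \<Longrightarrow> s i > 0) \<Longrightarrow> \<kappa> \<le> A \<Longrightarrow> A \<le> 1 \<Longrightarrow> \<kappa> \<le> B \<Longrightarrow> B \<le> 1 \<Longrightarrow> 0 < \<epsilon> \<Longrightarrow> \<epsilon> \<le> 1 \<Longrightarrow> D \<ge> 0 \<Longrightarrow>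
     (\<And>\<sigma>. 0 < \<sigma> \<Longrightarrow> \<sigma> \<le> 1 / \<kappa>\<^sup>2 \<Longrightarrow> (4 * pi * \<sigma>) powr (real DIM('a) / 2) * (\<Sum>i\<in>I. \<Sum>j\<in>I. q i * q j * heat (s i + s j + \<sigma>) (p i - p j)) \<le> D * \<sigma> powr (1 / 2 + \<omega>)) \<Longrightarrow>
     shell_energy A B \<epsilon> (\<lambda>z. \<Sum>i\<in>I. q i * heat (s i) (z - p i)) \<le> ennreal (C * D)"
    using shell_energy_le[OF assms(1-3), where 'i="'a \<times> nat" and 'a='a] by blast
  obtain C1 where C1: "C1 > 0" "\<And>K \<delta> (A :: 'a set) m \<sigma> \<tau>. frostman K \<alpha> \<delta> A m \<Longrightarrow> \<delta> > 0 \<Longrightarrow> \<tau> \<ge> \<delta>\<^sup>2 \<Longrightarrow> \<sigma> \<ge> \<tau> \<Longrightarrow>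
     (\<Sum>a\<in>A. \<Sum>b\<in>A. m a * m b * heat \<sigma> (a - b)) \<le> C1 * K\<^sup>2 * \<tau> powr ((\<alpha> - real DIM('a)) / 2)"
    using frostman_heat_energy[OF assms(5,6)] by blast
  obtain C2 where C2: "C2 > 0" "\<And>r. r \<ge> 0 \<Longrightarrow> r powr (real (2 * M)) \<le> C2 * exp r"
    using powr_le_exp[of "real (2 * M)"] by auto
  \<comment> \<open>The heat energy of the weights costs the power \<open>- \<beta>\<close>. The
    exponent \<gamma> is fixed by d / 2 - \<gamma> = 1 / 2 + \<omega>, the power of \<sigma>
    demanded by \<open>shell_energy_le\<close>; it is nonnegative by the upper bound on
    \<omega>.\<close>
  define \<beta> where "\<beta> = (d - \<alpha>) / 2"
  define \<gamma> where "\<gamma> = (d - 1) / 2 - \<omega>"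
  have d0: "d \<ge> 0" by (simp add: d_def)
  have \<beta>: "\<beta> \<ge> 0" and \<gamma>: "\<gamma> \<ge> 0" using assms by (auto simp: \<beta>_def \<gamma>_def d_def)
  define E where "E = (4 * pi) powr (d / 2) * (4 ^ M * C2 * (C1 * K\<^sup>2)) * 2 powr \<gamma>"
  have E: "E \<ge> 0" using C1 C2 by (simp add: E_def)
  show thesis
  proof
    show "C * E + 1 > 0" using C E by (simp add: add_nonneg_pos)
    fix \<delta> and A :: "'a set" and m and \<tau> Aa Bb \<epsilon> :: real
    assume F: "frostman K \<alpha> \<delta> A m" and \<delta>: "\<delta> > 0" and \<tau>: "\<tau> \<ge> \<delta>\<^sup>2"
      and AB: "\<kappa> \<le> Aa" "Aa \<le> 1" "\<kappa> \<le> Bb" "Bb \<le> 1" and \<epsilon>: "0 < \<epsilon>" "\<epsilon> \<le> 1"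
    have A: "finite A" using F by (auto simp: frostman_def)
    have tp: "\<tau> > 0" using \<delta> \<tau> by (smt (verit) zero_less_power)
    define c where "c l = moll_coeff M l - moll_coeff_double M l" for l
    let ?I = "A \<times> {1..2 * M}"
    have spec: "(4 * pi * \<sigma>) powr (real DIM('a) / 2) * (\<Sum>i\<in>?I. \<Sum>j\<in>?I. (m (fst i) * c (snd i)) * (m (fst j) * c (snd j)) * heat (\<tau> * real (snd i) + \<tau> * real (snd j) + \<sigma>) (fst i - fst j))
        \<le> (E * \<tau> powr (\<gamma> - \<beta>)) * \<sigma> powr (1 / 2 + \<omega>)" if \<sigma>: "\<sigma> > 0" for \<sigma>
    proof -
      \<comment> \<open>With this \<open>h\<close> one has
        \<open>X\<^sup>2 * exp (- \<sigma> * u) = exp (- 2 * h * u)\<close>. One half of this decay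
        absorbs the factor \<open>(h * u) ^ (2 * M)\<close> from the vanishing moments, the other
        half remains as a heat kernel of time \<open>h\<close>.\<close>
      define h where "h = \<tau> + \<sigma> / 2"
      have h: "h > 0" "\<tau> \<le> h" "\<sigma> / 2 \<le> h" using tp \<sigma> by (auto simp: h_def)
      define D where "D = 4 ^ M * C2 * (\<tau> / h) ^ (2 * M)"
      have "(\<Sum>l\<in>{1..2 * M}. c l * exp (- \<tau> * u) ^ l)\<^sup>2 * exp (- \<sigma> * u) \<le> D * exp (- h * u)" if u: "u \<ge> 0" for u
      proof -
        define X where "X = exp (- \<tau> * u)"
        have X: "0 \<le> X" "X \<le> 1" "1 - X \<le> \<tau> * u"
          unfolding X_def using tp u exp_ge_add_one_self[of "- \<tau> * u"] by auto
        have "\<bar>\<Sum>l\<in>{1..2 * M}. c l * X ^ l\<bar> \<le> 2 ^ M * X * (1 - X) ^ M"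
          unfolding c_def by (rule mollifier_symbol_le[OF X(1,2)])
        also have "\<dots> \<le> 2 ^ M * X * (\<tau> * u) ^ M"
          using X by (intro mult_left_mono power_mono) auto
        finally have "\<bar>\<Sum>l\<in>{1..2 * M}. c l * X ^ l\<bar>\<^sup>2 \<le> (2 ^ M * X * (\<tau> * u) ^ M)\<^sup>2"
          by (intro power_mono) auto
        then have "(\<Sum>l\<in>{1..2 * M}. c l * X ^ l)\<^sup>2 * exp (- \<sigma> * u) \<le> (2 ^ M * X * (\<tau> * u) ^ M)\<^sup>2 * exp (- \<sigma> * u)"
          by (intro mult_right_mono) auto
        also have "\<dots> = 4 ^ M * (\<tau> / h) ^ (2 * M) * ((h * u) ^ (2 * M)) * (X\<^sup>2 * exp (- \<sigma> * u))"
        proof -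
          have 1: "(2 ^ M :: real)\<^sup>2 = 4 ^ M" by (simp add: power_mult[symmetric] mult.commute[of M]) (simp add: power_mult)
          have 2: "((\<tau> * u) ^ M)\<^sup>2 = (\<tau> / h) ^ (2 * M) * (h * u) ^ (2 * M)"
            using h by (simp add: power_mult[symmetric] mult.commute[of M] flip: power_mult_distrib)
          have 3: "(a * X * b)\<^sup>2 = a\<^sup>2 * X\<^sup>2 * b\<^sup>2" for a b by (simp add: power_mult_distrib)
          show ?thesis unfolding 3 1 2 by (simp only: mult_ac)
        qed
        also have "X\<^sup>2 * exp (- \<sigma> * u) = exp (- 2 * h * u)"
          unfolding X_def h_def by (simp add: algebra_simps flip: exp_double exp_add)
        also have "(h * u) ^ (2 * M) \<le> C2 * exp (h * u)"
        proof (cases "h * u = 0")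
          case True
          have "(h * u) ^ (2 * M) = 0" unfolding True using M by (simp add: power_0_left)
          moreover have "C2 * exp (h * u) > 0" using C2(1) by simp
          ultimately show ?thesis by (simp only: less_imp_le)
        next
          case False
          then have "h * u > 0" using h u by (simp add: zero_less_mult_iff less_le)
          then show ?thesis using C2(2)[of "h * u"] by (simp add: powr_realpow del: of_nat_mult)
        qed
        also have "4 ^ M * (\<tau> / h) ^ (2 * M) * (C2 * exp (h * u)) * exp (- 2 * h * u) = D * exp (- h * u)"
          unfolding D_def by (simp add: mult_ac flip: exp_add)
        finally show ?thesis unfolding X_def using tp h by (simp add: mult_right_mono)
      qed
      from moll_energy_le[where c=c and N="2 * M" and m=m, OF A tp \<sigma> h(1) this]
      have "(\<Sum>i\<in>?I. \<Sum>j\<in>?I. (m (fst i) * c (snd i)) * (m (fst j) * c (snd j)) * heat (\<tau> * real (snd i) + \<tau> * real (snd j) + \<sigma>) (fst i - fst j))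
         \<le> D * (\<Sum>a\<in>A. \<Sum>b\<in>A. m a * m b * heat h (a - b))" .
      also have "\<dots> \<le> D * (C1 * K\<^sup>2 * h powr ((\<alpha> - real DIM('a)) / 2))"
        using C2 tp h \<tau> by (intro mult_left_mono C1(2)[OF F \<delta>]) (auto simp: D_def)
      also have "\<dots> = (4 ^ M * C2 * (C1 * K\<^sup>2)) * ((\<tau> / h) ^ (2 * M) * h powr (- \<beta>))"
        unfolding D_def \<beta>_def d_def by (simp add: mult_ac minus_divide_left)
      also have "(\<tau> / h) ^ (2 * M) * h powr (- \<beta>) \<le> 2 powr \<gamma> * (\<tau> powr (\<gamma> - \<beta>) * \<sigma> powr (- \<gamma>))"
      proof -
        \<comment> \<open>All powers of \<open>h\<close> are collected into \<tau> / h, which is at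
          most 1, so its exponent may be lowered to \<gamma>. The choice of \<open>M\<close> as the
          dimension guarantees that the exponent available is at least \<gamma>.\<close>
        have "(\<tau> / h) ^ (2 * M) * h powr (- \<beta>) = \<tau> powr (- \<beta>) * (\<tau> / h) powr (2 * d + \<beta>)"
          using tp h M by (simp add: powr_add powr_divide powr_minus powr_realpow[symmetric] field_simps del: powr_realpow)
        also have "(\<tau> / h) powr (2 * d + \<beta>) \<le> (\<tau> / h) powr \<gamma>"
        proof (rule powr_mono')
          show "\<gamma> \<le> 2 * d + \<beta>" using assms(3) \<beta> d0 unfolding \<gamma>_def by (simp add: field_simps)
        qed (use tp h in auto)
        also have "(\<tau> / h) powr \<gamma> \<le> (\<tau> / (\<sigma> / 2)) powr \<gamma>"
          using tp h \<sigma> \<gamma> by (intro powr_mono2 divide_left_mono) auto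
        also have "(\<tau> / (\<sigma> / 2)) powr \<gamma> = 2 powr \<gamma> * (\<tau> powr \<gamma> * \<sigma> powr (- \<gamma>))"
          using tp \<sigma> by (simp add: powr_divide powr_mult powr_minus field_simps)
        finally show ?thesis using tp by (simp add: powr_diff powr_minus mult_ac divide_inverse mult_left_mono)
      qed
      finally have S: "(\<Sum>i\<in>?I. \<Sum>j\<in>?I. (m (fst i) * c (snd i)) * (m (fst j) * c (snd j)) * heat (\<tau> * real (snd i) + \<tau> * real (snd j) + \<sigma>) (fst i - fst j))
         \<le> (4 ^ M * C2 * (C1 * K\<^sup>2)) * (2 powr \<gamma> * (\<tau> powr (\<gamma> - \<beta>) * \<sigma> powr (- \<gamma>)))"
        using C1 C2 by (simp add: mult_left_mono)
      have "(4 * pi * \<sigma>) powr (real DIM('a) / 2) * (\<Sum>i\<in>?I. \<Sum>j\<in>?I. (m (fst i) * c (snd i)) * (m (fst j) * c (snd j)) * heat (\<tau> * real (snd i) + \<tau> * real (snd j) + \<sigma>) (fst i - fst j))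
        \<le> (4 * pi * \<sigma>) powr (d / 2) * ((4 ^ M * C2 * (C1 * K\<^sup>2)) * (2 powr \<gamma> * (\<tau> powr (\<gamma> - \<beta>) * \<sigma> powr (- \<gamma>))))"
        unfolding d_def by (intro mult_left_mono S[unfolded d_def]) auto
      also have "\<dots> = (E * \<tau> powr (\<gamma> - \<beta>)) * (\<sigma> powr (d / 2) * \<sigma> powr (- \<gamma>))"
        unfolding E_def using \<sigma> by (simp add: powr_mult mult_ac)
      also have "\<sigma> powr (d / 2) * \<sigma> powr (- \<gamma>) = \<sigma> powr (1 / 2 + \<omega>)"
        unfolding \<gamma>_def by (simp add: algebra_simps diff_divide_distrib flip: powr_add)
      finally show ?thesis .
    qed
    have "shell_energy Aa Bb \<epsilon> (moll (2 * M) c \<tau> A m) \<le> ennreal (C * (E * \<tau> powr (\<gamma> - \<beta>)))"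
      unfolding moll_def[abs_def]
      by (rule C(2)[OF _ _ AB \<epsilon>]) (use A tp E spec in auto)
    also have "\<dots> \<le> ennreal ((C * E + 1) * \<tau> powr (\<gamma> - \<beta>))"
      by (intro ennreal_leI) (simp add: algebra_simps)
    also have "\<gamma> - \<beta> = (\<alpha> - 1) / 2 - \<omega>" by (simp add: \<gamma>_def \<beta>_def field_simps)
    finally show "shell_energy Aa Bb \<epsilon> (moll (2 * M) (\<lambda>l. moll_coeff M l - moll_coeff_double M l) \<tau> A m) \<le> ennreal ((C * E + 1) * \<tau> powr ((\<alpha> - 1) / 2 - \<omega>))"
      unfolding c_def .
  qed
qed

section \<open>Changing the scale of mollification\<close>

lemma ennreal_square_le_imp:
  assumes "(ennreal \<bar>t\<bar>)\<^sup>2 \<le> ennreal c" "c \<ge> 0"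
  shows "\<bar>t\<bar> \<le> sqrt c"
proof -
  have "ennreal (\<bar>t\<bar>\<^sup>2) \<le> ennreal c" using assms(1) by (simp add: ennreal_power)
  then have "\<bar>t\<bar>\<^sup>2 \<le> c" using assms(2) by (simp add: ennreal_le_iff)
  then show ?thesis by (rule real_le_rsqrt)
qed

lemma frostman_constant_nonneg: "frostman K \<alpha> \<delta> A m \<Longrightarrow> K \<ge> 0"
  by (auto simp: frostman_def intro: order_trans[OF sum_nonneg])

text \<open>A crude bound at a fixed scale, with a constant depending on \<tau>: every heat kernel
  involved is at most the peak of \<open>heat \<tau>\<close>. It is the case \<kappa> = 1, \<omega>
  = 1/2 of \<open>shell_energy_le\<close>, where d >= 2 and \<sigma> \<le> 1 turn
  \<open>\<sigma> powr (d / 2)\<close> into \<sigma>.\<close>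

lemma shell_energy_moll_bounded:
  assumes "\<tau> > 0" "DIM('a::euclidean_space) \<ge> 2"
  obtains C :: real where "C > 0" "\<And>\<delta> (A :: 'a set) m \<epsilon>. frostman K \<alpha> \<delta> A m \<Longrightarrow> 0 < \<epsilon> \<Longrightarrow> \<epsilon> \<le> 1 \<Longrightarrow>
     shell_energy 1 1 \<epsilon> (moll N c \<tau> A m) \<le> ennreal C"
proof -
  define d where "d = real DIM('a)"
  have d: "d / 2 \<ge> 1" using assms(2) by (simp add: d_def)
  have h: "(0::real) < 1" "(1::real) \<le> 1" "(0::real) < 1 / 2" by auto
  obtain C where C: "C > 0" "\<And>(I :: ('a \<times> nat) set) q s (p :: 'a \<times> nat \<Rightarrow> 'a::euclidean_space) A B \<epsilon> D.
     finite I \<Longrightarrow> (\<And>i. i \<in> I \<Longrightarrow> s i > 0) \<Longrightarrow> 1 \<le> A \<Longrightarrow> A \<le> 1 \<Longrightarrow> 1 \<le> B \<Longrightarrow> B \<le> 1 \<Longrightarrow> 0 < \<epsilon> \<Longrightarrow> \<epsilon> \<le> 1 \<Longrightarrow> D \<ge> 0 \<Longrightarrow>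
     (\<And>\<sigma>. 0 < \<sigma> \<Longrightarrow> \<sigma> \<le> 1 / 1\<^sup>2 \<Longrightarrow> (4 * pi * \<sigma>) powr (real DIM('a) / 2) * (\<Sum>i\<in>I. \<Sum>j\<in>I. q i * q j * heat (s i + s j + \<sigma>) (p i - p j)) \<le> D * \<sigma> powr (1 / 2 + 1 / 2)) \<Longrightarrow>
     shell_energy A B \<epsilon> (\<lambda>z. \<Sum>i\<in>I. q i * heat (s i) (z - p i)) \<le> ennreal (C * D)"
    using shell_energy_le[OF h, where 'i="'a \<times> nat" and 'a='a] by blast
  define Sc where "Sc = (\<Sum>l\<in>{1..N}. \<bar>c l\<bar>)"
  have Sc: "Sc \<ge> 0" by (simp add: Sc_def sum_nonneg)
  define D where "D = (4 * pi) powr (d / 2) * ((K * Sc)\<^sup>2 * (4 * pi * \<tau>) powr (- (d / 2)))"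
  have D: "D \<ge> 0" by (simp add: D_def)
  show thesis
  proof
    show "C * D + 1 > 0" using C D by (simp add: add_nonneg_pos)
    fix \<delta> and A :: "'a set" and m and \<epsilon> :: real
    assume F: "frostman K \<alpha> \<delta> A m" and \<epsilon>: "0 < \<epsilon>" "\<epsilon> \<le> 1"
    have A: "finite A" and m0: "\<And>a. a \<in> A \<Longrightarrow> m a \<ge> 0" and K: "sum m A \<le> K"
      using F by (auto simp: frostman_def)
    let ?I = "A \<times> {1..N}"
    define q where "q i = m (fst i) * c (snd i)" for i :: "'a \<times> nat"
    have qs: "(\<Sum>i\<in>?I. \<bar>q i\<bar>) \<le> K * Sc"
    proof -
      have "(\<Sum>i\<in>?I. \<bar>q i\<bar>) = sum m A * Sc"
        unfolding q_def Sc_def sum_product sum.cartesian_product' using m0 by (simp add: abs_mult)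
      also have "\<dots> \<le> K * Sc" using K Sc by (intro mult_right_mono) auto
      finally show ?thesis .
    qed
    have spec: "(4 * pi * \<sigma>) powr (real DIM('a) / 2) * (\<Sum>i\<in>?I. \<Sum>j\<in>?I. q i * q j * heat (\<tau> * real (snd i) + \<tau> * real (snd j) + \<sigma>) (fst i - fst j)) \<le> D * \<sigma> powr (1 / 2 + 1 / 2)"
      if \<sigma>: "0 < \<sigma>" "\<sigma> \<le> 1 / 1\<^sup>2" for \<sigma>
    proof -
      have "(\<Sum>i\<in>?I. \<Sum>j\<in>?I. q i * q j * heat (\<tau> * real (snd i) + \<tau> * real (snd j) + \<sigma>) (fst i - fst j))
        \<le> (\<Sum>i\<in>?I. \<Sum>j\<in>?I. \<bar>q i\<bar> * \<bar>q j\<bar> * (4 * pi * \<tau>) powr (- (d / 2)))"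
      proof (intro sum_mono)
        fix i j assume ij: "i \<in> ?I" "j \<in> ?I"
        have "q i * q j * heat (\<tau> * real (snd i) + \<tau> * real (snd j) + \<sigma>) (fst i - fst j)
          \<le> \<bar>q i * q j\<bar> * heat (\<tau> * real (snd i) + \<tau> * real (snd j) + \<sigma>) (fst i - fst j)"
          by (intro mult_right_mono) auto
        also have "\<dots> \<le> \<bar>q i * q j\<bar> * (4 * pi * \<tau>) powr (- (d / 2))"
          unfolding d_def
        proof (intro mult_left_mono heat_le)
          have "\<tau> * 1 \<le> \<tau> * real (snd i)" using ij assms by (intro mult_left_mono) auto
          moreover have "\<tau> * real (snd j) \<ge> 0" using assms by simp
          ultimately show "\<tau> \<le> \<tau> * real (snd i) + \<tau> * real (snd j) + \<sigma>" using \<sigma> by linarith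
        qed (use assms in auto)
        finally show "q i * q j * heat (\<tau> * real (snd i) + \<tau> * real (snd j) + \<sigma>) (fst i - fst j) \<le> \<bar>q i\<bar> * \<bar>q j\<bar> * (4 * pi * \<tau>) powr (- (d / 2))"
          by (simp add: abs_mult)
      qed
      also have "\<dots> = (\<Sum>i\<in>?I. \<bar>q i\<bar>)\<^sup>2 * (4 * pi * \<tau>) powr (- (d / 2))"
        by (simp only: power2_eq_square sum_product) (simp only: sum_distrib_right)
      also have "\<dots> \<le> (K * Sc)\<^sup>2 * (4 * pi * \<tau>) powr (- (d / 2))"
        by (intro mult_right_mono power_mono qs) (auto simp: sum_nonneg)
      finally have s: "(\<Sum>i\<in>?I. \<Sum>j\<in>?I. q i * q j * heat (\<tau> * real (snd i) + \<tau> * real (snd j) + \<sigma>) (fst i - fst j)) \<le> (K * Sc)\<^sup>2 * (4 * pi * \<tau>) powr (- (d / 2))" .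
      have "\<sigma> powr (d / 2) \<le> \<sigma> powr 1" using d \<sigma> by (intro powr_mono') auto
      then have p: "(4 * pi * \<sigma>) powr (d / 2) \<le> (4 * pi) powr (d / 2) * \<sigma> powr (1 / 2 + 1 / 2)"
        using \<sigma> by (simp add: powr_mult)
      have "(4 * pi * \<sigma>) powr (real DIM('a) / 2) * (\<Sum>i\<in>?I. \<Sum>j\<in>?I. q i * q j * heat (\<tau> * real (snd i) + \<tau> * real (snd j) + \<sigma>) (fst i - fst j))
        \<le> (4 * pi * \<sigma>) powr (d / 2) * ((K * Sc)\<^sup>2 * (4 * pi * \<tau>) powr (- (d / 2)))"
        unfolding d_def by (intro mult_left_mono s[unfolded d_def]) auto
      also have "\<dots> \<le> ((4 * pi) powr (d / 2) * \<sigma> powr (1 / 2 + 1 / 2)) * ((K * Sc)\<^sup>2 * (4 * pi * \<tau>) powr (- (d / 2)))"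
        by (intro mult_right_mono p) auto
      finally show ?thesis unfolding D_def by (simp add: mult_ac)
    qed
    have "shell_energy 1 1 \<epsilon> (\<lambda>z. \<Sum>i\<in>?I. q i * heat (\<tau> * real (snd i)) (z - fst i)) \<le> ennreal (C * D)"
      by (rule C(2)[OF _ _ _ _ _ _ \<epsilon> D spec]) (use A assms in auto)
    also have "\<dots> \<le> ennreal (C * D + 1)" by (intro ennreal_leI) simp
    finally show "shell_energy 1 1 \<epsilon> (moll N c \<tau> A m) \<le> ennreal (C * D + 1)"
      unfolding moll_def[abs_def] q_def .
  qed
qed

text \<open>The three functions are replaced one at a time, and in each term the difference
  \<open>FD\<close> is the function that is averaged over shells, so that its vanishing moments act
  on the energy while the other two contribute square norms.\<close>

lemma tri_step:
  fixes \<alpha> K R T1 :: real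
  assumes d2: "DIM('a::euclidean_space) \<ge> 2" and \<alpha>: "(2 * real DIM('a) + 1) / 3 < \<alpha>" "\<alpha> \<le> real DIM('a)"
    and T1: "0 < T1" "T1 \<le> 1 / 2"
  defines "M \<equiv> DIM('a)"
  obtains C \<eta> :: real where "C > 0" "\<eta> > 0"
    "\<And>\<delta> \<epsilon> T \<tau> (A1 :: 'a set) m1 A2 m2 A3 m3.
       frostman K \<alpha> \<delta> A1 m1 \<Longrightarrow> frostman K \<alpha> \<delta> A2 m2 \<Longrightarrow> frostman K \<alpha> \<delta> A3 m3 \<Longrightarrow>
       A1 \<subseteq> cball 0 R \<Longrightarrow> A2 \<subseteq> cball 0 R \<Longrightarrow> A3 \<subseteq> cball 0 R \<Longrightarrow>
       \<delta> > 0 \<Longrightarrow> \<delta>\<^sup>2 \<le> \<tau> \<Longrightarrow> \<tau> * real (2 * M) \<le> 1 / 32 \<Longrightarrow> 0 < \<epsilon> \<Longrightarrow> \<epsilon> \<le> 1 \<Longrightarrow> T1 \<le> T \<Longrightarrow> T \<le> 1 / 2 \<Longrightarrow>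
       \<bar>tri_form \<epsilon> T (moll (2 * M) (moll_coeff M) \<tau> A1 m1) (moll (2 * M) (moll_coeff M) \<tau> A2 m2) (moll (2 * M) (moll_coeff M) \<tau> A3 m3)
         - tri_form \<epsilon> T (moll (2 * M) (moll_coeff M) (2 * \<tau>) A1 m1) (moll (2 * M) (moll_coeff M) (2 * \<tau>) A2 m2) (moll (2 * M) (moll_coeff M) (2 * \<tau>) A3 m3)\<bar> \<le> C * \<tau> powr \<eta>"
proof -
  define d where "d = real DIM('a)"
  have d: "d \<ge> 2" using d2 by (simp add: d_def)
  \<comment> \<open>The squared bound carries the power (3 \<alpha> - 2 d - 1) / 2 - \<omega> of
    \<tau>. Giving half of the gain to \<omega> leaves \<omega>, and \<eta> = \<omega> / 2 after the
    square root.\<close>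
  define \<omega> where "\<omega> = (3 * \<alpha> - 2 * d - 1) / 4"
  have \<omega>: "\<omega> > 0" "\<omega> \<le> (real DIM('a) - 1) / 2" using \<alpha> d by (auto simp: \<omega>_def d_def field_simps)
  have \<alpha>0: "0 \<le> \<alpha>" using \<alpha> d by (simp add: d_def)
  obtain CT where CT: "CT > 0" "\<And>(f :: 'a \<Rightarrow> real) g h \<epsilon> T.
      integrable lborel f \<Longrightarrow> integrable lborel g \<Longrightarrow> integrable lborel h \<Longrightarrow> 0 < \<epsilon> \<Longrightarrow> 0 < T \<Longrightarrow> T < 1 \<Longrightarrow>
      (ennreal \<bar>tri_form \<epsilon> T f g h\<bar>)\<^sup>2 \<le> ennreal CT * wnorm f * wnorm g * shell_energy 1 T \<epsilon> h \<and>
      (ennreal \<bar>tri_form \<epsilon> T f g h\<bar>)\<^sup>2 \<le> ennreal CT * wnorm f * wnorm h * shell_energy T 1 \<epsilon> g \<and>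
      (ennreal \<bar>tri_form \<epsilon> T f g h\<bar>)\<^sup>2 \<le> ennreal CT * wnorm h * wnorm g * shell_energy (1 - T) (T / (1 - T)) \<epsilon> f"
    using tri_bounds[OF d2] by blast
  obtain W0 where W0: "W0 > 0" "\<And>\<delta> (A :: 'a set) m \<tau>. frostman K \<alpha> \<delta> A m \<Longrightarrow> A \<subseteq> cball 0 R \<Longrightarrow> \<delta> > 0 \<Longrightarrow> \<tau> \<ge> \<delta>\<^sup>2 \<Longrightarrow> \<tau> * real (2 * M) \<le> 1 / 32 \<Longrightarrow>
     wnorm (moll (2 * M) (moll_coeff M) \<tau> A m) \<le> ennreal (W0 * \<tau> powr ((\<alpha> - real DIM('a)) / 2))"
    using wnorm_moll_le[OF \<alpha>0 \<alpha>(2)] by blast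
  obtain W2 where W2: "W2 > 0" "\<And>\<delta> (A :: 'a set) m \<tau>. frostman K \<alpha> \<delta> A m \<Longrightarrow> A \<subseteq> cball 0 R \<Longrightarrow> \<delta> > 0 \<Longrightarrow> \<tau> \<ge> \<delta>\<^sup>2 \<Longrightarrow> \<tau> * real (2 * M) \<le> 1 / 32 \<Longrightarrow>
     wnorm (moll (2 * M) (moll_coeff_double M) \<tau> A m) \<le> ennreal (W2 * \<tau> powr ((\<alpha> - real DIM('a)) / 2))"
    using wnorm_moll_le[OF \<alpha>0 \<alpha>(2)] by blast
  have T11: "T1 \<le> 1" using T1 by simp
  obtain S where S: "S > 0" "\<And>\<delta> (A :: 'a set) m \<tau> Aa Bb \<epsilon>. frostman K \<alpha> \<delta> A m \<Longrightarrow> \<delta> > 0 \<Longrightarrow> \<tau> \<ge> \<delta>\<^sup>2 \<Longrightarrow>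
     T1 \<le> Aa \<Longrightarrow> Aa \<le> 1 \<Longrightarrow> T1 \<le> Bb \<Longrightarrow> Bb \<le> 1 \<Longrightarrow> 0 < \<epsilon> \<Longrightarrow> \<epsilon> \<le> 1 \<Longrightarrow>
     shell_energy Aa Bb \<epsilon> (moll (2 * M) (\<lambda>l. moll_coeff M l - moll_coeff_double M l) \<tau> A m) \<le> ennreal (S * \<tau> powr ((\<alpha> - 1) / 2 - \<omega>))"
    using shell_energy_difference[OF T1(1) T11 \<omega> \<alpha>0 \<alpha>(2)] unfolding M_def by blast
  define W where "W = max W0 W2"
  have W: "W > 0" "W0 \<le> W" "W2 \<le> W" using W0 by (auto simp: W_def)
  define \<eta> where "\<eta> = \<omega> / 2"
  have \<eta>: "\<eta> > 0" using \<omega> by (simp add: \<eta>_def)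
  define c where "c = CT * W * W * S"
  have c: "c > 0" using CT W S by (simp add: c_def)
  show thesis
  proof (rule that[of "3 * sqrt c" \<eta>])
    show "3 * sqrt c > 0" using c by simp
    show "\<eta> > 0" by (rule \<eta>)
    fix \<delta> \<epsilon> T \<tau> :: real and A1 A2 A3 :: "'a set" and m1 m2 m3
    assume F: "frostman K \<alpha> \<delta> A1 m1" "frostman K \<alpha> \<delta> A2 m2" "frostman K \<alpha> \<delta> A3 m3"
      and R: "A1 \<subseteq> cball 0 R" "A2 \<subseteq> cball 0 R" "A3 \<subseteq> cball 0 R"
      and \<delta>: "\<delta> > 0" and \<tau>: "\<delta>\<^sup>2 \<le> \<tau>" "\<tau> * real (2 * M) \<le> 1 / 32" and \<epsilon>: "0 < \<epsilon>" "\<epsilon> \<le> 1" and T: "T1 \<le> T" "T \<le> 1 / 2"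
    have tp: "\<tau> > 0" using \<delta> \<tau> by (smt (verit) zero_less_power)
    define F0 where "F0 A m = moll (2 * M) (moll_coeff M) \<tau> A m" for A :: "'a set" and m
    define F2 where "F2 A m = moll (2 * M) (moll_coeff_double M) \<tau> A m" for A :: "'a set" and m
    define FD where "FD A m = moll (2 * M) (\<lambda>l. moll_coeff M l - moll_coeff_double M l) \<tau> A m" for A :: "'a set" and m
    have FD: "FD A m = (\<lambda>x. F0 A m x - F2 A m x)" for A m
      unfolding FD_def F0_def F2_def by (rule ext) (rule moll_diff)
    have i0: "integrable lborel (F0 A m)" "integrable lborel (F2 A m)" "integrable lborel (FD A m)" for A m
      unfolding F0_def F2_def FD_def by (rule integrable_moll[OF tp])+
    define w where "w = W * \<tau> powr ((\<alpha> - real DIM('a)) / 2)"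
    define e where "e = S * \<tau> powr ((\<alpha> - 1) / 2 - \<omega>)"
    have w0: "w \<ge> 0" and e0: "e \<ge> 0" using W S by (auto simp: w_def e_def)
    have wn: "wnorm (F0 A m) \<le> ennreal w \<and> wnorm (F2 A m) \<le> ennreal w"
      if "frostman K \<alpha> \<delta> A m" "A \<subseteq> cball 0 R" for A m
      unfolding F0_def F2_def w_def using W W0(1) W2(1) W0(2)[OF that \<delta> \<tau>] W2(2)[OF that \<delta> \<tau>]
      by (auto elim!: order_trans intro!: ennreal_leI mult_right_mono)
    have ed: "shell_energy Aa Bb \<epsilon> (FD A m) \<le> ennreal e"
      if "frostman K \<alpha> \<delta> A m" "T1 \<le> Aa" "Aa \<le> 1" "T1 \<le> Bb" "Bb \<le> 1" for A m Aa Bb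
      unfolding FD_def e_def by (rule S(2)[OF that(1) \<delta> \<tau>(1) that(2-5) \<epsilon>])
    have T01: "0 < T" "T < 1" using T T1 by auto
    have final: "\<bar>t\<bar> \<le> sqrt c * \<tau> powr \<eta>"
      if "(ennreal \<bar>t\<bar>)\<^sup>2 \<le> ennreal CT * u * v * s" "u \<le> ennreal w" "v \<le> ennreal w" "s \<le> ennreal e" for t u v s
    proof -
      have "(ennreal \<bar>t\<bar>)\<^sup>2 \<le> ennreal CT * ennreal w * ennreal w * ennreal e"
        by (rule order_trans[OF that(1)]) (intro mult_mono that order_refl zero_le)
      also have "\<dots> = ennreal (CT * w * w * e)"
        using CT w0 e0 by (simp add: ennreal_mult[symmetric] mult.assoc)
      finally have "\<bar>t\<bar> \<le> sqrt (CT * w * w * e)"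
        using CT w0 e0 by (intro ennreal_square_le_imp) auto
      also have "CT * w * w * e = c * (\<tau> powr \<eta>)\<^sup>2"
      proof -
        have "\<tau> powr ((\<alpha> - real DIM('a)) / 2) * (\<tau> powr ((\<alpha> - real DIM('a)) / 2) * \<tau> powr ((\<alpha> - 1) / 2 - \<omega>)) = \<tau> powr \<eta> * \<tau> powr \<eta>"
          unfolding powr_add[symmetric]
          by (intro arg_cong[of _ _ "\<lambda>t. \<tau> powr t"]) (simp add: \<eta>_def \<omega>_def d_def field_simps)
        then show ?thesis unfolding c_def w_def e_def by (simp add: power2_eq_square mult_ac)
      qed
      finally show ?thesis using c by (simp add: real_sqrt_mult)
    qed
    have 1: "\<bar>tri_form \<epsilon> T (FD A1 m1) (F0 A2 m2) (F0 A3 m3)\<bar> \<le> sqrt c * \<tau> powr \<eta>"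
    proof (rule final)
      show "(ennreal \<bar>tri_form \<epsilon> T (FD A1 m1) (F0 A2 m2) (F0 A3 m3)\<bar>)\<^sup>2 \<le> ennreal CT * wnorm (F0 A3 m3) * wnorm (F0 A2 m2) * shell_energy (1 - T) (T / (1 - T)) \<epsilon> (FD A1 m1)"
        using CT(2)[OF i0(3) i0(1) i0(1) \<epsilon>(1) T01] by blast
      \<comment> \<open>For T in [T1, 1/2] the Apollonius parameters 1 - T and T / (1 - T) both stay
        in [T1, 1].\<close>
      have "T * (1 - T) \<le> T * 1" using T01 by (intro mult_left_mono) auto
      then have "T \<le> T / (1 - T)" using T01 by (simp add: field_simps)
      moreover have "T / (1 - T) \<le> 1" using T T01 by (simp add: field_simps)
      ultimately show "shell_energy (1 - T) (T / (1 - T)) \<epsilon> (FD A1 m1) \<le> ennreal e"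
        using T T1 by (intro ed F) auto
    qed (use wn F R in auto)
    have 2: "\<bar>tri_form \<epsilon> T (F2 A1 m1) (FD A2 m2) (F0 A3 m3)\<bar> \<le> sqrt c * \<tau> powr \<eta>"
    proof (rule final)
      show "(ennreal \<bar>tri_form \<epsilon> T (F2 A1 m1) (FD A2 m2) (F0 A3 m3)\<bar>)\<^sup>2 \<le> ennreal CT * wnorm (F2 A1 m1) * wnorm (F0 A3 m3) * shell_energy T 1 \<epsilon> (FD A2 m2)"
        using CT(2)[OF i0(2) i0(3) i0(1) \<epsilon>(1) T01] by blast
      show "shell_energy T 1 \<epsilon> (FD A2 m2) \<le> ennreal e"
        using T T1 by (intro ed F) auto
    qed (use wn F R in auto)
    have 3: "\<bar>tri_form \<epsilon> T (F2 A1 m1) (F2 A2 m2) (FD A3 m3)\<bar> \<le> sqrt c * \<tau> powr \<eta>"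
    proof (rule final)
      show "(ennreal \<bar>tri_form \<epsilon> T (F2 A1 m1) (F2 A2 m2) (FD A3 m3)\<bar>)\<^sup>2 \<le> ennreal CT * wnorm (F2 A1 m1) * wnorm (F2 A2 m2) * shell_energy 1 T \<epsilon> (FD A3 m3)"
        using CT(2)[OF i0(2) i0(2) i0(3) \<epsilon>(1) T01] by blast
      show "shell_energy 1 T \<epsilon> (FD A3 m3) \<le> ennreal e"
        using T T1 by (intro ed F) auto
    qed (use wn F R in auto)
    have "tri_form \<epsilon> T (F0 A1 m1) (F0 A2 m2) (F0 A3 m3) - tri_form \<epsilon> T (F2 A1 m1) (F2 A2 m2) (F2 A3 m3)
      = tri_form \<epsilon> T (FD A1 m1) (F0 A2 m2) (F0 A3 m3) + tri_form \<epsilon> T (F2 A1 m1) (FD A2 m2) (F0 A3 m3) + tri_form \<epsilon> T (F2 A1 m1) (F2 A2 m2) (FD A3 m3)"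
      unfolding FD by (simp add: tri_diff1 tri_diff2 tri_diff3 i0 \<epsilon>)
    then have "\<bar>tri_form \<epsilon> T (F0 A1 m1) (F0 A2 m2) (F0 A3 m3) - tri_form \<epsilon> T (F2 A1 m1) (F2 A2 m2) (F2 A3 m3)\<bar> \<le> 3 * sqrt c * \<tau> powr \<eta>"
      using 1 2 3 by linarith
    then show "\<bar>tri_form \<epsilon> T (moll (2 * M) (moll_coeff M) \<tau> A1 m1) (moll (2 * M) (moll_coeff M) \<tau> A2 m2) (moll (2 * M) (moll_coeff M) \<tau> A3 m3)
         - tri_form \<epsilon> T (moll (2 * M) (moll_coeff M) (2 * \<tau>) A1 m1) (moll (2 * M) (moll_coeff M) (2 * \<tau>) A2 m2) (moll (2 * M) (moll_coeff M) (2 * \<tau>) A3 m3)\<bar> \<le> 3 * sqrt c * \<tau> powr \<eta>"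
      unfolding F0_def F2_def moll_coeff_double_eq .
  qed
qed

text \<open>A geometric sum over dyadic scales, dominated by the coarsest one. The bound does not
  depend on \<open>k\<close>, so the fine scale can later be as small as the resolution \<delta>
  permits.\<close>

lemma tri_telescope:
  fixes \<alpha> K R T1 :: real
  assumes d2: "DIM('a::euclidean_space) \<ge> 2" and \<alpha>: "(2 * real DIM('a) + 1) / 3 < \<alpha>" "\<alpha> \<le> real DIM('a)"
    and T1: "0 < T1" "T1 \<le> 1 / 2"
  defines "M \<equiv> DIM('a)"
  obtains C \<eta> :: real where "C > 0" "\<eta> > 0"
    "\<And>\<delta> \<epsilon> T \<tau> k (A1 :: 'a set) m1 A2 m2 A3 m3.
       frostman K \<alpha> \<delta> A1 m1 \<Longrightarrow> frostman K \<alpha> \<delta> A2 m2 \<Longrightarrow> frostman K \<alpha> \<delta> A3 m3 \<Longrightarrow>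
       A1 \<subseteq> cball 0 R \<Longrightarrow> A2 \<subseteq> cball 0 R \<Longrightarrow> A3 \<subseteq> cball 0 R \<Longrightarrow>
       \<delta> > 0 \<Longrightarrow> \<delta>\<^sup>2 \<le> \<tau> / 2 ^ k \<Longrightarrow> \<tau> * real (2 * M) \<le> 1 / 32 \<Longrightarrow> 0 < \<epsilon> \<Longrightarrow> \<epsilon> \<le> 1 \<Longrightarrow> T1 \<le> T \<Longrightarrow> T \<le> 1 / 2 \<Longrightarrow>
       \<bar>tri_form \<epsilon> T (moll (2 * M) (moll_coeff M) (\<tau> / 2 ^ k) A1 m1) (moll (2 * M) (moll_coeff M) (\<tau> / 2 ^ k) A2 m2) (moll (2 * M) (moll_coeff M) (\<tau> / 2 ^ k) A3 m3)
         - tri_form \<epsilon> T (moll (2 * M) (moll_coeff M) \<tau> A1 m1) (moll (2 * M) (moll_coeff M) \<tau> A2 m2) (moll (2 * M) (moll_coeff M) \<tau> A3 m3)\<bar> \<le> C * \<tau> powr \<eta>"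
proof -
  obtain C \<eta> where C: "C > 0" "\<eta> > 0"
    "\<And>\<delta> \<epsilon> T \<tau> (A1 :: 'a set) m1 A2 m2 A3 m3.
       frostman K \<alpha> \<delta> A1 m1 \<Longrightarrow> frostman K \<alpha> \<delta> A2 m2 \<Longrightarrow> frostman K \<alpha> \<delta> A3 m3 \<Longrightarrow>
       A1 \<subseteq> cball 0 R \<Longrightarrow> A2 \<subseteq> cball 0 R \<Longrightarrow> A3 \<subseteq> cball 0 R \<Longrightarrow>
       \<delta> > 0 \<Longrightarrow> \<delta>\<^sup>2 \<le> \<tau> \<Longrightarrow> \<tau> * real (2 * M) \<le> 1 / 32 \<Longrightarrow> 0 < \<epsilon> \<Longrightarrow> \<epsilon> \<le> 1 \<Longrightarrow> T1 \<le> T \<Longrightarrow> T \<le> 1 / 2 \<Longrightarrow>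
       \<bar>tri_form \<epsilon> T (moll (2 * M) (moll_coeff M) \<tau> A1 m1) (moll (2 * M) (moll_coeff M) \<tau> A2 m2) (moll (2 * M) (moll_coeff M) \<tau> A3 m3)
         - tri_form \<epsilon> T (moll (2 * M) (moll_coeff M) (2 * \<tau>) A1 m1) (moll (2 * M) (moll_coeff M) (2 * \<tau>) A2 m2) (moll (2 * M) (moll_coeff M) (2 * \<tau>) A3 m3)\<bar> \<le> C * \<tau> powr \<eta>"
    using tri_step[OF d2 \<alpha> T1, where K=K and R=R] unfolding M_def by metis
  \<comment> \<open>With this constant, \<open>C * t powr \<eta>\<close> equals
    \<open>C' * ((2 * t) powr \<eta> - t powr \<eta>)\<close>, so the errors telescope
    exactly.\<close>
  define C' where "C' = C / (2 powr \<eta> - 1)"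
  have g: "2 powr \<eta> - 1 > 0" using C(2) by simp
  show thesis
  proof (rule that[of C' \<eta>])
    show "C' > 0" using C g by (simp add: C'_def)
    show "\<eta> > 0" by fact
    fix \<delta> \<epsilon> T \<tau> :: real and k :: nat and A1 A2 A3 :: "'a set" and m1 m2 m3
    assume F: "frostman K \<alpha> \<delta> A1 m1" "frostman K \<alpha> \<delta> A2 m2" "frostman K \<alpha> \<delta> A3 m3"
      and R: "A1 \<subseteq> cball 0 R" "A2 \<subseteq> cball 0 R" "A3 \<subseteq> cball 0 R"
      and \<delta>: "\<delta> > 0" and \<tau>: "\<delta>\<^sup>2 \<le> \<tau> / 2 ^ k" "\<tau> * real (2 * M) \<le> 1 / 32" and \<epsilon>: "0 < \<epsilon>" "\<epsilon> \<le> 1" and T: "T1 \<le> T" "T \<le> 1 / 2"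
    define L where "L t = tri_form \<epsilon> T (moll (2 * M) (moll_coeff M) t A1 m1) (moll (2 * M) (moll_coeff M) t A2 m2) (moll (2 * M) (moll_coeff M) t A3 m3)" for t
    have tp: "\<tau> > 0"
    proof -
      have "0 < \<tau> / 2 ^ k" using \<delta> \<tau>(1) by (smt (verit) zero_less_power)
      then show ?thesis by (simp add: zero_less_divide_iff)
    qed
    have "\<bar>L (\<tau> / 2 ^ k) - L \<tau>\<bar> \<le> C' * (\<tau> powr \<eta> - (\<tau> / 2 ^ k) powr \<eta>)"
      using \<tau>(1)
    proof (induction k)
      case (Suc k)
      define t where "t = \<tau> / 2 ^ Suc k"
      have "\<tau> / 2 ^ Suc k \<le> \<tau> / 1" using tp one_le_power[of "2::real" "Suc k"] by (intro divide_left_mono) auto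
      then have t: "t > 0" "2 * t = \<tau> / 2 ^ k" "t \<le> \<tau>"
        using tp by (auto simp: t_def)
      have "t * real (2 * M) \<le> \<tau> * real (2 * M)" using t by (intro mult_right_mono) auto
      then have tM: "t * real (2 * M) \<le> 1 / 32" using \<tau>(2) by linarith
      have dt: "\<delta>\<^sup>2 \<le> t" using Suc.prems by (simp add: t_def)
      have "\<bar>L t - L (2 * t)\<bar> \<le> C * t powr \<eta>"
        unfolding L_def by (rule C(3)[OF F R \<delta> dt tM \<epsilon> T])
      also have "\<dots> = C' * ((2 * t) powr \<eta> - t powr \<eta>)"
      proof -
        have "(2 * t) powr \<eta> - t powr \<eta> = t powr \<eta> * (2 powr \<eta> - 1)"
          using t(1) by (simp add: powr_mult algebra_simps)
        then show ?thesis unfolding C'_def using g C(2) by simp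
      qed
      finally have 1: "\<bar>L t - L (2 * t)\<bar> \<le> C' * ((2 * t) powr \<eta> - t powr \<eta>)" .
      have "\<delta>\<^sup>2 \<le> \<tau> / 2 ^ k" using dt t by linarith
      from Suc.IH[OF this] have 2: "\<bar>L (2 * t) - L \<tau>\<bar> \<le> C' * (\<tau> powr \<eta> - (2 * t) powr \<eta>)"
        unfolding t(2) .
      have "\<bar>L t - L \<tau>\<bar> \<le> C' * ((2 * t) powr \<eta> - t powr \<eta>) + C' * (\<tau> powr \<eta> - (2 * t) powr \<eta>)"
        using 1 2 by linarith
      then show ?case unfolding t_def[symmetric] by (simp add: algebra_simps)
    qed simp
    also have "\<dots> \<le> C' * \<tau> powr \<eta>" using \<open>C' > 0\<close> by (simp add: algebra_simps)
    finally show "\<bar>tri_form \<epsilon> T (moll (2 * M) (moll_coeff M) (\<tau> / 2 ^ k) A1 m1) (moll (2 * M) (moll_coeff M) (\<tau> / 2 ^ k) A2 m2) (moll (2 * M) (moll_coeff M) (\<tau> / 2 ^ k) A3 m3)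
         - tri_form \<epsilon> T (moll (2 * M) (moll_coeff M) \<tau> A1 m1) (moll (2 * M) (moll_coeff M) \<tau> A2 m2) (moll (2 * M) (moll_coeff M) \<tau> A3 m3)\<bar> \<le> C' * \<tau> powr \<eta>"
      unfolding L_def .
  qed
qed

section \<open>Continuity in the ratio\<close>

lemma
  fixes \<phi> :: "'a::euclidean_space \<Rightarrow> real"
  assumes c: "c > 0" and \<phi>: "integrable lborel \<phi>"
  shows integrable_lborel_dilate: "integrable lborel (\<lambda>v. \<phi> (t + c *\<^sub>R v))"
    and integral_lborel_dilate: "c ^ DIM('a) * (\<integral>v. \<phi> (t + c *\<^sub>R v) \<partial>lborel) = (\<integral>y. \<phi> y \<partial>lborel)"
proof -
  have [measurable]: "\<phi> \<in> borel_measurable borel" using \<phi> by auto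
  have L: "lborel = density (distr lborel borel (\<lambda>x::'a. t + c *\<^sub>R x)) (\<lambda>_. ennreal (\<bar>c\<bar> ^ DIM('a)))"
    using c lborel_affine[of c t] by simp
  have "integrable (density (distr lborel borel (\<lambda>x::'a. t + c *\<^sub>R x)) (\<lambda>_. ennreal (\<bar>c\<bar> ^ DIM('a)))) \<phi>"
    using \<phi> L by simp
  then have "integrable (distr lborel borel (\<lambda>x::'a. t + c *\<^sub>R x)) (\<lambda>x. \<bar>c\<bar> ^ DIM('a) *\<^sub>R \<phi> x)"
    by (subst (asm) integrable_density) auto
  then have "integrable lborel (\<lambda>x. c ^ DIM('a) *\<^sub>R \<phi> (t + c *\<^sub>R x))"
    using c by (subst (asm) integrable_distr_eq) auto
  then show "integrable lborel (\<lambda>v. \<phi> (t + c *\<^sub>R v))" using c by simp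
  have "(\<integral>y. \<phi> y \<partial>lborel) = (\<integral>y. \<phi> y \<partial>(density (distr lborel borel (\<lambda>x::'a. t + c *\<^sub>R x)) (\<lambda>_. ennreal (\<bar>c\<bar> ^ DIM('a)))))"
    using L by simp
  also have "\<dots> = (\<integral>x. \<bar>c\<bar> ^ DIM('a) *\<^sub>R \<phi> x \<partial>(distr lborel borel (\<lambda>x::'a. t + c *\<^sub>R x)))"
    by (subst integral_density) auto
  also have "\<dots> = (\<integral>x. c ^ DIM('a) *\<^sub>R \<phi> (t + c *\<^sub>R x) \<partial>lborel)"
    using c by (subst integral_distr) auto
  finally show "c ^ DIM('a) * (\<integral>v. \<phi> (t + c *\<^sub>R v) \<partial>lborel) = (\<integral>y. \<phi> y \<partial>lborel)" by simp
qed

text \<open>Substituting \<open>v = sqrt T (y - x)\<close> moves the dependence on \<open>T\<close> from the singular kernel to the smooth function \<open>g\<close>.\<close>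

definition dilate :: "real \<Rightarrow> ('a::euclidean_space \<Rightarrow> real) \<Rightarrow> 'a \<Rightarrow> 'a \<Rightarrow> real" where
  "dilate T g x v = (1 / sqrt T) ^ DIM('a) * g (x + (1 / sqrt T) *\<^sub>R v)"

lemma abs_mult_le_abs_mult: "\<bar>s\<bar> \<le> b \<Longrightarrow> norm (a * s) \<le> norm (b * a)" for a b s :: real
  by (simp add: abs_mult) (metis abs_ge_self abs_ge_zero mult.commute mult_left_mono order_trans)

lemma shell_avg_bound:
  assumes "integrable lborel h" "\<epsilon> > 0"
  shows "\<bar>shell_avg A B \<epsilon> h x r\<bar> \<le> (\<integral>z. \<bar>h z\<bar> \<partial>lborel) / \<epsilon>"
proof -
  have [measurable]: "h \<in> borel_measurable borel" using assms by auto
  have "norm (shell_avg A B \<epsilon> h x r) \<le> (\<integral>z. norm (h z * thick \<epsilon> (A * (norm (z - x))\<^sup>2 - B * r)) \<partial>lborel)"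
    unfolding shell_avg_def by (rule integral_norm_bound)
  also have "\<dots> \<le> (\<integral>z. (1 / \<epsilon>) * \<bar>h z\<bar> \<partial>lborel)"
  proof (rule integral_mono)
    show "integrable lborel (\<lambda>z. norm (h z * thick \<epsilon> (A * (norm (z - x))\<^sup>2 - B * r)))"
      using assms by (intro integrable_norm integrable_mult_thick) auto
    show "norm (h z * thick \<epsilon> (A * (norm (z - x))\<^sup>2 - B * r)) \<le> (1 / \<epsilon>) * \<bar>h z\<bar>" for z
      using mult_left_mono[OF thick_bounds(2)[OF assms(2), of "A * (norm (z - x))\<^sup>2 - B * r"], of "\<bar>h z\<bar>"] thick_bounds(1)[OF assms(2)]
      by (simp add: abs_mult)
  qed (use assms in auto)
  finally show ?thesis by simp
qed

lemma
  fixes f g h :: "'a::euclidean_space \<Rightarrow> real"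
  assumes fgh: "integrable lborel f" "integrable lborel g" "integrable lborel h" and \<epsilon>: "\<epsilon> > 0" and T: "T > 0"
  shows integrable_tri_dilate: "integrable (lborel \<Otimes>\<^sub>M lborel) (\<lambda>(x, v). f x * dilate T g x v * shell_avg 1 1 \<epsilon> h x ((norm v)\<^sup>2))"
    and tri_dilate: "tri_form \<epsilon> T f g h = (\<integral>(x, v). f x * dilate T g x v * shell_avg 1 1 \<epsilon> h x ((norm v)\<^sup>2) \<partial>(lborel \<Otimes>\<^sub>M lborel))"
proof -
  have [measurable]: "f \<in> borel_measurable borel" "g \<in> borel_measurable borel" "h \<in> borel_measurable borel" using fgh by auto
  have [measurable (raw)]: "(\<lambda>u. shell_avg A B \<epsilon> h (f1 u) (f2 u)) \<in> borel_measurable M"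
    if [measurable]: "f1 \<in> M \<rightarrow>\<^sub>M borel" "f2 \<in> M \<rightarrow>\<^sub>M borel" for A B and M :: "'z measure" and f1 f2
    unfolding shell_avg_def by measurable
  \<comment> \<open>Since \<open>T * c\<^sup>2 = 1\<close>, the squared radius T |y - x|^2 becomes
    |v|^2, free of \<open>T\<close>; the Jacobian \<open>c ^ DIM('a)\<close> is the prefactor in
    \<open>dilate\<close>.\<close>
  define c where "c = 1 / sqrt T"
  have c: "c > 0" "T * c\<^sup>2 = 1" using T by (auto simp: c_def power_divide)
  have iG: "integrable (lborel \<Otimes>\<^sub>M lborel) (\<lambda>(x, v). f x * dilate T g x v)"
  proof (rule lborel_pair.Fubini_integrable)
    show "(\<lambda>(x, v). f x * dilate T g x v) \<in> borel_measurable (lborel \<Otimes>\<^sub>M lborel)"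
      unfolding dilate_def by measurable
    have "(\<integral>v. norm (f x * dilate T g x v) \<partial>lborel) = \<bar>f x\<bar> * (\<integral>y. \<bar>g y\<bar> \<partial>lborel)" for x
      using integral_lborel_dilate[OF c(1), of "\<lambda>y. \<bar>g y\<bar>" x] fgh(2) c
      by (simp add: dilate_def abs_mult c_def[symmetric])
    then show "integrable lborel (\<lambda>x. \<integral>v. norm (case (x, v) of (x, v) \<Rightarrow> f x * dilate T g x v) \<partial>lborel)"
      using fgh by simp
    show "AE x in lborel. integrable lborel (\<lambda>v. case (x, v) of (x, v) \<Rightarrow> f x * dilate T g x v)"
      using integrable_lborel_dilate[OF c(1) fgh(2)] by (simp add: dilate_def c_def[symmetric])
  qed
  show i: "integrable (lborel \<Otimes>\<^sub>M lborel) (\<lambda>(x, v). f x * dilate T g x v * shell_avg 1 1 \<epsilon> h x ((norm v)\<^sup>2))"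
  proof (rule Bochner_Integration.integrable_bound)
    show "integrable (lborel \<Otimes>\<^sub>M lborel) (\<lambda>u. ((\<integral>z. \<bar>h z\<bar> \<partial>lborel) / \<epsilon>) * (case u of (x, v) \<Rightarrow> f x * dilate T g x v))"
      by (rule integrable_mult_right[OF iG])
    show "(\<lambda>(x, v). f x * dilate T g x v * shell_avg 1 1 \<epsilon> h x ((norm v)\<^sup>2)) \<in> borel_measurable (lborel \<Otimes>\<^sub>M lborel)"
      unfolding dilate_def by measurable
    show "AE u in lborel \<Otimes>\<^sub>M lborel. norm (case u of (x, v) \<Rightarrow> f x * dilate T g x v * shell_avg 1 1 \<epsilon> h x ((norm v)\<^sup>2))
       \<le> norm (((\<integral>z. \<bar>h z\<bar> \<partial>lborel) / \<epsilon>) * (case u of (x, v) \<Rightarrow> f x * dilate T g x v))"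
      by (intro AE_I2, clarify) (rule abs_mult_le_abs_mult[OF shell_avg_bound[OF fgh(3) \<epsilon>]])
  qed
  have "tri_form \<epsilon> T f g h = (\<integral>x. \<integral>v. f x * dilate T g x v * shell_avg 1 1 \<epsilon> h x ((norm v)\<^sup>2) \<partial>lborel \<partial>lborel)"
    unfolding tri_xyz[OF fgh \<epsilon>]
  proof (rule Bochner_Integration.integral_cong[OF refl])
    fix x :: 'a
    define \<phi> where "\<phi> y = f x * g y * shell_avg 1 1 \<epsilon> h x (T * (norm (y - x))\<^sup>2)" for y
    have i\<phi>: "integrable lborel \<phi>"
    proof (rule Bochner_Integration.integrable_bound)
      show "integrable lborel (\<lambda>y. ((\<integral>z. \<bar>h z\<bar> \<partial>lborel) / \<epsilon>) * (f x * g y))"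
        using fgh by simp
      show "\<phi> \<in> borel_measurable lborel" unfolding \<phi>_def by measurable
      show "AE y in lborel. norm (\<phi> y) \<le> norm (((\<integral>z. \<bar>h z\<bar> \<partial>lborel) / \<epsilon>) * (f x * g y))"
        unfolding \<phi>_def by (intro AE_I2) (rule abs_mult_le_abs_mult[OF shell_avg_bound[OF fgh(3) \<epsilon>]])
    qed
    have "(\<integral>y. \<integral>z. f x * g y * h z * thick \<epsilon> ((norm (x - z))\<^sup>2 - T * (norm (x - y))\<^sup>2) \<partial>lborel \<partial>lborel) = (\<integral>y. \<phi> y \<partial>lborel)"
      unfolding \<phi>_def shell_avg_def by (simp add: norm_minus_commute mult.assoc)
    also have "\<dots> = c ^ DIM('a) * (\<integral>v. \<phi> (x + c *\<^sub>R v) \<partial>lborel)"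
      by (rule integral_lborel_dilate[OF c(1) i\<phi>, symmetric])
    also have "\<dots> = (\<integral>v. f x * dilate T g x v * shell_avg 1 1 \<epsilon> h x ((norm v)\<^sup>2) \<partial>lborel)"
    proof -
      have "T * (norm (c *\<^sub>R v))\<^sup>2 = (norm v)\<^sup>2" for v :: 'a
        using c by (simp add: power_mult_distrib flip: mult.assoc)
      then have "\<phi> (x + c *\<^sub>R v) = f x * g (x + c *\<^sub>R v) * shell_avg 1 1 \<epsilon> h x ((norm v)\<^sup>2)" for v
        unfolding \<phi>_def by simp
      then show ?thesis
        unfolding dilate_def c_def[symmetric] by (simp only: integral_mult_right_zero[symmetric] mult_ac)
    qed
    finally show "(\<integral>y. \<integral>z. f x * g y * h z * thick \<epsilon> ((norm (x - z))\<^sup>2 - T * (norm (x - y))\<^sup>2) \<partial>lborel \<partial>lborel)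
      = (\<integral>v. f x * dilate T g x v * shell_avg 1 1 \<epsilon> h x ((norm v)\<^sup>2) \<partial>lborel)" .
  qed
  also have "\<dots> = (\<integral>(x, v). f x * dilate T g x v * shell_avg 1 1 \<epsilon> h x ((norm v)\<^sup>2) \<partial>(lborel \<Otimes>\<^sub>M lborel))"
    by (rule lborel_pair.integral_fst[OF i])
  finally show "tri_form \<epsilon> T f g h = (\<integral>(x, v). f x * dilate T g x v * shell_avg 1 1 \<epsilon> h x ((norm v)\<^sup>2) \<partial>(lborel \<Otimes>\<^sub>M lborel))" .
qed

text \<open>Parabolic scaling: lengths multiplied by sqrt T correspond to times multiplied by
  \<open>T\<close>, and the prefactor of \<open>dilate\<close> restores unit mass.\<close>

lemma dilate_heat:
  fixes x v p :: "'a::euclidean_space"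
  assumes "s > 0" "T > 0"
  shows "dilate T (\<lambda>y. heat s (y - p)) x v = heat (s * T) (v + sqrt T *\<^sub>R (x - p))"
proof -
  define c where "c = 1 / sqrt T"
  have c: "c > 0" "c * sqrt T = 1" "c\<^sup>2 = 1 / T" using assms by (auto simp: c_def power_divide)
  have "x + c *\<^sub>R v - p = c *\<^sub>R (v + sqrt T *\<^sub>R (x - p))"
    using c by (simp add: scaleR_add_right algebra_simps)
  then have n: "(norm (x + c *\<^sub>R v - p))\<^sup>2 / (4 * s) = (norm (v + sqrt T *\<^sub>R (x - p)))\<^sup>2 / (4 * (s * T))"
    using c by (simp add: power_mult_distrib)
  have "c ^ DIM('a) = T powr (- (real DIM('a) / 2))"
    using assms unfolding c_def by (simp add: powr_half_sqrt[symmetric] powr_realpow[symmetric] powr_powr powr_minus_divide power_one_over powr_divide)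
  then have "c ^ DIM('a) * (4 * pi * s) powr (- (real DIM('a) / 2)) = (4 * pi * (s * T)) powr (- (real DIM('a) / 2))"
    using assms by (simp add: powr_mult mult_ac)
  then show ?thesis
    unfolding dilate_def heat_def c_def[symmetric] using n by (simp add: mult.assoc[symmetric])
qed

lemma gaussian_lipschitz: "\<bar>exp (- a\<^sup>2) - exp (- b\<^sup>2)\<bar> \<le> \<bar>a - b\<bar>" for a b :: real
proof -
  have "norm (exp (- a\<^sup>2) - exp (- b\<^sup>2)) \<le> 1 * norm (a - b)"
  proof (rule field_differentiable_bound[where S=UNIV and f'="\<lambda>x. - (2 * x) * exp (- x\<^sup>2)"])
    show "((\<lambda>x. exp (- x\<^sup>2)) has_field_derivative - (2 * x) * exp (- x\<^sup>2)) (at x within UNIV)" for x :: real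
      by (auto intro!: derivative_eq_intros)
    fix x :: real
    have "0 \<le> (\<bar>x\<bar> - 1)\<^sup>2" by simp
    then have "2 * \<bar>x\<bar> \<le> 1 + x\<^sup>2" by (simp add: power2_diff)
    also have "\<dots> \<le> exp (x\<^sup>2)" by (rule exp_ge_add_one_self)
    finally show "norm (- (2 * x) * exp (- x\<^sup>2)) \<le> 1"
      by (simp add: abs_mult exp_minus field_simps)
  qed auto
  then show ?thesis by simp
qed

text \<open>Scaled back by 1 / sqrt T, the kernel depends on \<open>T\<close> only through a
  prefactor and through the coefficient of \<open>v\<close> in its argument. The vector
  \<open>y\<close> cancels in the difference of the arguments, so the bound grows with
  \<open>v\<close> alone and is uniform in \<open>x\<close>.\<close>

lemma heat_dilate_lipschitz:
  fixes v y :: "'a::euclidean_space"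
  assumes "0 < \<tau>" "\<tau> \<le> s" "0 < T1" "T1 \<le> T" "T1 \<le> T'"
    and b: "\<bar>T powr (- (real DIM('a) / 2)) - T' powr (- (real DIM('a) / 2))\<bar> \<le> e" "\<bar>1 / sqrt T - 1 / sqrt T'\<bar> \<le> e"
  shows "\<bar>heat (s * T) (v + sqrt T *\<^sub>R y) - heat (s * T') (v + sqrt T' *\<^sub>R y)\<bar>
    \<le> (4 * pi * \<tau>) powr (- (real DIM('a) / 2)) * (1 + T1 powr (- (real DIM('a) / 2)) / sqrt (4 * \<tau>)) * e * (1 + norm v)"
proof -
  define q where "q = real DIM('a) / 2"
  have q: "q > 0" by (simp add: q_def)
  have e: "e \<ge> 0" using b by linarith
  have T: "T > 0" "T' > 0" "s > 0" using assms by auto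
  define E where "E \<zeta> = exp (- (norm (\<zeta> :: 'a) / sqrt (4 * s))\<^sup>2)" for \<zeta>
  have H: "heat (s * t) (v + sqrt t *\<^sub>R y) = (4 * pi * s) powr (- q) * (t powr (- q) * E ((1 / sqrt t) *\<^sub>R v + y))" if "t > 0" for t
  proof -
    have "v + sqrt t *\<^sub>R y = sqrt t *\<^sub>R ((1 / sqrt t) *\<^sub>R v + y)" using that by (simp add: scaleR_add_right)
    then have "(norm (v + sqrt t *\<^sub>R y))\<^sup>2 / (4 * (s * t)) = (norm ((1 / sqrt t) *\<^sub>R v + y) / sqrt (4 * s))\<^sup>2"
      using that T by (simp add: power_mult_distrib power_divide)
    moreover have "(4 * pi * (s * t)) powr (- q) = (4 * pi * s) powr (- q) * t powr (- q)"
      using that T by (simp add: powr_mult mult_ac)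
    ultimately show ?thesis unfolding heat_def E_def q_def by simp
  qed
  define \<zeta> \<zeta>' where "\<zeta> = (1 / sqrt T) *\<^sub>R v + y" and "\<zeta>' = (1 / sqrt T') *\<^sub>R v + y"
  have E01: "0 \<le> E z" "E z \<le> 1" for z by (auto simp: E_def)
  have "\<bar>E \<zeta> - E \<zeta>'\<bar> \<le> \<bar>norm \<zeta> / sqrt (4 * s) - norm \<zeta>' / sqrt (4 * s)\<bar>"
    unfolding E_def by (rule gaussian_lipschitz)
  also have "\<dots> = \<bar>norm \<zeta> - norm \<zeta>'\<bar> / sqrt (4 * s)"
    using T by (simp add: diff_divide_distrib[symmetric])
  also have "\<dots> \<le> norm (\<zeta> - \<zeta>') / sqrt (4 * \<tau>)"
    using assms by (intro frac_le norm_triangle_ineq3) auto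
  also have "\<zeta> - \<zeta>' = (1 / sqrt T - 1 / sqrt T') *\<^sub>R v" by (simp add: \<zeta>_def \<zeta>'_def scaleR_diff_left)
  also have "norm \<dots> / sqrt (4 * \<tau>) \<le> (e * norm v) / sqrt (4 * \<tau>)"
    using b(2) assms by (intro divide_right_mono) (auto intro: mult_right_mono)
  finally have dE: "\<bar>E \<zeta> - E \<zeta>'\<bar> \<le> (e * norm v) / sqrt (4 * \<tau>)" .
  have "\<bar>T powr (- q) * E \<zeta> - T' powr (- q) * E \<zeta>'\<bar> = \<bar>(T powr (- q) - T' powr (- q)) * E \<zeta> + T' powr (- q) * (E \<zeta> - E \<zeta>')\<bar>"
    by (simp add: algebra_simps)
  also have "\<dots> \<le> \<bar>T powr (- q) - T' powr (- q)\<bar> * E \<zeta> + T' powr (- q) * \<bar>E \<zeta> - E \<zeta>'\<bar>"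
    using E01 by (intro order_trans[OF abs_triangle_ineq]) (simp add: abs_mult)
  also have "\<dots> \<le> e * 1 + T1 powr (- q) * ((e * norm v) / sqrt (4 * \<tau>))"
    using b(1) E01 dE assms q e unfolding q_def[symmetric]
    by (intro add_mono mult_mono powr_mono2') auto
  also have "\<dots> \<le> (1 + T1 powr (- q) / sqrt (4 * \<tau>)) * e * (1 + norm v)"
  proof -
    define a where "a = T1 powr (- q) / sqrt (4 * \<tau>)"
    have "a \<ge> 0" using assms by (simp add: a_def)
    then have "e * 1 + a * (e * norm v) \<le> (1 + a) * e * (1 + norm v)"
      using e by (simp add: algebra_simps)
    then show ?thesis by (simp add: a_def)
  qed
  finally have "(4 * pi * s) powr (- q) * \<bar>T powr (- q) * E \<zeta> - T' powr (- q) * E \<zeta>'\<bar> \<le> (4 * pi * \<tau>) powr (- q) * ((1 + T1 powr (- q) / sqrt (4 * \<tau>)) * e * (1 + norm v))"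
    using assms q by (intro mult_mono powr_mono2') auto
  then show ?thesis
    unfolding H[OF T(1)] H[OF T(2)] \<zeta>_def[symmetric] \<zeta>'_def[symmetric] q_def[symmetric] right_diff_distrib[symmetric] abs_mult by (simp add: mult.assoc)
qed

lemma heat_times_gauss_le8:
  fixes v :: "'a::euclidean_space"
  assumes "s > 0" "s \<le> 1 / 64"
  shows "heat s v * exp (8 * (norm v)\<^sup>2) \<le> 2 powr real DIM('a) * heat (4 * s) v"
proof -
  have "heat s v * exp (8 * (norm v)\<^sup>2) = (heat s v * exp (4 * (norm v)\<^sup>2)) * exp (4 * (norm v)\<^sup>2)"
    by (simp add: mult.assoc flip: exp_add)
  also have "\<dots> \<le> (2 powr (real DIM('a) / 2) * heat (2 * s) v) * exp (4 * (norm v)\<^sup>2)"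
    using assms by (intro mult_right_mono heat_times_gauss_le) auto
  also have "\<dots> = 2 powr (real DIM('a) / 2) * (heat (2 * s) v * exp (4 * (norm v)\<^sup>2))" by simp
  also have "\<dots> \<le> 2 powr (real DIM('a) / 2) * (2 powr (real DIM('a) / 2) * heat (2 * (2 * s)) v)"
    using assms by (intro mult_left_mono heat_times_gauss_le) auto
  also have "\<dots> = 2 powr real DIM('a) * heat (4 * s) v" by (simp flip: mult.assoc powr_add)
  finally show ?thesis .
qed

text \<open>Uniform continuity in \<open>T\<close> in the weighted square norm, for single pairs of
  kernels. The Lipschitz bound alone grows with \<open>v\<close>; it is combined with the Gaussian
  decay of the kernels themselves.\<close>

lemma weighted_heat_difference:
  fixes R \<tau> T1 :: real
  assumes "0 < \<tau>" "0 < T1" "e > 0" "R \<ge> 0"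
  obtains \<kappa> where "\<kappa> > 0" "\<And>T T' s t (p :: 'a::euclidean_space) p'. T1 \<le> T \<Longrightarrow> T \<le> 1 / 2 \<Longrightarrow> T1 \<le> T' \<Longrightarrow> T' \<le> 1 / 2 \<Longrightarrow> \<bar>T - T'\<bar> < \<kappa> \<Longrightarrow>
    \<tau> \<le> s \<Longrightarrow> s \<le> 1 / 64 \<Longrightarrow> \<tau> \<le> t \<Longrightarrow> t \<le> 1 / 64 \<Longrightarrow> norm p \<le> R \<Longrightarrow> norm p' \<le> R \<Longrightarrow>
    (\<integral>\<^sup>+x. \<integral>\<^sup>+v. ennreal ((heat s (x - p) * (heat (t * T) (v + sqrt T *\<^sub>R (x - p')) - heat (t * T') (v + sqrt T' *\<^sub>R (x - p'))))\<^sup>2 * exp (2 * (norm v)\<^sup>2)) \<partial>lborel \<partial>lborel) \<le> ennreal e"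
proof -
  define H0 where "H0 = (4 * pi * \<tau>) powr (- (real DIM('a) / 2))"
  define C0 where "C0 = H0 * (1 + T1 powr (- (real DIM('a) / 2)) / sqrt (4 * \<tau>))"
  define C3 where "C3 = exp (32 * R\<^sup>2) * (2 powr real DIM('a) * 2 powr real DIM('a))"
  have H0: "H0 > 0" using assms by (simp add: H0_def)
  have C0: "C0 > 0" using assms H0 by (simp add: C0_def add_pos_nonneg)
  have C3: "C3 > 0" by (simp add: C3_def)
  \<comment> \<open>In the 4, one factor 2 comes from \<open>(1 + norm v) * exp (2 * (norm
    v)\<^sup>2) \<le> 2 * exp (4 * (norm v)\<^sup>2)\<close>, the other from the two functions
    \<open>w T\<close> and \<open>w T'\<close> of unit mass.\<close>
  define e' where "e' = e / (4 * H0 * C0 * C3)"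
  have e': "e' > 0" using assms H0 C0 C3 by (simp add: e'_def)
  have "uniformly_continuous_on {T1..1/2} (\<lambda>T. T powr (- (real DIM('a) / 2)))"
    using assms by (intro compact_uniformly_continuous continuous_intros) auto
  then obtain \<kappa>1 where k1: "\<kappa>1 > 0" "\<And>T T'. T \<in> {T1..1/2} \<Longrightarrow> T' \<in> {T1..1/2} \<Longrightarrow> dist T' T < \<kappa>1 \<Longrightarrow> dist (T' powr (- (real DIM('a) / 2))) (T powr (- (real DIM('a) / 2))) < e'"
    using e' unfolding uniformly_continuous_on_def by metis
  have "uniformly_continuous_on {T1..1/2} (\<lambda>T. 1 / sqrt T)"
    using assms by (intro compact_uniformly_continuous continuous_intros) auto
  then obtain \<kappa>2 where k2: "\<kappa>2 > 0" "\<And>T T'. T \<in> {T1..1/2} \<Longrightarrow> T' \<in> {T1..1/2} \<Longrightarrow> dist T' T < \<kappa>2 \<Longrightarrow> dist (1 / sqrt T') (1 / sqrt T) < e'"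
    using e' unfolding uniformly_continuous_on_def by metis
  show thesis
  proof (rule that[of "min \<kappa>1 \<kappa>2"])
    show "min \<kappa>1 \<kappa>2 > 0" using k1 k2 by simp
    fix T T' s t :: real and p p' :: 'a
    assume T: "T1 \<le> T" "T \<le> 1 / 2" "T1 \<le> T'" "T' \<le> 1 / 2" and close: "\<bar>T - T'\<bar> < min \<kappa>1 \<kappa>2"
      and st: "\<tau> \<le> s" "s \<le> 1 / 64" "\<tau> \<le> t" "t \<le> 1 / 64" and p: "norm p \<le> R" "norm p' \<le> R"
    have st0: "s > 0" "t > 0" "T > 0" "T' > 0" using st T assms by auto
    define h where "h T x v = heat (t * T) (v + sqrt T *\<^sub>R (x - p'))" for T and x v :: 'a
    define w where "w T x v = heat (4 * s) (x - p) * heat (4 * (t * T)) (v + sqrt T *\<^sub>R (x - p'))" for T and x v :: 'a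
    have h0: "h T x v \<ge> 0" for T x v by (simp add: h_def)
    have d: "\<bar>h T x v - h T' x v\<bar> \<le> C0 * e' * (1 + norm v)" for x v
      unfolding h_def C0_def H0_def
      using k1(2)[of T T'] k2(2)[of T T'] T close
      by (intro heat_dilate_lipschitz assms st T) (auto simp: dist_real_def abs_minus_commute)
    \<comment> \<open>The weight in \<open>v\<close> is distributed over u = v + sqrt t0 (x - p')
      and y = x - p. Because t0 <= 1/2 and both centres have norm at most \<open>R\<close>, one gets
      4 |v|^2 <= 8 |u|^2 + 8 |y|^2 + 32 R^2, and each factor exp (8 |.|^2) is absorbed by
      \<open>heat_times_gauss_le8\<close>.\<close>
    have hw: "heat s (x - p) * h t0 x v * exp (4 * (norm v)\<^sup>2) \<le> C3 * w t0 x v" if t0: "T1 \<le> t0" "t0 \<le> 1 / 2" for t0 x v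
    proof -
      define u where "u = v + sqrt t0 *\<^sub>R (x - p')"
      define y where "y = x - p"
      have t00: "t0 > 0" using t0 assms by simp
      have par: "(norm (a + b))\<^sup>2 \<le> 2 * (norm a)\<^sup>2 + 2 * (norm b)\<^sup>2" for a b :: 'a
      proof -
        have "(norm (a + b))\<^sup>2 + (norm (a - b))\<^sup>2 = 2 * (norm a)\<^sup>2 + 2 * (norm b)\<^sup>2"
          by (simp add: power2_norm_eq_inner inner_simps inner_commute)
        then show ?thesis by (smt (verit) zero_le_power2)
      qed
      have "v = u + (- sqrt t0) *\<^sub>R (x - p')" by (simp add: u_def)
      then have "(norm v)\<^sup>2 \<le> 2 * (norm u)\<^sup>2 + 2 * (norm ((- sqrt t0) *\<^sub>R (x - p')))\<^sup>2" using par by metis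
      also have "(norm ((- sqrt t0) *\<^sub>R (x - p')))\<^sup>2 = t0 * (norm (x - p'))\<^sup>2" using t00 by (simp add: power_mult_distrib)
      also have "\<dots> \<le> 1 / 2 * (norm (x - p'))\<^sup>2" using t0 by (intro mult_right_mono) auto
      also have "x - p' = y + (p - p')" by (simp add: y_def)
      also have "(norm (y + (p - p')))\<^sup>2 \<le> 2 * (norm y)\<^sup>2 + 2 * (norm (p - p'))\<^sup>2" by (rule par)
      also have "(norm (p - p'))\<^sup>2 \<le> (2 * R)\<^sup>2"
        using p norm_triangle_ineq4[of p p'] by (intro power_mono) auto
      finally have "2 * (norm v)\<^sup>2 \<le> 4 * (norm u)\<^sup>2 + 4 * (norm y)\<^sup>2 + 16 * R\<^sup>2" by (simp add: power_mult_distrib field_simps)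
      then have "4 * (norm v)\<^sup>2 \<le> 8 * (norm u)\<^sup>2 + 8 * (norm y)\<^sup>2 + 32 * R\<^sup>2" by linarith
      then have "exp (4 * (norm v)\<^sup>2) \<le> exp (8 * (norm u)\<^sup>2) * exp (8 * (norm y)\<^sup>2) * exp (32 * R\<^sup>2)"
        by (simp flip: exp_add)
      then have "heat s y * heat (t * t0) u * exp (4 * (norm v)\<^sup>2) \<le> heat s y * heat (t * t0) u * (exp (8 * (norm u)\<^sup>2) * exp (8 * (norm y)\<^sup>2) * exp (32 * R\<^sup>2))"
        by (intro mult_left_mono) auto
      also have "\<dots> = exp (32 * R\<^sup>2) * ((heat s y * exp (8 * (norm y)\<^sup>2)) * (heat (t * t0) u * exp (8 * (norm u)\<^sup>2)))" by simp
      also have "\<dots> \<le> exp (32 * R\<^sup>2) * ((2 powr real DIM('a) * heat (4 * s) y) * (2 powr real DIM('a) * heat (4 * (t * t0)) u))"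
      proof -
        have "t * t0 \<le> 1 / 64" using mult_mono[of t "1/64" t0 1] st0 t0 st t00 by simp
        then show ?thesis
          by (intro mult_left_mono mult_mono[OF heat_times_gauss_le8 heat_times_gauss_le8]) (use st st0 t00 in auto)
      qed
      finally show ?thesis unfolding h_def w_def C3_def y_def u_def by (simp add: mult_ac)
    qed
    \<comment> \<open>Of the squared difference one factor is estimated by the Lipschitz bound,
      which supplies the smallness, and the other by \<open>h T x v + h T' x v\<close>, which
      supplies the decay against the weight.\<close>
    have "(heat s (x - p) * (h T x v - h T' x v))\<^sup>2 * exp (2 * (norm v)\<^sup>2) \<le> (2 * H0 * C0 * e' * C3) * (w T x v + w T' x v)" for x v
    proof -
      have "(h T x v - h T' x v)\<^sup>2 = \<bar>h T x v - h T' x v\<bar> * \<bar>h T x v - h T' x v\<bar>" by (simp add: power2_eq_square)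
      also have "\<dots> \<le> (C0 * e' * (1 + norm v)) * (h T x v + h T' x v)"
        using d h0[of T x v] h0[of T' x v] C0 e' by (intro mult_mono) auto
      finally have 1: "(h T x v - h T' x v)\<^sup>2 \<le> (C0 * e' * (1 + norm v)) * (h T x v + h T' x v)" .
      have "heat s (x - p) \<le> H0" unfolding H0_def using assms st by (intro heat_le) auto
      then have 2: "(heat s (x - p))\<^sup>2 \<le> H0 * heat s (x - p)" unfolding power2_eq_square by (intro mult_right_mono) auto
      have 3: "(1 + norm v) * exp (2 * (norm v)\<^sup>2) \<le> 2 * exp (4 * (norm v)\<^sup>2)"
      proof -
        have "0 \<le> (norm v - 1)\<^sup>2" by simp
        then have "1 + norm v \<le> 2 * (1 + 2 * (norm v)\<^sup>2)" by (simp add: power2_diff) (smt (verit) zero_le_power2)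
        also have "\<dots> \<le> 2 * exp (2 * (norm v)\<^sup>2)" by (intro mult_left_mono exp_ge_add_one_self) auto
        finally have "(1 + norm v) * exp (2 * (norm v)\<^sup>2) \<le> 2 * exp (2 * (norm v)\<^sup>2) * exp (2 * (norm v)\<^sup>2)" by (intro mult_right_mono) auto
        then show ?thesis by (simp add: mult.assoc flip: exp_add)
      qed
      have "(heat s (x - p) * (h T x v - h T' x v))\<^sup>2 * exp (2 * (norm v)\<^sup>2) = (heat s (x - p))\<^sup>2 * (h T x v - h T' x v)\<^sup>2 * exp (2 * (norm v)\<^sup>2)"
        by (simp add: power_mult_distrib)
      also have "\<dots> \<le> (H0 * heat s (x - p)) * ((C0 * e' * (1 + norm v)) * (h T x v + h T' x v)) * exp (2 * (norm v)\<^sup>2)"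
        using 1 2 H0 by (intro mult_right_mono mult_mono) auto
      also have "\<dots> = (H0 * C0 * e' * heat s (x - p) * (h T x v + h T' x v)) * ((1 + norm v) * exp (2 * (norm v)\<^sup>2))" by (simp add: mult_ac)
      also have "\<dots> \<le> (H0 * C0 * e' * heat s (x - p) * (h T x v + h T' x v)) * (2 * exp (4 * (norm v)\<^sup>2))"
        using H0 C0 e' h0[of T x v] h0[of T' x v] by (intro mult_left_mono 3) auto
      also have "\<dots> = (2 * H0 * C0 * e') * (heat s (x - p) * h T x v * exp (4 * (norm v)\<^sup>2) + heat s (x - p) * h T' x v * exp (4 * (norm v)\<^sup>2))"
        by (simp add: algebra_simps)
      also have "\<dots> \<le> (2 * H0 * C0 * e') * (C3 * w T x v + C3 * w T' x v)"
        using H0 C0 e' T by (intro mult_left_mono add_mono hw) auto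
      finally show ?thesis by (simp add: algebra_simps)
    qed
    then have "(\<integral>\<^sup>+x. \<integral>\<^sup>+v. ennreal ((heat s (x - p) * (h T x v - h T' x v))\<^sup>2 * exp (2 * (norm v)\<^sup>2)) \<partial>lborel \<partial>lborel)
      \<le> (\<integral>\<^sup>+x. \<integral>\<^sup>+v. ennreal (2 * H0 * C0 * e' * C3) * (ennreal (w T x v) + ennreal (w T' x v)) \<partial>lborel \<partial>lborel)"
      using H0 C0 C3 e'
      by (intro nn_integral_mono) (simp add: w_def ennreal_mult[symmetric] ennreal_plus[symmetric] ennreal_leI del: ennreal_plus)
    also have "\<dots> = ennreal (2 * H0 * C0 * e' * C3) * ((\<integral>\<^sup>+x. \<integral>\<^sup>+v. ennreal (w T x v) \<partial>lborel \<partial>lborel) + (\<integral>\<^sup>+x. \<integral>\<^sup>+v. ennreal (w T' x v) \<partial>lborel \<partial>lborel))"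
      unfolding w_def by (simp add: nn_integral_cmult nn_integral_add)
    also have w1: "(\<integral>\<^sup>+x. \<integral>\<^sup>+v. ennreal (w t0 x v) \<partial>lborel \<partial>lborel) = 1" if "t0 > 0" for t0
    proof -
      have "(\<integral>\<^sup>+v. ennreal (w t0 x v) \<partial>lborel) = ennreal (heat (4 * s) (x - p))" for x
      proof -
        have tt: "4 * (t * t0) > 0" using st0 that by simp
        have "integrable lborel (\<lambda>v::'a. heat (4 * (t * t0)) (v + sqrt t0 *\<^sub>R (x - p')))" "(\<integral>v. heat (4 * (t * t0)) (v + sqrt t0 *\<^sub>R (x - p')) \<partial>lborel) = 1"
          using integrable_heat[OF tt, of "- (sqrt t0 *\<^sub>R (x - p'))"] integral_heat[OF tt, of "- (sqrt t0 *\<^sub>R (x - p'))"] by simp_all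
        then show ?thesis unfolding w_def by (subst nn_integral_eq_integral) auto
      qed
      moreover have s4: "4 * s > 0" using st0 by simp
      ultimately show ?thesis
        using integrable_heat[OF s4, of p] integral_heat[OF s4, of p] by (simp add: nn_integral_eq_integral)
    qed
    have "ennreal (2 * H0 * C0 * e' * C3) * ((\<integral>\<^sup>+x. \<integral>\<^sup>+v. ennreal (w T x v) \<partial>lborel \<partial>lborel) + (\<integral>\<^sup>+x. \<integral>\<^sup>+v. ennreal (w T' x v) \<partial>lborel \<partial>lborel))
       = ennreal (2 * H0 * C0 * e' * C3) * ennreal 2"
      using w1 st0 by simp
    also have "\<dots> = ennreal e"
      using H0 C0 C3 assms(3) by (subst ennreal_mult[symmetric]) (auto simp: e'_def)
    finally show "(\<integral>\<^sup>+x. \<integral>\<^sup>+v. ennreal ((heat s (x - p) * (heat (t * T) (v + sqrt T *\<^sub>R (x - p')) - heat (t * T') (v + sqrt T' *\<^sub>R (x - p'))))\<^sup>2 * exp (2 * (norm v)\<^sup>2)) \<partial>lborel \<partial>lborel) \<le> ennreal e"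
      unfolding h_def .
  qed
qed

text \<open>Cauchy-Schwarz after splitting each weight into \<open>sqrt \<bar>w k\<bar>\<close> and
  \<open>sgn (w k) * sqrt \<bar>w k\<bar>\<close>.\<close>

lemma weighted_sum_square_le:
  fixes w \<phi> :: "'i \<Rightarrow> real"
  shows "(\<Sum>k\<in>S. w k * \<phi> k)\<^sup>2 \<le> (\<Sum>k\<in>S. \<bar>w k\<bar>) * (\<Sum>k\<in>S. \<bar>w k\<bar> * (\<phi> k)\<^sup>2)"
proof -
  have "(\<Sum>k\<in>S. w k * \<phi> k) = (\<Sum>k\<in>S. sqrt \<bar>w k\<bar> * (sgn (w k) * sqrt \<bar>w k\<bar> * \<phi> k))"
  proof (rule sum.cong[OF refl])
    fix k
    have "sqrt \<bar>w k\<bar> * (sgn (w k) * sqrt \<bar>w k\<bar> * \<phi> k) = (sqrt \<bar>w k\<bar> * sqrt \<bar>w k\<bar>) * sgn (w k) * \<phi> k" by (simp only: mult_ac)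
    moreover have "sqrt \<bar>w k\<bar> * sqrt \<bar>w k\<bar> = \<bar>w k\<bar>" by simp
    ultimately show "w k * \<phi> k = sqrt \<bar>w k\<bar> * (sgn (w k) * sqrt \<bar>w k\<bar> * \<phi> k)" by (simp only: abs_mult_sgn)
  qed
  also have "\<dots>\<^sup>2 \<le> (\<Sum>k\<in>S. (sqrt \<bar>w k\<bar>)\<^sup>2) * (\<Sum>k\<in>S. (sgn (w k) * sqrt \<bar>w k\<bar> * \<phi> k)\<^sup>2)"
    by (rule Cauchy_Schwarz_ineq_sum)
  also have "\<dots> = (\<Sum>k\<in>S. \<bar>w k\<bar>) * (\<Sum>k\<in>S. \<bar>w k\<bar> * (\<phi> k)\<^sup>2)"
  proof -
    have "(sgn (w k) * sqrt \<bar>w k\<bar> * \<phi> k)\<^sup>2 = \<bar>w k\<bar> * (\<phi> k)\<^sup>2" for k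
      by (cases "w k = 0") (auto simp: power_mult_distrib sgn_if)
    then show ?thesis by simp
  qed
  finally show ?thesis .
qed

lemma moll_abs_weight_le:
  assumes "frostman K \<alpha> \<delta> A m"
  shows "(\<Sum>i\<in>A \<times> {1..N}. \<bar>m (fst i) * c (snd i)\<bar>) \<le> K * (\<Sum>l\<in>{1..N}. \<bar>c l\<bar>)"
proof -
  have m0: "\<And>a. a \<in> A \<Longrightarrow> m a \<ge> 0" and K: "sum m A \<le> K" using assms by (auto simp: frostman_def)
  have "(\<Sum>i\<in>A \<times> {1..N}. \<bar>m (fst i) * c (snd i)\<bar>) = sum m A * (\<Sum>l\<in>{1..N}. \<bar>c l\<bar>)"
    unfolding sum_product sum.cartesian_product' using m0 by (simp add: abs_mult)
  also have "\<dots> \<le> K * (\<Sum>l\<in>{1..N}. \<bar>c l\<bar>)" using K by (intro mult_right_mono) (auto simp: sum_nonneg)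
  finally show ?thesis .
qed

lemma dilate_sum: "dilate T (\<lambda>y. \<Sum>i\<in>I. q i * g i y) x v = (\<Sum>i\<in>I. q i * dilate T (g i) x v)"
  unfolding dilate_def by (simp add: sum_distrib_left mult.left_commute)

text \<open>After the dilation \<open>T\<close> occurs only in the smooth factor \<open>G\<close>.
  Cauchy-Schwarz separates it from the shell average of the third function, whose energy at the
  fixed scale \<tau> is bounded uniformly in \<epsilon>. Hence \<kappa> depends neither on
  \<epsilon> nor on the weights or their resolution.\<close>

lemma tri_equicontinuous:
  fixes \<tau> K R T1 :: real
  assumes d2: "DIM('a::euclidean_space) \<ge> 2" and \<tau>: "\<tau> > 0" "\<tau> * real N \<le> 1 / 64" and T1: "T1 > 0" and e: "e > 0" and R: "R \<ge> 0"
  obtains \<kappa> where "\<kappa> > 0" "\<And>T T' \<delta> \<epsilon> (A1 :: 'a set) m1 A2 m2 A3 m3. T1 \<le> T \<Longrightarrow> T \<le> 1 / 2 \<Longrightarrow> T1 \<le> T' \<Longrightarrow> T' \<le> 1 / 2 \<Longrightarrow> \<bar>T - T'\<bar> < \<kappa> \<Longrightarrow>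
     frostman K \<alpha> \<delta> A1 m1 \<Longrightarrow> frostman K \<alpha> \<delta> A2 m2 \<Longrightarrow> frostman K \<alpha> \<delta> A3 m3 \<Longrightarrow> A1 \<subseteq> cball 0 R \<Longrightarrow> A2 \<subseteq> cball 0 R \<Longrightarrow>
     0 < \<epsilon> \<Longrightarrow> \<epsilon> \<le> 1 \<Longrightarrow>
     \<bar>tri_form \<epsilon> T (moll N c \<tau> A1 m1) (moll N c \<tau> A2 m2) (moll N c \<tau> A3 m3) - tri_form \<epsilon> T' (moll N c \<tau> A1 m1) (moll N c \<tau> A2 m2) (moll N c \<tau> A3 m3)\<bar> \<le> e"
proof -
  obtain C where C: "C > 0" "\<And>S :: 'a \<Rightarrow> real \<Rightarrow> real. case_prod S \<in> borel_measurable (borel \<Otimes>\<^sub>M borel) \<Longrightarrow>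
    (\<integral>\<^sup>+c. \<integral>\<^sup>+u. ennreal (exp (- 2 * (norm u)\<^sup>2) * (S c ((norm u)\<^sup>2))\<^sup>2) \<partial>(lborel :: 'a measure) \<partial>lborel)
      \<le> ennreal C * (\<integral>\<^sup>+c. \<integral>\<^sup>+r. ennreal (exp (- r) * (S c r)\<^sup>2) \<partial>lborel \<partial>lborel)"
    using radial_energy_le[OF d2] by blast
  obtain D where D: "D > 0" "\<And>\<delta> (A :: 'a set) m \<epsilon>. frostman K \<alpha> \<delta> A m \<Longrightarrow> 0 < \<epsilon> \<Longrightarrow> \<epsilon> \<le> 1 \<Longrightarrow>
     shell_energy 1 1 \<epsilon> (moll N c \<tau> A m) \<le> ennreal D"
    using shell_energy_moll_bounded[OF \<tau>(1) d2] by blast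
  define Q where "Q = (K * (\<Sum>l\<in>{1..N}. \<bar>c l\<bar>))\<^sup>2"
  have Q: "Q \<ge> 0" by (simp add: Q_def)
  \<comment> \<open>Chosen so that the final product \<open>Q\<^sup>2 * e1 * C * D\<close> is at
    most \<open>e\<^sup>2\<close>; the summand 1 covers the case \<open>Q = 0\<close>.\<close>
  define e1 where "e1 = e\<^sup>2 / ((Q\<^sup>2 + 1) * C * D)"
  have e1: "e1 > 0" using e C D by (simp add: e1_def add_nonneg_pos)
  obtain \<kappa> where \<kappa>: "\<kappa> > 0" "\<And>T T' s t (p :: 'a::euclidean_space) p'. T1 \<le> T \<Longrightarrow> T \<le> 1 / 2 \<Longrightarrow> T1 \<le> T' \<Longrightarrow> T' \<le> 1 / 2 \<Longrightarrow> \<bar>T - T'\<bar> < \<kappa> \<Longrightarrow>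
    \<tau> \<le> s \<Longrightarrow> s \<le> 1 / 64 \<Longrightarrow> \<tau> \<le> t \<Longrightarrow> t \<le> 1 / 64 \<Longrightarrow> norm p \<le> R \<Longrightarrow> norm p' \<le> R \<Longrightarrow>
    (\<integral>\<^sup>+x. \<integral>\<^sup>+v. ennreal ((heat s (x - p) * (heat (t * T) (v + sqrt T *\<^sub>R (x - p')) - heat (t * T') (v + sqrt T' *\<^sub>R (x - p'))))\<^sup>2 * exp (2 * (norm v)\<^sup>2)) \<partial>lborel \<partial>lborel) \<le> ennreal e1"
    using weighted_heat_difference[OF \<tau>(1) T1 e1 R, where 'a='a] by blast
  show thesis
  proof (rule that[OF \<kappa>(1)])
    fix T T' \<delta> \<epsilon> :: real and A1 A2 A3 :: "'a set" and m1 m2 m3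
    assume T: "T1 \<le> T" "T \<le> 1 / 2" "T1 \<le> T'" "T' \<le> 1 / 2" "\<bar>T - T'\<bar> < \<kappa>"
      and F: "frostman K \<alpha> \<delta> A1 m1" "frostman K \<alpha> \<delta> A2 m2" "frostman K \<alpha> \<delta> A3 m3"
      and AR: "A1 \<subseteq> cball 0 R" "A2 \<subseteq> cball 0 R" and \<epsilon>: "0 < \<epsilon>" "\<epsilon> \<le> 1"
    have T0: "T > 0" "T' > 0" using T T1 by auto
    define f where "f = moll N c \<tau> A1 m1"
    define g where "g = moll N c \<tau> A2 m2"
    define h where "h = moll N c \<tau> A3 m3"
    have fgh: "integrable lborel f" "integrable lborel g" "integrable lborel h"
      unfolding f_def g_def h_def by (rule integrable_moll[OF \<tau>(1)])+
    have [measurable]: "f \<in> borel_measurable borel" "g \<in> borel_measurable borel" "h \<in> borel_measurable borel" using fgh by auto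
    have [measurable (raw)]: "(\<lambda>u. shell_avg A B \<epsilon> h (f1 u) (f2 u)) \<in> borel_measurable M"
      if [measurable]: "f1 \<in> M \<rightarrow>\<^sub>M borel" "f2 \<in> M \<rightarrow>\<^sub>M borel" for A B and M :: "'z measure" and f1 f2
      unfolding shell_avg_def by measurable
    define I1 where "I1 = A1 \<times> {1..N}"
    define I2 where "I2 = A2 \<times> {1..N}"
    define q1 where "q1 i = m1 (fst i) * c (snd i)" for i
    define q2 where "q2 i = m2 (fst i) * c (snd i)" for i
    define H where "H t j x v = heat (\<tau> * real (snd j) * t) (v + sqrt t *\<^sub>R (x - fst j))" for t and j :: "'a \<times> nat" and x v :: 'a
    define \<phi> where "\<phi> k x v = heat (\<tau> * real (snd (fst k))) (x - fst (fst k)) * (H T (snd k) x v - H T' (snd k) x v)" for k :: "('a \<times> nat) \<times> ('a \<times> nat)" and x v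
    define w where "w k = q1 (fst k) * q2 (snd k)" for k
    define G where "G x v = f x * dilate T g x v - f x * dilate T' g x v" for x v
    have fin: "finite (I1 \<times> I2)" using F by (auto simp: I1_def I2_def frostman_def)
    have lab: "\<tau> \<le> \<tau> * real (snd i)" "\<tau> * real (snd i) \<le> 1 / 64" if "i \<in> I1 \<union> I2" for i
    proof -
      have n: "1 \<le> snd i" "snd i \<le> N" using that by (auto simp: I1_def I2_def)
      have "\<tau> * 1 \<le> \<tau> * real (snd i)" using n \<tau> by (intro mult_left_mono) auto
      then show "\<tau> \<le> \<tau> * real (snd i)" by simp
      have "\<tau> * real (snd i) \<le> \<tau> * real N" using n \<tau> by (intro mult_left_mono) auto
      then show "\<tau> * real (snd i) \<le> 1 / 64" using \<tau>(2) by linarith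
    qed
    have dil: "dilate t g x v = (\<Sum>j\<in>I2. q2 j * H t j x v)" if "t > 0" for t x v
    proof -
      have "dilate t g x v = (\<Sum>j\<in>I2. q2 j * dilate t (\<lambda>y. heat (\<tau> * real (snd j)) (y - fst j)) x v)"
        unfolding g_def moll_def[abs_def] I2_def q2_def by (rule dilate_sum)
      also have "\<dots> = (\<Sum>j\<in>I2. q2 j * H t j x v)"
        unfolding H_def using lab \<tau>(1) that by (intro sum.cong refl arg_cong2[where f="(*)"] dilate_heat) (auto simp: I2_def)
      finally show ?thesis .
    qed
    have G_eq: "G x v = (\<Sum>k\<in>I1 \<times> I2. w k * \<phi> k x v)" for x v
    proof -
      have "G x v = f x * (\<Sum>j\<in>I2. q2 j * (H T j x v - H T' j x v))"
        unfolding G_def dil[OF T0(1)] dil[OF T0(2)] by (simp add: right_diff_distrib sum_subtractf)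
      also have "f x = (\<Sum>i\<in>I1. q1 i * heat (\<tau> * real (snd i)) (x - fst i))"
        unfolding f_def moll_def I1_def q1_def ..
      also have "(\<Sum>i\<in>I1. q1 i * heat (\<tau> * real (snd i)) (x - fst i)) * (\<Sum>j\<in>I2. q2 j * (H T j x v - H T' j x v)) = (\<Sum>k\<in>I1 \<times> I2. w k * \<phi> k x v)"
        unfolding sum_product sum.cartesian_product' w_def \<phi>_def by (simp add: mult_ac)
      finally show ?thesis .
    qed
    have wQ: "(\<Sum>k\<in>I1 \<times> I2. \<bar>w k\<bar>) \<le> Q"
    proof -
      have "(\<Sum>k\<in>I1 \<times> I2. \<bar>w k\<bar>) = (\<Sum>i\<in>I1. \<bar>q1 i\<bar>) * (\<Sum>j\<in>I2. \<bar>q2 j\<bar>)"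
        unfolding sum_product sum.cartesian_product' w_def by (simp add: abs_mult)
      also have "\<dots> \<le> (K * (\<Sum>l\<in>{1..N}. \<bar>c l\<bar>)) * (K * (\<Sum>l\<in>{1..N}. \<bar>c l\<bar>))"
        using moll_abs_weight_le[OF F(1), of c N] moll_abs_weight_le[OF F(2), of c N] frostman_constant_nonneg[OF F(1)]
        unfolding I1_def I2_def q1_def q2_def by (intro mult_mono) (auto simp: sum_nonneg)
      finally show ?thesis by (simp add: Q_def power2_eq_square)
    qed
    have [measurable]: "case_prod (\<phi> k) \<in> borel_measurable (borel \<Otimes>\<^sub>M borel)" for k
      unfolding \<phi>_def H_def by measurable
    have [measurable (raw)]: "(\<lambda>u. \<phi> k (f1 u) (f2 u)) \<in> borel_measurable M"
      if [measurable]: "f1 \<in> M \<rightarrow>\<^sub>M borel" "f2 \<in> M \<rightarrow>\<^sub>M borel" for k and M :: "'z measure" and f1 f2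
      unfolding \<phi>_def H_def by measurable
    \<comment> \<open>\<open>G\<close> is a signed combination of pairs of kernels with total
      absolute weight at most \<open>Q\<close>. Weighted Cauchy-Schwarz reduces its square norm to
      those of single pairs, at the cost of \<open>Q\<close> twice.\<close>
    have GG: "(\<integral>\<^sup>+x. \<integral>\<^sup>+v. ennreal ((G x v * exp ((norm v)\<^sup>2))\<^sup>2) \<partial>lborel \<partial>lborel) \<le> ennreal (Q\<^sup>2 * e1)"
    proof -
      have "(\<integral>\<^sup>+x. \<integral>\<^sup>+v. ennreal ((G x v * exp ((norm v)\<^sup>2))\<^sup>2) \<partial>lborel \<partial>lborel)
        \<le> (\<integral>\<^sup>+x. \<integral>\<^sup>+v. (\<Sum>k\<in>I1 \<times> I2. ennreal (Q * \<bar>w k\<bar>) * ennreal ((\<phi> k x v)\<^sup>2 * exp (2 * (norm v)\<^sup>2))) \<partial>lborel \<partial>lborel)"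
      proof (intro nn_integral_mono)
        fix x v :: 'a
        have "(G x v)\<^sup>2 \<le> (\<Sum>k\<in>I1 \<times> I2. \<bar>w k\<bar>) * (\<Sum>k\<in>I1 \<times> I2. \<bar>w k\<bar> * (\<phi> k x v)\<^sup>2)"
          unfolding G_eq by (rule weighted_sum_square_le)
        also have "\<dots> \<le> Q * (\<Sum>k\<in>I1 \<times> I2. \<bar>w k\<bar> * (\<phi> k x v)\<^sup>2)"
          by (intro mult_right_mono wQ sum_nonneg) auto
        finally have "(G x v)\<^sup>2 * exp (2 * (norm v)\<^sup>2) \<le> Q * (\<Sum>k\<in>I1 \<times> I2. \<bar>w k\<bar> * (\<phi> k x v)\<^sup>2) * exp (2 * (norm v)\<^sup>2)"
          by (intro mult_right_mono) auto
        also have "\<dots> = (\<Sum>k\<in>I1 \<times> I2. Q * \<bar>w k\<bar> * ((\<phi> k x v)\<^sup>2 * exp (2 * (norm v)\<^sup>2)))"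
          by (simp add: sum_distrib_left sum_distrib_right mult.assoc)
        finally have "ennreal ((G x v)\<^sup>2 * exp (2 * (norm v)\<^sup>2)) \<le> ennreal (\<Sum>k\<in>I1 \<times> I2. Q * \<bar>w k\<bar> * ((\<phi> k x v)\<^sup>2 * exp (2 * (norm v)\<^sup>2)))"
          by (rule ennreal_leI)
        also have "\<dots> = (\<Sum>k\<in>I1 \<times> I2. ennreal (Q * \<bar>w k\<bar>) * ennreal ((\<phi> k x v)\<^sup>2 * exp (2 * (norm v)\<^sup>2)))"
        proof -
          have "(\<Sum>k\<in>I1 \<times> I2. ennreal (Q * \<bar>w k\<bar>) * ennreal ((\<phi> k x v)\<^sup>2 * exp (2 * (norm v)\<^sup>2)))
             = (\<Sum>k\<in>I1 \<times> I2. ennreal (Q * \<bar>w k\<bar> * ((\<phi> k x v)\<^sup>2 * exp (2 * (norm v)\<^sup>2))))"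
            using Q by (intro sum.cong refl ennreal_mult[symmetric]) auto
          also have "\<dots> = ennreal (\<Sum>k\<in>I1 \<times> I2. Q * \<bar>w k\<bar> * ((\<phi> k x v)\<^sup>2 * exp (2 * (norm v)\<^sup>2)))"
            using Q by (intro sum_ennreal) auto
          finally show ?thesis by simp
        qed
        finally show "ennreal ((G x v * exp ((norm v)\<^sup>2))\<^sup>2) \<le> (\<Sum>k\<in>I1 \<times> I2. ennreal (Q * \<bar>w k\<bar>) * ennreal ((\<phi> k x v)\<^sup>2 * exp (2 * (norm v)\<^sup>2)))"
          by (simp add: power_mult_distrib exp_double)
      qed
      also have "\<dots> = (\<Sum>k\<in>I1 \<times> I2. ennreal (Q * \<bar>w k\<bar>) * (\<integral>\<^sup>+x. \<integral>\<^sup>+v. ennreal ((\<phi> k x v)\<^sup>2 * exp (2 * (norm v)\<^sup>2)) \<partial>lborel \<partial>lborel))"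
        by (simp add: nn_integral_sum nn_integral_cmult)
      also have "\<dots> \<le> (\<Sum>k\<in>I1 \<times> I2. ennreal (Q * \<bar>w k\<bar>) * ennreal e1)"
      proof (intro sum_mono mult_left_mono)
        fix k assume k: "k \<in> I1 \<times> I2"
        have a: "norm (fst (fst k)) \<le> R" "norm (fst (snd k)) \<le> R" using k AR by (auto simp: I1_def I2_def)
        show "(\<integral>\<^sup>+x. \<integral>\<^sup>+v. ennreal ((\<phi> k x v)\<^sup>2 * exp (2 * (norm v)\<^sup>2)) \<partial>lborel \<partial>lborel) \<le> ennreal e1"
          unfolding \<phi>_def H_def using k by (intro \<kappa>(2) T lab a) auto
      qed simp
      also have "\<dots> = ennreal (\<Sum>k\<in>I1 \<times> I2. Q * \<bar>w k\<bar> * e1)"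
        using Q e1 by (subst sum_ennreal[symmetric]) (auto intro!: sum.cong simp: ennreal_mult)
      also have "\<dots> \<le> ennreal (Q\<^sup>2 * e1)"
      proof (rule ennreal_leI)
        have "(\<Sum>k\<in>I1 \<times> I2. Q * \<bar>w k\<bar> * e1) = Q * (\<Sum>k\<in>I1 \<times> I2. \<bar>w k\<bar>) * e1"
          by (simp add: sum_distrib_left sum_distrib_right)
        also have "\<dots> \<le> Q * Q * e1" using Q e1 by (intro mult_right_mono mult_left_mono wQ) auto
        finally show "(\<Sum>k\<in>I1 \<times> I2. Q * \<bar>w k\<bar> * e1) \<le> Q\<^sup>2 * e1" by (simp add: power2_eq_square)
      qed
      finally show ?thesis .
    qed
    define S where "S x r = shell_avg 1 1 \<epsilon> h x r" for x r
    have S_meas: "case_prod S \<in> borel_measurable (borel \<Otimes>\<^sub>M borel)"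
      unfolding S_def by measurable
    have "tri_form \<epsilon> T f g h - tri_form \<epsilon> T' f g h = (\<integral>(x, v). G x v * S x ((norm v)\<^sup>2) \<partial>(lborel \<Otimes>\<^sub>M lborel))"
      unfolding tri_dilate[OF fgh \<epsilon>(1) T0(1)] tri_dilate[OF fgh \<epsilon>(1) T0(2)]
      by (subst Bochner_Integration.integral_diff[symmetric, OF integrable_tri_dilate[OF fgh \<epsilon>(1) T0(1)] integrable_tri_dilate[OF fgh \<epsilon>(1) T0(2)]])
        (simp add: G_def S_def case_prod_unfold left_diff_distrib)
    also have "\<dots> = (\<integral>x. \<integral>v. G x v * S x ((norm v)\<^sup>2) \<partial>lborel \<partial>lborel)"
    proof (rule lborel_pair.integral_fst[symmetric])
      show "integrable (lborel \<Otimes>\<^sub>M lborel) (\<lambda>(x, v). G x v * S x ((norm v)\<^sup>2))"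
        using Bochner_Integration.integrable_diff[OF integrable_tri_dilate[OF fgh \<epsilon>(1) T0(1)] integrable_tri_dilate[OF fgh \<epsilon>(1) T0(2)]]
        by (simp add: G_def S_def case_prod_unfold left_diff_distrib)
    qed
    finally have eq: "tri_form \<epsilon> T f g h - tri_form \<epsilon> T' f g h = (\<integral>x. \<integral>v. G x v * S x ((norm v)\<^sup>2) \<partial>lborel \<partial>lborel)" .
    have "(ennreal \<bar>tri_form \<epsilon> T f g h - tri_form \<epsilon> T' f g h\<bar>)\<^sup>2 \<le> (\<integral>\<^sup>+x. \<integral>\<^sup>+v. ennreal \<bar>G x v * S x ((norm v)\<^sup>2)\<bar> \<partial>lborel \<partial>lborel)\<^sup>2"
      unfolding eq by (intro power_mono abs_iterated_integral_le) auto
    also have "\<dots> = (\<integral>\<^sup>+x. \<integral>\<^sup>+v. ennreal \<bar>(G x v * exp ((norm v)\<^sup>2)) * (exp (- (norm v)\<^sup>2) * S x ((norm v)\<^sup>2))\<bar> \<partial>lborel \<partial>lborel)\<^sup>2"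
    proof -
      have "(G x v * exp ((norm v)\<^sup>2)) * (exp (- (norm v)\<^sup>2) * S x ((norm v)\<^sup>2)) = G x v * S x ((norm v)\<^sup>2)" for x v
        by (simp add: exp_minus field_simps)
      then show ?thesis by (simp only:)
    qed
    also have "\<dots> \<le> (\<integral>\<^sup>+x. \<integral>\<^sup>+v. ennreal ((G x v * exp ((norm v)\<^sup>2))\<^sup>2) \<partial>lborel \<partial>lborel) * (\<integral>\<^sup>+x. \<integral>\<^sup>+(v::'a). ennreal ((exp (- (norm v)\<^sup>2) * S x ((norm v)\<^sup>2))\<^sup>2) \<partial>lborel \<partial>lborel)"
      by (rule nn_integral_Cauchy_Schwarz_iterated) (simp_all only: G_eq S_def, measurable)
    also have "\<dots> \<le> ennreal (Q\<^sup>2 * e1) * (ennreal C * ennreal D)"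
    proof (rule mult_mono[OF GG])
      have "(\<integral>\<^sup>+x. \<integral>\<^sup>+v. ennreal ((exp (- (norm v)\<^sup>2) * S x ((norm v)\<^sup>2))\<^sup>2) \<partial>(lborel :: 'a measure) \<partial>lborel)
        = (\<integral>\<^sup>+x. \<integral>\<^sup>+v. ennreal (exp (- 2 * (norm v)\<^sup>2) * (S x ((norm v)\<^sup>2))\<^sup>2) \<partial>(lborel :: 'a measure) \<partial>lborel)"
        by (simp add: power_mult_distrib exp_double[symmetric])
      also have "\<dots> \<le> ennreal C * (\<integral>\<^sup>+c. \<integral>\<^sup>+r. ennreal (exp (- r) * (S c r)\<^sup>2) \<partial>lborel \<partial>lborel)"
        by (rule C(2)[OF S_meas])
      also have "\<dots> \<le> ennreal C * ennreal D"
        using D(2)[OF F(3) \<epsilon>] unfolding S_def h_def shell_energy_def by (rule mult_left_mono) simp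
      finally show "(\<integral>\<^sup>+x. \<integral>\<^sup>+v. ennreal ((exp (- (norm v)\<^sup>2) * S x ((norm v)\<^sup>2))\<^sup>2) \<partial>(lborel :: 'a measure) \<partial>lborel) \<le> ennreal C * ennreal D" .
    qed auto
    also have "\<dots> = ennreal (Q\<^sup>2 * e1 * C * D)"
      using C D e1 by (simp add: ennreal_mult[symmetric] mult.assoc)
    also have "\<dots> \<le> ennreal (e\<^sup>2)"
    proof (rule ennreal_leI)
      have "Q\<^sup>2 * e1 * C * D \<le> (Q\<^sup>2 + 1) * e1 * C * D" using e1 C D by (intro mult_right_mono) auto
      also have "\<dots> = ((Q\<^sup>2 + 1) * C * D) * e1" by (simp add: mult_ac)
      also have "\<dots> = e\<^sup>2" unfolding e1_def using C D by (simp add: add_nonneg_pos[THEN less_imp_neq, symmetric])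
      finally show "Q\<^sup>2 * e1 * C * D \<le> e\<^sup>2" .
    qed
    finally have "\<bar>tri_form \<epsilon> T f g h - tri_form \<epsilon> T' f g h\<bar> \<le> sqrt (e\<^sup>2)" by (rule ennreal_square_le_imp) simp
    then show "\<bar>tri_form \<epsilon> T (moll N c \<tau> A1 m1) (moll N c \<tau> A2 m2) (moll N c \<tau> A3 m3) - tri_form \<epsilon> T' (moll N c \<tau> A1 m1) (moll N c \<tau> A2 m2) (moll N c \<tau> A3 m3)\<bar> \<le> e"
      using e unfolding f_def g_def h_def by simp
  qed
qed

section \<open>Mollified and atomic forms\<close>

text \<open>What \<open>tri_form\<close> becomes at mollification scale 0, with the atoms themselves
  in place of densities.\<close>

definition atom_tri :: "real \<Rightarrow> real \<Rightarrow> 'a::euclidean_space set \<Rightarrow> ('a \<Rightarrow> real) \<Rightarrow> 'a set \<Rightarrow> ('a \<Rightarrow> real) \<Rightarrow> 'a set \<Rightarrow> ('a \<Rightarrow> real) \<Rightarrow> real" where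
  "atom_tri \<epsilon> T A1 m1 A2 m2 A3 m3 = (\<Sum>x\<in>A1. \<Sum>y\<in>A2. \<Sum>z\<in>A3. m1 x * m2 y * m3 z * thick \<epsilon> ((norm (x - z))\<^sup>2 - T * (norm (x - y))\<^sup>2))"

lemma thick_lipschitz:
  assumes "\<epsilon> > 0"
  shows "\<bar>thick \<epsilon> u - thick \<epsilon> v\<bar> \<le> \<bar>u - v\<bar> / \<epsilon>\<^sup>2"
proof -
  have "\<bar>thick \<epsilon> u - thick \<epsilon> v\<bar> = \<bar>exp (- (u / \<epsilon>)\<^sup>2) - exp (- (v / \<epsilon>)\<^sup>2)\<bar> / \<epsilon>"
    using assms unfolding thick_def by (simp flip: diff_divide_distrib)
  also have "\<dots> \<le> \<bar>u / \<epsilon> - v / \<epsilon>\<bar> / \<epsilon>"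
    using assms by (intro divide_right_mono gaussian_lipschitz) auto
  also have "\<dots> = \<bar>u - v\<bar> / \<epsilon>\<^sup>2"
    using assms by (simp add: power2_eq_square flip: diff_divide_distrib)
  finally show ?thesis .
qed

text \<open>The cross term is linear in the displacement. It is split as \<open>\<rho>\<close> plus
  a square divided by \<open>\<rho>\<close>, so that in the application second moments of the heat
  kernels suffice; \<open>\<rho>\<close> is optimised later.\<close>

lemma norm_square_perturb:
  fixes p q \<xi> \<zeta> :: "'a::real_inner"
  assumes "norm p \<le> R" "norm q \<le> R" "\<rho> > 0"
  shows "\<bar>(norm ((p + \<xi>) - (q + \<zeta>)))\<^sup>2 - (norm (p - q))\<^sup>2\<bar> \<le> (1 + 4 * R / \<rho>) * (2 * (norm \<xi>)\<^sup>2 + 2 * (norm \<zeta>)\<^sup>2) + 4 * R * \<rho>"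
proof -
  define w D where "w = p - q" and "D = \<xi> - \<zeta>"
  have R: "R \<ge> 0" using assms(1) norm_ge_zero order_trans by blast
  have w: "norm w \<le> 2 * R" unfolding w_def using assms norm_triangle_ineq4[of p q] by linarith
  have "(norm ((p + \<xi>) - (q + \<zeta>)))\<^sup>2 - (norm (p - q))\<^sup>2 = (norm D)\<^sup>2 + 2 * (w \<bullet> D)"
    unfolding w_def D_def by (simp add: power2_norm_eq_inner inner_simps inner_commute)
  moreover have "\<bar>w \<bullet> D\<bar> \<le> 2 * R * norm D"
    using Cauchy_Schwarz_ineq2[of w D] mult_right_mono[OF w norm_ge_zero[of D]] by linarith
  ultimately have 1: "\<bar>(norm ((p + \<xi>) - (q + \<zeta>)))\<^sup>2 - (norm (p - q))\<^sup>2\<bar> \<le> (norm D)\<^sup>2 + 4 * R * norm D"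
    using zero_le_power2[of "norm D"] by linarith
  have "norm D \<le> \<rho> + (norm D)\<^sup>2 / \<rho>"
  proof -
    have "0 \<le> (norm D - \<rho> / 2)\<^sup>2 + 3 / 4 * \<rho>\<^sup>2" by simp
    then have "norm D * \<rho> \<le> \<rho> * \<rho> + (norm D)\<^sup>2" by (simp add: power2_eq_square algebra_simps)
    then show ?thesis using assms(3) by (simp add: field_simps power2_eq_square)
  qed
  then have "4 * R * norm D \<le> 4 * R * (\<rho> + (norm D)\<^sup>2 / \<rho>)" using R by (intro mult_left_mono) auto
  then have "(norm D)\<^sup>2 + 4 * R * norm D \<le> (1 + 4 * R / \<rho>) * (norm D)\<^sup>2 + 4 * R * \<rho>"
    by (simp add: algebra_simps)
  also have "(1 + 4 * R / \<rho>) * (norm D)\<^sup>2 \<le> (1 + 4 * R / \<rho>) * (2 * (norm \<xi>)\<^sup>2 + 2 * (norm \<zeta>)\<^sup>2)"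
  proof (rule mult_left_mono)
    have "(norm D)\<^sup>2 + (norm (\<xi> + \<zeta>))\<^sup>2 = 2 * (norm \<xi>)\<^sup>2 + 2 * (norm \<zeta>)\<^sup>2"
      unfolding D_def by (simp add: power2_norm_eq_inner inner_simps inner_commute)
    then show "(norm D)\<^sup>2 \<le> 2 * (norm \<xi>)\<^sup>2 + 2 * (norm \<zeta>)\<^sup>2" by (smt (verit) zero_le_power2)
    show "0 \<le> 1 + 4 * R / \<rho>" using R assms(3) by simp
  qed
  finally show ?thesis using 1 by linarith
qed

text \<open>Doubling the time leaves a factor exp (- y) with y = |v|^2 / (8 s), and y exp (- y) <=
  1.\<close>

lemma norm_square_heat_le:
  fixes v :: "'a::euclidean_space"
  assumes "0 < s" "s \<le> \<sigma>"
  shows "(norm v)\<^sup>2 * heat s v \<le> (8 * \<sigma> * 2 powr (real DIM('a) / 2)) * heat (2 * s) v"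
proof -
  define y where "y = (norm v)\<^sup>2 / (8 * s)"
  have y: "y \<ge> 0" "(norm v)\<^sup>2 = 8 * s * y" using assms by (auto simp: y_def)
  have e: "exp (- (norm v)\<^sup>2 / (4 * s)) = exp (- y) * exp (- y)" using assms unfolding y_def by (simp flip: exp_add)
  have "y \<le> exp y" using exp_ge_add_one_self[of y] by linarith
  then have "y * exp (- y) \<le> 1" by (simp add: exp_minus field_simps)
  have p: "(4 * pi * s) powr (- (real DIM('a) / 2)) = 2 powr (real DIM('a) / 2) * (4 * pi * (2 * s)) powr (- (real DIM('a) / 2))"
  proof -
    have "4 * pi * (2 * s) = 2 * (4 * pi * s)" by simp
    then have "(4 * pi * (2 * s)) powr (- (real DIM('a) / 2)) = 2 powr (- (real DIM('a) / 2)) * (4 * pi * s) powr (- (real DIM('a) / 2))"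
      using assms by (simp only: powr_mult)
    then show ?thesis by (simp add: powr_minus)
  qed
  have h: "heat (2 * s) v = (4 * pi * (2 * s)) powr (- (real DIM('a) / 2)) * exp (- y)" by (simp add: heat_def y_def)
  have "(norm v)\<^sup>2 * heat s v = (8 * s * 2 powr (real DIM('a) / 2)) * heat (2 * s) v * (y * exp (- y))"
    unfolding h unfolding heat_def unfolding e p unfolding y(2) by (simp only: mult_ac)
  also have "\<dots> \<le> (8 * s * 2 powr (real DIM('a) / 2)) * heat (2 * s) v * 1"
    using \<open>y * exp (- y) \<le> 1\<close> assms by (intro mult_left_mono) auto
  also have "\<dots> \<le> (8 * \<sigma> * 2 powr (real DIM('a) / 2)) * heat (2 * s) v * 1"
    using assms by (intro mult_right_mono) auto
  finally show ?thesis by simp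
qed

lemma
  fixes f :: "'a::euclidean_space \<Rightarrow> real" and g h :: "'a \<Rightarrow> real"
  assumes "integrable lborel f" "integrable lborel g" "integrable lborel h"
  shows integrable_triple_product: "integrable (lborel \<Otimes>\<^sub>M (lborel \<Otimes>\<^sub>M lborel)) (\<lambda>(x, y, z). f x * g y * h z)"
    and integral_triple_product: "(\<integral>(x, y, z). f x * g y * h z \<partial>(lborel \<Otimes>\<^sub>M (lborel \<Otimes>\<^sub>M lborel))) = (\<integral>x. f x \<partial>lborel) * (\<integral>x. g x \<partial>lborel) * (\<integral>x. h x \<partial>lborel)"
proof -
  have i2: "integrable (lborel \<Otimes>\<^sub>M lborel) (\<lambda>(y, z). g y * h z)" by (rule integrable_lborel_pair_mult[OF assms(2,3)])
  then have i2': "integrable lborel (\<lambda>u. g (fst u) * h (snd u))" by (simp add: lborel_prod case_prod_unfold)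
  have i3: "integrable (lborel \<Otimes>\<^sub>M lborel) (\<lambda>(x, u). f x * (g (fst u) * h (snd u)))"
    by (rule integrable_lborel_pair_mult[OF assms(1) i2'])
  then show "integrable (lborel \<Otimes>\<^sub>M (lborel \<Otimes>\<^sub>M lborel)) (\<lambda>(x, y, z). f x * g y * h z)"
    by (simp add: lborel_prod case_prod_unfold mult.assoc)
  have "(\<integral>u. g (fst u) * h (snd u) \<partial>lborel) = (\<integral>y. \<integral>z. g y * h z \<partial>lborel \<partial>lborel)"
    using lborel_pair.integral_fst[OF i2] by (simp add: lborel_prod case_prod_unfold)
  then have 2: "(\<integral>u. g (fst u) * h (snd u) \<partial>lborel) = (\<integral>x. g x \<partial>lborel) * (\<integral>x. h x \<partial>lborel)" by simp
  have "(\<integral>(x, y, z). f x * g y * h z \<partial>(lborel \<Otimes>\<^sub>M (lborel \<Otimes>\<^sub>M lborel))) = (\<integral>x. \<integral>u. f x * (g (fst u) * h (snd u)) \<partial>lborel \<partial>lborel)"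
    using lborel_pair.integral_fst[OF i3] by (simp add: lborel_prod case_prod_unfold mult.assoc)
  then show "(\<integral>(x, y, z). f x * g y * h z \<partial>(lborel \<Otimes>\<^sub>M (lborel \<Otimes>\<^sub>M lborel))) = (\<integral>x. f x \<partial>lborel) * (\<integral>x. g x \<partial>lborel) * (\<integral>x. h x \<partial>lborel)"
    using 2 by simp
qed

text \<open>The heat kernels are probability densities concentrated near \<open>p1\<close>,
  \<open>p2\<close>, \<open>p3\<close>, and \<open>thick \<epsilon>\<close> has Lipschitz constant
  at most \<open>1 / \<epsilon>\<^sup>2\<close>. The error is therefore controlled by the mean
  displacement of the argument, that is by second moments of order \<sigma>.\<close>

lemma tri_heat_close:
  fixes p1 p2 p3 :: "'a::euclidean_space"
  assumes s: "0 < s1" "s1 \<le> \<sigma>" "0 < s2" "s2 \<le> \<sigma>" "0 < s3" "s3 \<le> \<sigma>"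
    and p: "norm p1 \<le> R" "norm p2 \<le> R" "norm p3 \<le> R" and T: "0 \<le> T" "T \<le> 1" and \<epsilon>: "\<epsilon> > 0" and \<rho>: "\<rho> > 0"
  shows "\<bar>tri_form \<epsilon> T (\<lambda>x. heat s1 (x - p1)) (\<lambda>x. heat s2 (x - p2)) (\<lambda>x. heat s3 (x - p3)) - thick \<epsilon> ((norm (p1 - p3))\<^sup>2 - T * (norm (p1 - p2))\<^sup>2)\<bar>
    \<le> ((1 + 4 * R / \<rho>) * 8 * (8 * \<sigma> * 2 powr (real DIM('a) / 2)) + 8 * R * \<rho>) / \<epsilon>\<^sup>2"
proof -
  let ?M = "lborel \<Otimes>\<^sub>M (lborel \<Otimes>\<^sub>M lborel) :: ('a \<times> 'a \<times> 'a) measure"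
  define \<Phi> where "\<Phi> x y z = (norm (x - z))\<^sup>2 - T * (norm (x - y))\<^sup>2" for x y z :: 'a
  define h1 h2 h3 where "h1 x = heat s1 (x - p1)" and "h2 x = heat s2 (x - p2)" and "h3 x = heat s3 (x - p3)" for x
  define k1 k2 k3 where "k1 x = heat (2 * s1) (x - p1)" and "k2 x = heat (2 * s2) (x - p2)" and "k3 x = heat (2 * s3) (x - p3)" for x
  define \<kappa> where "\<kappa> = 8 * \<sigma> * 2 powr (real DIM('a) / 2)"
  define c where "c = 1 + 4 * R / \<rho>"
  have R: "R \<ge> 0" using p(1) norm_ge_zero order_trans by blast
  have c: "c \<ge> 0" using R \<rho> by (simp add: c_def)
  have \<kappa>: "\<kappa> \<ge> 0" using s by (simp add: \<kappa>_def)
  have ih: "integrable lborel h1" "integrable lborel h2" "integrable lborel h3" and vh: "(\<integral>x. h1 x \<partial>lborel) = 1" "(\<integral>x. h2 x \<partial>lborel) = 1" "(\<integral>x. h3 x \<partial>lborel) = 1"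
    unfolding h1_def h2_def h3_def using s by (auto intro!: integrable_heat simp: integral_heat)
  have ik: "integrable lborel k1" "integrable lborel k2" "integrable lborel k3" and vk: "(\<integral>x. k1 x \<partial>lborel) = 1" "(\<integral>x. k2 x \<partial>lborel) = 1" "(\<integral>x. k3 x \<partial>lborel) = 1"
    unfolding k1_def k2_def k3_def using s by (auto intro!: integrable_heat simp: integral_heat)
  have h0: "h1 x \<ge> 0" "h2 x \<ge> 0" "h3 x \<ge> 0" for x by (auto simp: h1_def h2_def h3_def)
  have kh: "(norm (x - p1))\<^sup>2 * h1 x \<le> \<kappa> * k1 x" "(norm (x - p2))\<^sup>2 * h2 x \<le> \<kappa> * k2 x" "(norm (x - p3))\<^sup>2 * h3 x \<le> \<kappa> * k3 x" for x
    unfolding h1_def h2_def h3_def k1_def k2_def k3_def \<kappa>_def using s by (auto intro!: norm_square_heat_le)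
  \<comment> \<open>An integrable majorant. Its displacement term in \<open>x\<close> has
    coefficient 4 instead of 2 because \<open>x\<close> occurs in both distances; the total is 8 R
    \<rho> + 8 c \<kappa>.\<close>
  define B where "B = (\<lambda>(x, y, z). (8 * R * \<rho>) * (h1 x * h2 y * h3 z) + (4 * c * \<kappa>) * (k1 x * h2 y * h3 z) + (2 * c * \<kappa>) * (h1 x * k2 y * h3 z) + (2 * c * \<kappa>) * (h1 x * h2 y * k3 z))"
  have iB: "integrable ?M B"
    unfolding B_def case_prod_unfold
    using integrable_triple_product[OF ih(1,2,3)] integrable_triple_product[OF ik(1) ih(2,3)] integrable_triple_product[OF ih(1) ik(2) ih(3)] integrable_triple_product[OF ih(1,2) ik(3)]
    unfolding case_prod_unfold
    by (intro Bochner_Integration.integrable_add integrable_mult_right)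
  have vB: "integral\<^sup>L ?M B = 8 * R * \<rho> + 8 * c * \<kappa>"
    unfolding B_def case_prod_unfold
    using integrable_triple_product[OF ih(1,2,3)] integrable_triple_product[OF ik(1) ih(2,3)] integrable_triple_product[OF ih(1) ik(2) ih(3)] integrable_triple_product[OF ih(1,2) ik(3)]
      integral_triple_product[OF ih(1,2,3)] integral_triple_product[OF ik(1) ih(2,3)] integral_triple_product[OF ih(1) ik(2) ih(3)] integral_triple_product[OF ih(1,2) ik(3)]
    unfolding case_prod_unfold
    by (simp add: vh vk)
  have bound: "h1 x * h2 y * h3 z * \<bar>\<Phi> x y z - \<Phi> p1 p2 p3\<bar> \<le> B (x, y, z)" for x y z
  proof -
    define X Y Z where "X = (norm (x - p1))\<^sup>2" and "Y = (norm (y - p2))\<^sup>2" and "Z = (norm (z - p3))\<^sup>2"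
    have 1: "\<bar>(norm (x - z))\<^sup>2 - (norm (p1 - p3))\<^sup>2\<bar> \<le> c * (2 * X + 2 * Z) + 4 * R * \<rho>"
      using norm_square_perturb[OF p(1) p(3) \<rho>, of "x - p1" "z - p3"] by (simp add: X_def Z_def c_def)
    have "\<bar>(norm (x - y))\<^sup>2 - (norm (p1 - p2))\<^sup>2\<bar> \<le> c * (2 * X + 2 * Y) + 4 * R * \<rho>"
      using norm_square_perturb[OF p(1) p(2) \<rho>, of "x - p1" "y - p2"] by (simp add: X_def Y_def c_def)
    then have "T * \<bar>(norm (x - y))\<^sup>2 - (norm (p1 - p2))\<^sup>2\<bar> \<le> 1 * (c * (2 * X + 2 * Y) + 4 * R * \<rho>)"
      using T by (intro mult_mono) auto
    moreover have "\<bar>T * (norm (x - y))\<^sup>2 - T * (norm (p1 - p2))\<^sup>2\<bar> = T * \<bar>(norm (x - y))\<^sup>2 - (norm (p1 - p2))\<^sup>2\<bar>"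
      using T by (simp add: abs_mult flip: right_diff_distrib)
    ultimately have 2: "\<bar>T * (norm (x - y))\<^sup>2 - T * (norm (p1 - p2))\<^sup>2\<bar> \<le> c * (2 * X + 2 * Y) + 4 * R * \<rho>" by simp
    have "\<Phi> x y z - \<Phi> p1 p2 p3 = ((norm (x - z))\<^sup>2 - (norm (p1 - p3))\<^sup>2) - (T * (norm (x - y))\<^sup>2 - T * (norm (p1 - p2))\<^sup>2)"
      by (simp add: \<Phi>_def)
    then have "\<bar>\<Phi> x y z - \<Phi> p1 p2 p3\<bar> \<le> (c * (2 * X + 2 * Z) + 4 * R * \<rho>) + (c * (2 * X + 2 * Y) + 4 * R * \<rho>)"
      using order_trans[OF abs_triangle_ineq4 add_mono[OF 1 2]] by simp
    also have "\<dots> = 8 * R * \<rho> + 4 * c * X + 2 * c * Y + 2 * c * Z" by (simp add: algebra_simps)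
    finally have "h1 x * h2 y * h3 z * \<bar>\<Phi> x y z - \<Phi> p1 p2 p3\<bar> \<le> h1 x * h2 y * h3 z * (8 * R * \<rho> + 4 * c * X + 2 * c * Y + 2 * c * Z)"
      using h0 by (intro mult_left_mono) auto
    also have "\<dots> = (8 * R * \<rho>) * (h1 x * h2 y * h3 z) + (4 * c) * ((X * h1 x) * (h2 y * h3 z)) + (2 * c) * ((Y * h2 y) * (h1 x * h3 z)) + (2 * c) * ((Z * h3 z) * (h1 x * h2 y))"
      by (simp add: algebra_simps)
    also have "\<dots> \<le> (8 * R * \<rho>) * (h1 x * h2 y * h3 z) + (4 * c) * ((\<kappa> * k1 x) * (h2 y * h3 z)) + (2 * c) * ((\<kappa> * k2 y) * (h1 x * h3 z)) + (2 * c) * ((\<kappa> * k3 z) * (h1 x * h2 y))"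
      unfolding X_def Y_def Z_def using h0 c by (intro add_mono order_refl mult_left_mono mult_right_mono kh) auto
    also have "\<dots> = B (x, y, z)" by (simp add: B_def mult_ac)
    finally show ?thesis .
  qed
  let ?t = "thick \<epsilon> (\<Phi> p1 p2 p3)"
  have i1: "integrable ?M (\<lambda>(x, y, z). h1 x * h2 y * h3 z * thick \<epsilon> (\<Phi> x y z))"
    unfolding \<Phi>_def by (rule integrable_tri[OF ih \<epsilon>])
  have i2: "integrable ?M (\<lambda>(x, y, z). h1 x * h2 y * h3 z * ?t)"
    using integrable_mult_left[OF integrable_triple_product[OF ih], of ?t] by (simp add: case_prod_unfold)
  have v2: "(\<integral>(x, y, z). h1 x * h2 y * h3 z * ?t \<partial>?M) = ?t"
    using integral_triple_product[OF ih] vh by (simp add: case_prod_unfold)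
  have "tri_form \<epsilon> T h1 h2 h3 - ?t = (\<integral>(x, y, z). h1 x * h2 y * h3 z * (thick \<epsilon> (\<Phi> x y z) - ?t) \<partial>?M)"
    unfolding tri_form_def \<Phi>_def[symmetric] by (subst v2[symmetric], subst Bochner_Integration.integral_diff[symmetric, OF i1 i2]) (simp add: case_prod_unfold algebra_simps)
  also have "\<bar>\<dots>\<bar> \<le> (\<integral>u. B u / \<epsilon>\<^sup>2 \<partial>?M)"
  proof (rule integral_abs_bound[THEN order_trans], rule integral_mono')
    show "integrable ?M (\<lambda>u. B u / \<epsilon>\<^sup>2)" using iB by simp
    fix u :: "'a \<times> 'a \<times> 'a"
    obtain x y z where u: "u = (x, y, z)" by (cases u) auto
    have "h1 x * h2 y * h3 z * \<bar>thick \<epsilon> (\<Phi> x y z) - ?t\<bar> \<le> h1 x * h2 y * h3 z * (\<bar>\<Phi> x y z - \<Phi> p1 p2 p3\<bar> / \<epsilon>\<^sup>2)"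
      using h0 by (intro mult_left_mono thick_lipschitz \<epsilon>) auto
    also have "\<dots> \<le> B u / \<epsilon>\<^sup>2"
      using divide_right_mono[OF bound[of x y z], of "\<epsilon>\<^sup>2"] by (simp add: u)
    finally show le: "\<bar>case u of (x, y, z) \<Rightarrow> h1 x * h2 y * h3 z * (thick \<epsilon> (\<Phi> x y z) - ?t)\<bar> \<le> B u / \<epsilon>\<^sup>2"
      using h0 by (simp add: u abs_mult)
    then show "0 \<le> B u / \<epsilon>\<^sup>2" by (rule order_trans[rotated]) simp
  qed
  also have "(\<integral>u. B u / \<epsilon>\<^sup>2 \<partial>?M) = (8 * R * \<rho> + 8 * c * \<kappa>) / \<epsilon>\<^sup>2" using vB by simp
  finally have "\<bar>tri_form \<epsilon> T h1 h2 h3 - ?t\<bar> \<le> (8 * R * \<rho> + 8 * c * \<kappa>) / \<epsilon>\<^sup>2" .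
  moreover have "8 * R * \<rho> + 8 * c * \<kappa> = (1 + 4 * R / \<rho>) * 8 * (8 * \<sigma> * 2 powr (real DIM('a) / 2)) + 8 * R * \<rho>"
    by (simp add: c_def \<kappa>_def mult_ac)
  ultimately show ?thesis unfolding \<Phi>_def h1_def h2_def h3_def by simp
qed

lemma tri_sum:
  assumes "\<And>i. i \<in> I \<Longrightarrow> integrable lborel (f i)" "\<And>i. i \<in> J \<Longrightarrow> integrable lborel (g i)" "\<And>i. i \<in> L \<Longrightarrow> integrable lborel (h i)" "\<epsilon> > 0"
  shows "tri_form \<epsilon> T (\<lambda>x. \<Sum>i\<in>I. a i * f i x) (\<lambda>x. \<Sum>j\<in>J. b j * g j x) (\<lambda>x. \<Sum>l\<in>L. c l * h l x)
    = (\<Sum>i\<in>I. \<Sum>j\<in>J. \<Sum>l\<in>L. a i * b j * c l * tri_form \<epsilon> T (f i) (g j) (h l))"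
proof -
  have eq: "(\<Sum>i\<in>I. a i * f i x) * (\<Sum>j\<in>J. b j * g j y) * (\<Sum>l\<in>L. c l * h l z) * t = (\<Sum>i\<in>I. \<Sum>j\<in>J. \<Sum>l\<in>L. a i * b j * c l * (f i x * g j y * h l z * t))" for x y z t
  proof -
    have "(\<Sum>i\<in>I. a i * f i x) * ((\<Sum>j\<in>J. b j * g j y) * ((\<Sum>l\<in>L. c l * h l z) * t)) = (\<Sum>i\<in>I. \<Sum>j\<in>J. \<Sum>l\<in>L. (a i * f i x) * ((b j * g j y) * ((c l * h l z) * t)))"
      by (simp only: sum_distrib_right) (simp only: sum_distrib_left)
    then show ?thesis by (simp only: mult_ac)
  qed
  show ?thesis
    unfolding tri_form_def eq case_prod_unfold
    using integrable_tri[OF assms(1) assms(2) assms(3) assms(4), unfolded case_prod_unfold]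
    by (simp add: Bochner_Integration.integral_sum)
qed

text \<open>Single triples of kernels are compared with single triples of atoms and summed with the
  absolute weights. The threshold \<open>\<tau>1\<close> may depend on \<epsilon>, but not on the
  resolution of the weights.\<close>

lemma tri_moll_atoms:
  fixes K R \<epsilon> :: real
  assumes c1: "(\<Sum>l\<in>{1..N}. c l) = 1" and \<epsilon>: "\<epsilon> > 0" and e: "e > 0" and R: "R \<ge> 0"
  obtains \<tau>1 where "\<tau>1 > 0" "\<And>\<tau> T \<delta> (A1 :: 'a::euclidean_space set) m1 A2 m2 A3 m3. 0 < \<tau> \<Longrightarrow> \<tau> \<le> \<tau>1 \<Longrightarrow> 0 \<le> T \<Longrightarrow> T \<le> 1 \<Longrightarrow>
     frostman K \<alpha> \<delta> A1 m1 \<Longrightarrow> frostman K \<alpha> \<delta> A2 m2 \<Longrightarrow> frostman K \<alpha> \<delta> A3 m3 \<Longrightarrow> A1 \<subseteq> cball 0 R \<Longrightarrow> A2 \<subseteq> cball 0 R \<Longrightarrow> A3 \<subseteq> cball 0 R \<Longrightarrow>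
     \<bar>tri_form \<epsilon> T (moll N c \<tau> A1 m1) (moll N c \<tau> A2 m2) (moll N c \<tau> A3 m3) - atom_tri \<epsilon> T A1 m1 A2 m2 A3 m3\<bar> \<le> e"
proof -
  define Sc where "Sc = (\<Sum>l\<in>{1..N}. \<bar>c l\<bar>)"
  define Q where "Q = \<bar>K\<bar> * Sc"
  have Sc: "Sc \<ge> 0" by (simp add: Sc_def sum_nonneg)
  have Q: "Q \<ge> 0" using Sc by (simp add: Q_def)
  define P where "P = 64 * real N * 2 powr (real DIM('a) / 2)"
  have P: "P \<ge> 0" by (simp add: P_def)
  define E where "E = Q ^ 3 * ((1 + 4 * R) * P + 8 * R) / \<epsilon>\<^sup>2 + 1"
  have E: "E > 0" using Q R P \<epsilon> by (simp add: E_def add_nonneg_pos)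
  \<comment> \<open>The total error is at most \<open>E * sqrt \<tau>\<close>, so this threshold
    makes it at most \<open>e\<close>.\<close>
  define \<tau>1 where "\<tau>1 = min 1 ((e / E)\<^sup>2)"
  show thesis
  proof (rule that[of \<tau>1])
    show "\<tau>1 > 0" using e E by (simp add: \<tau>1_def)
    fix \<tau> T \<delta> :: real and A1 A2 A3 :: "'a set" and m1 m2 m3
    assume \<tau>: "0 < \<tau>" "\<tau> \<le> \<tau>1" and T: "0 \<le> T" "T \<le> 1"
      and F: "frostman K \<alpha> \<delta> A1 m1" "frostman K \<alpha> \<delta> A2 m2" "frostman K \<alpha> \<delta> A3 m3"
      and AR: "A1 \<subseteq> cball 0 R" "A2 \<subseteq> cball 0 R" "A3 \<subseteq> cball 0 R"
    \<comment> \<open>The error has terms of order \<tau> / \<rho> and \<rho>, which balance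
      here.\<close>
    define \<rho> where "\<rho> = sqrt \<tau>"
    have \<rho>: "\<rho> > 0" "\<rho>\<^sup>2 = \<tau>" "\<rho> \<le> 1" using \<tau> by (auto simp: \<rho>_def \<tau>1_def)
    define b where "b = ((1 + 4 * R / \<rho>) * 8 * (8 * (\<tau> * real N) * 2 powr (real DIM('a) / 2)) + 8 * R * \<rho>) / \<epsilon>\<^sup>2"
    let ?I = "\<lambda>A::'a set. A \<times> {1..N}"
    let ?q = "\<lambda>(m :: 'a \<Rightarrow> real) i. m (fst i) * c (snd i)"
    let ?h = "\<lambda>i x. heat (\<tau> * real (snd i)) (x - fst i :: 'a)"
    have q: "(\<Sum>i\<in>?I A. \<bar>?q m i\<bar>) \<le> Q" if "frostman K \<alpha> \<delta> A m" for A m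
      using moll_abs_weight_le[OF that, of c N] frostman_constant_nonneg[OF that] by (simp add: Q_def Sc_def)
    have t: "tri_form \<epsilon> T (moll N c \<tau> A1 m1) (moll N c \<tau> A2 m2) (moll N c \<tau> A3 m3)
       = (\<Sum>i\<in>?I A1. \<Sum>j\<in>?I A2. \<Sum>k\<in>?I A3. ?q m1 i * ?q m2 j * ?q m3 k * tri_form \<epsilon> T (?h i) (?h j) (?h k))"
      unfolding moll_def[abs_def] using \<tau> \<epsilon> by (intro tri_sum integrable_heat) auto
    \<comment> \<open>As the coefficients \<open>c\<close> sum to 1, the atomic sums can be taken
      over the same index pairs as the mollified ones, and the two forms can be subtracted term by
      term.\<close>
    have w: "(\<Sum>a\<in>A. m a * F a) = (\<Sum>i\<in>?I A. ?q m i * F (fst i))" for A :: "'a set" and m F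
    proof -
      have "(\<Sum>i\<in>?I A. ?q m i * F (fst i)) = (\<Sum>a\<in>A. m a * F a * (\<Sum>l\<in>{1..N}. c l))"
        unfolding sum.cartesian_product' sum_distrib_left by (simp add: mult_ac)
      then show ?thesis unfolding c1 by simp
    qed
    have a: "atom_tri \<epsilon> T A1 m1 A2 m2 A3 m3 = (\<Sum>i\<in>?I A1. \<Sum>j\<in>?I A2. \<Sum>k\<in>?I A3. ?q m1 i * ?q m2 j * ?q m3 k * thick \<epsilon> ((norm (fst i - fst k))\<^sup>2 - T * (norm (fst i - fst j))\<^sup>2))"
    proof -
      have "atom_tri \<epsilon> T A1 m1 A2 m2 A3 m3 = (\<Sum>x\<in>A1. m1 x * (\<Sum>y\<in>A2. m2 y * (\<Sum>z\<in>A3. m3 z * thick \<epsilon> ((norm (x - z))\<^sup>2 - T * (norm (x - y))\<^sup>2))))"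
        unfolding atom_tri_def by (simp only: sum_distrib_left mult.assoc)
      also have "\<dots> = (\<Sum>i\<in>?I A1. ?q m1 i * (\<Sum>j\<in>?I A2. ?q m2 j * (\<Sum>k\<in>?I A3. ?q m3 k * thick \<epsilon> ((norm (fst i - fst k))\<^sup>2 - T * (norm (fst i - fst j))\<^sup>2))))"
        unfolding w[of m1] w[of m2] w[of m3] ..
      finally show ?thesis by (simp only: sum_distrib_left mult.assoc)
    qed
    have single: "\<bar>tri_form \<epsilon> T (?h i) (?h j) (?h k) - thick \<epsilon> ((norm (fst i - fst k))\<^sup>2 - T * (norm (fst i - fst j))\<^sup>2)\<bar> \<le> b"
      if "i \<in> ?I A1" "j \<in> ?I A2" "k \<in> ?I A3" for i j k
      unfolding b_def using that AR \<tau>(1) by (intro tri_heat_close T \<epsilon> \<rho>(1)) auto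
    have b0: "b \<ge> 0" using R \<rho> \<tau> by (simp add: b_def)
    have "\<bar>tri_form \<epsilon> T (moll N c \<tau> A1 m1) (moll N c \<tau> A2 m2) (moll N c \<tau> A3 m3) - atom_tri \<epsilon> T A1 m1 A2 m2 A3 m3\<bar>
      = \<bar>\<Sum>i\<in>?I A1. \<Sum>j\<in>?I A2. \<Sum>k\<in>?I A3. ?q m1 i * ?q m2 j * ?q m3 k * (tri_form \<epsilon> T (?h i) (?h j) (?h k) - thick \<epsilon> ((norm (fst i - fst k))\<^sup>2 - T * (norm (fst i - fst j))\<^sup>2))\<bar>"
      unfolding t a by (simp only: sum_subtractf[symmetric] right_diff_distrib[symmetric])
    also have "\<dots> \<le> (\<Sum>i\<in>?I A1. \<Sum>j\<in>?I A2. \<Sum>k\<in>?I A3. \<bar>?q m1 i\<bar> * \<bar>?q m2 j\<bar> * \<bar>?q m3 k\<bar> * b)"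
    proof (rule order_trans[OF sum_abs], rule sum_mono, rule order_trans[OF sum_abs], rule sum_mono, rule order_trans[OF sum_abs], rule sum_mono)
      fix i j k assume "i \<in> ?I A1" "j \<in> ?I A2" "k \<in> ?I A3"
      then show "\<bar>?q m1 i * ?q m2 j * ?q m3 k * (tri_form \<epsilon> T (?h i) (?h j) (?h k) - thick \<epsilon> ((norm (fst i - fst k))\<^sup>2 - T * (norm (fst i - fst j))\<^sup>2))\<bar>
        \<le> \<bar>?q m1 i\<bar> * \<bar>?q m2 j\<bar> * \<bar>?q m3 k\<bar> * b"
        unfolding abs_mult[of "?q m1 i * ?q m2 j * ?q m3 k"] abs_mult[of "?q m1 i * ?q m2 j"] abs_mult[of "?q m1 i"]
        by (intro mult_left_mono single) auto
    qed
    also have "\<dots> = (\<Sum>i\<in>?I A1. \<bar>?q m1 i\<bar>) * ((\<Sum>j\<in>?I A2. \<bar>?q m2 j\<bar>) * ((\<Sum>k\<in>?I A3. \<bar>?q m3 k\<bar>) * b))"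
      by (simp only: mult.assoc sum_distrib_right) (simp only: sum_distrib_left)
    also have "\<dots> \<le> Q * (Q * (Q * b))"
      using b0 Q by (intro mult_mono q F) (auto simp: sum_nonneg intro!: mult_nonneg_nonneg)
    also have "\<dots> = Q ^ 3 * b" by (simp add: power3_eq_cube mult.assoc)
    also have "\<dots> \<le> Q ^ 3 * (((1 + 4 * R) * P + 8 * R) / \<epsilon>\<^sup>2 * \<rho>)"
    proof (rule mult_left_mono)
      have "(1 + 4 * R / \<rho>) * \<tau> \<le> (1 + 4 * R) * \<rho>"
      proof -
        have "(1 + 4 * R / \<rho>) * \<tau> = \<rho> * \<rho> + 4 * R * \<rho>" using \<rho> by (simp add: \<rho>(2)[symmetric] power2_eq_square field_simps)
        also have "\<rho> * \<rho> \<le> 1 * \<rho>" using \<rho> by (intro mult_right_mono) auto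
        finally show ?thesis by (simp add: algebra_simps)
      qed
      then have "(1 + 4 * R / \<rho>) * \<tau> * P \<le> (1 + 4 * R) * \<rho> * P" using P by (rule mult_right_mono)
      moreover have "(1 + 4 * R / \<rho>) * 8 * (8 * (\<tau> * real N) * 2 powr (real DIM('a) / 2)) = (1 + 4 * R / \<rho>) * \<tau> * P"
        by (simp add: P_def mult_ac)
      ultimately have "(1 + 4 * R / \<rho>) * 8 * (8 * (\<tau> * real N) * 2 powr (real DIM('a) / 2)) + 8 * R * \<rho> \<le> ((1 + 4 * R) * P + 8 * R) * \<rho>"
        by (simp add: algebra_simps)
      then show "b \<le> ((1 + 4 * R) * P + 8 * R) / \<epsilon>\<^sup>2 * \<rho>"
        unfolding b_def times_divide_eq_left by (intro divide_right_mono) auto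
    qed (use Q in auto)
    also have "\<dots> \<le> E * \<rho>" unfolding E_def using \<rho> by (simp add: algebra_simps)
    also have "\<dots> \<le> e"
    proof -
      have "\<rho> \<le> sqrt ((e / E)\<^sup>2)" unfolding \<rho>_def using \<tau> by (intro real_sqrt_le_mono) (simp add: \<tau>1_def)
      then have "\<rho> \<le> e / E" using e E by simp
      then show ?thesis using E by (simp add: field_simps)
    qed
    finally show "\<bar>tri_form \<epsilon> T (moll N c \<tau> A1 m1) (moll N c \<tau> A2 m2) (moll N c \<tau> A3 m3) - atom_tri \<epsilon> T A1 m1 A2 m2 A3 m3\<bar> \<le> e" .
  qed
qed

section \<open>Frostman weights on finite sets\<close>

text \<open>Bottom-up construction: start with saturated cells at level \<open>n\<close> and, going up, scale down the weights inside every
  cell that violates its bound. Each point then lies in a saturated cell of some level.\<close>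

lemma tree_weights:
  fixes cell :: "nat \<Rightarrow> 'a \<Rightarrow> 'c" and W :: "nat \<Rightarrow> real"
  assumes A: "finite A" and W: "\<And>j. W j > 0"
    and refine: "\<And>j k x y. k \<le> j \<Longrightarrow> cell j x = cell j y \<Longrightarrow> cell k x = cell k y"
    and "k \<le> n"
  shows "\<exists>m. (\<forall>a\<in>A. m a \<ge> 0) \<and> (\<forall>j v. k \<le> j \<longrightarrow> j \<le> n \<longrightarrow> sum m {a\<in>A. cell j a = v} \<le> W j) \<and>
     (\<forall>a\<in>A. \<exists>j. k \<le> j \<and> j \<le> n \<and> sum m {b\<in>A. cell j b = cell j a} = W j)"
  using \<open>k \<le> n\<close>
proof (induction k rule: inc_induct)
  case base
  \<comment> \<open>At the finest level the mass \<open>W n\<close> is shared equally by the points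
    of each occupied cell.\<close>
  define m where "m a = W n / real (card {b\<in>A. cell n b = cell n a})" for a
  have s: "sum m {b\<in>A. cell n b = cell n a} = W n" if "a \<in> A" for a
  proof -
    have "sum m {b\<in>A. cell n b = cell n a} = (\<Sum>b\<in>{b\<in>A. cell n b = cell n a}. W n / real (card {b\<in>A. cell n b = cell n a}))"
      by (intro sum.cong) (auto simp: m_def)
    also have "\<dots> = W n"
      using that A by (subst sum_constant) (auto simp: card_eq_0_iff)
    finally show ?thesis .
  qed
  have "sum m {a\<in>A. cell n a = v} \<le> W n" for v
  proof (cases "\<exists>a\<in>A. cell n a = v")
    case True
    then obtain a where "a \<in> A" "v = cell n a" by blast
    then show ?thesis using s[of a] by (simp only: order_refl)
  next
    case False
    then have e: "{a\<in>A. cell n a = v} = {}" by auto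
    show ?thesis unfolding e using W[of n] by simp
  qed
  moreover have "m a \<ge> 0" for a using W[of n] by (simp add: m_def less_imp_le)
  ultimately show ?case using s by (intro exI[of _ m] conjI ballI allI impI) (auto dest: le_antisym)
next
  case (step k)
  from step.IH obtain m where m: "(\<forall>a\<in>A. m a \<ge> 0) \<and> (\<forall>j v. Suc k \<le> j \<longrightarrow> j \<le> n \<longrightarrow> sum m {a\<in>A. cell j a = v} \<le> W j) \<and>
     (\<forall>a\<in>A. \<exists>j. Suc k \<le> j \<and> j \<le> n \<and> sum m {b\<in>A. cell j b = cell j a} = W j)"
    by (rule exE)
  have m0: "m a \<ge> 0" if "a \<in> A" for a using m that by simp
  have mW: "sum m {a\<in>A. cell j a = v} \<le> W j" if "Suc k \<le> j" "j \<le> n" for j v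
    using conjunct1[OF conjunct2[OF m]] that by simp
  have ms: "\<exists>j. Suc k \<le> j \<and> j \<le> n \<and> sum m {b\<in>A. cell j b = cell j a} = W j" if "a \<in> A" for a
    using conjunct2[OF conjunct2[OF m]] that by blast
  define s where "s a = sum m {b\<in>A. cell k b = cell k a}" for a
  \<comment> \<open>Only overfull cells of level \<open>k\<close> are rescaled, and they become
    saturated.\<close>
  define m' where "m' a = (if s a > W k then m a * (W k / s a) else m a)" for a
  have s_cong: "s b = s a" if "cell k b = cell k a" for a b using that by (simp add: s_def)
  have le: "0 \<le> m' a \<and> m' a \<le> m a" if "a \<in> A" for a
  proof (cases "s a > W k")
    case True
    then have q: "0 \<le> W k / s a" "W k / s a \<le> 1" using W[of k] by auto
    have "m' a = m a * (W k / s a)" using True by (simp only: m'_def if_True)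
    then show ?thesis using mult_nonneg_nonneg[OF m0[OF that] q(1)] mult_left_mono[OF q(2) m0[OF that]] by (simp only: mult_1_right)
  qed (use m0[OF that] in \<open>auto simp: m'_def\<close>)
  have top: "sum m' {b\<in>A. cell k b = cell k a} = (if s a > W k then W k else s a)" for a
  proof -
    have "sum m' {b\<in>A. cell k b = cell k a} = (\<Sum>b\<in>{b\<in>A. cell k b = cell k a}. if s a > W k then m b * (W k / s a) else m b)"
    proof (intro sum.cong refl)
      fix b assume "b \<in> {b\<in>A. cell k b = cell k a}"
      then have "s b = s a" by (intro s_cong) simp
      then show "m' b = (if s a > W k then m b * (W k / s a) else m b)" by (simp only: m'_def)
    qed
    also have "\<dots> = (if s a > W k then W k else s a)"
    proof (cases "s a > W k")
      case True
      then have "(\<Sum>b\<in>{b\<in>A. cell k b = cell k a}. if s a > W k then m b * (W k / s a) else m b) = s a * (W k / s a)"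
        by (simp only: if_True sum_distrib_right[symmetric] s_def[symmetric])
      then show ?thesis using True W[of k] by simp
    qed (simp add: s_def)
    finally show ?thesis .
  qed
  have f1: "sum m' {a\<in>A. cell j a = v} \<le> W j" if j: "k \<le> j" "j \<le> n" for j v
  proof (cases "j = k")
    case True
    show ?thesis
    proof (cases "\<exists>a\<in>A. cell k a = v")
      case True
      then obtain a where a: "a \<in> A" "v = cell k a" by blast
      then show ?thesis using top[of a] \<open>j = k\<close> by (cases "s a > W k") (simp_all only: if_True if_False not_less order_refl)
    next
      case False
      then have e: "{a\<in>A. cell j a = v} = {}" using \<open>j = k\<close> by auto
      show ?thesis unfolding e using W[of j] by simp
    qed
  next
    case False
    then have "sum m' {a\<in>A. cell j a = v} \<le> sum m {a\<in>A. cell j a = v}" using le by (intro sum_mono) auto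
    also have "\<dots> \<le> W j" using False j by (intro mW) auto
    finally show ?thesis .
  qed
  have f2: "\<exists>j. k \<le> j \<and> j \<le> n \<and> sum m' {b\<in>A. cell j b = cell j a} = W j" if a: "a \<in> A" for a
  proof (cases "s a > W k")
    case True
    then show ?thesis using top[of a] step.hyps by (intro exI[of _ k]) auto
  next
    case False
    obtain j where j: "Suc k \<le> j" "j \<le> n" "sum m {b\<in>A. cell j b = cell j a} = W j" using ms[OF a] by auto
    \<comment> \<open>If the level \<open>k\<close> cell of \<open>a\<close> is not overfull,
      nothing inside it changes; by refinement it contains the saturated cell of level
      \<open>j\<close> found before, which therefore stays saturated.\<close>
    have "sum m' {b\<in>A. cell j b = cell j a} = sum m {b\<in>A. cell j b = cell j a}"
    proof (intro sum.cong refl)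
      fix b assume "b \<in> {b\<in>A. cell j b = cell j a}"
      then have "cell k b = cell k a" using refine[of k j b a] j by auto
      then have "s b = s a" by (rule s_cong)
      then show "m' b = m b" using False by (simp add: m'_def)
    qed
    then show ?thesis using j by (intro exI[of _ j]) auto
  qed
  show ?case by (intro exI[of _ m'] conjI ballI allI impI f1 f2) (use le in auto)
qed

text \<open>The coarsest saturated cells around the points are pairwise disjoint on
  \<open>A\<close>, since cells are nested. They cover \<open>A\<close>, so the total mass is the
  sum of their bounds \<open>W\<close>.\<close>

lemma tree_weights_total:
  fixes cell :: "nat \<Rightarrow> 'a \<Rightarrow> 'c" and W :: "nat \<Rightarrow> real"
  assumes A: "finite A"
    and refine: "\<And>j k x y. k \<le> j \<Longrightarrow> cell j x = cell j y \<Longrightarrow> cell k x = cell k y"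
    and sat: "\<And>a. a \<in> A \<Longrightarrow> \<exists>j. j \<le> n \<and> sum m {b\<in>A. cell j b = cell j a} = W j"
  obtains C where "finite C" "\<And>c. c \<in> C \<Longrightarrow> fst c \<le> n" "sum m A = (\<Sum>c\<in>C. W (fst c))" "\<And>a. a \<in> A \<Longrightarrow> \<exists>c\<in>C. cell (fst c) a = snd c"
proof -
  define S where "S j a \<longleftrightarrow> j \<le> n \<and> sum m {b\<in>A. cell j b = cell j a} = W j" for j a
  \<comment> \<open>Small indices are coarse levels, so the least index is the largest saturated
    cell containing \<open>a\<close>.\<close>
  define l where "l a = (LEAST j. S j a)" for a
  have l: "S (l a) a" if a: "a \<in> A" for a
  proof -
    obtain j where "S j a" using sat[OF a] by (auto simp: S_def)
    then show ?thesis unfolding l_def by (rule LeastI)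
  qed
  have l_le: "l a \<le> j" if "S j a" for j a using that unfolding l_def by (rule Least_le)
  have S_cong: "S j a \<longleftrightarrow> S j b" if "cell j a = cell j b" for j a b using that by (simp add: S_def)
  define \<pi> where "\<pi> a = (l a, cell (l a) a)" for a
  have \<pi>: "{b\<in>A. \<pi> b = \<pi> a} = {b\<in>A. cell (l a) b = cell (l a) a}" if a: "a \<in> A" for a
  proof (intro Collect_cong conj_cong refl)
    fix b assume b: "b \<in> A"
    show "\<pi> b = \<pi> a \<longleftrightarrow> cell (l a) b = cell (l a) a"
    proof
      assume c: "cell (l a) b = cell (l a) a"
      have "S (l a) b" using l[OF a] S_cong[OF c] by simp
      then have 1: "l b \<le> l a" by (rule l_le)
      have "cell (l b) b = cell (l b) a" using refine[OF 1 c] .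
      then have "S (l b) a" using l[OF b] S_cong by blast
      then have "l a \<le> l b" by (rule l_le)
      with 1 c show "\<pi> b = \<pi> a" by (simp add: \<pi>_def)
    qed (auto simp: \<pi>_def)
  qed
  show thesis
  proof
    show "finite (\<pi> ` A)" using A by simp
    show "fst c \<le> n" if "c \<in> \<pi> ` A" for c using that l by (auto simp: \<pi>_def S_def)
    show "\<exists>c\<in>\<pi> ` A. cell (fst c) a = snd c" if "a \<in> A" for a using that by (auto simp: \<pi>_def)
    have "sum m A = (\<Sum>c\<in>\<pi> ` A. sum m {b\<in>A. \<pi> b = c})" by (rule sum.image_gen[OF A])
    also have "\<dots> = (\<Sum>c\<in>\<pi> ` A. W (fst c))"
    proof (intro sum.cong refl)
      fix c assume "c \<in> \<pi> ` A"
      then obtain a where a: "a \<in> A" "c = \<pi> a" by auto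
      show "sum m {b\<in>A. \<pi> b = c} = W (fst c)"
        unfolding a(2) \<pi>[OF a(1)] using l[OF a(1)] by (simp add: S_def \<pi>_def)
    qed
    finally show "sum m A = (\<Sum>c\<in>\<pi> ` A. W (fst c))" .
  qed
qed

text \<open>The integer index of the half-open cube of side 2^-k containing \<open>x\<close>.
  Restriction to \<open>Basis\<close> makes indices extensional, so that they lie in a finite
  \<open>PiE\<close>.\<close>

definition dyadic :: "nat \<Rightarrow> 'a::euclidean_space \<Rightarrow> 'a \<Rightarrow> int" where
  "dyadic k x = (\<lambda>b\<in>Basis. \<lfloor>2 ^ k * (x \<bullet> b)\<rfloor>)"

lemma dyadic_refine:
  assumes "k \<le> j" "dyadic j x = dyadic j y"
  shows "dyadic k x = dyadic k y"
proof
  fix b :: 'a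
  show "dyadic k x b = dyadic k y b"
  proof (cases "b \<in> Basis")
    case True
    have eq: "\<lfloor>2 ^ j * (x \<bullet> b)\<rfloor> = \<lfloor>2 ^ j * (y \<bullet> b)\<rfloor>"
      using fun_cong[OF assms(2), of b] True by (simp add: dyadic_def)
    have "2 ^ k * t = 2 ^ j * t / real_of_int (2 ^ (j - k))" for t :: real
    proof -
      have "(2::real) ^ j = 2 ^ k * 2 ^ (j - k)" using assms(1) by (simp flip: power_add)
      then show ?thesis by simp
    qed
    then have "\<lfloor>2 ^ k * t\<rfloor> = \<lfloor>2 ^ j * t\<rfloor> div 2 ^ (j - k)" for t :: real
      using floor_divide_real_eq_div[of "2 ^ (j - k)" "2 ^ j * t"] by simp
    then show ?thesis using eq True by (simp add: dyadic_def)
  qed (simp add: dyadic_def)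
qed

lemma dyadic_dist:
  fixes x y :: "'a::euclidean_space"
  assumes "dyadic k x = dyadic k y"
  shows "dist x y \<le> real DIM('a) * (1 / 2) ^ k"
proof -
  have "norm (x - y) \<le> (\<Sum>b\<in>Basis. \<bar>(x - y) \<bullet> b\<bar>)" by (rule norm_le_l1)
  also have "\<dots> \<le> (\<Sum>b\<in>(Basis::'a set). (1 / 2) ^ k)"
  proof (rule sum_mono)
    fix b :: 'a assume b: "b \<in> Basis"
    have "\<lfloor>2 ^ k * (x \<bullet> b)\<rfloor> = \<lfloor>2 ^ k * (y \<bullet> b)\<rfloor>"
      using fun_cong[OF assms, of b] b by (simp add: dyadic_def)
    then have "\<bar>2 ^ k * (x \<bullet> b) - 2 ^ k * (y \<bullet> b)\<bar> \<le> 1" by linarith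
    then have "2 ^ k * \<bar>(x - y) \<bullet> b\<bar> \<le> 1" by (simp add: inner_diff_left abs_mult flip: right_diff_distrib)
    then show "\<bar>(x - y) \<bullet> b\<bar> \<le> (1 / 2) ^ k" by (simp add: power_one_over field_simps)
  qed
  finally show ?thesis by (simp add: dist_norm)
qed

text \<open>Each coordinate index changes by at most 1, so a ball of radius 2^-k meets at most 3^d
  cubes of side 2^-k.\<close>

lemma dyadic_near:
  fixes x y :: "'a::euclidean_space"
  assumes "dist x y \<le> (1 / 2) ^ k"
  shows "dyadic k y \<in> PiE Basis (\<lambda>b. {dyadic k x b - 1..dyadic k x b + 1})"
proof (rule PiE_I)
  fix b :: 'a assume b: "b \<in> Basis"
  have "\<bar>(x - y) \<bullet> b\<bar> \<le> (1 / 2) ^ k" using Basis_le_norm[OF b, of "x - y"] assms by (simp add: dist_norm)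
  then have "2 ^ k * \<bar>(x - y) \<bullet> b\<bar> \<le> 1" by (simp add: power_one_over field_simps)
  then have "\<bar>2 ^ k * (x \<bullet> b) - 2 ^ k * (y \<bullet> b)\<bar> \<le> 1" by (simp add: inner_diff_left abs_mult flip: right_diff_distrib)
  then have "\<lfloor>2 ^ k * (x \<bullet> b)\<rfloor> - 1 \<le> \<lfloor>2 ^ k * (y \<bullet> b)\<rfloor>" "\<lfloor>2 ^ k * (y \<bullet> b)\<rfloor> \<le> \<lfloor>2 ^ k * (x \<bullet> b)\<rfloor> + 1" by linarith+
  then show "dyadic k y b \<in> {dyadic k x b - 1..dyadic k x b + 1}" using b by (simp add: dyadic_def)
qed (simp add: dyadic_def)

lemma finite_dyadic_image:
  fixes E :: "'a::euclidean_space set"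
  assumes "bounded E"
  shows "finite (dyadic k ` E)"
proof -
  obtain B where B: "\<And>x. x \<in> E \<Longrightarrow> norm x \<le> B" using assms by (auto simp: bounded_iff)
  define N where "N = \<lceil>2 ^ k * B\<rceil> + 1"
  have "dyadic k x \<in> PiE Basis (\<lambda>_. {- N..N})" if "x \<in> E" for x
  proof (rule PiE_I)
    fix b :: 'a assume b: "b \<in> Basis"
    have "\<bar>x \<bullet> b\<bar> \<le> B" using Basis_le_norm[OF b, of x] B[OF that] by linarith
    then have "2 ^ k * \<bar>x \<bullet> b\<bar> \<le> 2 ^ k * B" by (intro mult_left_mono) auto
    then have "\<bar>2 ^ k * (x \<bullet> b)\<bar> \<le> 2 ^ k * B" by (simp add: abs_mult)
    then have "- N \<le> \<lfloor>2 ^ k * (x \<bullet> b)\<rfloor>" "\<lfloor>2 ^ k * (x \<bullet> b)\<rfloor> \<le> N" unfolding N_def by linarith+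
    then show "dyadic k x b \<in> {- N..N}" using b by (simp add: dyadic_def)
  qed (simp add: dyadic_def)
  then have "dyadic k ` E \<subseteq> PiE Basis (\<lambda>_. {- N..N})" by auto
  moreover have "finite (PiE (Basis :: 'a set) (\<lambda>_. {- N..N}))" by (intro finite_PiE) auto
  ultimately show ?thesis by (rule finite_subset)
qed

text \<open>Below the dimension the measure is nonzero, hence the content is positive for some
  \<delta>. Covers by sets of diameter at most \<delta> are bounded below by that content, and a
  cover with a larger set already has sum above \<open>\<delta> powr \<alpha>\<close>.\<close>

lemma finite_cover_lower_bound:
  fixes E :: "'a::metric_space set"
  assumes "0 < \<alpha>" "\<alpha> < hausdorff_dim E"
  obtains c :: real where "c > 0" "\<And>(C :: 'i set) U. finite C \<Longrightarrow> E \<subseteq> (\<Union>i\<in>C. U i) \<Longrightarrow> (\<And>i. i \<in> C \<Longrightarrow> bounded (U i)) \<Longrightarrow>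
     c \<le> (\<Sum>i\<in>C. diameter (U i) powr \<alpha>)"
proof -
  have "hausdorff_measure \<alpha> E \<noteq> 0"
  proof
    assume "hausdorff_measure \<alpha> E = 0"
    then have "Inf {s. 0 \<le> s \<and> hausdorff_measure s E = 0} \<le> \<alpha>"
      using assms(1) by (intro cInf_lower) (auto simp: bdd_below_def)
    then show False using assms(2) by (simp add: hausdorff_dim_def)
  qed
  then obtain \<delta> where \<delta>: "\<delta> > 0" "hausdorff_content \<alpha> \<delta> E > 0"
    unfolding hausdorff_measure_def by (auto simp: SUP_eq_iff zero_less_iff_neq_zero)
  define h where "h = enn2real (min 1 (hausdorff_content \<alpha> \<delta> E))"
  have h: "h > 0" "ennreal h \<le> hausdorff_content \<alpha> \<delta> E"
  proof -
    have "min 1 (hausdorff_content \<alpha> \<delta> E) < top" by (simp add: min_less_iff_disj)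
    then show "ennreal h \<le> hausdorff_content \<alpha> \<delta> E" "h > 0"
      using \<delta>(2) by (auto simp: h_def enn2real_positive_iff)
  qed
  show thesis
  proof (rule that[of "min h (\<delta> powr \<alpha>)"])
    show "min h (\<delta> powr \<alpha>) > 0" using h \<delta> by simp
    fix C :: "'i set" and U :: "'i \<Rightarrow> 'a set"
    assume C: "finite C" and cov: "E \<subseteq> (\<Union>i\<in>C. U i)" and bd: "\<And>i. i \<in> C \<Longrightarrow> bounded (U i)"
    show "min h (\<delta> powr \<alpha>) \<le> (\<Sum>i\<in>C. diameter (U i) powr \<alpha>)"
    proof (cases "\<forall>i\<in>C. diameter (U i) \<le> \<delta>")
      case False
      then obtain i where i: "i \<in> C" "diameter (U i) > \<delta>" by auto
      then have "\<delta> powr \<alpha> \<le> diameter (U i) powr \<alpha>" using \<delta> assms by (intro powr_mono2) auto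
      also have "\<dots> \<le> (\<Sum>i\<in>C. diameter (U i) powr \<alpha>)" using C i by (intro member_le_sum) auto
      finally show ?thesis by simp
    next
      case True
      obtain g where g: "bij_betw g {..<card C} C"
        using ex_bij_betw_nat_finite[OF C] by (auto simp: atLeast0LessThan)
      \<comment> \<open>The finite cover is continued by empty sets, which contribute nothing
        because their diameter is 0 and \<open>0 powr \<alpha> = 0\<close>.\<close>
      define V where "V i = (if i < card C then U (g i) else {})" for i
      have gC: "g i \<in> C" if "i < card C" for i using g that by (auto simp: bij_betw_def)
      have "E \<subseteq> (\<Union>i. V i)"
      proof
        fix x assume "x \<in> E"
        then obtain c where c: "c \<in> C" "x \<in> U c" using cov by auto
        from c(1) have "c \<in> g ` {..<card C}" using g by (simp add: bij_betw_def)
        then obtain i where "i < card C" "g i = c" by auto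
        then show "x \<in> (\<Union>i. V i)" using c by (auto simp: V_def intro!: exI[of _ i])
      qed
      moreover have "bounded (V i) \<and> diameter (V i) \<le> \<delta>" for i
        using True bd gC \<delta> by (auto simp: V_def)
      ultimately have "hausdorff_content \<alpha> \<delta> E \<le> (\<Sum>i. ennreal (diameter (V i) powr \<alpha>))"
        unfolding hausdorff_content_def by (intro INF_lower) auto
      also have "\<dots> = (\<Sum>i<card C. ennreal (diameter (V i) powr \<alpha>))"
        by (intro suminf_finite) (auto simp: V_def)
      also have "\<dots> = ennreal (\<Sum>i<card C. diameter (V i) powr \<alpha>)" by (intro sum_ennreal) auto
      also have "(\<Sum>i<card C. diameter (V i) powr \<alpha>) = (\<Sum>i<card C. diameter (U (g i)) powr \<alpha>)" by (simp add: V_def)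
      also have "\<dots> = (\<Sum>i\<in>C. diameter (U i) powr \<alpha>)" by (rule sum.reindex_bij_betw[OF g])
      finally have "ennreal h \<le> ennreal (\<Sum>i\<in>C. diameter (U i) powr \<alpha>)" using h(2) by (rule order_trans[rotated])
      then show ?thesis by (simp add: ennreal_le_iff sum_nonneg)
    qed
  qed
qed

text \<open>Frostman's lemma at finite resolution, with the weights of \<open>tree_weights\<close>
  on one point of each occupied cube. The saturated cubes cover all of \<open>E\<close>, so the
  positive lower bound for covers bounds the total mass from below by a constant independent of
  \<open>n\<close>.\<close>

lemma finite_frostman:
  fixes E :: "'a::euclidean_space set"
  assumes "bounded E" "0 < \<alpha>" "\<alpha> < hausdorff_dim E"
  obtains K c :: real where "K > 0" "c > 0" "\<And>n. \<exists>A m. A \<subseteq> E \<and> frostman K \<alpha> ((1 / 2) ^ n) A m \<and> c \<le> sum m A"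
proof -
  obtain c1 where c1: "c1 > 0" "\<And>(C :: (nat \<times> ('a \<Rightarrow> int)) set) U. finite C \<Longrightarrow> E \<subseteq> (\<Union>i\<in>C. U i) \<Longrightarrow> (\<And>i. i \<in> C \<Longrightarrow> bounded (U i)) \<Longrightarrow>
     c1 \<le> (\<Sum>i\<in>C. diameter (U i) powr \<alpha>)"
    using finite_cover_lower_bound[OF assms(2,3), where 'i="nat \<times> ('a \<Rightarrow> int)"] by blast
  define d where "d = real DIM('a)"
  have d: "d > 0" by (simp add: d_def)
  define W where "W j = ((1 / 2) ^ j) powr \<alpha>" for j :: nat
  have W: "W j > 0" for j by (simp add: W_def)
  \<comment> \<open>The first entry bounds the total mass by the number of unit cubes. The second
    bounds the mass of balls: 3^d cubes of side at most 2 r.\<close>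
  define K where "K = max (real (card (dyadic 0 ` E))) (3 ^ DIM('a) * 2 powr \<alpha>)"
  show thesis
  proof (rule that[of K "c1 / d powr \<alpha>"])
    show "K > 0" by (simp add: K_def less_max_iff_disj)
    show "c1 / d powr \<alpha> > 0" using c1 d by simp
    fix n
    \<comment> \<open>One representative for each cube of level \<open>n\<close> that meets
      \<open>E\<close>. Every point of \<open>E\<close> shares its level \<open>n\<close> cube with
      a representative, so coarser cubes covering \<open>A\<close> also cover
      \<open>E\<close>.\<close>
    define rep where "rep v = (SOME x. x \<in> E \<and> dyadic n x = v)" for v
    define A where "A = rep ` (dyadic n ` E)"
    have rep: "rep (dyadic n x) \<in> E \<and> dyadic n (rep (dyadic n x)) = dyadic n x" if "x \<in> E" for x
      unfolding rep_def by (rule someI[of _ x]) (use that in simp)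
    have finA: "finite A" unfolding A_def using finite_dyadic_image[OF assms(1)] by simp
    have AE: "A \<subseteq> E" unfolding A_def using rep by auto
    from tree_weights[where cell=dyadic and W=W and n=n and k=0, OF finA W dyadic_refine le0]
    obtain m where m: "(\<forall>a\<in>A. m a \<ge> 0) \<and> (\<forall>j v. 0 \<le> j \<longrightarrow> j \<le> n \<longrightarrow> sum m {a\<in>A. dyadic j a = v} \<le> W j) \<and>
      (\<forall>a\<in>A. \<exists>j. 0 \<le> j \<and> j \<le> n \<and> sum m {b\<in>A. dyadic j b = dyadic j a} = W j)"
      by (rule exE)
    have m0: "m a \<ge> 0" if "a \<in> A" for a using m that by simp
    have mW: "sum m {a\<in>A. dyadic j a = v} \<le> W j" if "j \<le> n" for j v
      using conjunct1[OF conjunct2[OF m]] that by simp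
    have ms: "\<exists>j. j \<le> n \<and> sum m {b\<in>A. dyadic j b = dyadic j a} = W j" if "a \<in> A" for a
      using conjunct2[OF conjunct2[OF m]] that by blast
    obtain C where C: "finite C" "\<And>c. c \<in> C \<Longrightarrow> fst c \<le> n" "sum m A = (\<Sum>c\<in>C. W (fst c))" "\<And>a. a \<in> A \<Longrightarrow> \<exists>c\<in>C. dyadic (fst c) a = snd c"
      by (rule tree_weights_total[where cell=dyadic and W=W and n=n and m=m, OF finA])
        (erule (1) dyadic_refine, erule ms, rule that, assumption+)
    define U where "U c = {x\<in>E. dyadic (fst c) x = snd c}" for c :: "nat \<times> ('a \<Rightarrow> int)"
    have "E \<subseteq> (\<Union>c\<in>C. U c)"
    proof
      fix x assume x: "x \<in> E"
      define a where "a = rep (dyadic n x)"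
      have a: "a \<in> A" "dyadic n a = dyadic n x" using x rep[OF x] by (auto simp: a_def A_def)
      obtain c where c: "c \<in> C" "dyadic (fst c) a = snd c" using C(4)[OF a(1)] by auto
      have "dyadic (fst c) a = dyadic (fst c) x" using dyadic_refine[OF C(2)[OF c(1)] a(2)] .
      then have "x \<in> U c" using x c(2) by (simp add: U_def)
      then show "x \<in> (\<Union>c\<in>C. U c)" using c(1) by blast
    qed
    then have "c1 \<le> (\<Sum>c\<in>C. diameter (U c) powr \<alpha>)"
      using C(1) assms(1) by (intro c1(2)) (auto simp: U_def intro: bounded_subset)
    also have "\<dots> \<le> (\<Sum>c\<in>C. d powr \<alpha> * W (fst c))"
    proof (rule sum_mono)
      fix c assume "c \<in> C"
      have "diameter (U c) \<le> d * (1 / 2) ^ fst c"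
        unfolding d_def by (rule diameter_le) (auto simp: U_def dist_norm[symmetric] intro!: dyadic_dist)
      moreover have "diameter (U c) \<ge> 0"
        using assms(1) by (intro diameter_ge_0) (auto simp: U_def intro: bounded_subset)
      ultimately have "diameter (U c) powr \<alpha> \<le> (d * (1 / 2) ^ fst c) powr \<alpha>" using assms(2) by (intro powr_mono2) auto
      then show "diameter (U c) powr \<alpha> \<le> d powr \<alpha> * W (fst c)" unfolding W_def using d by (simp add: powr_mult)
    qed
    also have "\<dots> = d powr \<alpha> * sum m A" unfolding C(3) by (simp add: sum_distrib_left)
    finally have low: "c1 / d powr \<alpha> \<le> sum m A" using d by (simp add: field_simps)
    have K0: "K \<ge> 0" by (simp add: K_def le_max_iff_disj)
    have total: "sum m A \<le> K"
    proof -
      have "sum m A = (\<Sum>v\<in>dyadic 0 ` A. sum m {a\<in>A. dyadic 0 a = v})" by (rule sum.image_gen[OF finA])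
      also have "\<dots> \<le> (\<Sum>v\<in>dyadic 0 ` A. 1)"
      proof (rule sum_mono)
        fix v :: "'a \<Rightarrow> int"
        show "sum m {a\<in>A. dyadic 0 a = v} \<le> 1" using mW[of 0 v] by (simp add: W_def)
      qed
      also have "\<dots> = real (card (dyadic 0 ` A))" by simp
      also have "\<dots> \<le> real (card (dyadic 0 ` E))"
        using AE finite_dyadic_image[OF assms(1), of 0] by (simp add: card_mono image_mono)
      finally show ?thesis by (simp add: K_def)
    qed
    have "sum m (A \<inter> cball x r) \<le> K * r powr \<alpha>" if r: "r \<ge> (1 / 2) ^ n" for x r
    proof (cases "r \<ge> 1")
      case True
      have "sum m (A \<inter> cball x r) \<le> sum m A" using finA m0 by (intro sum_mono2) auto
      also have "\<dots> \<le> K * 1" using total by simp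
      also have "\<dots> \<le> K * r powr \<alpha>" using True assms(2) K0 by (intro mult_left_mono) (auto simp: ge_one_powr_ge_zero)
      finally show ?thesis .
    next
      case False
      \<comment> \<open>The finest level up to \<open>n\<close> whose side is at least
        \<open>r\<close>. That side is also at most 2 r: by maximality if k < n, and because r is at
        least 2^-n if k = n.\<close>
      define k where "k = (GREATEST k. k \<le> n \<and> r \<le> (1 / 2) ^ k)"
      have "0 \<le> n \<and> r \<le> (1 / 2) ^ 0" using False by simp
      then have k: "k \<le> n \<and> r \<le> (1 / 2) ^ k" unfolding k_def by (rule GreatestI_nat[where b=n]) auto
      have k': "(1 / 2) ^ k \<le> 2 * r"
      proof (cases "k = n")
        case True
        have "0 < (1 / 2 :: real) ^ n" by simp
        then have "r \<le> 2 * r" using r by linarith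
        then show ?thesis using r True by simp
      next
        case False
        have "\<not> (Suc k \<le> n \<and> r \<le> (1 / 2) ^ Suc k)"
        proof
          assume "Suc k \<le> n \<and> r \<le> (1 / 2) ^ Suc k"
          then have "Suc k \<le> k" unfolding k_def by (rule Greatest_le_nat[where b=n]) auto
          then show False by simp
        qed
        then show ?thesis using False k by simp
      qed
      have "0 < (1 / 2 :: real) ^ n" by simp
      then have r0: "r > 0" using r by linarith
      define V where "V = PiE (Basis::'a set) (\<lambda>b. {dyadic k x b - 1..dyadic k x b + 1})"
      have finV: "finite V" unfolding V_def by (intro finite_PiE) auto
      have cardV: "card V = 3 ^ DIM('a)" unfolding V_def by (simp add: card_PiE)
      have sub: "A \<inter> cball x r \<subseteq> (\<Union>v\<in>V. {a\<in>A. dyadic k a = v})"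
        using k by (auto simp: V_def intro!: dyadic_near)
      have "sum m (A \<inter> cball x r) \<le> sum m (\<Union>v\<in>V. {a\<in>A. dyadic k a = v})"
        using sub finA finV m0 by (intro sum_mono2) auto
      also have "\<dots> = (\<Sum>v\<in>V. sum m {a\<in>A. dyadic k a = v})"
        using finA finV by (intro sum.UNION_disjoint) auto
      also have "\<dots> \<le> (\<Sum>v\<in>V. W k)" using k by (intro sum_mono mW) auto
      also have "\<dots> = 3 ^ DIM('a) * W k" by (simp add: cardV)
      also have "W k \<le> (2 * r) powr \<alpha>" unfolding W_def using k' assms(2) by (intro powr_mono2) auto
      also have "3 ^ DIM('a) * (2 * r) powr \<alpha> = (3 ^ DIM('a) * 2 powr \<alpha>) * r powr \<alpha>" using r0 by (simp add: powr_mult)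
      also have "\<dots> \<le> K * r powr \<alpha>" by (intro mult_right_mono) (auto simp: K_def)
      finally show ?thesis by simp
    qed
    then have "frostman K \<alpha> ((1 / 2) ^ n) A m" unfolding frostman_def using finA m0 total by auto
    then show "\<exists>A m. A \<subseteq> E \<and> frostman K \<alpha> ((1 / 2) ^ n) A m \<and> c1 / d powr \<alpha> \<le> sum m A" using AE low by blast
  qed
qed

section \<open>Interior of the ratio set\<close>

lemma frostman_subset:
  assumes "frostman K \<alpha> \<delta> A m" "B \<subseteq> A"
  shows "frostman K \<alpha> \<delta> B m"
proof -
  have A: "finite A" and m0: "\<And>a. a \<in> A \<Longrightarrow> m a \<ge> 0" and K: "sum m A \<le> K"
    and FB: "\<And>x r. r \<ge> \<delta> \<Longrightarrow> sum m (A \<inter> cball x r) \<le> K * r powr \<alpha>"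
    using assms(1) by (auto simp: frostman_def)
  have "sum m B \<le> K" using K A m0 assms(2) by (intro order_trans[OF sum_mono2[of A B m] K]) auto
  moreover have "sum m (B \<inter> cball x r) \<le> K * r powr \<alpha>" if "r \<ge> \<delta>" for x r
    using A m0 assms(2) by (intro order_trans[OF sum_mono2 FB[OF that]]) auto
  ultimately show ?thesis
    unfolding frostman_def using A m0 assms(2) by (auto intro: finite_subset)
qed

lemma pigeonhole_mass:
  fixes m :: "'a::metric_space \<Rightarrow> real"
  assumes "finite A" "finite P" "A \<subseteq> (\<Union>p\<in>P. cball p r)" "\<And>a. a \<in> A \<Longrightarrow> m a \<ge> 0" "c \<le> sum m A" "c > 0"
  shows "\<exists>p\<in>P. c / real (card P) \<le> sum m (A \<inter> cball p r)"
proof (rule ccontr)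
  assume "\<not> ?thesis"
  then have neg: "sum m (A \<inter> cball p r) < c / real (card P)" if "p \<in> P" for p using that by auto
  have "A \<noteq> {}" using assms(5,6) by auto
  then have P: "P \<noteq> {}" using assms(3) by auto
  have "sum m A \<le> (\<Sum>a\<in>A. \<Sum>p\<in>P. if a \<in> cball p r then m a else 0)"
  proof (rule sum_mono)
    fix a assume a: "a \<in> A"
    then obtain p where p: "p \<in> P" "a \<in> cball p r" using assms(3) by auto
    have "(if a \<in> cball p r then m a else 0) \<le> (\<Sum>p\<in>P. if a \<in> cball p r then m a else 0)"
      using assms(2,4) a p by (intro member_le_sum) auto
    then show "m a \<le> (\<Sum>p\<in>P. if a \<in> cball p r then m a else 0)" using p by simp
  qed
  also have "\<dots> = (\<Sum>p\<in>P. sum m (A \<inter> cball p r))"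
    using assms(1) by (subst sum.swap) (simp add: sum.inter_restrict)
  also have "\<dots> < (\<Sum>p\<in>P. c / real (card P))"
    using assms(2) P neg by (intro sum_strict_mono) auto
  also have "\<dots> = c" using assms(2) P by simp
  finally show False using assms(5) by simp
qed

text \<open>On the window of length \<epsilon> / b starting at \<open>T = a / b\<close> the argument
  of the kernel is at most \<epsilon> in absolute value, so the kernel is at least exp (- 1) /
  \<epsilon>. The two bounds by 1/4 keep the window below 1/2.\<close>

lemma integral_thick_ge:
  fixes a b \<epsilon> T1 :: real
  assumes "\<epsilon> > 0" "b > 0" "T1 \<le> a / b" "a / b \<le> 1 / 4" "\<epsilon> / b \<le> 1 / 4"
  shows "exp (- 1) / b \<le> integral {T1..1/2} (\<lambda>T. thick \<epsilon> (a - T * b))"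
proof -
  have c: "continuous_on S (\<lambda>T. thick \<epsilon> (a - T * b))" for S
    unfolding thick_def using assms by (intro continuous_intros) auto
  have i: "(\<lambda>T. thick \<epsilon> (a - T * b)) integrable_on {u..v}" for u v
    by (intro integrable_continuous_interval c)
  have eb: "\<epsilon> / b > 0" using assms by simp
  have "exp (- 1) / b = integral {a / b..a / b + \<epsilon> / b} (\<lambda>T. exp (- 1) / \<epsilon>)"
    using assms eb by simp
  also have "\<dots> \<le> integral {a / b..a / b + \<epsilon> / b} (\<lambda>T. thick \<epsilon> (a - T * b))"
  proof (rule integral_le)
    fix T assume T: "T \<in> {a / b..a / b + \<epsilon> / b}"
    have "a \<le> T * b" using T assms by (simp add: field_simps)
    have "T * b \<le> (a / b + \<epsilon> / b) * b" using T assms by (intro mult_right_mono) auto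
    then have "T * b \<le> a + \<epsilon>" using assms by (simp add: distrib_right)
    then have "\<bar>a - T * b\<bar> \<le> \<epsilon>" using \<open>a \<le> T * b\<close> by linarith
    then have "\<bar>(a - T * b) / \<epsilon>\<bar> \<le> 1" using assms by (simp add: abs_divide)
    then have "((a - T * b) / \<epsilon>)\<^sup>2 \<le> 1" by (simp add: abs_square_le_1)
    then show "exp (- 1) / \<epsilon> \<le> thick \<epsilon> (a - T * b)"
      unfolding thick_def using assms by (intro divide_right_mono) auto
  qed (auto intro: i)
  also have "\<dots> \<le> integral {T1..1/2} (\<lambda>T. thick \<epsilon> (a - T * b))"
  proof (rule integral_subset_le)
    have "a / b + \<epsilon> / b \<le> 1 / 2" using add_mono[OF assms(4,5)] by simp
    then show "{a / b..a / b + \<epsilon> / b} \<subseteq> {T1..1/2}"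
      by (intro atLeastatMost_subset_iff[THEN iffD2] disjI2 conjI assms(3))
  qed (use assms(1) i in \<open>auto simp: thick_bounds\<close>)
  finally show ?thesis .
qed

text \<open>Away from the zeros of its argument the kernel is small: exp (- t) <= 1 / t with t = (g
  / \<epsilon>)^2 leaves \<epsilon> / g^2.\<close>

lemma atom_tri_small:
  assumes F: "frostman K \<alpha> \<delta> A1 m" "frostman K \<alpha> \<delta> A2 m" and g: "g > 0" and \<epsilon>: "\<epsilon> > 0"
    and gap: "\<And>x y z. x \<in> A1 \<Longrightarrow> y \<in> A2 \<Longrightarrow> z \<in> A1 \<Longrightarrow> g \<le> \<bar>(norm (x - z))\<^sup>2 - T * (norm (x - y))\<^sup>2\<bar>"
  shows "atom_tri \<epsilon> T A1 m A2 m A1 m \<le> K ^ 3 * (\<epsilon> / g\<^sup>2)"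
proof -
  have m1: "\<And>a. a \<in> A1 \<Longrightarrow> m a \<ge> 0" "sum m A1 \<le> K" and m2: "\<And>a. a \<in> A2 \<Longrightarrow> m a \<ge> 0" "sum m A2 \<le> K" using F by (auto simp: frostman_def)
  have K: "K \<ge> 0" by (rule frostman_constant_nonneg[OF F(1)])
  have t: "thick \<epsilon> v \<le> \<epsilon> / g\<^sup>2" if "g \<le> \<bar>v\<bar>" for v
  proof -
    have "g\<^sup>2 \<le> v\<^sup>2" using power_mono[OF that, of 2] g by simp
    then have y: "(g / \<epsilon>)\<^sup>2 \<le> (v / \<epsilon>)\<^sup>2" by (simp add: power_divide divide_right_mono)
    have "exp (- (v / \<epsilon>)\<^sup>2) \<le> exp (- (g / \<epsilon>)\<^sup>2)" using y by simp
    also have "\<dots> \<le> 1 / (g / \<epsilon>)\<^sup>2"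
    proof -
      have "(g / \<epsilon>)\<^sup>2 \<le> exp ((g / \<epsilon>)\<^sup>2)" using exp_ge_add_one_self[of "(g / \<epsilon>)\<^sup>2"] by linarith
      then show ?thesis using g \<epsilon> by (simp add: exp_minus inverse_eq_divide frac_le)
    qed
    finally have "thick \<epsilon> v \<le> (1 / (g / \<epsilon>)\<^sup>2) / \<epsilon>" unfolding thick_def using \<epsilon> by (intro divide_right_mono) auto
    also have "\<dots> = \<epsilon> / g\<^sup>2" using \<epsilon> g by (simp add: power2_eq_square)
    finally show ?thesis .
  qed
  have "atom_tri \<epsilon> T A1 m A2 m A1 m \<le> (\<Sum>x\<in>A1. \<Sum>y\<in>A2. \<Sum>z\<in>A1. m x * m y * m z * (\<epsilon> / g\<^sup>2))"
    unfolding atom_tri_def by (intro sum_mono mult_left_mono t gap mult_nonneg_nonneg m1 m2)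
  also have "\<dots> = (\<Sum>x\<in>A1. m x) * ((\<Sum>y\<in>A2. m y) * ((\<Sum>z\<in>A1. m z) * (\<epsilon> / g\<^sup>2)))"
    by (simp only: sum_distrib_right mult.assoc) (simp only: sum_distrib_left mult.assoc)
  also have "\<dots> \<le> K * (K * (K * (\<epsilon> / g\<^sup>2)))"
    using m1 m2 K \<epsilon> g by (intro mult_mono mult_nonneg_nonneg sum_nonneg) auto
  finally show ?thesis by (simp add: power3_eq_cube mult.assoc)
qed

text \<open>The ratios produced by the weights fall in the right range of \<open>T\<close>:
  \<open>x\<close> and \<open>z\<close> lie in one cluster and \<open>y\<close> is far from it, so
  the squared ratio is at most 1/4. The Frostman bound at radius \<rho> leaves half of the mass of
  \<open>z\<close> at distance at least \<rho> from \<open>x\<close>, where the squared ratio is at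
  least \<open>T1\<close>. This half is the last factor c / 2.\<close>

lemma integral_atom_tri_ge:
  fixes A1 A2 :: "'a::euclidean_space set"
  assumes F: "frostman K \<alpha> \<delta> A1 m" "frostman K \<alpha> \<delta> A2 m" and mass: "c \<le> sum m A1" "c \<le> sum m A2" "c > 0"
    and \<rho>: "\<rho> > 0" "\<delta> \<le> \<rho>" "K * \<rho> powr \<alpha> \<le> c / 2"
    and r: "r > 0" and R: "R > 0" and T1: "T1 \<le> \<rho>\<^sup>2 / R\<^sup>2"
    and close: "\<And>x z. x \<in> A1 \<Longrightarrow> z \<in> A1 \<Longrightarrow> norm (x - z) \<le> 2 * r"
    and far: "\<And>x y. x \<in> A1 \<Longrightarrow> y \<in> A2 \<Longrightarrow> 4 * r \<le> norm (x - y) \<and> norm (x - y) \<le> R"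
    and \<epsilon>: "\<epsilon> > 0" "\<epsilon> \<le> 4 * r\<^sup>2"
  shows "exp (- 1) / R\<^sup>2 * (c * c * (c / 2)) \<le> integral {T1..1/2} (\<lambda>T. atom_tri \<epsilon> T A1 m A2 m A1 m)"
proof -
  have m1: "\<And>a. a \<in> A1 \<Longrightarrow> m a \<ge> 0" and m2: "\<And>a. a \<in> A2 \<Longrightarrow> m a \<ge> 0" and fin: "finite A1" "finite A2" using F by (auto simp: frostman_def)
  define t where "t x y z = integral {T1..1/2} (\<lambda>T. thick \<epsilon> ((norm (x - z))\<^sup>2 - T * (norm (x - y))\<^sup>2))" for x y z :: 'a
  have i: "(\<lambda>T. thick \<epsilon> (a - T * b)) integrable_on {T1..1/2}" for a b
    unfolding thick_def using \<epsilon> by (intro integrable_continuous_interval continuous_intros) auto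
  have t0: "t x y z \<ge> 0" for x y z
    unfolding t_def using \<epsilon> by (intro integral_nonneg i) (auto simp: thick_bounds)
  define e where "e = exp (- 1) / R\<^sup>2"
  have e: "e \<ge> 0" by (simp add: e_def)
  have tge: "e \<le> t x y z" if "x \<in> A1" "y \<in> A2" "z \<in> A1" "z \<notin> cball x \<rho>" for x y z
  proof -
    define a b where "a = (norm (x - z))\<^sup>2" and "b = (norm (x - y))\<^sup>2"
    have xy: "4 * r \<le> norm (x - y)" "norm (x - y) \<le> R" using far that by auto
    have xz: "norm (x - z) \<le> 2 * r" "\<rho> \<le> norm (x - z)" using close that by (auto simp: dist_norm not_le)
    have b: "(4 * r)\<^sup>2 \<le> b" "b \<le> R\<^sup>2"
      unfolding b_def using power_mono[OF xy(1), of 2] power_mono[OF xy(2), of 2] r by simp_all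
    have a: "a \<le> (2 * r)\<^sup>2" "\<rho>\<^sup>2 \<le> a"
      unfolding a_def using power_mono[OF xz(1), of 2] power_mono[OF xz(2), of 2] \<rho> by simp_all
    have b0: "b > 0" using b(1) r by (smt (verit) zero_less_power)
    have a0: "a \<ge> 0" by (simp add: a_def)
    have "T1 \<le> \<rho>\<^sup>2 / R\<^sup>2" by fact
    also have "\<dots> \<le> a / b" using a b b0 a0 by (intro frac_le) auto
    finally have 1: "T1 \<le> a / b" .
    have "a / b \<le> (2 * r)\<^sup>2 / (4 * r)\<^sup>2" using a b r by (intro frac_le) auto
    also have "\<dots> = 1 / 4" using r by (simp add: power_mult_distrib)
    finally have 2: "a / b \<le> 1 / 4" .
    have "\<epsilon> / b \<le> (4 * r\<^sup>2) / (4 * r)\<^sup>2" using \<epsilon> b r by (intro frac_le) auto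
    also have "\<dots> = 1 / 4" using r by (simp add: power_mult_distrib)
    finally have 3: "\<epsilon> / b \<le> 1 / 4" .
    have "e \<le> exp (- 1) / b" unfolding e_def using b b0 R by (intro divide_left_mono) auto
    also have "\<dots> \<le> t x y z" unfolding t_def using integral_thick_ge[OF \<epsilon>(1) b0 1 2 3] by (simp add: a_def b_def)
    finally show ?thesis .
  qed
  have inner: "c / 2 * e \<le> (\<Sum>z\<in>A1. m z * t x y z)" if "x \<in> A1" "y \<in> A2" for x y
  proof -
    have "sum m A1 = sum m (A1 \<inter> cball x \<rho>) + sum m (A1 - cball x \<rho>)"
      using fin by (simp add: sum.Int_Diff)
    moreover have "sum m (A1 \<inter> cball x \<rho>) \<le> c / 2" using F(1) \<rho> unfolding frostman_def by (meson order_trans)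
    ultimately have "c / 2 \<le> sum m (A1 - cball x \<rho>)" using mass by linarith
    then have "c / 2 * e \<le> sum m (A1 - cball x \<rho>) * e" using e by (rule mult_right_mono)
    also have "\<dots> = (\<Sum>z\<in>A1 - cball x \<rho>. m z * e)" by (rule sum_distrib_right)
    also have "\<dots> \<le> (\<Sum>z\<in>A1 - cball x \<rho>. m z * t x y z)"
      using that m1 by (intro sum_mono mult_left_mono tge) auto
    also have "\<dots> \<le> (\<Sum>z\<in>A1. m z * t x y z)"
      using fin m1 t0 by (intro sum_mono2) auto
    finally show ?thesis .
  qed
  have ce: "c / 2 * e \<ge> 0" using mass e by simp
  have "c * (c * (c / 2 * e)) \<le> sum m A1 * (sum m A2 * (c / 2 * e))"
    using mass ce e by (intro mult_mono) auto
  also have "\<dots> = (\<Sum>x\<in>A1. m x * (\<Sum>y\<in>A2. m y * (c / 2 * e)))" by (simp only: sum_distrib_right)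
  also have "\<dots> \<le> (\<Sum>x\<in>A1. m x * (\<Sum>y\<in>A2. m y * (\<Sum>z\<in>A1. m z * t x y z)))"
    by (intro sum_mono mult_left_mono inner m1 m2)
  also have "\<dots> = (\<Sum>x\<in>A1. \<Sum>y\<in>A2. \<Sum>z\<in>A1. m x * m y * m z * t x y z)"
    by (simp only: sum_distrib_left mult.assoc)
  also have "\<dots> = integral {T1..1/2} (\<lambda>T. atom_tri \<epsilon> T A1 m A2 m A1 m)"
    unfolding atom_tri_def t_def using fin
    by (simp add: integral_sum integrable_sum i integrable_on_mult_right)
  finally show ?thesis by (simp add: e_def mult_ac)
qed

text \<open>The constants are chosen in a fixed order: \<open>T1\<close> and \<open>e\<close> from
  the geometry of \<open>E\<close>, then \<tau>, the modulus \<kappa>, the net \<open>Z\<close> with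
  its gap \<open>g\<close>, then \<epsilon>, and last the fine scale and the resolution \<delta>.
  Each estimate used is uniform in everything chosen after its constants.\<close>

lemma pinned_ratio_interior:
  fixes E :: "'a::euclidean_space set"
  assumes d2: "DIM('a) \<ge> 2" and E: "compact E" and dim: "hausdorff_dim E > (2 * real DIM('a) + 1) / 3"
  shows "interior {dist x z / dist x y | x y z. x \<in> E \<and> y \<in> E \<and> z \<in> E \<and> x \<noteq> y} \<noteq> {}"
proof
  assume empty: "interior {dist x z / dist x y | x y z. x \<in> E \<and> y \<in> E \<and> z \<in> E \<and> x \<noteq> y} = {}"
  define d where "d = real DIM('a)"
  define M where "M = DIM('a)"
  have M: "M \<ge> 2" using d2 by (simp add: M_def)
  \<comment> \<open>The exponent \<alpha> has to be at most the dimension of the space; taking the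
    minimum avoids proving that \<open>hausdorff_dim E\<close> is.\<close>
  have "(2 * d + 1) / 3 < min d (hausdorff_dim E)" using dim d2 by (simp add: d_def)
  then obtain \<alpha> where \<alpha>: "(2 * d + 1) / 3 < \<alpha>" "\<alpha> < min d (hausdorff_dim E)" using dense by blast
  have "(2 * d + 1) / 3 \<ge> 0" by (simp add: d_def)
  then have \<alpha>0: "\<alpha> > 0" using \<alpha>(1) by linarith
  have \<alpha>1: "(2 * real DIM('a) + 1) / 3 < \<alpha>" "\<alpha> \<le> real DIM('a)" "\<alpha> < hausdorff_dim E" using \<alpha> by (auto simp: d_def)
  obtain R where R: "R > 0" "E \<subseteq> cball 0 R"
    using compact_imp_bounded[OF E] by (auto simp: bounded_pos subset_iff)
  obtain K c where K: "K > 0" "c > 0" "\<And>n. \<exists>A m. A \<subseteq> E \<and> frostman K \<alpha> ((1 / 2) ^ n) A m \<and> c \<le> sum m A"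
    using finite_frostman[OF compact_imp_bounded[OF E] \<alpha>0 \<alpha>1(3)] by blast
  have small: "\<exists>r>0. K * r powr \<alpha> \<le> u" if "u > 0" for u
  proof (intro exI conjI)
    show "(u / K) powr (1 / \<alpha>) > 0" using K that by simp
    show "K * ((u / K) powr (1 / \<alpha>)) powr \<alpha> \<le> u" using K that \<alpha>0 by (simp add: powr_powr)
  qed
  \<comment> \<open>A ball of radius \<open>r8\<close> carries at most half of the mass
    \<open>c\<close>. With r = r8 / 8, a point within \<open>r\<close> of a centre and a point
    outside the ball of radius \<open>r8\<close> around it are more than 4 r apart.\<close>
  obtain r8 where r8: "r8 > 0" "K * r8 powr \<alpha> \<le> c / 2" using small[of "c / 2"] K by auto
  define r where "r = r8 / 8"
  have r: "r > 0" using r8 by (simp add: r_def)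
  have cov: "E \<subseteq> (\<Union>p\<in>E. ball p r)" using r by force
  have op: "open (ball p r)" for p :: 'a by simp
  obtain P where P': "P \<subseteq> E" "finite P" "E \<subseteq> (\<Union>p\<in>P. ball p r)"
    by (rule compactE_image[OF E op cov]) (rule that)
  note P = P'(2) P'(1) P'(3)
  have Pc: "E \<subseteq> (\<Union>p\<in>P. cball p r)" using P(3) by (meson UN_mono ball_subset_cball order_refl order_trans)
  have P0: "card P > 0"
  proof -
    obtain A m where "A \<subseteq> E" "c \<le> sum m A" using K(3)[of 0] by blast
    then have "E \<noteq> {}" using K(2) by auto
    then show ?thesis using P by (auto simp: card_gt_0_iff)
  qed
  \<comment> \<open>The mass that the pigeonhole principle yields in one of \<open>card P\<close>
    balls when at least c / 2 is available.\<close>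
  define c' where "c' = c / 2 / real (card P)"
  have c': "c' > 0" using K P0 by (simp add: c'_def)
  obtain \<rho> where \<rho>: "\<rho> > 0" "K * \<rho> powr \<alpha> \<le> c' / 2" using small[of "c' / 2"] c' by auto
  \<comment> \<open>Distances in \<open>E\<close> are at most 2 R, so \<rho>^2 / (2 R)^2 bounds from
    below the squared ratios with numerator at least \<rho>.\<close>
  define T1 where "T1 = min (1 / 4) (\<rho>\<^sup>2 / (2 * R)\<^sup>2)"
  have T1: "T1 > 0" "T1 \<le> 1 / 2" "T1 < 1 / 2" "T1 \<le> \<rho>\<^sup>2 / (2 * R)\<^sup>2" using \<rho> R by (auto simp: T1_def)
  define L0 where "L0 = exp (- 1) / (2 * R)\<^sup>2 * (c' * c' * (c' / 2))"
  have L0: "L0 > 0" using R c' by (simp add: L0_def)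
  \<comment> \<open>The final upper bound consists of six errors \<open>e\<close> on an interval of
    length below 1, hence stays below \<open>L0\<close>.\<close>
  define e where "e = L0 / 8"
  have e: "e > 0" using L0 by (simp add: e_def)
  obtain C \<eta> where C: "C > 0" "\<eta> > 0"
    "\<And>\<delta> \<epsilon> T \<tau> k (A1 :: 'a set) m1 A2 m2 A3 m3.
       frostman K \<alpha> \<delta> A1 m1 \<Longrightarrow> frostman K \<alpha> \<delta> A2 m2 \<Longrightarrow> frostman K \<alpha> \<delta> A3 m3 \<Longrightarrow>
       A1 \<subseteq> cball 0 R \<Longrightarrow> A2 \<subseteq> cball 0 R \<Longrightarrow> A3 \<subseteq> cball 0 R \<Longrightarrow>
       \<delta> > 0 \<Longrightarrow> \<delta>\<^sup>2 \<le> \<tau> / 2 ^ k \<Longrightarrow> \<tau> * real (2 * M) \<le> 1 / 32 \<Longrightarrow> 0 < \<epsilon> \<Longrightarrow> \<epsilon> \<le> 1 \<Longrightarrow> T1 \<le> T \<Longrightarrow> T \<le> 1 / 2 \<Longrightarrow>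
       \<bar>tri_form \<epsilon> T (moll (2 * M) (moll_coeff M) (\<tau> / 2 ^ k) A1 m1) (moll (2 * M) (moll_coeff M) (\<tau> / 2 ^ k) A2 m2) (moll (2 * M) (moll_coeff M) (\<tau> / 2 ^ k) A3 m3)
         - tri_form \<epsilon> T (moll (2 * M) (moll_coeff M) \<tau> A1 m1) (moll (2 * M) (moll_coeff M) \<tau> A2 m2) (moll (2 * M) (moll_coeff M) \<tau> A3 m3)\<bar> \<le> C * \<tau> powr \<eta>"
    by (rule tri_telescope[OF d2 \<alpha>1(1,2) T1(1,2), where K=K and R=R, folded M_def]) (rule that, assumption+)
  \<comment> \<open>The first entry keeps all heat times small enough for the Gaussian weights; the
    second makes the telescoping error at most \<open>e\<close>.\<close>
  define \<tau> where "\<tau> = min (1 / (64 * real (2 * M))) ((e / C) powr (1 / \<eta>))"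
  have \<tau>: "\<tau> > 0" "\<tau> * real (2 * M) \<le> 1 / 64" "C * \<tau> powr \<eta> \<le> e"
  proof -
    show \<tau>0: "\<tau> > 0" using M e C by (simp add: \<tau>_def)
    have "\<tau> * real (2 * M) \<le> 1 / (64 * real (2 * M)) * real (2 * M)" unfolding \<tau>_def by (intro mult_right_mono) auto
    also have "\<dots> = 1 / 64" using M by simp
    finally show "\<tau> * real (2 * M) \<le> 1 / 64" .
    have "\<tau> powr \<eta> \<le> ((e / C) powr (1 / \<eta>)) powr \<eta>" using \<tau>0 C by (intro powr_mono2) (auto simp: \<tau>_def)
    also have "\<dots> = e / C" using e C by (simp add: powr_powr)
    finally show "C * \<tau> powr \<eta> \<le> e" using C by (simp add: field_simps)
  qed
  have R0: "R \<ge> 0" using R by simp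
  obtain \<kappa> where \<kappa>: "\<kappa> > 0" "\<And>T T' \<delta> \<epsilon> (A1 :: 'a set) m1 A2 m2 A3 m3. T1 \<le> T \<Longrightarrow> T \<le> 1 / 2 \<Longrightarrow> T1 \<le> T' \<Longrightarrow> T' \<le> 1 / 2 \<Longrightarrow> \<bar>T - T'\<bar> < \<kappa> \<Longrightarrow>
     frostman K \<alpha> \<delta> A1 m1 \<Longrightarrow> frostman K \<alpha> \<delta> A2 m2 \<Longrightarrow> frostman K \<alpha> \<delta> A3 m3 \<Longrightarrow> A1 \<subseteq> cball 0 R \<Longrightarrow> A2 \<subseteq> cball 0 R \<Longrightarrow>
     0 < \<epsilon> \<Longrightarrow> \<epsilon> \<le> 1 \<Longrightarrow>
     \<bar>tri_form \<epsilon> T (moll (2 * M) (moll_coeff M) \<tau> A1 m1) (moll (2 * M) (moll_coeff M) \<tau> A2 m2) (moll (2 * M) (moll_coeff M) \<tau> A3 m3) - tri_form \<epsilon> T' (moll (2 * M) (moll_coeff M) \<tau> A1 m1) (moll (2 * M) (moll_coeff M) \<tau> A2 m2) (moll (2 * M) (moll_coeff M) \<tau> A3 m3)\<bar> \<le> e"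
    by (rule tri_equicontinuous[OF d2 \<tau>(1,2) T1(1) e R0, where K=K and \<alpha>=\<alpha> and c="moll_coeff M"]) (rule that, assumption+)

  \<comment> \<open>Squared ratios missed by the set, and their gap\<close>
  define S where "S = {T. \<exists>x\<in>E. \<exists>y\<in>E. \<exists>z\<in>E. 4 * r \<le> norm (x - y) \<and> (norm (x - z))\<^sup>2 = T * (norm (x - y))\<^sup>2}"
  \<comment> \<open>An interval inside \<open>S\<close> would give, by square roots, an interval of
    ratios with denominators at least 4 r.\<close>
  have notS: "\<exists>T. u < T \<and> T < v \<and> T \<notin> S" if uv: "0 \<le> u" "u < v" for u v
  proof (rule ccontr)
    assume "\<not> ?thesis"
    then have sub: "T \<in> S" if "u < T" "T < v" for T using that by blast
    have "{sqrt u<..<sqrt v} \<subseteq> {dist x z / dist x y | x y z. x \<in> E \<and> y \<in> E \<and> z \<in> E \<and> x \<noteq> y}"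
    proof
      fix t assume t: "t \<in> {sqrt u<..<sqrt v}"
      have "sqrt u < t" using t by simp
      then have t0: "t \<ge> 0" using real_sqrt_ge_zero[OF uv(1)] by linarith
      have "u < t\<^sup>2" using t uv(1) t0 by (metis greaterThanLessThan_iff real_sqrt_less_iff real_sqrt_unique)
      moreover have "t\<^sup>2 < v" using t uv t0 by (metis greaterThanLessThan_iff real_sqrt_less_iff real_sqrt_unique)
      ultimately obtain x y z where xyz: "x \<in> E" "y \<in> E" "z \<in> E" "4 * r \<le> norm (x - y)" "(norm (x - z))\<^sup>2 = t\<^sup>2 * (norm (x - y))\<^sup>2"
        using sub[of "t\<^sup>2"] by (auto simp: S_def)
      have "norm (x - z) = t * norm (x - y)"
        using xyz(5) t0 by (metis mult_nonneg_nonneg norm_ge_zero power2_eq_imp_eq power_mult_distrib)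
      moreover have ne: "norm (x - y) \<noteq> 0" using xyz(4) r by auto
      ultimately have "t = dist x z / dist x y" by (simp add: dist_norm)
      then show "t \<in> {dist x z / dist x y | x y z. x \<in> E \<and> y \<in> E \<and> z \<in> E \<and> x \<noteq> y}" using xyz ne by auto
    qed
    then have "{sqrt u<..<sqrt v} \<subseteq> interior {dist x z / dist x y | x y z. x \<in> E \<and> y \<in> E \<and> z \<in> E \<and> x \<noteq> y}"
      by (rule interior_maximal) simp
    moreover have "(sqrt u + sqrt v) / 2 \<in> {sqrt u<..<sqrt v}" using uv by simp
    ultimately show False using empty by auto
  qed
  have gap: "\<exists>g>0. \<forall>x\<in>E. \<forall>y\<in>E. \<forall>z\<in>E. 4 * r \<le> norm (x - y) \<longrightarrow> g \<le> \<bar>(norm (x - z))\<^sup>2 - T * (norm (x - y))\<^sup>2\<bar>" if T: "T \<notin> S" for T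
  proof -
    \<comment> \<open>The condition that |x - y| is at least 4 r is closed, so the admissible
      triples form a compact set and a continuous function without zeros on it has a positive
      minimum.\<close>
    define X where "X = (E \<times> E \<times> E) \<inter> {u. 4 * r \<le> norm (fst u - fst (snd u))}"
    define F where "F u = \<bar>(norm (fst u - snd (snd u)))\<^sup>2 - T * (norm (fst u - fst (snd u)))\<^sup>2\<bar>" for u :: "'a \<times> 'a \<times> 'a"
    have "closed {u :: 'a \<times> 'a \<times> 'a. 4 * r \<le> norm (fst u - fst (snd u))}"
      by (intro closed_Collect_le continuous_intros)
    then have X: "compact X" unfolding X_def by (intro compact_Int_closed compact_Times E)
    have F: "continuous_on X F" unfolding F_def by (intro continuous_intros)
    show ?thesis
    proof (cases "X = {}")
      case True
      have "\<not> 4 * r \<le> norm (x - y)" if "x \<in> E" "y \<in> E" "z \<in> E" for x y z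
      proof
        assume "4 * r \<le> norm (x - y)"
        then have "(x, y, z) \<in> X" using that by (simp add: X_def)
        then show False using True by simp
      qed
      then show ?thesis by (meson zero_less_one)
    next
      case False
      obtain u where u: "u \<in> X" "\<And>w. w \<in> X \<Longrightarrow> F u \<le> F w" using continuous_attains_inf[OF X False F] by auto
      have "F u \<noteq> 0"
      proof
        assume 0: "F u = 0"
        obtain x y z where xyz: "u = (x, y, z)" by (cases u) auto
        have "x \<in> E" "y \<in> E" "z \<in> E" "4 * r \<le> norm (x - y)" using u(1) by (simp_all add: X_def xyz)
        moreover have "(norm (x - z))\<^sup>2 = T * (norm (x - y))\<^sup>2" using 0 by (simp add: F_def xyz)
        ultimately show False using T unfolding S_def by blast
      qed
      then have "F u > 0" by (simp add: F_def)
      moreover have "F u \<le> \<bar>(norm (x - z))\<^sup>2 - T * (norm (x - y))\<^sup>2\<bar>" if "x \<in> E" "y \<in> E" "z \<in> E" "4 * r \<le> norm (x - y)" for x y z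
        using u(2)[of "(x, y, z)"] that by (simp add: X_def F_def)
      ultimately show ?thesis by blast
    qed
  qed
  \<comment> \<open>A finite net outside \<open>S\<close>: the interval is covered by balls of
    radius \<kappa> / 2, and each centre is moved by less than \<kappa> / 2 to a point outside
    \<open>S\<close> without leaving the interval.\<close>
  obtain Z where Z: "finite Z" "\<And>T. T \<in> Z \<Longrightarrow> T \<notin> S \<and> T1 \<le> T \<and> T \<le> 1 / 2" "\<And>T. T1 \<le> T \<Longrightarrow> T \<le> 1 / 2 \<Longrightarrow> \<exists>T'\<in>Z. \<bar>T - T'\<bar> < \<kappa>"
  proof -
    have cov: "{T1..1/2} \<subseteq> (\<Union>u\<in>{T1..1/2}. ball u (\<kappa> / 2))" using \<kappa>(1) by force
    have op: "open (ball u (\<kappa> / 2))" for u :: real by simp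
    obtain U where U': "U \<subseteq> {T1..1/2}" "finite U" "{T1..1/2} \<subseteq> (\<Union>u\<in>U. ball u (\<kappa> / 2))"
      by (rule compactE_image[OF compact_Icc op cov]) (rule that)
    note U = U'(2) U'(1) U'(3)
    have "\<exists>T. max T1 (u - \<kappa> / 2) < T \<and> T < min (1 / 2) (u + \<kappa> / 2) \<and> T \<notin> S" if "u \<in> U" for u
    proof (rule notS)
      have "u \<in> {T1..1/2}" using that U by auto
      then have "T1 \<le> u" "u \<le> 1 / 2" by simp_all
      then show "max T1 (u - \<kappa> / 2) < min (1 / 2) (u + \<kappa> / 2)" using \<kappa>(1) T1(3) unfolding max_less_iff_conj min_less_iff_conj by linarith
    qed (use T1 in auto)
    then obtain f where f: "\<And>u. u \<in> U \<Longrightarrow> max T1 (u - \<kappa> / 2) < f u \<and> f u < min (1 / 2) (u + \<kappa> / 2) \<and> f u \<notin> S" by metis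
    show thesis
    proof (rule that[of "f ` U"])
      show "finite (f ` U)" using U by simp
      show "T \<notin> S \<and> T1 \<le> T \<and> T \<le> 1 / 2" if "T \<in> f ` U" for T using f that by fastforce
      fix T assume "T1 \<le> T" "T \<le> 1 / 2"
      then have "T \<in> {T1..1/2}" by simp
      then have "T \<in> (\<Union>u\<in>U. ball u (\<kappa> / 2))" by (rule subsetD[OF U(3)])
      then obtain u where u: "u \<in> U" "\<bar>u - T\<bar> < \<kappa> / 2" unfolding UN_iff mem_ball dist_real_def by blast
      have "u - \<kappa> / 2 < f u" "f u < u + \<kappa> / 2" using f[OF u(1)] by simp_all
      then have "\<bar>T - f u\<bar> < \<kappa>" using u(2) by (simp only: abs_less_iff) linarith
      then show "\<exists>T'\<in>f ` U. \<bar>T - T'\<bar> < \<kappa>" using u(1) by auto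
    qed
  qed
  have "\<exists>g>0. \<forall>T\<in>Z. \<forall>x\<in>E. \<forall>y\<in>E. \<forall>z\<in>E. 4 * r \<le> norm (x - y) \<longrightarrow> g \<le> \<bar>(norm (x - z))\<^sup>2 - T * (norm (x - y))\<^sup>2\<bar>"
    using Z(1) Z(2)
  proof (induction Z rule: finite_induct)
    case (insert T Z)
    obtain g1 where g1: "g1 > 0" "\<forall>x\<in>E. \<forall>y\<in>E. \<forall>z\<in>E. 4 * r \<le> norm (x - y) \<longrightarrow> g1 \<le> \<bar>(norm (x - z))\<^sup>2 - T * (norm (x - y))\<^sup>2\<bar>"
      using gap[of T] insert.prems[of T] by auto
    obtain g2 where g2: "g2 > 0" "\<forall>T\<in>Z. \<forall>x\<in>E. \<forall>y\<in>E. \<forall>z\<in>E. 4 * r \<le> norm (x - y) \<longrightarrow> g2 \<le> \<bar>(norm (x - z))\<^sup>2 - T * (norm (x - y))\<^sup>2\<bar>"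
      using insert.IH insert.prems by auto
    show ?case by (intro exI[of _ "min g1 g2"]) (use g1 g2 in \<open>auto simp: min_le_iff_disj\<close>)
  qed (auto intro: exI[of _ 1])
  then obtain g where g: "g > 0" "\<And>T x y z. T \<in> Z \<Longrightarrow> x \<in> E \<Longrightarrow> y \<in> E \<Longrightarrow> z \<in> E \<Longrightarrow> 4 * r \<le> norm (x - y) \<Longrightarrow> g \<le> \<bar>(norm (x - z))\<^sup>2 - T * (norm (x - y))\<^sup>2\<bar>"
    by blast
  \<comment> \<open>The last entry makes the atomic form at most \<open>e\<close> on the net; the
    others are the ranges required by the uniform bounds and by the lower bound for the
    integral.\<close>
  define \<epsilon> where "\<epsilon> = min (min 1 (4 * r\<^sup>2)) (e * g\<^sup>2 / K ^ 3)"
  have \<epsilon>: "\<epsilon> > 0" "\<epsilon> \<le> 1" "\<epsilon> \<le> 4 * r\<^sup>2" "K ^ 3 * (\<epsilon> / g\<^sup>2) \<le> e"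
  proof -
    show "\<epsilon> > 0" "\<epsilon> \<le> 1" "\<epsilon> \<le> 4 * r\<^sup>2" using r e g K by (auto simp: \<epsilon>_def)
    have "K ^ 3 * (\<epsilon> / g\<^sup>2) \<le> K ^ 3 * ((e * g\<^sup>2 / K ^ 3) / g\<^sup>2)"
      using K g by (intro mult_left_mono divide_right_mono) (auto simp: \<epsilon>_def)
    also have "\<dots> = e" using K g by simp
    finally show "K ^ 3 * (\<epsilon> / g\<^sup>2) \<le> e" .
  qed
  have c01: "(\<Sum>l\<in>{1..2 * M}. moll_coeff M l) = 1" using sum_moll_coeff[of M 1] M by (simp add: power_0_left)
  obtain \<tau>1 where \<tau>1: "\<tau>1 > 0" "\<And>\<tau> T \<delta> (A1 :: 'a set) m1 A2 m2 A3 m3. 0 < \<tau> \<Longrightarrow> \<tau> \<le> \<tau>1 \<Longrightarrow> 0 \<le> T \<Longrightarrow> T \<le> 1 \<Longrightarrow>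
     frostman K \<alpha> \<delta> A1 m1 \<Longrightarrow> frostman K \<alpha> \<delta> A2 m2 \<Longrightarrow> frostman K \<alpha> \<delta> A3 m3 \<Longrightarrow> A1 \<subseteq> cball 0 R \<Longrightarrow> A2 \<subseteq> cball 0 R \<Longrightarrow> A3 \<subseteq> cball 0 R \<Longrightarrow>
     \<bar>tri_form \<epsilon> T (moll (2 * M) (moll_coeff M) \<tau> A1 m1) (moll (2 * M) (moll_coeff M) \<tau> A2 m2) (moll (2 * M) (moll_coeff M) \<tau> A3 m3) - atom_tri \<epsilon> T A1 m1 A2 m2 A3 m3\<bar> \<le> e"
    by (rule tri_moll_atoms[OF c01 \<epsilon>(1) e R0, where K=K and \<alpha>=\<alpha>]) (rule that, assumption+)

  \<comment> \<open>Resolution and two separated clusters\<close>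
  have half: "\<exists>n. ((1 / 2) ^ n :: real) < u" if "u > 0" for u using real_arch_pow_inv[OF that, of "1 / 2"] by simp
  obtain k where k: "(1 / 2) ^ k < \<tau>1 / \<tau>" using half[of "\<tau>1 / \<tau>"] \<tau> \<tau>1 by auto
  have tk: "0 < \<tau> / 2 ^ k" "\<tau> / 2 ^ k \<le> \<tau>1" using k \<tau> by (auto simp: power_one_over field_simps)
  \<comment> \<open>The resolution must lie below \<open>r8\<close> and \<rho>, where the Frostman
    bound is applied, and below the square root of the finest mollification time.\<close>
  define u where "u = min (min r8 \<rho>) (sqrt (\<tau> / 2 ^ k))"
  have "u > 0" using r8 \<rho> tk by (simp add: u_def)
  then obtain n where n: "(1 / 2) ^ n < u" using half by blast
  define \<delta> where "\<delta> = ((1 / 2) ^ n :: real)"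
  have \<delta>: "\<delta> > 0" "\<delta> \<le> r8" "\<delta> \<le> \<rho>" "\<delta> \<le> sqrt (\<tau> / 2 ^ k)" using n by (auto simp: \<delta>_def u_def)
  have \<delta>2: "\<delta>\<^sup>2 \<le> \<tau> / 2 ^ k"
  proof -
    have "\<delta>\<^sup>2 \<le> (sqrt (\<tau> / 2 ^ k))\<^sup>2" using \<delta> by (intro power_mono) auto
    then show ?thesis using tk by simp
  qed
  obtain A m where A: "A \<subseteq> E" "frostman K \<alpha> \<delta> A m" "c \<le> sum m A" using K(3)[of n] unfolding \<delta>_def by blast
  have finA: "finite A" and m0: "\<And>a. a \<in> A \<Longrightarrow> m a \<ge> 0" and FB: "\<And>x s. s \<ge> \<delta> \<Longrightarrow> sum m (A \<inter> cball x s) \<le> K * s powr \<alpha>"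
    using A(2) by (auto simp: frostman_def)
  have "\<exists>p\<in>P. c / real (card P) \<le> sum m (A \<inter> cball p r)"
    by (rule pigeonhole_mass[OF finA P(1)]) (use A Pc m0 K in auto)
  then obtain p where p: "p \<in> P" "c / real (card P) \<le> sum m (A \<inter> cball p r)" by auto
  \<comment> \<open>Outside the ball of radius \<open>r8\<close> around \<open>p\<close> at least
    half of the mass remains, and the second cluster is taken from there.\<close>
  define B where "B = A - cball p r8"
  have "sum m A = sum m (A \<inter> cball p r8) + sum m B" unfolding B_def using finA by (simp add: sum.Int_Diff)
  moreover have "sum m (A \<inter> cball p r8) \<le> c / 2" using FB[OF \<delta>(2), of p] r8 by linarith
  ultimately have Bm: "c / 2 \<le> sum m B" using A(3) by linarith
  have "\<exists>q\<in>P. c / 2 / real (card P) \<le> sum m (B \<inter> cball q r)"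
    by (rule pigeonhole_mass[OF _ P(1)]) (use A Pc m0 K finA Bm in \<open>auto simp: B_def\<close>)
  then obtain q where q: "q \<in> P" "c' \<le> sum m (B \<inter> cball q r)" unfolding c'_def by auto
  define A1 where "A1 = A \<inter> cball p r"
  define A2 where "A2 = B \<inter> cball q r"
  have sub: "A1 \<subseteq> A" "A2 \<subseteq> A" by (auto simp: A1_def A2_def B_def)
  have F: "frostman K \<alpha> \<delta> A1 m" "frostman K \<alpha> \<delta> A2 m" using frostman_subset[OF A(2)] sub by auto
  have AR: "A1 \<subseteq> cball 0 R" "A2 \<subseteq> cball 0 R" using sub A(1) R(2) by auto
  have "c' \<le> c / real (card P)" using K P0 by (simp add: c'_def field_simps)
  then have mass: "c' \<le> sum m A1" "c' \<le> sum m A2" using p q by (auto simp: A1_def A2_def)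
  have close: "norm (x - z) \<le> 2 * r" if "x \<in> A1" "z \<in> A1" for x z
    using that dist_triangle2[of x z p] by (auto simp: A1_def dist_commute simp flip: dist_norm)
  have far: "4 * r \<le> norm (x - y) \<and> norm (x - y) \<le> 2 * R" if "x \<in> A1" "y \<in> A2" for x y
  proof
    have "r8 < dist p y" "dist p x \<le> r" using that by (auto simp: A1_def A2_def B_def)
    then have "r8 < r + dist x y" using dist_triangle[of p y x] by linarith
    then show "4 * r \<le> norm (x - y)" using r by (simp add: r_def dist_norm)
    have "norm x \<le> R" "norm y \<le> R" using that AR by auto
    then show "norm (x - y) \<le> 2 * R" using norm_triangle_ineq4[of x y] by linarith
  qed

  \<comment> \<open>Smallness for every value of the ratio, and contradiction\<close>
  have upper: "atom_tri \<epsilon> T A1 m A2 m A1 m \<le> 6 * e" if T: "T1 \<le> T" "T \<le> 1 / 2" for T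
  proof -
    obtain T' where T': "T' \<in> Z" "\<bar>T - T'\<bar> < \<kappa>" using Z(3)[OF T] by auto
    have T'1: "T1 \<le> T'" "T' \<le> 1 / 2" using Z(2)[OF T'(1)] by auto
    define L where "L t s = tri_form \<epsilon> t (moll (2 * M) (moll_coeff M) s A1 m) (moll (2 * M) (moll_coeff M) s A2 m) (moll (2 * M) (moll_coeff M) s A1 m)" for t s
    define X where "X t = atom_tri \<epsilon> t A1 m A2 m A1 m" for t
    have \<tau>M: "\<tau> * real (2 * M) \<le> 1 / 32" using \<tau>(2) by linarith
    have tele: "\<bar>L t (\<tau> / 2 ^ k) - L t \<tau>\<bar> \<le> e" if "T1 \<le> t" "t \<le> 1 / 2" for t
      unfolding L_def by (rule order_trans[OF C(3)[OF F(1) F(2) F(1) AR(1) AR(2) AR(1) \<delta>(1) \<delta>2 \<tau>M \<epsilon>(1,2) that] \<tau>(3)])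
    have at: "\<bar>L t (\<tau> / 2 ^ k) - X t\<bar> \<le> e" if "T1 \<le> t" "t \<le> 1 / 2" for t
      unfolding L_def X_def using that T1 by (intro \<tau>1(2)[OF tk _ _ F(1) F(2) F(1) AR(1) AR(2) AR(1)]) auto
    have eq: "\<bar>L T \<tau> - L T' \<tau>\<bar> \<le> e"
      unfolding L_def by (rule \<kappa>(2)[OF T T'1 T'(2) F(1) F(2) F(1) AR \<epsilon>(1,2)])
    have "X T' \<le> K ^ 3 * (\<epsilon> / g\<^sup>2)"
      unfolding X_def
    proof (rule atom_tri_small[OF F g(1) \<epsilon>(1)])
      fix x y z assume "x \<in> A1" "y \<in> A2" "z \<in> A1"
      then show "g \<le> \<bar>(norm (x - z))\<^sup>2 - T' * (norm (x - y))\<^sup>2\<bar>"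
        using far sub A(1) by (intro g(2)[OF T'(1)]) auto
    qed
    then have "X T' \<le> e" using \<epsilon>(4) by linarith
    \<comment> \<open>From \<open>T\<close> to the net point \<open>T'\<close>: unmollifying and
      coarsening at \<open>T\<close>, moving to \<open>T'\<close>, then refining and returning to
      atoms costs five errors \<open>e\<close>; the value at \<open>T'\<close> is the sixth.\<close>
    then have "X T \<le> 6 * e"
      using tele[OF T] tele[OF T'1] at[OF T] at[OF T'1] eq by linarith
    then show ?thesis by (simp add: X_def)
  qed
  have R2: "2 * R > 0" using R by simp
  have "L0 \<le> integral {T1..1/2} (\<lambda>T. atom_tri \<epsilon> T A1 m A2 m A1 m)"
    unfolding L0_def
    by (rule integral_atom_tri_ge[OF F mass c' \<rho>(1) \<delta>(3) \<rho>(2) r R2 T1(4) close far \<epsilon>(1,3)])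
  also have "\<dots> \<le> integral {T1..1/2} (\<lambda>T. 6 * e)"
  proof (rule integral_le)
    have "continuous_on {T1..1/2} (\<lambda>T. atom_tri \<epsilon> T A1 m A2 m A1 m)"
      unfolding atom_tri_def thick_def using \<epsilon> by (intro continuous_intros) auto
    then show "(\<lambda>T. atom_tri \<epsilon> T A1 m A2 m A1 m) integrable_on {T1..1/2}"
      by (rule integrable_continuous_interval)
  qed (use upper in auto)
  also have "\<dots> = (1 / 2 - T1) * (6 * e)" using T1 by simp
  also have "\<dots> \<le> 1 * (6 * e)" using T1 e by (intro mult_right_mono) auto
  also have "\<dots> < L0" using L0 by (simp add: e_def)
  finally show False by simp
qed

theorem theorem1p3:
  fixes E :: "(real ^ 'd) set"
  assumes "CARD('d) \<ge> 2"
    and "compact E"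
    and "hausdorff_dim E > (2 * real CARD('d) + 1) / 3"
  shows "interior {dist x z / dist x y | x y z. x \<in> E \<and> y \<in> E \<and> z \<in> E \<and> x \<noteq> y} \<noteq> {}"
  using assms by (intro pinned_ratio_interior) simp_all

end
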